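(* Suppose that $[\omega],[\omega']\in\mathcal B_0=\mathcal B_h\sqcup\mathcal B_{ah}$ are of the same type, i.e. both in $\mathcal B_h$ (holomorphic) or both in $\mathcal B_{ah}$ (anti-holomorphic). Then for every $[\eta]\in\mathcal B$, $$\langle[\omega]\otimes[\omega'],\varphi_\infty^{[1,2]}([\eta]^\vee)\rangle=0 .$$
   Context: $F\subset\mathbf R$ is a subfield, $X$ a smooth projective geometrically connected curve over $F$, $D\subset X$ a non-empty reduced zero-dimensional closed subscheme, $Y=X\setminus D$. $b$ is an $F$-rational base point of $Y$: a point of $Y(F)$, or a non-zero $F$-rational tangent vector of $X$ at a point of $D(F)$ (tangential base point). $A^\bullet(X\log D)$ is the space of global sections of the total complex of $\Omega^\bullet_{X_{\mathrm{an}}}(\log D)\otimes_{\mathcal O}\mathcal A^{0,*}_X$ (smooth forms with log poles along $D$), with Hodge filtration $F^i$ (holomorphic degree $\ge i$) and weight filtration $W_0=A^\bullet(X)\subset W_1=A^\bullet(X\log D)$. $\mathrm H_1^{\mathrm{dR}}(Y)$ is the dual of $\mathrm H^1_{\mathrm{dR}}(Y)$ with its mixed Hodge structure, and $\widehat T=\widehat T(\mathrm H_1^{\mathrm{dR}}(Y))=\prod_{i\ge0}\mathrm H_1^{\mathrm{dR}}(Y)^{\otimes i}$ is the completed tensor algebra. $c$ is complex conjugation of differential forms (acting on the form factor only), and $F_\infty:Y(\mathbf C)\to Y(\mathbf C)$ is complex conjugation. **$\Omega$.** Fix $\Omega=\sum_{n\ge1}\Omega^{(n)}$, $\Omega^{(n)}\in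 \mathrm H_1^{\mathrm{dR}}(Y/F)^{\otimes n}\otimes_F A^1(X\log D)$, lying in $F^0W_{-1}$, taking values in the completed free Lie algebra in $\widehat T$, with $d\Omega=\Omega\wedge\Omega$, $c\circ F_\infty^*(\Omega)=\Omega$, and $\Omega^{(1)}$ closed representing the identity of $\mathrm H^1_{\mathrm{dR}}(Y/\mathbf C)$. For a path $\gamma$ in $Y(\mathbf C)$ put $T(\gamma)=\sum_{n\ge0}\int_\gamma\Omega^n\in\widehat T_{\mathbf C}$, where $\int_\gamma\omega_1\cdots\omega_n=\int_{0\le t_n\le\cdots\le t_1\le1}\gamma^*\omega_1(t_1)\cdots\gamma^*\omega_n(t_n)$. (For tangential $b$ at $c_0$, a path $\gamma$ ending at $b$ uses $T(\gamma)=\lim_{\epsilon\to0}\exp(-\log(\epsilon)\mathrm{Res}_b\Omega)\sum_n\int_{\gamma_\epsilon}\Omega^n$, where $\gamma_\epsilon$ is $\gamma$ stopped at the point where the local parameter $q$ at $c_0$, $\partial/\partial q=b$, equals $\epsilon$; $T(\gamma^{-1})=T(\gamma)^{-1}$.) The map $\gamma\mapsto T(\gamma)$ induces $\varprojlim_N\mathbf C[\pi_1(Y(\mathbf C),b)]/I_b^N\cong\widehat T_{\mathbf C}$, $I_b$ the augmentation ideal. $\varphi_\infty$ is the $\mathbf C$-linear automorphism of $\widehat T_{\mathbf C}$ with $\varphi_\infty(T(\gamma))=T(F_\infty\circ\gamma)$ for $\gamma\in\pi_1(Y(\mathbf C),b)$, and $\varphi_\infty^{[1,2]}:\mathrm H_1^{\mathrm{dR}}(Y/\mathbf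 C)\to \mathrm H_1^{\mathrm{dR}}(Y/\mathbf C)^{\otimes2}$ is the composite of the inclusion of the degree-1 part, $\varphi_\infty$, and the projection to degree 2. **Basis.** $\mathcal B=\mathcal B_h\sqcup\mathcal B_{ah}\sqcup\mathcal B_e$ is a basis of $\mathrm H^1_{\mathrm{dR}}(Y/\mathbf R)$: $\mathcal B_h$ a basis of $\mathrm H^0(X,\Omega^1_{X/F})\otimes_F\mathbf R$; $\mathcal B_{ah}=\{\overline\omega:\omega\in\mathcal B_h\}$; $\mathcal B_e$ a set of lifts of a basis of $\mathrm{Coker}(\mathrm H^1_{\mathrm{dR}}(X/\mathbf R)\to\mathrm H^1_{\mathrm{dR}}(Y/\mathbf R))$ consisting of $\pm1$-eigenvectors of the involution of $\mathrm H^1_{\mathrm{dR}}(Y/\mathbf R)$ induced by $F_\infty$. $\{[\omega]^\vee\}$ is the dual basis. $\Omega^{(1)}=\sum_{[\omega]\in\mathcal B}[\omega]^\vee\otimes\omega$ and $\Omega^{(2)}=\sum_{[\omega],[\omega']\in\mathcal B}[\omega]^\vee[\omega']^\vee\otimes\alpha_{\omega,\omega'}$; the forms representing $\mathcal B_e$ are of type $(1,0)$, and whenever $\omega,\omega'$ are of the same type ($(1,0)$ or $(0,1)$), so that $\omega\wedge\omega'=0$, one takes $\alpha_{\omega,\omega'}=0$. $\langle\ ,\ \rangle$ is the canonical pairing. *)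

theory Defs
  imports "HOL-Complex_Analysis.Complex_Analysis"
begin

section \<open>The curve, the divisor and the open part\<close>

text \<open>
  A projective variety is handled in homogeneous coordinates: \<open>complex^'n\<close> has
  \<open>CARD('n)\<close> coordinates, the ambient space is the projective space of dimension
  \<open>CARD('n) - 1\<close>, and a set of complex points is represented by its punctured affine cone, a
  set of nonzero vectors stable under nonzero scalars.
\<close>

definition real_subfield :: "real set \<Rightarrow> bool" where
  "real_subfield F \<longleftrightarrow> 1 \<in> F \<and> (\<forall>x\<in>F. \<forall>y\<in>F. x - y \<in> F \<and> x * y \<in> F \<and> x / y \<in> F)"

definition hom_poly :: "real set \<Rightarrow> nat \<Rightarrow> (complex^'n \<Rightarrow> complex) \<Rightarrow> bool" where
  "hom_poly F d P \<longleftrightarrow>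
     (\<exists>a :: ('n \<Rightarrow> nat) \<Rightarrow> real. (\<forall>m. a m \<in> F) \<and>
        P = (\<lambda>v. \<Sum>m \<in> {m. (\<Sum>i\<in>UNIV. m i) = d}. of_real (a m) * (\<Prod>i\<in>UNIV. (v $ i) ^ m i)))"

definition pt :: "complex^'n \<Rightarrow> (complex^'n) set" where
  "pt v = {c *s v | c. c \<noteq> 0}"

definition cone :: "(complex^'n \<Rightarrow> complex) set \<Rightarrow> (complex^'n) set" where
  "cone E = {v. v \<noteq> 0 \<and> (\<forall>P\<in>E. P v = 0)}"

definition tangent :: "(complex^'n \<Rightarrow> complex) set \<Rightarrow> complex^'n \<Rightarrow> (complex^'n) set" where
  "tangent E v = {w. \<forall>P\<in>E. frechet_derivative P (at v) w = 0}"

text \<open>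
  The closed subscheme of projective space with equations \<open>E\<close> is a smooth geometrically
  connected curve.  The dimension condition is the Jacobian criterion (the rank of the Jacobian
  matrix is \<open>CARD('n) - 2\<close> at every point; the line through \<open>v\<close> itself always lies
  in the kernel).  The Jacobian criterion alone would allow a single fat point, which is excluded by
  having infinitely many points.  The cone is a bundle with connected fibres over \<open>X(\<complex>)\<close>,
  so it is connected if and only if \<open>X(\<complex>)\<close> is.
\<close>

definition smooth_projective_curve :: "real set \<Rightarrow> (complex^'n \<Rightarrow> complex) set \<Rightarrow> bool" where
  "smooth_projective_curve F E \<longleftrightarrow>
     (\<forall>P\<in>E. \<exists>d. hom_poly F d P) \<and>
     (\<forall>v\<in>cone E. vec.dim (tangent E v) = 2) \<and>
     infinite (pt ` cone E) \<and>
     connected (cone E)"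

text \<open>
  A reduced zero-dimensional closed subscheme over \<open>F\<close> is the same thing as a finite set of
  complex points that is the zero locus of homogeneous polynomials over \<open>F\<close>;
  \<open>D\<close> is the cone over this set.
\<close>

definition reduced_divisor ::
  "real set \<Rightarrow> (complex^'n \<Rightarrow> complex) set \<Rightarrow> (complex^'n) set \<Rightarrow> bool" where
  "reduced_divisor F E D \<longleftrightarrow>
     (\<exists>G. (\<forall>P\<in>G. \<exists>d. hom_poly F d P) \<and> D = cone (E \<union> G)) \<and> D \<noteq> {} \<and> finite (pt ` D)"

definition open_part ::
  "(complex^'n \<Rightarrow> complex) set \<Rightarrow> (complex^'n) set \<Rightarrow> (complex^'n) set" where
  "open_part E D = cone E - D"

definition F_inf :: "complex^'n \<Rightarrow> complex^'n" where
  "F_inf v = (\<chi> i. cnj (v $ i))"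


section \<open>Smooth differential forms\<close>

text \<open>All mixed partial derivatives of \<open>f\<close> exist and are Frechet differentiable on \<open>U\<close>.\<close>

definition smooth_fun :: "complex set \<Rightarrow> (complex \<Rightarrow> complex) \<Rightarrow> bool" where
  "smooth_fun U f \<longleftrightarrow>
     (\<exists>p :: nat \<Rightarrow> nat \<Rightarrow> complex \<Rightarrow> complex. p 0 0 = f \<and>
        (\<forall>i j. \<forall>z\<in>U. (p i j has_derivative
            (\<lambda>h. of_real (Re h) * p (Suc i) j z + of_real (Im h) * p i (Suc j) z)) (at z)))"

definition cderiv :: "(complex \<Rightarrow> complex^'n) \<Rightarrow> complex \<Rightarrow> complex^'n" where
  "cderiv u z = (\<chi> i. deriv (\<lambda>x. u x $ i) z)"

text \<open>
  A chart is a homogeneous lift of a holomorphic immersion of the open set \<open>U\<close> into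
  \<open>X(\<complex>)\<close>; locally it is the inverse of a holomorphic coordinate.
\<close>

definition chart ::
  "(complex^'n \<Rightarrow> complex) set \<Rightarrow> complex set \<Rightarrow> (complex \<Rightarrow> complex^'n) \<Rightarrow> bool" where
  "chart E U u \<longleftrightarrow> open U \<and> (\<forall>i. (\<lambda>z. u z $ i) holomorphic_on U) \<and>
     (\<forall>z\<in>U. u z \<in> cone E \<and> (\<forall>c. cderiv u z \<noteq> c *s u z))"

text \<open>
  A complex valued 1-form on \<open>Y(\<complex>)\<close> is represented by its pullback to the cone, i.e. by
  \<open>\<omega> v w\<close> for \<open>v\<close> in the cone and \<open>w\<close> tangent to the cone at \<open>v\<close>:
  real linear in \<open>w\<close>, invariant under scaling and zero on the directions of the fibres.
  Outside of its domain it is \<open>0\<close>, so that equality of forms is equality of functions.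
\<close>

type_synonym 'n form = "complex^'n \<Rightarrow> complex^'n \<Rightarrow> complex"

definition one_forms ::
  "(complex^'n \<Rightarrow> complex) set \<Rightarrow> (complex^'n) set \<Rightarrow> 'n::finite form set" where
  "one_forms E D = {\<omega>.
     (\<forall>v\<in>open_part E D.
        (\<forall>w\<in>tangent E v. \<forall>w'\<in>tangent E v. \<forall>a b :: real.
            \<omega> v (a *\<^sub>R w + b *\<^sub>R w') = of_real a * \<omega> v w + of_real b * \<omega> v w') \<and>
        (\<forall>w\<in>tangent E v. \<forall>c. c \<noteq> 0 \<longrightarrow> \<omega> (c *s v) (c *s w) = \<omega> v w) \<and>
        (\<forall>c. \<omega> v (c *s v) = 0)) \<and>
     (\<forall>v w. v \<notin> open_part E D \<or> w \<notin> tangent E v \<longrightarrow> \<omega> v w = 0)}"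

definition zero_form :: "'n::finite form" where
  "zero_form = (\<lambda>v w. 0)"

definition form_sum :: "'n::finite form set \<Rightarrow> ('n::finite form \<Rightarrow> complex) \<Rightarrow> 'n::finite form" where
  "form_sum A k = (\<lambda>v w. \<Sum>\<omega>\<in>A. k \<omega> * \<omega> v w)"

text \<open>The value of \<open>u\<^sup>* \<omega>\<close> at \<open>z\<close> on the tangent vector \<open>h\<close>.\<close>

definition pull :: "(complex \<Rightarrow> complex^'n) \<Rightarrow> 'n::finite form \<Rightarrow> complex \<Rightarrow> complex \<Rightarrow> complex" where
  "pull u \<omega> z h = \<omega> (u z) (h *s cderiv u z)"

definition smooth_forms ::
  "(complex^'n \<Rightarrow> complex) set \<Rightarrow> (complex^'n) set \<Rightarrow> 'n::finite form set" where
  "smooth_forms E D = {\<omega> \<in> one_forms E D. \<forall>U u. chart E U u \<and> u ` U \<subseteq> open_part E D \<longrightarrow>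
     (\<exists>f g. smooth_fun U f \<and> smooth_fun U g \<and>
        (\<forall>z\<in>U. \<forall>h. pull u \<omega> z h = f z * h + g z * cnj h))}"

text \<open>\<open>A\<^sup>1(X)\<close>, viewed as the forms on \<open>Y\<close> that extend smoothly across \<open>D\<close>.\<close>

definition A1_compact ::
  "(complex^'n \<Rightarrow> complex) set \<Rightarrow> (complex^'n) set \<Rightarrow> 'n::finite form set" where
  "A1_compact E D = {\<omega> \<in> one_forms E D. \<forall>U u. chart E U u \<longrightarrow>
     (\<exists>f g. smooth_fun U f \<and> smooth_fun U g \<and>
        (\<forall>z\<in>U. u z \<notin> D \<longrightarrow> (\<forall>h. pull u \<omega> z h = f z * h + g z * cnj h)))}"

definition centred_chart ::
  "(complex^'n \<Rightarrow> complex) set \<Rightarrow> (complex^'n) set \<Rightarrow> complex^'n \<Rightarrow>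
    complex set \<Rightarrow> (complex \<Rightarrow> complex^'n) \<Rightarrow> bool" where
  "centred_chart E D v U u \<longleftrightarrow>
     chart E U u \<and> 0 \<in> U \<and> u 0 \<in> pt v \<and> (\<forall>z\<in>U - {0}. u z \<notin> D)"

text \<open>\<open>u\<^sup>* \<omega> = f dz/z + g dz'\<close> (with \<open>z'\<close> the conjugate of \<open>z\<close>), with \<open>f\<close> and \<open>g\<close> smooth on \<open>U\<close>, including at \<open>0\<close>.\<close>

definition log_rep ::
  "complex set \<Rightarrow> (complex \<Rightarrow> complex^'n) \<Rightarrow> 'n::finite form \<Rightarrow>
    (complex \<Rightarrow> complex) \<Rightarrow> (complex \<Rightarrow> complex) \<Rightarrow> bool" where
  "log_rep U u \<omega> f g \<longleftrightarrow> smooth_fun U f \<and> smooth_fun U g \<and>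
     (\<forall>z\<in>U - {0}. \<forall>h. pull u \<omega> z h = f z * (h / z) + g z * cnj h)"

definition A1_log ::
  "(complex^'n \<Rightarrow> complex) set \<Rightarrow> (complex^'n) set \<Rightarrow> 'n::finite form set" where
  "A1_log E D = {\<omega> \<in> smooth_forms E D.
     \<forall>v\<in>D. \<forall>U u. centred_chart E D v U u \<longrightarrow> (\<exists>f g. log_rep U u \<omega> f g)}"

definition residue_at ::
  "(complex^'n \<Rightarrow> complex) set \<Rightarrow> (complex^'n) set \<Rightarrow> complex^'n \<Rightarrow> 'n::finite form \<Rightarrow> complex" where
  "residue_at E D v \<omega> =
     (THE r. \<forall>U u f g. centred_chart E D v U u \<and> log_rep U u \<omega> f g \<longrightarrow> f 0 = r)"

definition type_10 ::
  "(complex^'n \<Rightarrow> complex) set \<Rightarrow> (complex^'n) set \<Rightarrow> 'n::finite form set" where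
  "type_10 E D = {\<omega> \<in> A1_log E D. \<forall>v w c. \<omega> v (c *s w) = c * \<omega> v w}"

definition hodge_A :: "(complex^'n \<Rightarrow> complex) set \<Rightarrow> (complex^'n) set \<Rightarrow> nat \<Rightarrow> 'n::finite form set" where
  "hodge_A E D p =
     (if p = 0 then A1_log E D else if p = 1 then type_10 E D else {zero_form})"

definition weight_A :: "(complex^'n \<Rightarrow> complex) set \<Rightarrow> (complex^'n) set \<Rightarrow> int \<Rightarrow> 'n::finite form set" where
  "weight_A E D m =
     (if m < 0 then {zero_form} else if m = 0 then A1_compact E D else A1_log E D)"

text \<open>
  2-forms only occur through their coefficient with respect to \<open>dx \<and> dy\<close> in a chart with
  \<open>z = x + \<i> y\<close>; \<open>wedge_coeff\<close> and \<open>d_coeff\<close> are the coefficients of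
  \<open>\<alpha> \<and> \<beta>\<close> and \<open>d \<omega>\<close>.
\<close>

definition wedge_coeff ::
  "(complex \<Rightarrow> complex^'n) \<Rightarrow> 'n::finite form \<Rightarrow> 'n::finite form \<Rightarrow> complex \<Rightarrow> complex" where
  "wedge_coeff u \<alpha> \<beta> z = pull u \<alpha> z 1 * pull u \<beta> z \<i> - pull u \<alpha> z \<i> * pull u \<beta> z 1"

definition d_coeff :: "(complex \<Rightarrow> complex^'n) \<Rightarrow> 'n::finite form \<Rightarrow> complex \<Rightarrow> complex" where
  "d_coeff u \<omega> z =
     vector_derivative (\<lambda>t::real. pull u \<omega> (z + of_real t) \<i>) (at 0)
     - vector_derivative (\<lambda>t::real. pull u \<omega> (z + \<i> * of_real t) 1) (at 0)"

definition closed_form ::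
  "(complex^'n \<Rightarrow> complex) set \<Rightarrow> (complex^'n) set \<Rightarrow> 'n::finite form \<Rightarrow> bool" where
  "closed_form E D \<omega> \<longleftrightarrow>
     (\<forall>U u. chart E U u \<and> u ` U \<subseteq> open_part E D \<longrightarrow> (\<forall>z\<in>U. d_coeff u \<omega> z = 0))"

definition exact_forms ::
  "(complex^'n \<Rightarrow> complex) set \<Rightarrow> (complex^'n) set \<Rightarrow> 'n::finite form set" where
  "exact_forms E D = {\<omega> \<in> smooth_forms E D.
     \<exists>\<Phi> :: complex^'n \<Rightarrow> complex.
       (\<forall>v\<in>open_part E D. \<forall>c. c \<noteq> 0 \<longrightarrow> \<Phi> (c *s v) = \<Phi> v) \<and>
       (\<forall>U u. chart E U u \<and> u ` U \<subseteq> open_part E D \<longrightarrow>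
          smooth_fun U (\<lambda>z. \<Phi> (u z)) \<and>
          (\<forall>z\<in>U. ((\<lambda>x. \<Phi> (u x)) has_derivative pull u \<omega> z) (at z)))}"

definition cohomologous ::
  "(complex^'n \<Rightarrow> complex) set \<Rightarrow> (complex^'n) set \<Rightarrow> 'n::finite form \<Rightarrow> 'n::finite form \<Rightarrow> bool" where
  "cohomologous E D \<omega> \<omega>' \<longleftrightarrow> (\<lambda>v w. \<omega> v w - \<omega>' v w) \<in> exact_forms E D"

definition conj_form :: "'n::finite form \<Rightarrow> 'n::finite form" where
  "conj_form \<omega> = (\<lambda>v w. cnj (\<omega> v w))"

definition F_inf_pullback :: "'n::finite form \<Rightarrow> 'n::finite form" where
  "F_inf_pullback \<omega> = (\<lambda>v w. \<omega> (F_inf v) (F_inf w))"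


section \<open>De Rham cohomology\<close>

text \<open>
  Sections over \<open>V\<close> of the sheaf of Kaehler differentials of \<open>X\<close> over \<open>F\<close>, where
  \<open>V\<close> is \<open>cone E\<close> for \<open>X\<close> and \<open>open_part E D\<close> for \<open>Y\<close>: near every point of
  \<open>V\<close> a finite sum of terms \<open>g dh\<close> with \<open>g = P i / N\<close> and \<open>h = R i / N\<close>
  regular over \<open>F\<close> (a common denominator can always be chosen).
\<close>

definition algebraic_forms ::
  "real set \<Rightarrow> (complex^'n \<Rightarrow> complex) set \<Rightarrow> (complex^'n) set \<Rightarrow> (complex^'n) set \<Rightarrow> 'n::finite form set"
where
  "algebraic_forms F E D V = {\<omega> \<in> one_forms E D.
     \<forall>v\<in>V. \<exists>d N (k::nat) P R.
       hom_poly F d N \<and> N v \<noteq> 0 \<and> (\<forall>i<k. hom_poly F d (P i) \<and> hom_poly F d (R i)) \<and>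
       (\<forall>x\<in>open_part E D. N x \<noteq> 0 \<longrightarrow> (\<forall>w\<in>tangent E x.
          \<omega> x w = (\<Sum>i<k. P i x / N x * frechet_derivative (\<lambda>y. R i y / N y) (at x) w)))}"

definition lin_span :: "complex set \<Rightarrow> 'n::finite form set \<Rightarrow> 'n::finite form set" where
  "lin_span K S = {form_sum A k | A k. finite A \<and> A \<subseteq> S \<and> (\<forall>\<omega>\<in>A. k \<omega> \<in> K)}"

text \<open>
  The closed forms on \<open>Y(\<complex>)\<close> whose class lies in
  \<open>H\<^sup>1_dR(Y/K) = H\<^sup>1_dR(Y/F) \<otimes> K\<close>, for fields \<open>F \<subseteq> K \<subseteq> \<complex>\<close>.  As \<open>Y\<close> is affine,
  \<open>H\<^sup>1_dR(Y/F)\<close> consists of the classes of the algebraic 1-forms on \<open>Y\<close>.  The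
  cohomology group itself is the quotient of this space by \<open>exact_forms\<close>.
\<close>

definition dR ::
  "complex set \<Rightarrow> real set \<Rightarrow> (complex^'n \<Rightarrow> complex) set \<Rightarrow> (complex^'n) set \<Rightarrow> 'n::finite form set" where
  "dR K F E D = {\<omega> \<in> smooth_forms E D. closed_form E D \<omega> \<and>
     (\<exists>\<eta> \<in> lin_span K (algebraic_forms F E D (open_part E D)). cohomologous E D \<omega> \<eta>)}"

abbreviation dR_F where "dR_F F E D \<equiv> dR (of_real ` F) F E D"
abbreviation dR_R where "dR_R F E D \<equiv> dR \<real> F E D"
abbreviation dR_C where "dR_C F E D \<equiv> dR UNIV F E D"

text \<open>\<open>F\<^sup>1\<close> of the Hodge filtration (\<open>F\<^sup>0\<close> is everything, \<open>F\<^sup>2 = 0\<close>).\<close>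

definition hodge_H1 ::
  "real set \<Rightarrow> (complex^'n \<Rightarrow> complex) set \<Rightarrow> (complex^'n) set \<Rightarrow> 'n::finite form set" where
  "hodge_H1 F E D = {\<omega> \<in> dR_C F E D.
     \<exists>\<eta>\<in>type_10 E D. closed_form E D \<eta> \<and> cohomologous E D \<omega> \<eta>}"

text \<open>
  The image of \<open>H\<^sup>1(X)\<close>, which is \<open>W\<^sub>1\<close> of the weight filtration
  (\<open>W\<^sub>0 = 0\<close> and \<open>W\<^sub>2\<close> is everything).
\<close>

definition weight1_H1 ::
  "complex set \<Rightarrow> real set \<Rightarrow> (complex^'n \<Rightarrow> complex) set \<Rightarrow> (complex^'n) set \<Rightarrow> 'n::finite form set" where
  "weight1_H1 K F E D = {\<omega> \<in> dR K F E D.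
     \<exists>\<eta>\<in>A1_compact E D. closed_form E D \<eta> \<and> cohomologous E D \<omega> \<eta>}"

definition weight_of ::
  "real set \<Rightarrow> (complex^'n \<Rightarrow> complex) set \<Rightarrow> (complex^'n) set \<Rightarrow> 'n::finite form \<Rightarrow> int" where
  "weight_of F E D \<omega> = (if \<omega> \<in> weight1_H1 UNIV F E D then 1 else 2)"

text \<open>\<open>B\<close> is a finite set representing a real basis of \<open>S / N\<close>.\<close>

definition real_basis_mod :: "'n::finite form set \<Rightarrow> 'n::finite form set \<Rightarrow> 'n::finite form set \<Rightarrow> bool" where
  "real_basis_mod N S B \<longleftrightarrow> finite B \<and> B \<subseteq> S \<and>
     (\<forall>\<omega>\<in>S. \<exists>k. (\<forall>\<beta>\<in>B. k \<beta> \<in> \<real>) \<and> (\<lambda>v w. \<omega> v w - form_sum B k v w) \<in> N) \<and>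
     (\<forall>k. (\<forall>\<beta>\<in>B. k \<beta> \<in> \<real>) \<and> form_sum B k \<in> N \<longrightarrow> (\<forall>\<beta>\<in>B. k \<beta> = 0))"

definition adapted_basis ::
  "real set \<Rightarrow> (complex^'n \<Rightarrow> complex) set \<Rightarrow> (complex^'n) set \<Rightarrow>
    'n::finite form set \<Rightarrow> 'n::finite form set \<Rightarrow> 'n::finite form set \<Rightarrow> bool" where
  "adapted_basis F E D Bh Bah Be \<longleftrightarrow>
     real_basis_mod {zero_form} (lin_span \<real> (algebraic_forms F E D (cone E))) Bh \<and>
     Bah = conj_form ` Bh \<and>
     real_basis_mod (weight1_H1 \<real> F E D) (dR_R F E D) Be \<and>
     Be \<subseteq> type_10 E D \<and>
     (\<forall>\<omega>\<in>Be. cohomologous E D (F_inf_pullback \<omega>) \<omega> \<or>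
             cohomologous E D (F_inf_pullback \<omega>) (\<lambda>v w. - \<omega> v w)) \<and>
     Bh \<inter> Bah = {} \<and> Bh \<inter> Be = {} \<and> Bah \<inter> Be = {} \<and>
     real_basis_mod (exact_forms E D) (dR_R F E D) (Bh \<union> Bah \<union> Be)"


section \<open>The completed tensor algebra\<close>

text \<open>
  \<open>H\<^sub>1^dR(Y)\<close> is the dual of the finite dimensional space \<open>H\<^sup>1_dR(Y)\<close>, so its
  \<open>n\<close>-th tensor power is the space of \<open>n\<close>-linear functionals on \<open>H\<^sup>1_dR(Y)\<close>.
  An element of the completed tensor algebra is a sequence of such functionals, one for each
  \<open>n\<close>, encoded as a function of the list of arguments; the arguments are representing forms.
  The canonical pairing with \<open>[\<omega>\<^sub>1] \<otimes> \<dots> \<otimes> [\<omega>\<^sub>n]\<close> is evaluation at the list.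
\<close>

type_synonym 'n tensor = "'n form list \<Rightarrow> complex"

definition T_hat ::
  "real set \<Rightarrow> (complex^'n \<Rightarrow> complex) set \<Rightarrow> (complex^'n) set \<Rightarrow> 'n::finite tensor set" where
  "T_hat F E D = {t. \<forall>xs ys.
     (\<forall>\<omega>. \<omega> \<notin> dR_C F E D \<longrightarrow> t (xs @ \<omega> # ys) = 0) \<and>
     (\<forall>\<omega>\<in>exact_forms E D. t (xs @ \<omega> # ys) = 0) \<and>
     (\<forall>\<omega>\<in>dR_C F E D. \<forall>\<omega>'\<in>dR_C F E D. \<forall>a b.
        t (xs @ (\<lambda>v w. a * \<omega> v w + b * \<omega>' v w) # ys) =
          a * t (xs @ \<omega> # ys) + b * t (xs @ \<omega>' # ys))}"

definition T_hat_ge ::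
  "real set \<Rightarrow> (complex^'n \<Rightarrow> complex) set \<Rightarrow> (complex^'n) set \<Rightarrow> nat \<Rightarrow> 'n::finite tensor set" where
  "T_hat_ge F E D n = {t \<in> T_hat F E D. \<forall>ws. length ws < n \<longrightarrow> t ws = 0}"

definition T_deg ::
  "real set \<Rightarrow> (complex^'n \<Rightarrow> complex) set \<Rightarrow> (complex^'n) set \<Rightarrow> nat \<Rightarrow> 'n::finite tensor set" where
  "T_deg F E D n = {t \<in> T_hat F E D. \<forall>ws. length ws \<noteq> n \<longrightarrow> t ws = 0}"

definition deg_part :: "nat \<Rightarrow> 'n::finite tensor \<Rightarrow> 'n::finite tensor" where
  "deg_part n t = (\<lambda>ws. if length ws = n then t ws else 0)"

definition t_comb :: "complex \<Rightarrow> 'n::finite tensor \<Rightarrow> complex \<Rightarrow> 'n::finite tensor \<Rightarrow> 'n::finite tensor" where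
  "t_comb a s b t = (\<lambda>ws. a * s ws + b * t ws)"

definition t_one :: "'n::finite tensor" where
  "t_one = (\<lambda>ws. if ws = [] then 1 else 0)"

definition t_mult :: "'n::finite tensor \<Rightarrow> 'n::finite tensor \<Rightarrow> 'n::finite tensor" where
  "t_mult s t = (\<lambda>ws. \<Sum>i\<le>length ws. s (take i ws) * t (drop i ws))"

primrec t_power :: "'n::finite tensor \<Rightarrow> nat \<Rightarrow> 'n::finite tensor" where
  "t_power t 0 = t_one"
| "t_power t (Suc k) = t_mult t (t_power t k)"

text \<open>
  For \<open>t\<close> without constant term, \<open>t_power t k\<close> vanishes on lists shorter than \<open>k\<close>,
  so the exponential series is finite on each list.
\<close>

definition t_exp :: "'n::finite tensor \<Rightarrow> 'n::finite tensor" where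
  "t_exp t = (\<lambda>ws. \<Sum>k\<le>length ws. t_power t k ws / fact k)"

definition t_inverse :: "'n::finite tensor \<Rightarrow> 'n::finite tensor" where
  "t_inverse t = (THE s. t_mult s t = t_one \<and> t_mult t s = t_one)"

inductive_set free_lie ::
  "real set \<Rightarrow> (complex^'n \<Rightarrow> complex) set \<Rightarrow> (complex^'n) set \<Rightarrow> 'n::finite tensor set"
  for F E D where
    gen: "t \<in> T_deg F E D 1 \<Longrightarrow> t \<in> free_lie F E D"
  | comb: "s \<in> free_lie F E D \<Longrightarrow> t \<in> free_lie F E D \<Longrightarrow> t_comb a s b t \<in> free_lie F E D"
  | bracket: "s \<in> free_lie F E D \<Longrightarrow> t \<in> free_lie F E D \<Longrightarrow>
      t_comb 1 (t_mult s t) (-1) (t_mult t s) \<in> free_lie F E D"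

text \<open>The element \<open>[\<eta>]\<^sup>\<or>\<close> of the dual basis of \<open>B\<close>.\<close>

definition dual_basis_elem ::
  "real set \<Rightarrow> (complex^'n \<Rightarrow> complex) set \<Rightarrow> (complex^'n) set \<Rightarrow> 'n::finite form set \<Rightarrow>
    'n::finite form \<Rightarrow> 'n::finite tensor" where
  "dual_basis_elem F E D B \<eta> =
     (THE t. t \<in> T_deg F E D 1 \<and> (\<forall>\<omega>\<in>B. t [\<omega>] = (if \<omega> = \<eta> then 1 else 0)))"


section \<open>The form \<open>\<Omega>\<close>\<close>

text \<open>
  \<open>\<Omega>\<^sup>(\<^sup>n\<^sup>)\<close> is a tensor with coefficients in \<open>A\<^sup>1(X log D)\<close>, encoded as the
  corresponding \<open>n\<close>-linear map from classes to forms.  Tensors over \<open>F\<close> of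
  \<open>H\<^sub>1^dR(Y/F)\<close> with a complex vector space are the same as tensors over \<open>\<complex>\<close> of
  \<open>H\<^sub>1^dR(Y/\<complex>)\<close> with it; the \<open>F\<close>-structure enters through the fact that
  \<open>c \<circ> F_inf\<^sup>*\<close> acts on the form factor only, i.e. on the values at \<open>F\<close>-rational classes.
  The condition \<open>\<Omega> \<in> F\<^sup>0 W\<^sub>-\<^sub>1\<close> says that the maps respect the Hodge filtrations and
  lower the weight filtrations by one, with the usual filtrations on
  tensor powers of \<open>H\<^sup>1\<close>.  Since \<open>d\<Omega> = \<Omega> \<and> \<Omega>\<close> is imposed also for \<open>n = 1\<close>, where the
  sum is empty, it contains the closedness of \<open>\<Omega>\<^sup>(\<^sup>1\<^sup>)\<close>.
\<close>

definition is_Omega ::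
  "real set \<Rightarrow> (complex^'n \<Rightarrow> complex) set \<Rightarrow> (complex^'n) set \<Rightarrow>
    ('n::finite form list \<Rightarrow> 'n::finite form) \<Rightarrow> bool" where
  "is_Omega F E D \<Omega> \<longleftrightarrow>
     \<Omega> [] = zero_form \<and>
     (\<forall>v w. (\<lambda>ws. \<Omega> ws v w) \<in> T_hat F E D) \<and>
     (\<forall>ws. \<Omega> ws \<in> A1_log E D) \<and>
     \<comment> \<open>\<open>F\<^sup>0\<close>\<close>
     (\<forall>ws \<in> lists (dR_C F E D). ws \<noteq> [] \<longrightarrow>
        \<Omega> ws \<in> hodge_A E D (length (filter (\<lambda>\<omega>. \<omega> \<in> hodge_H1 F E D) ws))) \<and>
     \<comment> \<open>\<open>W\<^sub>-\<^sub>1\<close>\<close>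
     (\<forall>ws \<in> lists (dR_C F E D). ws \<noteq> [] \<longrightarrow>
        \<Omega> ws \<in> weight_A E D ((\<Sum>\<omega>\<leftarrow>ws. weight_of F E D \<omega>) - 1)) \<and>
     \<comment> \<open>values in the completed free Lie algebra\<close>
     (\<forall>n\<ge>1. \<exists>(k::nat) l a.
        (\<forall>i<k. l i \<in> free_lie F E D \<inter> T_deg F E D n \<and> a i \<in> A1_log E D) \<and>
        (\<forall>ws. length ws = n \<longrightarrow> \<Omega> ws = (\<lambda>v w. \<Sum>i<k. l i ws * a i v w))) \<and>
     \<comment> \<open>\<open>d\<Omega> = \<Omega> \<and> \<Omega>\<close>\<close>
     (\<forall>ws U u. chart E U u \<and> u ` U \<subseteq> open_part E D \<longrightarrow>
        (\<forall>z\<in>U. d_coeff u (\<Omega> ws) z =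
           (\<Sum>i\<in>{0<..<length ws}. wedge_coeff u (\<Omega> (take i ws)) (\<Omega> (drop i ws)) z))) \<and>
     \<comment> \<open>\<open>c \<circ> F_inf\<^sup>*(\<Omega>) = \<Omega>\<close>\<close>
     (\<forall>ws \<in> lists (dR_F F E D). conj_form (F_inf_pullback (\<Omega> ws)) = \<Omega> ws) \<and>
     \<comment> \<open>\<open>\<Omega>\<^sup>(\<^sup>1\<^sup>)\<close> represents the identity\<close>
     (\<forall>\<omega> \<in> dR_C F E D. cohomologous E D (\<Omega> [\<omega>]) \<omega>)"

text \<open>
  \<open>\<Omega>\<^sup>(\<^sup>1\<^sup>) = \<Sum> [\<omega>]\<^sup>\<or> \<otimes> \<omega>\<close> and \<open>\<alpha>_{\<omega>,\<omega>'} = \<Omega> [\<omega>, \<omega>'] = 0\<close> for \<open>\<omega>, \<omega>'\<close> of the same type.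
\<close>

definition Omega_compatible ::
  "('n::finite form list \<Rightarrow> 'n::finite form) \<Rightarrow> 'n::finite form set \<Rightarrow> 'n::finite form set \<Rightarrow> 'n::finite form set \<Rightarrow> bool" where
  "Omega_compatible \<Omega> Bh Bah Be \<longleftrightarrow>
     (\<forall>\<omega> \<in> Bh \<union> Bah \<union> Be. \<Omega> [\<omega>] = \<omega>) \<and>
     (\<forall>\<omega> \<in> Bh \<union> Be. \<forall>\<omega>' \<in> Bh \<union> Be. \<Omega> [\<omega>, \<omega>'] = zero_form) \<and>
     (\<forall>\<omega> \<in> Bah. \<forall>\<omega>' \<in> Bah. \<Omega> [\<omega>, \<omega>'] = zero_form)"


section \<open>Iterated integrals and base points\<close>

text \<open>
  Paths in \<open>X(\<complex>)\<close> are given by piecewise \<open>C\<^sup>1\<close> lifts to the cone.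
  \<open>iter_int \<gamma> s [\<omega>\<^sub>1, \<dots>, \<omega>\<^sub>n]\<close> is the integral over \<open>0 \<le> t\<^sub>n \<le> \<dots> \<le> t\<^sub>1 \<le> s\<close>.
\<close>

primrec iter_int :: "(real \<Rightarrow> complex^'n) \<Rightarrow> 'n::finite form list \<Rightarrow> real \<Rightarrow> complex" where
  "iter_int \<gamma> [] s = 1"
| "iter_int \<gamma> (\<omega> # \<omega>s) s =
     integral {0..s} (\<lambda>t. \<omega> (\<gamma> t) (vector_derivative \<gamma> (at t within {0..1})) * iter_int \<gamma> \<omega>s t)"

text \<open>
  The coefficient of \<open>\<Sum>\<^sub>n \<integral> \<Omega>\<^sup>n\<close> at \<open>ws\<close> along the part of \<open>\<gamma>\<close> over \<open>[0, s]\<close>: by definition of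
  the product of tensors, \<open>\<Omega>\<^sup>n\<close> at \<open>ws\<close> is the sum over all ways of cutting \<open>ws\<close> into \<open>n\<close>
  nonempty pieces.
\<close>

definition T_upto ::
  "('n::finite form list \<Rightarrow> 'n::finite form) \<Rightarrow> (real \<Rightarrow> complex^'n) \<Rightarrow> real \<Rightarrow> 'n::finite tensor" where
  "T_upto \<Omega> \<gamma> s = (\<lambda>ws. \<Sum>wss \<in> {wss. concat wss = ws \<and> [] \<notin> set wss}. iter_int \<gamma> (map \<Omega> wss) s)"

text \<open>
  \<open>Point v\<close> is the point with homogeneous coordinates \<open>v\<close>; \<open>Tangential v w\<close> is the
  tangent vector at that point which is the image of the vector \<open>w\<close>, tangent to the cone at
  \<open>v\<close>.  It is zero if and only if \<open>w\<close> is a multiple of \<open>v\<close>.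
\<close>

datatype 'n base_point = Point "complex^'n" | Tangential "complex^'n" "complex^'n"

definition rational_vector :: "real set \<Rightarrow> complex^'n \<Rightarrow> bool" where
  "rational_vector F v \<longleftrightarrow> (\<forall>i. v $ i \<in> of_real ` F)"

primrec rational_base_point ::
  "real set \<Rightarrow> (complex^'n \<Rightarrow> complex) set \<Rightarrow> (complex^'n) set \<Rightarrow> 'n::finite base_point \<Rightarrow> bool" where
  "rational_base_point F E D (Point v) \<longleftrightarrow> v \<in> open_part E D \<and> rational_vector F v"
| "rational_base_point F E D (Tangential v w) \<longleftrightarrow>
     v \<in> D \<and> rational_vector F v \<and> w \<in> tangent E v \<and> rational_vector F w \<and> (\<forall>c. w \<noteq> c *s v)"

text \<open>
  The inverse \<open>u\<close> of a local parameter \<open>q\<close> at the point of \<open>v\<close> with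
  \<open>\<partial>/\<partial>q\<close> the tangent vector given by \<open>(v, w)\<close>.
\<close>

definition tangential_chart ::
  "(complex^'n \<Rightarrow> complex) set \<Rightarrow> (complex^'n) set \<Rightarrow> complex^'n \<Rightarrow> complex^'n \<Rightarrow>
    complex set \<Rightarrow> (complex \<Rightarrow> complex^'n) \<Rightarrow> bool" where
  "tangential_chart E D v w U u \<longleftrightarrow> centred_chart E D v U u \<and>
     (\<exists>c a. c \<noteq> 0 \<and> u 0 = c *s v \<and> cderiv u 0 = c *s w + a *s v)"

text \<open>
  A path from a point of \<open>Y\<close> to the tangential base point: near its end it runs along the ray
  \<open>q > 0\<close>, parametrised by \<open>q = 1 - t\<close>, so the point where \<open>q = \<epsilon>\<close> is reached at
  time \<open>1 - \<epsilon>\<close>.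
\<close>

definition path_to_tangential ::
  "(complex^'n \<Rightarrow> complex) set \<Rightarrow> (complex^'n) set \<Rightarrow> complex^'n \<Rightarrow> complex^'n \<Rightarrow>
    (real \<Rightarrow> complex^'n) \<Rightarrow> bool" where
  "path_to_tangential E D v w \<gamma> \<longleftrightarrow> valid_path \<gamma> \<and> \<gamma> ` {0..<1} \<subseteq> open_part E D \<and>
     (\<exists>U u \<delta>. tangential_chart E D v w U u \<and> 0 < \<delta> \<and> \<delta> < 1 \<and>
        (\<forall>t\<in>{1-\<delta>..1}. of_real (1 - t) \<in> U \<and> \<gamma> t \<in> pt (u (of_real (1 - t)))))"

definition T_to_tangential ::
  "(complex^'n \<Rightarrow> complex) set \<Rightarrow> (complex^'n) set \<Rightarrow> ('n::finite form list \<Rightarrow> 'n::finite form) \<Rightarrow>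
    complex^'n \<Rightarrow> (real \<Rightarrow> complex^'n) \<Rightarrow> 'n::finite tensor" where
  "T_to_tangential E D \<Omega> v \<gamma> = (\<lambda>ws. Lim (at_right (0::real)) (\<lambda>\<epsilon>.
     t_mult (t_exp (\<lambda>xs. - of_real (ln \<epsilon>) * residue_at E D v (\<Omega> xs))) (T_upto \<Omega> \<gamma> (1 - \<epsilon>)) ws))"

definition loop_at ::
  "(complex^'n \<Rightarrow> complex) set \<Rightarrow> (complex^'n) set \<Rightarrow> complex^'n \<Rightarrow> (real \<Rightarrow> complex^'n) \<Rightarrow> bool" where
  "loop_at E D v \<gamma> \<longleftrightarrow>
     valid_path \<gamma> \<and> path_image \<gamma> \<subseteq> open_part E D \<and> pathstart \<gamma> \<in> pt v \<and> pathfinish \<gamma> \<in> pt v"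

text \<open>
  \<open>\<phi> (T(\<gamma>)) = T(F_inf \<circ> \<gamma>)\<close> for the loops at the base point.  A loop at a tangential base
  point is a path \<open>\<alpha>\<close> to it traversed backwards, followed by a path \<open>\<beta>\<close> to it with the same
  initial point, and then \<open>T(\<gamma>) = T(\<beta>) T(\<alpha>)\<^sup>-\<^sup>1\<close>: in iterated integrals with \<open>t\<^sub>n \<le> \<dots> \<le> t\<^sub>1\<close>
  the last part of the path contributes the first factor.
\<close>

primrec equivariant ::
  "(complex^'n \<Rightarrow> complex) set \<Rightarrow> (complex^'n) set \<Rightarrow> ('n::finite form list \<Rightarrow> 'n::finite form) \<Rightarrow>
    'n::finite base_point \<Rightarrow> ('n::finite tensor \<Rightarrow> 'n::finite tensor) \<Rightarrow> bool" where
  "equivariant E D \<Omega> (Point v) \<phi> \<longleftrightarrow>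
     (\<forall>\<gamma>. loop_at E D v \<gamma> \<longrightarrow> \<phi> (T_upto \<Omega> \<gamma> 1) = T_upto \<Omega> (F_inf \<circ> \<gamma>) 1)"
| "equivariant E D \<Omega> (Tangential v w) \<phi> \<longleftrightarrow>
     (\<forall>\<alpha> \<beta>. path_to_tangential E D v w \<alpha> \<and> path_to_tangential E D v w \<beta> \<and>
        pt (pathstart \<alpha>) = pt (pathstart \<beta>) \<longrightarrow>
        \<phi> (t_mult (T_to_tangential E D \<Omega> v \<beta>) (t_inverse (T_to_tangential E D \<Omega> v \<alpha>))) =
          t_mult (T_to_tangential E D \<Omega> v (F_inf \<circ> \<beta>))
                 (t_inverse (T_to_tangential E D \<Omega> v (F_inf \<circ> \<alpha>))))"

text \<open>
  An automorphism of the completed tensor algebra is understood to be continuous for the topology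
  given by the powers of the augmentation ideal; only then is it determined by its values on the
  \<open>T(\<gamma>)\<close>, whose span is dense.
\<close>

definition is_phi_inf ::
  "real set \<Rightarrow> (complex^'n \<Rightarrow> complex) set \<Rightarrow> (complex^'n) set \<Rightarrow> ('n::finite form list \<Rightarrow> 'n::finite form) \<Rightarrow>
    'n::finite base_point \<Rightarrow> ('n::finite tensor \<Rightarrow> 'n::finite tensor) \<Rightarrow> bool" where
  "is_phi_inf F E D \<Omega> b \<phi> \<longleftrightarrow>
     bij_betw \<phi> (T_hat F E D) (T_hat F E D) \<and>
     (\<forall>s\<in>T_hat F E D. \<forall>t\<in>T_hat F E D. \<forall>x y. \<phi> (t_comb x s y t) = t_comb x (\<phi> s) y (\<phi> t)) \<and>
     (\<forall>n. \<exists>m. \<phi> ` T_hat_ge F E D m \<subseteq> T_hat_ge F E D n) \<and>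
     equivariant E D \<Omega> b \<phi>"

definition phi_12 :: "('n::finite tensor \<Rightarrow> 'n::finite tensor) \<Rightarrow> 'n::finite tensor \<Rightarrow> 'n::finite tensor" where
  "phi_12 \<phi> t = deg_part 2 (\<phi> t)"

definition pairing :: "'n::finite form list \<Rightarrow> 'n::finite tensor \<Rightarrow> complex" where
  "pairing ws t = t ws"

end

theory Submission
  imports Defs
begin

text \<open>
  Let \<open>\<omega>, \<omega>'\<close> be of the same type. As \<open>\<Omega>\<close> vanishes on \<open>[\<omega>, \<omega>']\<close> and on the conjugate word, the coefficient of
  \<open>T(\<gamma>)\<close> at \<open>[\<omega>, \<omega>']\<close> is a plain iterated integral; as \<open>\<omega>\<close> is defined over the reals, \<open>F_inf\<^sup>* \<omega>\<close> is the complex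
  conjugate form. Hence the functional \<open>L t = \<phi> t [\<omega>, \<omega>'] - t [conj \<omega>, conj \<omega>']\<close> kills \<open>T(\<gamma>)\<close> for every loop
  \<open>\<gamma>\<close>. It also kills all tensors of large degree because \<open>\<phi>\<close> is continuous, so it is zero as soon as the
  \<open>T(\<gamma>)\<close> span a dense subspace. Their span is closed under products, so this reduces to degree 1, i.e. to the fact
  that a closed form without periods is exact. Finally \<open>L\<close> vanishes on \<open>[\<eta>]\<^sup>\<or>\<close>, whose degree 2 part is zero.

  At a tangential base point, \<open>T\<close> of a path is the regularised transport \<open>R\<close> along a ray composed with the
  transport from a nearby point, so conjugation by \<open>R\<close> reduces density to that point; and since forms in
  \<open>Bh \<union> Bah\<close> have no residues, the regularisation does not affect the words in question.
\<close>

section \<open>Tensors\<close>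

text \<open>Smoothness of a form is only given in charts, so the piecewise continuity of its
  pullback along a path is built into the class of \<open>nice\<close> paths. These are obtained
  from curves in charts by rescaling and joining; as \<open>equivariant\<close> speaks of all loops,
  it suffices that nice paths compose and connect any two points of \<open>Y\<close>. Paths are
  lifts to the cone and close up only to a scalar, which is why every composition rescales the
  second path. The sum over cuttings in \<open>T_upto\<close> is rewritten as the solution
  \<open>transport\<close> of a linear differential equation; composition of paths and
  class-linearity then follow by induction on the length of a word, and so does the growth estimate
  at a tangential base point, where the coefficient has a simple pole. There growth is measured by
  being below every negative power of the parameter, a condition that absorbs the logarithms. The
  residue is defined by a description over all charts, so its independence of the chart has to be
  proved; the local coordinates for this come from the inverse function theorem.\<close>

lemma t_mult_Nil [simp]: "t_mult s t [] = s [] * t []"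
  by (simp add: t_mult_def)

lemma t_mult_Cons: "t_mult s t (x # xs) = s [] * t (x # xs) + t_mult (\<lambda>ys. s (x # ys)) t xs"
  unfolding t_mult_def by (simp add: sum.atMost_Suc_shift del: sum.atMost_Suc)

lemma t_one_Nil [simp]: "t_one [] = 1" and t_one_Cons [simp]: "t_one (x # xs) = 0"
  by (simp_all add: t_one_def)

lemma t_mult_zero_left: "t_mult (\<lambda>_. 0) t ws = 0"
  by (simp add: t_mult_def)

lemma t_mult_comb_left: "t_mult (\<lambda>ws. a * s ws + b * s' ws) t ws = a * t_mult s t ws + b * t_mult s' t ws"
  by (simp add: t_mult_def distrib_right sum.distrib sum_distrib_left algebra_simps)

lemma t_mult_comb_right: "t_mult s (\<lambda>ws. a * t ws + b * t' ws) ws = a * t_mult s t ws + b * t_mult s t' ws"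
  by (simp add: t_mult_def distrib_left sum.distrib sum_distrib_left algebra_simps)

lemma t_mult_one_left [simp]: "t_mult t_one t = t"
proof
  show "t_mult t_one t ws = t ws" for ws
    by (cases ws) (simp_all add: t_mult_Cons t_mult_zero_left)
qed

lemma t_mult_one_right [simp]: "t_mult t t_one = t"
proof
  show "t_mult t t_one ws = t ws" for ws
    by (induction ws arbitrary: t) (simp_all add: t_mult_Cons)
qed

lemma t_mult_assoc: "t_mult (t_mult r s) t = t_mult r (t_mult s t)"
proof
  show "t_mult (t_mult r s) t ws = t_mult r (t_mult s t) ws" for ws
  proof (induction ws arbitrary: r s)
    case Nil
    show ?case by simp
  next
    case (Cons x xs)
    have "(\<lambda>ys. t_mult r s (x # ys)) = (\<lambda>ys. r [] * s (x # ys) + 1 * t_mult (\<lambda>zs. r (x # zs)) s ys)"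
      by (simp add: t_mult_Cons)
    then show ?case
      using t_mult_comb_left[of "r []" "\<lambda>ys. s (x # ys)" 1 "t_mult (\<lambda>zs. r (x # zs)) s" t xs]
      by (simp add: t_mult_Cons Cons.IH distrib_left mult.assoc)
  qed
qed

lemma t_mult_sum_left:
  "t_mult (\<lambda>ws. \<Sum>i\<in>I. s i ws) t ws = (\<Sum>i\<in>I. t_mult (s i) t ws)"
  unfolding t_mult_def sum_distrib_right by (rule sum.swap)

lemma t_mult_sum_right:
  "t_mult s (\<lambda>ws. \<Sum>i\<in>I. t i ws) ws = (\<Sum>i\<in>I. t_mult s (t i) ws)"
  unfolding t_mult_def sum_distrib_left by (rule sum.swap)

lemma t_mult_cong_length:
  assumes "\<And>us. length us \<le> length ws \<Longrightarrow> s us = s' us"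
    and "\<And>us. length us \<le> length ws \<Longrightarrow> t us = t' us"
  shows "t_mult s t ws = t_mult s' t' ws"
  unfolding t_mult_def using assms by (intro sum.cong) auto

text \<open>The condition that \<open>T_hat\<close> imposes on a single slot, isolated so that it
  can be carried through sums, limits and integrals one slot at a time.\<close>

definition class_linear ::
  "real set \<Rightarrow> (complex^'n \<Rightarrow> complex) set \<Rightarrow> (complex^'n) set \<Rightarrow> ('n::finite form \<Rightarrow> complex) \<Rightarrow> bool" where
  "class_linear F E D g \<longleftrightarrow>
     (\<forall>\<omega>. \<omega> \<notin> dR_C F E D \<longrightarrow> g \<omega> = 0) \<and> (\<forall>\<omega>\<in>exact_forms E D. g \<omega> = 0) \<and>
     (\<forall>\<omega>\<in>dR_C F E D. \<forall>\<omega>'\<in>dR_C F E D. \<forall>a b.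
        g (\<lambda>v w. a * \<omega> v w + b * \<omega>' v w) = a * g \<omega> + b * g \<omega>')"

lemma T_hat_iff: "t \<in> T_hat F E D \<longleftrightarrow> (\<forall>xs ys. class_linear F E D (\<lambda>\<omega>. t (xs @ \<omega> # ys)))"
  unfolding T_hat_def class_linear_def by blast

lemma class_linear_zero: "class_linear F E D (\<lambda>_. 0)"
  by (simp add: class_linear_def)

lemma class_linear_add:
  "class_linear F E D g \<Longrightarrow> class_linear F E D h \<Longrightarrow> class_linear F E D (\<lambda>\<omega>. g \<omega> + h \<omega>)"
  by (simp add: class_linear_def algebra_simps)

lemma class_linear_cmult: "class_linear F E D g \<Longrightarrow> class_linear F E D (\<lambda>\<omega>. c * g \<omega>)"
  by (simp add: class_linear_def algebra_simps)

lemma class_linear_sum: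
  "(\<And>i. i \<in> I \<Longrightarrow> class_linear F E D (g i)) \<Longrightarrow> class_linear F E D (\<lambda>\<omega>. \<Sum>i\<in>I. g i \<omega>)"
  by (induction I rule: infinite_finite_induct) (auto intro: class_linear_zero class_linear_add)

text \<open>Serves the regularised transport at a tangential base point, a coefficientwise limit
  that has to lie in \<open>T_hat\<close> before density applies to it.\<close>

lemma class_linear_limit:
  assumes "\<And>x. class_linear F E D (g x)" and "\<And>\<omega>. ((\<lambda>x. g x \<omega>) \<longlongrightarrow> l \<omega>) G" and "G \<noteq> bot"
  shows "class_linear F E D l"
  unfolding class_linear_def
proof (intro conjI allI ballI impI)
  fix \<omega> assume "\<omega> \<notin> dR_C F E D"
  then have "(\<lambda>x. g x \<omega>) = (\<lambda>x. 0)"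
    using assms(1) by (auto simp: class_linear_def)
  then show "l \<omega> = 0"
    using assms(2)[of \<omega>] assms(3) tendsto_unique tendsto_const by metis
next
  fix \<omega> assume "\<omega> \<in> exact_forms E D"
  then have "(\<lambda>x. g x \<omega>) = (\<lambda>x. 0)"
    using assms(1) by (auto simp: class_linear_def)
  then show "l \<omega> = 0"
    using assms(2)[of \<omega>] assms(3) tendsto_unique tendsto_const by metis
next
  fix \<omega> \<omega>' a b assume "\<omega> \<in> dR_C F E D" "\<omega>' \<in> dR_C F E D"
  then have "(\<lambda>x. g x (\<lambda>v w. a * \<omega> v w + b * \<omega>' v w)) = (\<lambda>x. a * g x \<omega> + b * g x \<omega>')"
    using assms(1) by (auto simp: class_linear_def)
  moreover have "((\<lambda>x. a * g x \<omega> + b * g x \<omega>') \<longlongrightarrow> a * l \<omega> + b * l \<omega>') G"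
    by (intro tendsto_intros assms)
  ultimately show "l (\<lambda>v w. a * \<omega> v w + b * \<omega>' v w) = a * l \<omega> + b * l \<omega>'"
    using tendsto_unique[OF assms(3) assms(2)[of "\<lambda>v w. a * \<omega> v w + b * \<omega>' v w"]] by simp
qed

lemma T_hatD: "t \<in> T_hat F E D \<Longrightarrow> class_linear F E D (\<lambda>\<omega>. t (xs @ \<omega> # ys))"
  by (simp add: T_hat_iff)

lemma T_hat_Cons: "t \<in> T_hat F E D \<Longrightarrow> (\<lambda>ys. t (x # ys)) \<in> T_hat F E D"
  unfolding T_hat_iff
proof (intro allI)
  fix xs ys
  assume "\<forall>xs ys. class_linear F E D (\<lambda>\<omega>. t (xs @ \<omega> # ys))"
  from spec[OF spec[OF this, of "x # xs"], of ys]
  show "class_linear F E D (\<lambda>\<omega>. t (x # xs @ \<omega> # ys))" by simp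
qed

lemma T_hat_one: "t_one \<in> T_hat F E D"
  by (simp add: T_hat_iff t_one_def class_linear_zero)

lemma T_hat_comb: "s \<in> T_hat F E D \<Longrightarrow> t \<in> T_hat F E D \<Longrightarrow> t_comb a s b t \<in> T_hat F E D"
  unfolding T_hat_iff t_comb_def by (intro allI class_linear_add class_linear_cmult) auto

text \<open>In every term of the product the varying slot belongs to exactly one of the two factors.
  The induction peels off the letters in front of the slot.\<close>

lemma T_hat_mult:
  assumes "s \<in> T_hat F E D" and "t \<in> T_hat F E D"
  shows "t_mult s t \<in> T_hat F E D"
proof -
  have "class_linear F E D (\<lambda>\<omega>. t_mult s t (xs @ \<omega> # ys))" for xs ys
    using assms(1)
  proof (induction xs arbitrary: s)
    case Nil
    have "class_linear F E D (\<lambda>\<omega>. t (ys @ \<omega> # zs))" for ys zs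
      using assms(2) by (rule T_hatD)
    from this[of "[]"] have 1: "class_linear F E D (\<lambda>\<omega>. t (\<omega> # zs))" for zs
      by simp
    have "class_linear F E D (\<lambda>\<omega>. s (\<omega> # zs) * c)" for zs c
      using class_linear_cmult[OF T_hatD[OF Nil, of "[]" zs], of c] by (simp add: mult.commute)
    then have "class_linear F E D (\<lambda>\<omega>. \<Sum>i\<le>length ys. s (\<omega> # take i ys) * t (drop i ys))"
      by (intro class_linear_sum)
    then have "class_linear F E D (\<lambda>\<omega>. t_mult (\<lambda>zs. s (\<omega> # zs)) t ys)"
      by (simp add: t_mult_def)
    then show ?case
      by (auto simp: t_mult_Cons intro!: class_linear_add class_linear_cmult 1)
  next
    case (Cons x xs)
    show ?case
      using T_hatD[OF assms(2), of "x # xs" ys] Cons.IH[OF T_hat_Cons[OF Cons.prems, of x]]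
      by (auto simp: t_mult_Cons intro!: class_linear_add class_linear_cmult)
  qed
  then show ?thesis
    by (simp add: T_hat_iff)
qed

lemma T_hat_cmult: "t \<in> T_hat F E D \<Longrightarrow> (\<lambda>ws. c * t ws) \<in> T_hat F E D"
  unfolding T_hat_iff by (intro allI class_linear_cmult) auto

text \<open>The range of summation depends only on the length of the word, so it stays constant
  while one letter varies.\<close>

lemma T_hat_sum_length:
  assumes "\<And>i. t i \<in> T_hat F E D"
  shows "(\<lambda>ws. \<Sum>i\<le>length ws. t i ws) \<in> T_hat F E D"
proof -
  have "class_linear F E D (\<lambda>\<omega>. \<Sum>i\<le>Suc (length xs + length ys). t i (xs @ \<omega> # ys))" for xs ys
    by (intro class_linear_sum T_hatD assms)
  then show ?thesis
    unfolding T_hat_iff by simp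
qed

lemma T_hat_limit:
  assumes "\<And>x. t x \<in> T_hat F E D" and "\<And>ws. ((\<lambda>x. t x ws) \<longlongrightarrow> l ws) G" and "G \<noteq> bot"
  shows "l \<in> T_hat F E D"
  unfolding T_hat_iff using assms(1)
  by (intro allI class_linear_limit[OF _ assms(2,3)]) (simp add: T_hat_iff)

section \<open>Powers, exponentials and inverses of tensors\<close>

lemma T_hat_power: "t \<in> T_hat F E D \<Longrightarrow> t_power t k \<in> T_hat F E D"
  by (induction k) (simp_all add: T_hat_one T_hat_mult)

lemma T_hat_exp:
  assumes "t \<in> T_hat F E D"
  shows "t_exp t \<in> T_hat F E D"
proof -
  have "(\<lambda>ws. \<Sum>k\<le>length ws. (1 / fact k) * t_power t k ws) \<in> T_hat F E D"
    by (intro T_hat_sum_length T_hat_cmult T_hat_power assms)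
  then show ?thesis
    by (simp add: t_exp_def)
qed

text \<open>Every factor without constant term uses up at least one letter.\<close>

lemma t_power_short:
  assumes "t [] = 0" and "length ws < k"
  shows "t_power t k ws = 0"
  using assms(2)
proof (induction k arbitrary: ws)
  case (Suc k)
  have "t (take i ws) * t_power t k (drop i ws) = 0" if "i \<le> length ws" for i
    using that Suc.prems assms(1) by (cases "i = 0") (auto intro!: Suc.IH)
  then show ?case
    unfolding t_power.simps t_mult_def by (intro sum.neutral) simp
qed simp

lemma t_power_commute: "t_mult (t_power t k) t = t_mult t (t_power t k)"
  by (induction k) (simp_all add: t_mult_assoc)

text \<open>The geometric series for the inverse of \<open>t = 1 - (1 - t)\<close>.\<close>

definition t_neumann :: "'n::finite tensor \<Rightarrow> 'n::finite tensor" where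
  "t_neumann t = (\<lambda>ws. \<Sum>k\<le>length ws. t_power (t_comb 1 t_one (-1) t) k ws)"

lemma T_hat_neumann: "t \<in> T_hat F E D \<Longrightarrow> t_neumann t \<in> T_hat F E D"
  unfolding t_neumann_def by (intro T_hat_sum_length T_hat_power T_hat_comb T_hat_one)

lemma t_neumann_inverse:
  assumes "t [] = 1"
  shows "t_mult t (t_neumann t) = t_one" and "t_mult (t_neumann t) t = t_one"
proof -
  define s where "s = t_comb 1 t_one (-1) t"
  have s0: "s [] = 0"
    using assms by (simp add: s_def t_comb_def)
  have t: "t = (\<lambda>ws. 1 * t_one ws + (-1) * s ws)"
    by (auto simp: s_def t_comb_def)
  \<comment> \<open>Powers beyond the length of a word vanish on it, so a single cutoff serves all
    subwords that occur in a product.\<close>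
  have N: "t_neumann t us = (\<Sum>k\<le>m. t_power s k us)" if "length us \<le> m" for us m
  proof -
    have "(\<Sum>k\<le>m. t_power s k us) = (\<Sum>k\<le>length us. t_power s k us)"
      by (rule sum.mono_neutral_right) (use that in \<open>auto intro!: t_power_short s0\<close>)
    then show ?thesis
      by (simp add: t_neumann_def s_def)
  qed
  have sN: "(\<Sum>k\<le>length ws. t_power s (Suc k) ws) = (\<Sum>k\<le>length ws. t_power s k ws) - t_one ws" for ws
  proof -
    have "(\<Sum>k\<le>length ws. t_power s (Suc k) ws) = (\<Sum>k\<le>Suc (length ws). t_power s k ws) - t_one ws"
      unfolding sum.atMost_Suc_shift by simp
    moreover have "t_power s (Suc (length ws)) ws = 0"
      by (rule t_power_short[where t = s, OF s0]) simp
    ultimately show ?thesis by (simp del: t_power.simps(2))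
  qed
  have l: "t_mult s (t_neumann t) ws = t_neumann t ws - t_one ws" for ws
  proof -
    have "t_mult s (t_neumann t) ws = t_mult s (\<lambda>us. \<Sum>k\<le>length ws. t_power s k us) ws"
      by (rule t_mult_cong_length) (simp_all add: N)
    also have "\<dots> = (\<Sum>k\<le>length ws. t_power s (Suc k) ws)"
      by (simp add: t_mult_sum_right)
    finally show ?thesis
      unfolding sN using N[of ws "length ws"] by simp
  qed
  have r: "t_mult (t_neumann t) s ws = t_neumann t ws - t_one ws" for ws
  proof -
    have "t_mult (t_neumann t) s ws = t_mult (\<lambda>us. \<Sum>k\<le>length ws. t_power s k us) s ws"
      by (rule t_mult_cong_length) (simp_all add: N)
    also have "\<dots> = (\<Sum>k\<le>length ws. t_mult (t_power s k) s ws)"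
      by (simp add: t_mult_sum_left)
    also have "\<dots> = (\<Sum>k\<le>length ws. t_power s (Suc k) ws)"
      by (simp add: t_power_commute)
    finally show ?thesis
      unfolding sN using N[of ws "length ws"] by simp
  qed
  show "t_mult t (t_neumann t) = t_one"
  proof
    show "t_mult t (t_neumann t) ws = t_one ws" for ws
      using t_mult_comb_left[of 1 t_one "-1" s "t_neumann t" ws] l[of ws] unfolding t[symmetric] by simp
  qed
  show "t_mult (t_neumann t) t = t_one"
  proof
    show "t_mult (t_neumann t) t ws = t_one ws" for ws
      using t_mult_comb_right[of "t_neumann t" 1 t_one "-1" s ws] r[of ws] unfolding t[symmetric] by simp
  qed
qed

lemma t_inverse_unique:
  assumes "t_mult t s = t_one" and "t_mult s t = t_one"
  shows "t_inverse t = s"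
  unfolding t_inverse_def
proof (rule the_equality)
  fix r assume r: "t_mult r t = t_one \<and> t_mult t r = t_one"
  have "t_mult (t_mult s t) r = s"
    unfolding t_mult_assoc using r by simp
  then show "r = s"
    using assms by simp
qed (use assms in auto)

lemma t_inverse_eq_neumann: "t [] = 1 \<Longrightarrow> t_inverse t = t_neumann t"
  by (intro t_inverse_unique t_neumann_inverse)

lemma t_mult_single: "t_mult s t [x] = s [] * t [x] + s [x] * t []"
  by (simp add: t_mult_Cons)

lemma t_mult_pair: "t_mult s t [x, y] = s [] * t [x, y] + s [x] * t [y] + s [x, y] * t []"
  by (simp add: t_mult_Cons)

text \<open>Solve \<open>t_mult t (t_inverse t) = t_one\<close> degree by degree. At a tangential
  base point the inverse is only ever evaluated on words of length at most two.\<close>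

lemma t_inverse_low:
  assumes "t [] = 1"
  shows "t_inverse t [] = 1" and "t_inverse t [x] = - t [x]"
    and "t_inverse t [x, y] = t [x] * t [y] - t [x, y]"
proof -
  let ?s = "t_inverse t"
  have ts: "t_mult t ?s = t_one"
    using assms by (simp add: t_inverse_eq_neumann t_neumann_inverse)
  show 0: "?s [] = 1"
    using fun_cong[OF ts, of "[]"] assms by simp
  have 1: "?s [z] = - t [z]" for z
    using fun_cong[OF ts, of "[z]"] assms 0 by (simp add: t_mult_single eq_neg_iff_add_eq_0)
  then show "?s [x] = - t [x]" .
  show "?s [x, y] = t [x] * t [y] - t [x, y]"
    using fun_cong[OF ts, of "[x, y]"] assms 0 1
    by (simp add: t_mult_pair algebra_simps)
qed

text \<open>Finite dimensional duality: a subspace \<open>W\<close> of functions on \<open>B\<close>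
  that is killed by no nonzero functional is the whole space. If every element of \<open>W\<close>
  vanishing on \<open>B\<close> also vanished at the new point \<open>b\<close>, then the value at
  \<open>b\<close> would be a linear combination of the values on \<open>B\<close>, which is a
  relation.\<close>

lemma interpolation:
  fixes W :: "('b \<Rightarrow> complex) set"
  assumes "finite B" and "W \<noteq> {}"
    and comb: "\<And>g h a c. g \<in> W \<Longrightarrow> h \<in> W \<Longrightarrow> (\<lambda>x. a * g x + c * h x) \<in> W"
    and "\<And>k. (\<forall>g\<in>W. (\<Sum>\<beta>\<in>B. k \<beta> * g \<beta>) = 0) \<Longrightarrow> \<forall>\<beta>\<in>B. k \<beta> = 0"
  shows "\<exists>g\<in>W. \<forall>\<beta>\<in>B. g \<beta> = f \<beta>"
  using assms(1,4)
proof (induction B arbitrary: f)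
  case empty
  then show ?case using assms(2) by auto
next
  case (insert b B)
  have IH: "\<exists>g\<in>W. \<forall>\<beta>\<in>B. g \<beta> = f \<beta>" for f
  proof (rule insert.IH)
    fix k assume k: "\<forall>g\<in>W. (\<Sum>\<beta>\<in>B. k \<beta> * g \<beta>) = 0"
    have "(\<Sum>\<beta>\<in>B. (k(b := 0)) \<beta> * g \<beta>) = (\<Sum>\<beta>\<in>B. k \<beta> * g \<beta>)" for g :: "'b \<Rightarrow> complex"
      by (rule sum.cong) (use insert.hyps in auto)
    then have "\<forall>\<beta>\<in>insert b B. (k(b := 0)) \<beta> = 0"
      using k by (intro insert.prems) (simp add: insert.hyps)
    then show "\<forall>\<beta>\<in>B. k \<beta> = 0"
      using insert.hyps by (metis fun_upd_apply insertI2)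
  qed
  \<comment> \<open>Elements of \<open>W\<close> dual to the points of \<open>B\<close>, from the
    induction hypothesis; subtracting their combinations makes any element of \<open>W\<close>
    vanish on \<open>B\<close>.\<close>
  define d where "d \<beta> = (SOME g. g \<in> W \<and> (\<forall>\<alpha>\<in>B. g \<alpha> = (if \<alpha> = \<beta> then 1 else 0)))" for \<beta>
  have d: "d \<beta> \<in> W \<and> (\<forall>\<alpha>\<in>B. d \<beta> \<alpha> = (if \<alpha> = \<beta> then 1 else 0))" for \<beta>
    unfolding d_def using IH[of "\<lambda>\<alpha>. if \<alpha> = \<beta> then 1 else 0"]
    by (intro someI_ex[of "\<lambda>g. g \<in> W \<and> (\<forall>\<alpha>\<in>B. g \<alpha> = (if \<alpha> = \<beta> then 1 else 0))"]) blast
  have sub: "(\<lambda>x. g x - (\<Sum>\<beta>\<in>C. c \<beta> * d \<beta> x)) \<in> W" if "g \<in> W" "finite C" for g c C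
    using that(2)
  proof (induction C)
    case (insert \<beta> C)
    have "(\<lambda>x. 1 * (g x - (\<Sum>\<beta>\<in>C. c \<beta> * d \<beta> x)) + (- c \<beta>) * d \<beta> x) \<in> W"
      by (rule comb) (use insert d in auto)
    moreover have "(\<lambda>x. 1 * (g x - (\<Sum>\<beta>\<in>C. c \<beta> * d \<beta> x)) + (- c \<beta>) * d \<beta> x) =
        (\<lambda>x. g x - (\<Sum>\<beta>\<in>insert \<beta> C. c \<beta> * d \<beta> x))"
      using insert.hyps by (auto simp: algebra_simps)
    ultimately show ?case by simp
  qed (use that in auto)
  have van: "(\<Sum>\<beta>\<in>B. g \<beta> * d \<beta> \<alpha>) = g \<alpha>" if "\<alpha> \<in> B" for g \<alpha>
  proof -
    have "(\<Sum>\<beta>\<in>B. g \<beta> * d \<beta> \<alpha>) = (\<Sum>\<beta>\<in>B. if \<beta> = \<alpha> then g \<alpha> else 0)"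
      by (rule sum.cong) (use d that in auto)
    then show ?thesis
      using insert.hyps(1) that by simp
  qed
  have "\<exists>h\<in>W. (\<forall>\<beta>\<in>B. h \<beta> = 0) \<and> h b \<noteq> 0"
  proof (rule ccontr)
    assume no: "\<not> ?thesis"
    \<comment> \<open>The coefficients of the forbidden relation: the value of \<open>g\<close> at
      \<open>b\<close> equals the sum of \<open>g \<beta> * d \<beta> b\<close>.\<close>
    let ?k = "\<lambda>\<beta>. if \<beta> = b then -1 else d \<beta> b"
    have "(\<Sum>\<beta>\<in>insert b B. ?k \<beta> * g \<beta>) = 0" if g: "g \<in> W" for g
    proof -
      have "g b - (\<Sum>\<beta>\<in>B. g \<beta> * d \<beta> b) = 0"
        using no sub[OF g insert.hyps(1), of g] van by fastforce
      moreover have "(\<Sum>\<beta>\<in>B. ?k \<beta> * g \<beta>) = (\<Sum>\<beta>\<in>B. g \<beta> * d \<beta> b)"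
        by (rule sum.cong) (use insert.hyps in auto)
      ultimately show ?thesis
        using insert.hyps by simp
    qed
    then have "\<forall>\<beta>\<in>insert b B. ?k \<beta> = 0"
      by (intro insert.prems) simp
    then show False by auto
  qed
  then obtain h where h: "h \<in> W" "\<forall>\<beta>\<in>B. h \<beta> = 0" "h b \<noteq> 0" by blast
  obtain g where g: "g \<in> W" "\<forall>\<beta>\<in>B. g \<beta> = f \<beta>" using IH by blast
  have "(\<lambda>x. 1 * g x + ((f b - g b) / h b) * h x) \<in> W"
    by (intro comb g h)
  then show ?case
    using g h by (intro bexI[of _ "\<lambda>x. 1 * g x + ((f b - g b) / h b) * h x"]) auto
qed

section \<open>Spans of tensors and their density\<close>

inductive_set tensor_span :: "'n::finite tensor set \<Rightarrow> 'n::finite tensor set" for S where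
  base: "s \<in> S \<Longrightarrow> s \<in> tensor_span S"
| comb: "s \<in> tensor_span S \<Longrightarrow> t \<in> tensor_span S \<Longrightarrow> t_comb a s b t \<in> tensor_span S"

lemma tensor_span_mult:
  assumes "\<And>s t. s \<in> S \<Longrightarrow> t \<in> S \<Longrightarrow> t_mult s t \<in> S"
    and "s \<in> tensor_span S" and "t \<in> tensor_span S"
  shows "t_mult s t \<in> tensor_span S"
  using assms(2)
proof induction
  case (base s)
  show ?case
    using assms(3)
  proof induction
    case (base t)
    then show ?case
      by (intro tensor_span.base assms(1)) (use \<open>s \<in> S\<close> in auto)
  next
    case (comb t t' a b)
    have "t_mult s (t_comb a t b t') = t_comb a (t_mult s t) b (t_mult s t')"
      by (rule ext) (simp add: t_comb_def t_mult_comb_right)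
    then show ?case using comb tensor_span.comb by metis
  qed
next
  case (comb s s' a b)
  have "t_mult (t_comb a s b s') t = t_comb a (t_mult s t) b (t_mult s' t)"
    by (rule ext) (simp add: t_comb_def t_mult_comb_left)
  then show ?case using comb tensor_span.comb by metis
qed

text \<open>Independence of the letters as seen by \<open>S\<close> in degree 1. For transports of
  loops it says that no nontrivial combination of the basis forms has all periods zero.\<close>

definition relation_free :: "'n::finite tensor set \<Rightarrow> 'n form set \<Rightarrow> bool" where
  "relation_free S B \<longleftrightarrow>
     (\<forall>k. (\<forall>s\<in>S. (\<Sum>\<beta>\<in>B. k \<beta> * s [\<beta>]) = 0) \<longrightarrow> (\<forall>\<beta>\<in>B. k \<beta> = 0))"

text \<open>Spanning in dual form: a functional on classes is determined by its values on
  \<open>B\<close>. Tensors are themselves functionals, so this is the form in which spanning gets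
  applied.\<close>

definition spans_classes ::
  "real set \<Rightarrow> (complex^'n \<Rightarrow> complex) set \<Rightarrow> (complex^'n) set \<Rightarrow> 'n::finite form set \<Rightarrow> bool" where
  "spans_classes F E D B \<longleftrightarrow>
     (\<forall>g. class_linear F E D g \<longrightarrow> (\<forall>\<beta>\<in>B. g \<beta> = 0) \<longrightarrow> (\<forall>\<omega>. g \<omega> = 0))"

lemma dual_elements:
  assumes "finite B" and "t_one \<in> S" and "\<And>s. s \<in> S \<Longrightarrow> s [] = 1"
    and "relation_free S B"
  shows "\<exists>e\<in>tensor_span S. e [] = 0 \<and> (\<forall>\<beta>\<in>B. e [\<beta>] = f \<beta>)"
proof -
  define W where "W = (\<lambda>t \<beta>. t [\<beta>]) ` tensor_span S"
  have "\<exists>g\<in>W. \<forall>\<beta>\<in>B. g \<beta> = f \<beta>"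
  proof (rule interpolation[OF assms(1)])
    show "W \<noteq> {}"
      using assms(2) tensor_span.base by (auto simp: W_def)
    show "(\<lambda>x. a * g x + c * h x) \<in> W" if "g \<in> W" "h \<in> W" for g h a c
    proof -
      obtain s t where "s \<in> tensor_span S" "t \<in> tensor_span S" "g = (\<lambda>\<beta>. s [\<beta>])" "h = (\<lambda>\<beta>. t [\<beta>])"
        using \<open>g \<in> W\<close> \<open>h \<in> W\<close> unfolding W_def by blast
      then show ?thesis
        unfolding W_def by (intro image_eqI[of _ _ "t_comb a s c t"] tensor_span.comb)
          (auto simp: t_comb_def)
    qed
    show "\<forall>\<beta>\<in>B. k \<beta> = 0" if "\<forall>g\<in>W. (\<Sum>\<beta>\<in>B. k \<beta> * g \<beta>) = 0" for k
      using that assms(4) unfolding relation_free_def W_def by (auto intro: tensor_span.base)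
  qed
  then obtain t where t: "t \<in> tensor_span S" "\<forall>\<beta>\<in>B. t [\<beta>] = f \<beta>"
    by (auto simp: W_def)
  \<comment> \<open>Subtracting the constant term times \<open>t_one\<close> leaves the coefficients
    in degree 1 unchanged.\<close>
  show ?thesis
  proof (intro bexI[of _ "t_comb 1 t (- t []) t_one"])
    show "t_comb 1 t (- t []) t_one \<in> tensor_span S"
      by (intro tensor_span.comb t tensor_span.base assms(2))
  qed (use t in \<open>auto simp: t_comb_def\<close>)
qed

text \<open>Multilinearity, one letter at a time: the first letter is reduced to \<open>B\<close> by
  \<open>spans_classes\<close>, the tail by the induction hypothesis.\<close>

lemma T_hat_eqI_basis:
  assumes span: "spans_classes F E D B"
    and "t \<in> T_hat F E D" and "\<And>us. set us \<subseteq> B \<Longrightarrow> length us = length ws \<Longrightarrow> t us = 0"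
  shows "t ws = 0"
  using assms(2,3)
proof (induction ws arbitrary: t)
  case Nil
  then show ?case by simp
next
  case (Cons x xs)
  have "class_linear F E D (\<lambda>\<omega>. t (\<omega> # xs))"
    using T_hatD[OF Cons.prems(1), of "[]" xs] by simp
  moreover have "\<forall>\<beta>\<in>B. t (\<beta> # xs) = 0"
    using Cons.IH[OF T_hat_Cons[OF Cons.prems(1)]] Cons.prems(2) by simp
  ultimately show ?case
    using span unfolding spans_classes_def by blast
qed

text \<open>
  The leading terms of products of elements \<open>s - 1\<close> with \<open>s\<close> in \<open>S\<close> exhaust every degree, so a functional
  that kills \<open>S\<close> and high degrees is zero by descending induction on the degree.
\<close>

lemma density:
  assumes fin: "finite B"
    and span: "spans_classes F E D B"
    and S: "S \<subseteq> T_hat F E D" "t_one \<in> S" "\<And>s. s \<in> S \<Longrightarrow> s [] = 1"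
      "\<And>s t. s \<in> S \<Longrightarrow> t \<in> S \<Longrightarrow> t_mult s t \<in> S"
    and indep: "relation_free S B"
    and lin: "\<And>s t a b. s \<in> T_hat F E D \<Longrightarrow> t \<in> T_hat F E D \<Longrightarrow> L (t_comb a s b t) = a * L s + b * L t"
    and LS: "\<And>s. s \<in> S \<Longrightarrow> L s = (0::complex)"
    and Lm: "\<And>t. t \<in> T_hat_ge F E D m \<Longrightarrow> L t = 0"
    and t: "t \<in> T_hat F E D"
  shows "L t = 0"
proof -
  have A_T: "s \<in> T_hat F E D \<and> L s = 0" if "s \<in> tensor_span S" for s
    using that
  proof induction
    case (comb s t a b)
    then show ?case by (simp add: lin T_hat_comb)
  qed (use S LS in auto)
  have "\<exists>e\<in>tensor_span S. e [] = 0 \<and> (\<forall>\<alpha>\<in>B. e [\<alpha>] = (if \<alpha> = \<beta> then 1 else 0))" for \<beta>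
    using dual_elements[OF fin S(2) _ indep] S(3) by simp
  then obtain e where e: "\<And>\<beta>. e \<beta> \<in> tensor_span S" "\<And>\<beta>. e \<beta> [] = 0"
      "\<And>\<alpha> \<beta>. \<alpha> \<in> B \<Longrightarrow> e \<beta> [\<alpha>] = (if \<alpha> = \<beta> then 1 else 0)"
    by metis
  \<comment> \<open>A product of dual elements: zero on words shorter than \<open>bs\<close>, and
    among the words over \<open>B\<close> of the length of \<open>bs\<close> it picks out
    \<open>bs\<close> itself.\<close>
  define p where "p bs = foldr (\<lambda>\<beta>. t_mult (e \<beta>)) bs t_one" for bs
  have pA: "p bs \<in> tensor_span S" for bs
    unfolding p_def by (induction bs) (auto intro: tensor_span.base S tensor_span_mult e)
  have p_short: "p bs ws = 0" if "length ws < length bs" for bs ws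
    using that
  proof (induction bs arbitrary: ws)
    case (Cons \<beta> bs)
    have "e \<beta> (take i ws) * p bs (drop i ws) = 0" if "i \<le> length ws" for i
      using that Cons.prems by (cases "i = 0") (auto simp: e intro!: Cons.IH)
    then show ?case
      unfolding p_def foldr.simps o_apply t_mult_def by (intro sum.neutral) (simp add: p_def)
  qed simp
  have p_lead: "p bs ws = (if ws = bs then 1 else 0)" if "length ws = length bs" "set ws \<subseteq> B" for bs ws
    using that
  proof (induction bs arbitrary: ws)
    case Nil
    then show ?case by (simp add: p_def)
  next
    case (Cons \<beta> bs)
    then obtain x xs where ws: "ws = x # xs" "x \<in> B" "set xs \<subseteq> B" "length xs = length bs"
      by (cases ws) auto
    have "p (\<beta> # bs) ws = t_mult (\<lambda>ys. e \<beta> (x # ys)) (p bs) xs"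
      by (simp add: p_def ws t_mult_Cons e)
    also have "\<dots> = (\<Sum>i\<le>length xs. if i = 0 then e \<beta> [x] * p bs xs else 0)"
      unfolding t_mult_def
      by (rule sum.cong) (use p_short[of "drop _ xs" bs] ws in auto)
    also have "\<dots> = (if ws = \<beta> # bs then 1 else 0)"
      using Cons.IH[of xs] ws by (simp add: e)
    finally show ?case .
  qed
  \<comment> \<open>The subtraction is truncated: at \<open>j = m\<close> the condition on
    \<open>s\<close> is just membership in \<open>T_hat\<close>.\<close>
  have main: "L s = 0" if "s \<in> T_hat_ge F E D (m - j)" for j s
    using that
  proof (induction j arbitrary: s)
    case 0
    then show ?case using Lm by simp
  next
    case (Suc j)
    show ?case
    proof (cases "j < m")
      case False
      then show ?thesis using Suc by simp
    next
      case True
      define k where "k = m - Suc j"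
      have mj: "m - j = Suc k"
        using True by (simp add: k_def)
      have s: "s \<in> T_hat F E D" "\<And>ws. length ws < k \<Longrightarrow> s ws = 0"
        using Suc.prems by (auto simp: T_hat_ge_def k_def)
      define K where "K = {bs. set bs \<subseteq> B \<and> length bs = k}"
      have finK: "finite K"
        unfolding K_def by (rule finite_lists_length_eq[OF fin])
      \<comment> \<open>A finite combination of the products \<open>p bs\<close> has to be built up
        term by term, since the span is generated by binary combinations.\<close>
      have q: "\<exists>q. q \<in> tensor_span S \<and> q = (\<lambda>ws. \<Sum>bs\<in>K'. s bs * p bs ws)" if "finite K'" for K'
        using that
      proof (induction K')
        case empty
        have "t_comb 0 t_one 0 t_one \<in> tensor_span S"
          by (intro tensor_span.intros S)
        then show ?case by (intro exI[of _ "t_comb 0 t_one 0 t_one"]) (auto simp: t_comb_def)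
      next
        case (insert bs K')
        then obtain q where "q \<in> tensor_span S" "q = (\<lambda>ws. \<Sum>bs\<in>K'. s bs * p bs ws)" by blast
        moreover have "t_comb (s bs) (p bs) 1 q \<in> tensor_span S"
          by (intro tensor_span.comb pA) fact
        ultimately show ?case
          using insert.hyps by (intro exI[of _ "t_comb (s bs) (p bs) 1 q"]) (auto simp: t_comb_def)
      qed
      from q[OF finK] obtain q where q: "q \<in> tensor_span S" "q = (\<lambda>ws. \<Sum>bs\<in>K. s bs * p bs ws)"
        by blast
      \<comment> \<open>Removing the leading part of \<open>s\<close> raises the degree by one
        without changing the value of \<open>L\<close>.\<close>
      define r where "r = t_comb 1 s (-1) q"
      have rT: "r \<in> T_hat F E D"
        unfolding r_def using A_T q s by (intro T_hat_comb) auto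
      have "r ws = 0" if "length ws < Suc k" for ws
      proof (cases "length ws = k")
        case True
        show ?thesis
        proof (rule T_hat_eqI_basis[OF span rT])
          fix us assume us: "set us \<subseteq> B" "length us = length ws"
          have "q us = (\<Sum>bs\<in>K. if bs = us then s us else 0)"
            unfolding q(2) by (rule sum.cong) (use us True in \<open>auto simp: K_def p_lead\<close>)
          also have "\<dots> = s us"
            using us True finK by (simp add: K_def)
          finally show "r us = 0"
            by (simp add: r_def t_comb_def)
        qed
      next
        case False
        then have "length ws < k" using that by simp
        moreover have "q ws = 0"
          unfolding q(2) using \<open>length ws < k\<close> by (intro sum.neutral) (auto simp: K_def p_short)
        ultimately show ?thesis
          by (simp add: r_def t_comb_def s)
      qed
      then have "L r = 0"
        using Suc.IH[of r] rT mj by (simp add: T_hat_ge_def)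
      moreover have "L r = L s - L q"
        unfolding r_def using lin[of s q 1 "-1"] A_T q s by simp
      ultimately show ?thesis
        using A_T q by simp
    qed
  qed
  show ?thesis
    by (rule main[of _ m]) (use t in \<open>simp add: T_hat_ge_def\<close>)
qed

text \<open>The description in \<open>dual_basis_elem\<close> is meaningful: the degree 1 part of
  \<open>e\<close> satisfies it, and a tensor is determined by its values on words over
  \<open>B\<close>. Any \<open>e\<close> in the span with the right coefficients serves as a
  witness.\<close>

lemma dual_basis_elem_T_deg:
  assumes "spans_classes F E D B"
    and "e \<in> T_hat F E D" and "\<And>\<beta>. \<beta> \<in> B \<Longrightarrow> e [\<beta>] = (if \<beta> = \<eta> then 1 else 0)"
  shows "dual_basis_elem F E D B \<eta> \<in> T_deg F E D 1"
proof -
  have "deg_part 1 e \<in> T_hat F E D"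
    unfolding T_hat_iff deg_part_def
  proof (intro allI)
    show "class_linear F E D (\<lambda>\<omega>. if length (xs @ \<omega> # ys) = 1 then e (xs @ \<omega> # ys) else 0)" for xs ys
      using T_hatD[OF assms(2), of xs ys] class_linear_zero by (cases "length (xs @ undefined # ys) = 1") auto
  qed
  then have ex: "deg_part 1 e \<in> T_deg F E D 1 \<and> (\<forall>\<omega>\<in>B. deg_part 1 e [\<omega>] = (if \<omega> = \<eta> then 1 else 0))"
    using assms(3) by (auto simp: T_deg_def deg_part_def)
  have uniq: "s = t" if s: "s \<in> T_deg F E D 1 \<and> (\<forall>\<omega>\<in>B. s [\<omega>] = (if \<omega> = \<eta> then 1 else 0))"
    and t: "t \<in> T_deg F E D 1 \<and> (\<forall>\<omega>\<in>B. t [\<omega>] = (if \<omega> = \<eta> then 1 else 0))" for s t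
  proof
    fix ws
    have T: "t_comb 1 s (-1) t \<in> T_hat F E D"
      using s t by (intro T_hat_comb) (auto simp: T_deg_def)
    have "t_comb 1 s (-1) t ws = 0"
    proof (rule T_hat_eqI_basis[OF assms(1) T])
      fix us assume "set us \<subseteq> B" "length us = length ws"
      show "t_comb 1 s (-1) t us = 0"
      proof (cases "length us = 1")
        case True
        then obtain x where "us = [x]" by (cases us) auto
        then show ?thesis using s t \<open>set us \<subseteq> B\<close> by (auto simp: t_comb_def)
      next
        case False
        then show ?thesis using s t by (auto simp: t_comb_def T_deg_def)
      qed
    qed
    then show "s ws = t ws" by (simp add: t_comb_def)
  qed
  have "\<exists>!t. t \<in> T_deg F E D 1 \<and> (\<forall>\<omega>\<in>B. t [\<omega>] = (if \<omega> = \<eta> then 1 else 0))"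
    using ex uniq by blast
  from theI'[OF this] show ?thesis
    unfolding dual_basis_elem_def by blast
qed

section \<open>Iterated integrals\<close>

text \<open>The derivative of a piecewise C1 path is continuous only off a finite set, where its
  values are arbitrary. Adding boundedness gives a class that is integrable and stable under
  products, joins and affine changes of parameter.\<close>

definition pcont :: "real \<Rightarrow> real \<Rightarrow> (real \<Rightarrow> complex) \<Rightarrow> bool" where
  "pcont a b f \<longleftrightarrow> (\<exists>S. finite S \<and> continuous_on ({a..b} - S) f) \<and> bounded (f ` {a..b})"

lemma pcont_continuous: "continuous_on {a..b} f \<Longrightarrow> pcont a b f"
  unfolding pcont_def using compact_continuous_image[of "{a..b}" f]
  by (metis Diff_empty compact_Icc compact_imp_bounded finite.emptyI)

lemma pcont_mono: "pcont a b f \<Longrightarrow> a \<le> c \<Longrightarrow> d \<le> b \<Longrightarrow> pcont c d f"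
  unfolding pcont_def
  by (metis Diff_mono atLeastatMost_subset_iff bounded_subset continuous_on_subset image_mono order_refl)

lemma pcont_mult:
  assumes "pcont a b f" and "pcont a b g"
  shows "pcont a b (\<lambda>t. f t * g t)"
proof -
  obtain S T where "finite S" "continuous_on ({a..b} - S) f" "finite T" "continuous_on ({a..b} - T) g"
    using assms by (auto simp: pcont_def)
  then have "finite (S \<union> T)" "continuous_on ({a..b} - (S \<union> T)) (\<lambda>t. f t * g t)"
    by (auto intro!: continuous_on_mult elim: continuous_on_subset)
  moreover obtain K L where "\<And>t. t \<in> {a..b} \<Longrightarrow> cmod (f t) \<le> K" "\<And>t. t \<in> {a..b} \<Longrightarrow> cmod (g t) \<le> L"
    using assms unfolding pcont_def bounded_iff by fastforce
  then have "cmod (f t * g t) \<le> K * L" if "t \<in> {a..b}" for t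
    using that order_trans[OF norm_ge_zero, of "f t" K] unfolding norm_mult by (intro mult_mono) auto
  then have "bounded ((\<lambda>t. f t * g t) ` {a..b})"
    unfolding bounded_iff by blast
  ultimately show ?thesis
    unfolding pcont_def by blast
qed

lemma pcont_add:
  assumes "pcont a b f" and "pcont a b g"
  shows "pcont a b (\<lambda>t. f t + g t)"
proof -
  obtain S T where "finite S" "continuous_on ({a..b} - S) f" "finite T" "continuous_on ({a..b} - T) g"
    using assms by (auto simp: pcont_def)
  then have "finite (S \<union> T)" "continuous_on ({a..b} - (S \<union> T)) (\<lambda>t. f t + g t)"
    by (auto intro!: continuous_on_add elim: continuous_on_subset)
  moreover have "bounded ((\<lambda>t. f t + g t) ` {a..b})"
    using assms by (intro bounded_plus_comp) (auto simp: pcont_def)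
  ultimately show ?thesis
    unfolding pcont_def by blast
qed

lemma pcont_const: "pcont a b (\<lambda>_. c)"
  by (intro pcont_continuous continuous_intros)

lemma pcont_sum: "(\<And>i. i \<in> I \<Longrightarrow> pcont a b (f i)) \<Longrightarrow> pcont a b (\<lambda>t. \<Sum>i\<in>I. f i t)"
  by (induction I rule: infinite_finite_induct) (auto intro: pcont_const pcont_add)

text \<open>Off the finite, hence negligible, exceptional set the function is measurable and
  dominated by a constant.\<close>

lemma pcont_integrable:
  assumes "pcont a b f"
  shows "f integrable_on {a..b}"
proof -
  obtain S K where S: "finite S" "continuous_on ({a..b} - S) f" and K: "\<And>t. t \<in> {a..b} \<Longrightarrow> cmod (f t) \<le> K"
    using assms unfolding pcont_def bounded_iff by fastforce
  have neg: "negligible (({a..b} - S - {a..b}) \<union> ({a..b} - ({a..b} - S)))"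
    by (rule negligible_finite, rule finite_subset[OF _ S(1)]) auto
  have leb: "{a..b} - S \<in> sets lebesgue"
    using S(1) by (intro sets.Diff) (auto intro: negligible_finite negligible_imp_sets)
  have "f integrable_on {a..b} - S"
  proof (rule measurable_bounded_by_integrable_imp_integrable)
    show "f \<in> borel_measurable (lebesgue_on ({a..b} - S))"
      using S leb by (intro continuous_imp_measurable_on_sets_lebesgue)
    show "(\<lambda>_. K) integrable_on {a..b} - S"
      using integrable_const_ivl integrable_spike_set_eq[OF neg] by blast
  qed (use K leb in auto)
  then show ?thesis
    using integrable_spike_set_eq[OF neg] by blast
qed

lemma pcont_spike:
  assumes "pcont a b f" and "finite S" and "\<And>t. t \<in> {a..b} - S \<Longrightarrow> g t = f t"
  shows "pcont a b g"
proof -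
  obtain T where T: "finite T" "continuous_on ({a..b} - T) f"
    using assms by (auto simp: pcont_def)
  have "continuous_on ({a..b} - (S \<union> T)) f"
    by (rule continuous_on_subset[OF T(2)]) auto
  then have "continuous_on ({a..b} - (S \<union> T)) g"
    by (rule continuous_on_eq) (use assms(3) in auto)
  moreover have "g ` {a..b} \<subseteq> f ` {a..b} \<union> g ` S"
    using assms(3) by force
  then have "bounded (g ` {a..b})"
    using assms(1,2) by (meson bounded_Un bounded_subset finite_imageI finite_imp_bounded pcont_def)
  ultimately show ?thesis
    unfolding pcont_def using T(1) assms(2) by blast
qed

lemma pcont_affine:
  assumes "pcont (k * a + d) (k * b + d) f" and "k > 0"
  shows "pcont a b (\<lambda>t. f (k * t + d))"
proof -
  obtain T where T: "finite T" "continuous_on ({k * a + d..k * b + d} - T) f"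
    using assms by (auto simp: pcont_def)
  let ?T = "(\<lambda>t. (t - d) / k) ` T"
  have sub: "k * t + d \<in> {k * a + d..k * b + d}" if "t \<in> {a..b}" for t
    using that assms(2) by auto
  have "k * t + d \<notin> T" if "t \<notin> ?T" for t
    using that assms(2) by (auto simp: image_iff)
  then have "continuous_on ({a..b} - ?T) (\<lambda>t. f (k * t + d))"
    using sub by (intro continuous_on_compose2[OF T(2)] continuous_intros) auto
  moreover have "bounded ((\<lambda>t. f (k * t + d)) ` {a..b})"
  proof -
    have "(\<lambda>t. f (k * t + d)) ` {a..b} \<subseteq> f ` {k * a + d..k * b + d}"
      using sub by auto
    then show ?thesis
      using assms(1) bounded_subset unfolding pcont_def by blast
  qed
  ultimately show ?thesis
    unfolding pcont_def using T(1) by blast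
qed

lemma pcont_combine:
  assumes "pcont a c f" and "pcont c b f" and "a \<le> c" and "c \<le> b"
  shows "pcont a b f"
proof -
  obtain S T where ST: "finite S" "continuous_on ({a..c} - S) f" "finite T" "continuous_on ({c..b} - T) f"
    using assms by (auto simp: pcont_def)
  \<comment> \<open>The junction, and below also the two ends, join the exceptional set. Two
    disjoint open pieces remain, on whose union continuity is automatic.\<close>
  let ?R = "insert c (S \<union> T)"
  have 1: "continuous_on ({a<..<c} \<inter> - ?R \<union> {c<..<b} \<inter> - ?R) f"
  proof (rule continuous_on_open_Un)
    have op: "open (- ?R)"
      using ST by (intro open_Compl finite_imp_closed) auto
    show "open ({a<..<c} \<inter> - ?R)" "open ({c<..<b} \<inter> - ?R)"
      using op by auto
    show "continuous_on ({a<..<c} \<inter> - ?R) f"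
      by (rule continuous_on_subset[OF ST(2)]) auto
    show "continuous_on ({c<..<b} \<inter> - ?R) f"
      by (rule continuous_on_subset[OF ST(4)]) auto
  qed
  have "continuous_on ({a..b} - insert a (insert b ?R)) f"
  proof (rule continuous_on_subset[OF 1], rule subsetI)
    fix x assume x: "x \<in> {a..b} - insert a (insert b ?R)"
    then have "x \<in> {a<..<c} \<or> x \<in> {c<..<b}" by auto
    then show "x \<in> {a<..<c} \<inter> - ?R \<union> {c<..<b} \<inter> - ?R"
      using x by blast
  qed
  moreover have "bounded (f ` {a..c})" "bounded (f ` {c..b})"
    using assms by (auto simp: pcont_def)
  then have "bounded (f ` ({a..c} \<union> {c..b}))"
    unfolding image_Un by (rule bounded_Un[THEN iffD2, OF conjI])
  then have "bounded (f ` {a..b})"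
    using assms(3,4) by (simp only: ivl_disj_un_two_touch(4))
  moreover have "finite (insert a (insert b ?R))"
    using ST by simp
  ultimately show ?thesis
    unfolding pcont_def by (intro conjI exI[of _ "insert a (insert b ?R)"])
qed

text \<open>
  \<open>transport A a s\<close> is the solution \<open>X s\<close> of the differential equation \<open>X' = A X\<close> in the tensor algebra
  with \<open>X a = 1\<close>, for \<open>A\<close> without constant term.
\<close>

function transport :: "(real \<Rightarrow> 'n::finite tensor) \<Rightarrow> real \<Rightarrow> real \<Rightarrow> 'n tensor" where
  "transport A a s [] = 1"
| "transport A a s (x # xs) =
     integral {a..s} (\<lambda>t. \<Sum>i\<le>length xs. A t (x # take i xs) * transport A a t (drop i xs))"
  by pat_completeness auto
termination
  by (relation "Wellfounded.measure (\<lambda>(A, a, s, ws). length ws)") auto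

lemma transport_Cons:
  "transport A a s (x # xs) = integral {a..s} (\<lambda>t. t_mult (\<lambda>ys. A t (x # ys)) (transport A a t) xs)"
  by (simp add: t_mult_def)

declare transport.simps(2) [simp del]

definition tpcont :: "real \<Rightarrow> real \<Rightarrow> (real \<Rightarrow> 'n::finite tensor) \<Rightarrow> bool" where
  "tpcont a b A \<longleftrightarrow> (\<forall>ws. pcont a b (\<lambda>t. A t ws))"

lemma tpcont_mono: "tpcont a b A \<Longrightarrow> a \<le> c \<Longrightarrow> d \<le> b \<Longrightarrow> tpcont c d A"
  unfolding tpcont_def using pcont_mono by blast

lemma transport_continuous:
  assumes "tpcont a b A"
  shows "continuous_on {a..b} (\<lambda>s. transport A a s ws)"
proof (induction ws rule: length_induct)
  case (1 ws)
  show ?case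
  proof (cases ws)
    case (Cons x xs)
    have "pcont a b (\<lambda>t. t_mult (\<lambda>ys. A t (x # ys)) (transport A a t) xs)"
      unfolding t_mult_def
    proof (intro pcont_sum pcont_mult)
      show "pcont a b (\<lambda>t. A t (x # take i xs))" for i
        using assms by (simp add: tpcont_def)
      show "pcont a b (\<lambda>t. transport A a t (drop i xs))" for i
        using 1 Cons by (intro pcont_continuous) auto
    qed
    then show ?thesis
      unfolding Cons transport_Cons by (intro indefinite_integral_continuous_1 pcont_integrable)
  qed simp
qed

lemma transport_pcont: "tpcont a b A \<Longrightarrow> pcont a b (\<lambda>s. transport A a s ws)"
  by (intro pcont_continuous transport_continuous)

lemma transport_integrand_pcont:
  assumes "tpcont a b A"
  shows "pcont a b (\<lambda>t. t_mult (\<lambda>ys. A t (x # ys)) (transport A a t) xs)"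
  unfolding t_mult_def using assms
  by (intro pcont_sum pcont_mult transport_pcont) (auto simp: tpcont_def)

text \<open>Needed because velocities of paths, and with them the coefficient \<open>A\<close>, are
  known only off a finite set.\<close>

lemma transport_spike:
  assumes "finite S" and "\<And>t ws. t \<in> {a..b} - S \<Longrightarrow> A t ws = A' t ws" and "s \<le> b"
  shows "transport A a s ws = transport A' a s ws"
  using assms(3)
proof (induction ws arbitrary: s rule: length_induct)
  case (1 ws)
  show ?case
  proof (cases ws)
    case (Cons x xs)
    have "t_mult (\<lambda>ys. A' t (x # ys)) (transport A' a t) xs = t_mult (\<lambda>ys. A t (x # ys)) (transport A a t) xs"
      if "t \<in> {a..s} - S" for t
      unfolding t_mult_def using that 1 assms(2) Cons by (intro sum.cong arg_cong2[where f = "(*)"]) auto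
    then show ?thesis
      unfolding Cons transport_Cons by (rule integral_spike[OF negligible_finite[OF assms(1)]])
  qed simp
qed

text \<open>Split the outer integral at \<open>c\<close>. On the later half the induction hypothesis
  rewrites the shorter words, and associativity collects the transport up to \<open>c\<close> as a
  constant right factor. The later part of a path thus stands on the left.\<close>

lemma transport_compose:
  assumes A: "tpcont a b A" and "a \<le> c" "c \<le> s" "s \<le> b"
  shows "transport A a s ws = t_mult (transport A c s) (transport A a c) ws"
  using assms(3,4)
proof (induction ws arbitrary: s rule: length_induct)
  case (1 ws)
  show ?case
  proof (cases ws)
    case (Cons x xs)
    let ?X = "transport A a" and ?Y = "transport A c"
    have pc: "pcont a s (\<lambda>t. t_mult (\<lambda>ys. A t (x # ys)) (?X t) xs)"
      by (intro transport_integrand_pcont tpcont_mono[OF A]) (use 1 in auto)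
    have pc': "pcont c s (\<lambda>t. t_mult (\<lambda>ys. A t (x # ys)) (?Y t) zs)" for zs
      by (intro transport_integrand_pcont tpcont_mono[OF A]) (use 1 assms in auto)
    have "?X s ws = ?X c ws + integral {c..s} (\<lambda>t. t_mult (\<lambda>ys. A t (x # ys)) (?X t) xs)"
      unfolding Cons transport_Cons
      by (rule Henstock_Kurzweil_Integration.integral_combine[symmetric])
        (use 1 assms in \<open>auto intro: pcont_integrable pc\<close>)
    also have "integral {c..s} (\<lambda>t. t_mult (\<lambda>ys. A t (x # ys)) (?X t) xs) =
        integral {c..s} (\<lambda>t. t_mult (t_mult (\<lambda>ys. A t (x # ys)) (?Y t)) (?X c) xs)"
    proof (rule Henstock_Kurzweil_Integration.integral_cong)
      fix t assume t: "t \<in> {c..s}"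
      show "t_mult (\<lambda>ys. A t (x # ys)) (?X t) xs = t_mult (t_mult (\<lambda>ys. A t (x # ys)) (?Y t)) (?X c) xs"
        unfolding t_mult_assoc using t 1 Cons by (intro t_mult_cong_length) auto
    qed
    also have "\<dots> = (\<Sum>i\<le>length xs. integral {c..s}
        (\<lambda>t. t_mult (\<lambda>ys. A t (x # ys)) (?Y t) (take i xs) * ?X c (drop i xs)))"
      unfolding t_mult_def[of "t_mult _ _"]
      by (rule Henstock_Kurzweil_Integration.integral_sum)
        (auto intro!: pcont_integrable pcont_mult pc' pcont_const)
    also have "\<dots> = t_mult (\<lambda>ys. ?Y s (x # ys)) (?X c) xs"
      unfolding transport_Cons by (simp add: t_mult_def[of _ "?X c"])
    finally show ?thesis
      unfolding Cons t_mult_Cons by simp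
  qed simp
qed

lemma integral_affine:
  fixes f :: "real \<Rightarrow> complex"
  assumes "f integrable_on {k * a + d..k * s + d}" and "k > 0"
  shows "integral {a..s} (\<lambda>t. of_real k * f (k * t + d)) = integral {k * a + d..k * s + d} f"
proof -
  have "(f has_integral integral {k * a + d..k * s + d} f) (cbox (k * a + d) (k * s + d))"
    using assms by (simp add: has_integral_integral)
  from has_integral_affinity'[OF this assms(2), of d]
  have "((\<lambda>t. f (k * t + d)) has_integral integral {k * a + d..k * s + d} f /\<^sub>R k) {a..s}"
    using assms(2) by (simp add: field_simps)
  from has_integral_mult_right[OF this, of "of_real k"] assms(2)
  have "((\<lambda>t. of_real k * f (k * t + d)) has_integral integral {k * a + d..k * s + d} f) {a..s}"
    by (simp add: scaleR_conv_of_real flip: mult.assoc)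
  then show ?thesis by (rule integral_unique)
qed

lemma transport_affine:
  assumes "tpcont (k * a + d) (k * b + d) A" and "k > 0" and "s \<le> b"
  shows "transport (\<lambda>t ws. of_real k * A (k * t + d) ws) a s ws = transport A (k * a + d) (k * s + d) ws"
  using assms(3)
proof (induction ws arbitrary: s rule: length_induct)
  case (1 ws)
  let ?A = "\<lambda>t ws. of_real k * A (k * t + d) ws" and ?X = "transport A (k * a + d)"
  show ?case
  proof (cases ws)
    case (Cons x xs)
    have "transport ?A a s ws = integral {a..s} (\<lambda>t. t_mult (\<lambda>ys. ?A t (x # ys)) (transport ?A a t) xs)"
      by (simp add: Cons transport_Cons)
    also have "\<dots> = integral {a..s} (\<lambda>t. of_real k * t_mult (\<lambda>ys. A (k * t + d) (x # ys)) (?X (k * t + d)) xs)"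
    proof (rule Henstock_Kurzweil_Integration.integral_cong)
      fix t assume t: "t \<in> {a..s}"
      have "t_mult (\<lambda>ys. ?A t (x # ys)) (transport ?A a t) xs =
          t_mult (\<lambda>ys. ?A t (x # ys)) (?X (k * t + d)) xs"
        by (rule t_mult_cong_length) (use t 1 Cons in auto)
      then show "t_mult (\<lambda>ys. ?A t (x # ys)) (transport ?A a t) xs =
          of_real k * t_mult (\<lambda>ys. A (k * t + d) (x # ys)) (?X (k * t + d)) xs"
        by (simp add: t_mult_def sum_distrib_left mult.assoc)
    qed
    also have "\<dots> = ?X (k * s + d) ws"
      unfolding Cons transport_Cons
    proof (rule integral_affine[OF pcont_integrable assms(2)])
      show "pcont (k * a + d) (k * s + d)
          (\<lambda>t. t_mult (\<lambda>ys. A t (x # ys)) (transport A (k * a + d) t) xs)"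
        by (intro transport_integrand_pcont tpcont_mono[OF assms(1)]) (use 1 assms in auto)
    qed
    finally show ?thesis .
  qed simp
qed

section \<open>Transports as elements of the completed tensor algebra\<close>

lemma class_linear_integral:
  assumes "\<And>t. t \<in> {a..s} \<Longrightarrow> class_linear F E D (g t)"
    and "\<And>\<omega>. (\<lambda>t. g t \<omega>) integrable_on {a..s}"
  shows "class_linear F E D (\<lambda>\<omega>. integral {a..s} (\<lambda>t. g t \<omega>))"
  unfolding class_linear_def
proof (intro conjI allI ballI impI)
  fix \<omega> assume "\<omega> \<notin> dR_C F E D"
  then have "integral {a..s} (\<lambda>t. g t \<omega>) = integral {a..s} (\<lambda>t. 0)"
    using assms(1) by (intro Henstock_Kurzweil_Integration.integral_cong) (auto simp: class_linear_def)
  then show "integral {a..s} (\<lambda>t. g t \<omega>) = 0" by simp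
next
  fix \<omega> assume "\<omega> \<in> exact_forms E D"
  then have "integral {a..s} (\<lambda>t. g t \<omega>) = integral {a..s} (\<lambda>t. 0)"
    using assms(1) by (intro Henstock_Kurzweil_Integration.integral_cong) (auto simp: class_linear_def)
  then show "integral {a..s} (\<lambda>t. g t \<omega>) = 0" by simp
next
  fix \<omega> \<omega>' p q assume *: "\<omega> \<in> dR_C F E D" "\<omega>' \<in> dR_C F E D"
  then have "integral {a..s} (\<lambda>t. g t (\<lambda>v w. p * \<omega> v w + q * \<omega>' v w)) =
      integral {a..s} (\<lambda>t. p * g t \<omega> + q * g t \<omega>')"
    using assms(1) by (intro Henstock_Kurzweil_Integration.integral_cong) (auto simp: class_linear_def)
  also have "\<dots> = p * integral {a..s} (\<lambda>t. g t \<omega>) + q * integral {a..s} (\<lambda>t. g t \<omega>')"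
    by (subst Henstock_Kurzweil_Integration.integral_add) (auto intro!: integrable_on_mult_right assms)
  finally show "integral {a..s} (\<lambda>t. g t (\<lambda>v w. p * \<omega> v w + q * \<omega>' v w)) =
      p * integral {a..s} (\<lambda>t. g t \<omega>) + q * integral {a..s} (\<lambda>t. g t \<omega>')" .
qed

definition truncate :: "nat \<Rightarrow> 'n::finite tensor \<Rightarrow> 'n tensor" where
  "truncate n t = (\<lambda>ws. if length ws \<le> n then t ws else 0)"

text \<open>Varying one slot keeps the length of the word, so class-linearity can be tested on
  truncations. This opens the way to induction on the degree.\<close>

lemma T_hat_truncate_iff: "t \<in> T_hat F E D \<longleftrightarrow> (\<forall>n. truncate n t \<in> T_hat F E D)"
proof
  assume t: "t \<in> T_hat F E D"
  show "\<forall>n. truncate n t \<in> T_hat F E D"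
    unfolding T_hat_iff truncate_def
  proof (intro allI)
    show "class_linear F E D (\<lambda>\<omega>. if length (xs @ \<omega> # ys) \<le> n then t (xs @ \<omega> # ys) else 0)" for n xs ys
      using T_hatD[OF t, of xs ys] class_linear_zero by (cases "length (xs @ undefined # ys) \<le> n") auto
  qed
next
  assume t: "\<forall>n. truncate n t \<in> T_hat F E D"
  show "t \<in> T_hat F E D"
    unfolding T_hat_iff
  proof (intro allI)
    show "class_linear F E D (\<lambda>\<omega>. t (xs @ \<omega> # ys))" for xs ys
      using T_hatD[OF t[rule_format], of "length (xs @ undefined # ys)" xs ys] by (simp add: truncate_def)
  qed
qed

text \<open>Since \<open>A\<close> has no constant term, the coefficients up to degree
  \<open>Suc n\<close> are integrals of products of \<open>A\<close> with the solution truncated at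
  \<open>n\<close>, and such products are class-linear by induction.\<close>

lemma transport_T_hat:
  assumes A: "tpcont a b A" "\<And>t. t \<in> {a..b} \<Longrightarrow> A t \<in> T_hat F E D" "\<And>t. A t [] = 0" and "s \<in> {a..b}"
  shows "transport A a s \<in> T_hat F E D"
proof -
  have "truncate n (transport A a s) \<in> T_hat F E D" for n
    using assms(4)
  proof (induction n arbitrary: s)
    case 0
    have "truncate 0 (transport A a s) = t_one"
      by (rule ext) (auto simp: truncate_def t_one_def)
    then show ?case by (simp add: T_hat_one)
  next
    case (Suc n)
    let ?X = "\<lambda>t. truncate n (transport A a t)"
    have M: "class_linear F E D (\<lambda>\<omega>. t_mult (A t) (?X t) (xs @ \<omega> # ys))" if "t \<in> {a..s}" for t xs ys
      using that Suc.prems by (intro T_hatD T_hat_mult Suc.IH A) auto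
    have eq: "transport A a s ws = integral {a..s} (\<lambda>t. t_mult (A t) (?X t) ws)"
      and int: "(\<lambda>t. t_mult (A t) (?X t) ws) integrable_on {a..s}"
      if ws: "ws \<noteq> []" "length ws \<le> Suc n" for ws
    proof -
      obtain x xs where x: "ws = x # xs" using ws(1) by (cases ws) auto
      have *: "t_mult (A t) (?X t) ws = t_mult (\<lambda>ys. A t (x # ys)) (transport A a t) xs" for t
        using ws(2) by (auto simp: x t_mult_Cons A(3) truncate_def intro!: t_mult_cong_length)
      show "transport A a s ws = integral {a..s} (\<lambda>t. t_mult (A t) (?X t) ws)"
        unfolding * by (simp add: x transport_Cons)
      show "(\<lambda>t. t_mult (A t) (?X t) ws) integrable_on {a..s}"
        unfolding * using Suc.prems
        by (intro pcont_integrable transport_integrand_pcont tpcont_mono[OF A(1)]) auto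
    qed
    show ?case
      unfolding T_hat_iff
    proof (intro allI)
      fix xs ys :: "'a form list"
      show "class_linear F E D (\<lambda>\<omega>. truncate (Suc n) (transport A a s) (xs @ \<omega> # ys))"
      proof (cases "length (xs @ undefined # ys) \<le> Suc n")
        case True
        have "(\<lambda>\<omega>. truncate (Suc n) (transport A a s) (xs @ \<omega> # ys)) =
            (\<lambda>\<omega>. integral {a..s} (\<lambda>t. t_mult (A t) (?X t) (xs @ \<omega> # ys)))"
          using True by (subst eq[symmetric]) (auto simp: truncate_def)
        moreover have "class_linear F E D \<dots>"
          by (intro class_linear_integral M int) (use True in auto)
        ultimately show ?thesis by simp
      next
        case False
        then show ?thesis by (simp add: truncate_def class_linear_zero)
      qed
    qed
  qed
  then show ?thesis
    using T_hat_truncate_iff by blast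
qed

section \<open>Iterated integrals as solutions of the differential equation\<close>

definition splittings :: "'b list \<Rightarrow> 'b list list set" where
  "splittings ws = {wss. concat wss = ws \<and> [] \<notin> set wss}"

lemma splittings_Nil [simp]: "splittings [] = {[]}"
proof -
  have "wss = []" if "concat wss = []" "[] \<notin> set wss" for wss :: "'b list list"
    using that by (cases wss) auto
  then show ?thesis by (auto simp: splittings_def)
qed

text \<open>A cutting of a nonempty word is determined by its first piece and a cutting of the rest;
  \<open>i\<close> counts the letters that follow \<open>x\<close> in the first piece.\<close>

lemma splittings_Cons:
  "splittings (x # xs) = (\<Union>i\<in>{..length xs}. (#) (x # take i xs) ` splittings (drop i xs))"
proof (intro equalityI subsetI)
  fix wss assume "wss \<in> splittings (x # xs)"
  then obtain y ys r where *: "wss = (y # ys) # r" "y # ys @ concat r = x # xs" "[] \<notin> set r"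
    by (cases wss; cases "hd wss") (auto simp: splittings_def)
  then have "wss = (x # take (length ys) xs) # r" "r \<in> splittings (drop (length ys) xs)" "length ys \<le> length xs"
    by (auto simp: splittings_def)
  then show "wss \<in> (\<Union>i\<in>{..length xs}. (#) (x # take i xs) ` splittings (drop i xs))"
    by blast
qed (auto simp: splittings_def)

lemma finite_splittings: "finite (splittings ws)"
proof (induction ws rule: length_induct)
  case (1 ws)
  then show ?case by (cases ws) (auto simp: splittings_Cons)
qed

text \<open>The pullback of \<open>\<Omega>\<close> to the parameter interval, as the coefficient of
  the differential equation. The derivative is taken within \<open>{0..1}\<close> to agree with
  \<open>iter_int\<close>.\<close>

definition along :: "('n::finite form list \<Rightarrow> 'n form) \<Rightarrow> (real \<Rightarrow> complex^'n) \<Rightarrow> real \<Rightarrow> 'n tensor" where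
  "along \<Omega> \<gamma> t = (\<lambda>ws. \<Omega> ws (\<gamma> t) (vector_derivative \<gamma> (at t within {0..1})))"

lemma iter_int_continuous:
  assumes "tpcont 0 b (along \<Omega> \<gamma>)"
  shows "continuous_on {0..b} (iter_int \<gamma> (map \<Omega> wss))"
proof (induction wss)
  case (Cons ws wss)
  have "pcont 0 b (\<lambda>t. along \<Omega> \<gamma> t ws * iter_int \<gamma> (map \<Omega> wss) t)"
    using assms Cons by (intro pcont_mult pcont_continuous[of _ _ "iter_int _ _"]) (auto simp: tpcont_def)
  then show ?case
    unfolding along_def by (auto intro!: indefinite_integral_continuous_1 dest: pcont_integrable)
qed simp

text \<open>Group the cuttings by their first piece. The outermost integral in
  \<open>iter_int\<close> belongs to that piece, and the cuttings of the remaining word sum to a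
  shorter coefficient of \<open>T_upto\<close>, so the two recursions coincide.\<close>

lemma T_upto_eq_transport:
  assumes "tpcont 0 b (along \<Omega> \<gamma>)" and "s \<le> b"
  shows "T_upto \<Omega> \<gamma> s ws = transport (along \<Omega> \<gamma>) 0 s ws"
  using assms(2)
proof (induction ws arbitrary: s rule: length_induct)
  case (1 ws)
  note IH = 1
  show ?case
  proof (cases ws)
    case Nil
    then show ?thesis by (simp add: T_upto_def flip: splittings_def)
  next
    case (Cons x xs)
    have pc: "pcont 0 s (\<lambda>t. along \<Omega> \<gamma> t ws * iter_int \<gamma> (map \<Omega> wss) t)" for ws wss
    proof (rule pcont_mono)
      show "pcont 0 b (\<lambda>t. along \<Omega> \<gamma> t ws * iter_int \<gamma> (map \<Omega> wss) t)"
        using assms iter_int_continuous[OF assms(1)]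
        by (intro pcont_mult pcont_continuous[of _ _ "iter_int _ _"]) (auto simp: tpcont_def)
    qed (use IH in auto)
    have disj: "(#) (x # take i xs) ` splittings (drop i xs) \<inter> (#) (x # take j xs) ` splittings (drop j xs) = {}"
      if "i \<in> {..length xs}" "j \<in> {..length xs}" "i \<noteq> j" for i j
    proof -
      have "take i xs \<noteq> take j xs"
        using that by (metis atMost_iff length_take min.absorb2)
      then show ?thesis by auto
    qed
    have "T_upto \<Omega> \<gamma> s ws = (\<Sum>wss\<in>splittings (x # xs). iter_int \<gamma> (map \<Omega> wss) s)"
      by (simp add: T_upto_def Cons splittings_def)
    also have "\<dots> = (\<Sum>i\<le>length xs. \<Sum>wss\<in>(#) (x # take i xs) ` splittings (drop i xs). iter_int \<gamma> (map \<Omega> wss) s)"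
      unfolding splittings_Cons
      by (rule sum.UNION_disjoint) (use disj in \<open>auto simp: finite_splittings\<close>)
    also have "\<dots> = (\<Sum>i\<le>length xs. \<Sum>r\<in>splittings (drop i xs).
        integral {0..s} (\<lambda>t. along \<Omega> \<gamma> t (x # take i xs) * iter_int \<gamma> (map \<Omega> r) t))"
      by (simp add: sum.reindex along_def)
    also have "\<dots> = (\<Sum>i\<le>length xs.
        integral {0..s} (\<lambda>t. \<Sum>r\<in>splittings (drop i xs). along \<Omega> \<gamma> t (x # take i xs) * iter_int \<gamma> (map \<Omega> r) t))"
      by (intro sum.cong refl Henstock_Kurzweil_Integration.integral_sum[symmetric])
        (auto simp: finite_splittings intro: pcont_integrable pc)
    also have "\<dots> = integral {0..s} (\<lambda>t. \<Sum>i\<le>length xs.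
        \<Sum>r\<in>splittings (drop i xs). along \<Omega> \<gamma> t (x # take i xs) * iter_int \<gamma> (map \<Omega> r) t)"
      by (intro Henstock_Kurzweil_Integration.integral_sum[symmetric])
        (auto intro!: pcont_integrable pcont_sum pc)
    also have "\<dots> = integral {0..s} (\<lambda>t. t_mult (\<lambda>ys. along \<Omega> \<gamma> t (x # ys)) (transport (along \<Omega> \<gamma>) 0 t) xs)"
    proof (rule Henstock_Kurzweil_Integration.integral_cong)
      fix t assume t: "t \<in> {0..s}"
      have "T_upto \<Omega> \<gamma> t (drop i xs) = transport (along \<Omega> \<gamma>) 0 t (drop i xs)" for i
        using t IH Cons by auto
      then show "(\<Sum>i\<le>length xs. \<Sum>r\<in>splittings (drop i xs).
            along \<Omega> \<gamma> t (x # take i xs) * iter_int \<gamma> (map \<Omega> r) t) =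
          t_mult (\<lambda>ys. along \<Omega> \<gamma> t (x # ys)) (transport (along \<Omega> \<gamma>) 0 t) xs"
        by (simp add: t_mult_def T_upto_def splittings_def flip: sum_distrib_left)
    qed
    finally show ?thesis
      by (simp add: Cons transport_Cons)
  qed
qed

section \<open>Polynomials and the real structure\<close>

lemma F_inf_nth [simp]: "F_inf v $ i = cnj (v $ i)"
  by (simp add: F_inf_def)

lemma F_inf_F_inf [simp]: "F_inf (F_inf v) = v"
  by (simp add: vec_eq_iff)

lemma F_inf_eq_0_iff [simp]: "F_inf v = 0 \<longleftrightarrow> v = 0"
  by (simp add: vec_eq_iff)

lemma F_inf_scale: "F_inf (c *s v) = cnj c *s F_inf v"
  by (simp add: vec_eq_iff)

lemma bounded_linear_F_inf: "bounded_linear F_inf"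
  unfolding linear_conv_bounded_linear[symmetric]
  by (intro linearI) (simp_all add: vec_eq_iff)

lemma scaleR_eq_scale: "a *\<^sub>R (v :: complex^'n) = of_real a *s v"
proof -
  have "(a *\<^sub>R v) $ i = of_real a * v $ i" for i
    by (simp only: vector_scaleR_component) (rule scaleR_conv_of_real)
  then show ?thesis by (simp add: vec_eq_iff)
qed

lemma has_derivative_vecI:
  fixes f :: "'a::real_normed_vector \<Rightarrow> complex^'n"
  assumes "\<And>i. ((\<lambda>x. f x $ i) has_derivative (\<lambda>h. f' h $ i)) (at x within S)"
  shows "(f has_derivative f') (at x within S)"
proof -
  have bl: "bounded_linear (axis i :: complex \<Rightarrow> complex^'n)" for i
    unfolding linear_conv_bounded_linear[symmetric] by (intro linearI) (simp_all add: vec_eq_iff axis_def)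
  have eq: "v = (\<Sum>i\<in>UNIV. axis i (v $ i))" for v :: "complex^'n"
    by (simp add: vec_eq_iff axis_def)
  have "((\<lambda>x. \<Sum>i\<in>UNIV. axis i (f x $ i)) has_derivative (\<lambda>h. \<Sum>i\<in>UNIV. axis i (f' h $ i))) (at x within S)"
    by (intro has_derivative_sum bounded_linear.has_derivative[OF bl] assms)
  then show ?thesis
    by (simp flip: eq)
qed

text \<open>Complex differentiability with gradient \<open>g\<close>. The pairing is bilinear and
  not Hermitian, which makes the derivative complex linear.\<close>

definition cgrad :: "(complex^'n \<Rightarrow> complex) \<Rightarrow> complex^'n \<Rightarrow> complex^'n \<Rightarrow> bool" where
  "cgrad f v g \<longleftrightarrow> (f has_derivative (\<lambda>w. \<Sum>i\<in>UNIV. g $ i * w $ i)) (at v)"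

lemma cgrad_frechet: "cgrad f v g \<Longrightarrow> frechet_derivative f (at v) w = (\<Sum>i\<in>UNIV. g $ i * w $ i)"
  unfolding cgrad_def by (drule frechet_derivative_at) (metis (no_types, lifting))

lemma cgrad_has_derivative: "cgrad f v g \<Longrightarrow> (f has_derivative frechet_derivative f (at v)) (at v)"
  unfolding cgrad_def using frechet_derivative_at by metis

lemma cgrad_mult:
  assumes "cgrad f v g" and "cgrad f' v g'"
  shows "cgrad (\<lambda>v. f v * f' v) v (f v *s g' + f' v *s g)"
proof -
  have "((\<lambda>v. f v * f' v) has_derivative
      (\<lambda>w. f v * (\<Sum>i\<in>UNIV. g' $ i * w $ i) + (\<Sum>i\<in>UNIV. g $ i * w $ i) * f' v)) (at v)"
    using assms unfolding cgrad_def by (rule has_derivative_mult)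
  then show ?thesis
    unfolding cgrad_def
    by (rule has_derivative_eq_rhs)
      (simp add: fun_eq_iff sum_distrib_left sum_distrib_right algebra_simps flip: sum.distrib)
qed

lemma cgrad_add:
  assumes "cgrad f v g" and "cgrad f' v g'"
  shows "cgrad (\<lambda>v. f v + f' v) v (g + g')"
  using has_derivative_add[OF assms[unfolded cgrad_def]] unfolding cgrad_def
  by (rule has_derivative_eq_rhs) (simp add: fun_eq_iff algebra_simps flip: sum.distrib)

lemma cgrad_const: "cgrad (\<lambda>v. c) v 0"
  by (simp add: cgrad_def)

lemma cgrad_nth: "cgrad (\<lambda>v. v $ i) v (axis i 1)"
proof -
  have "((\<lambda>v. v $ i) has_derivative (\<lambda>w. w $ i)) (at v)"
    by (rule bounded_linear_imp_has_derivative[OF bounded_linear_vec_nth])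
  then show ?thesis
    unfolding cgrad_def
    by (rule has_derivative_eq_rhs) (simp add: fun_eq_iff axis_def if_distrib[of "\<lambda>x. x * _"] cong: if_cong)
qed

lemma cgrad_inverse:
  assumes "cgrad f v g" and "f v \<noteq> 0"
  shows "cgrad (\<lambda>v. inverse (f v)) v ((- 1 / (f v)\<^sup>2) *s g)"
  using Deriv.has_derivative_inverse[OF assms(2) assms(1)[unfolded cgrad_def]] unfolding cgrad_def
  by (rule has_derivative_eq_rhs)
    (simp add: fun_eq_iff sum_distrib_left sum_distrib_right power2_eq_square field_simps flip: sum_negf)

text \<open>Retains two facts about a polynomial: it is complex differentiable everywhere and its
  gradient is continuous. The latter feeds the inverse function theorem.\<close>

definition cpoly :: "(complex^'n \<Rightarrow> complex) \<Rightarrow> bool" where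
  "cpoly P \<longleftrightarrow> (\<exists>G. (\<forall>v. cgrad P v (G v)) \<and> continuous_on UNIV G)"

lemma cpoly_cgrad: "cpoly P \<Longrightarrow> \<exists>g. cgrad P v g"
  by (auto simp: cpoly_def)

lemma cpoly_continuous: "cpoly P \<Longrightarrow> continuous_on UNIV P"
  unfolding cpoly_def cgrad_def
  by (meson continuous_at_imp_continuous_on has_derivative_continuous)

lemma continuous_on_scale [continuous_intros]:
  fixes f :: "'a::topological_space \<Rightarrow> complex" and g :: "'a \<Rightarrow> complex^'n"
  assumes "continuous_on S f" and "continuous_on S g"
  shows "continuous_on S (\<lambda>x. f x *s g x)"
proof -
  have "continuous_on S (\<lambda>x. \<chi> i. f x * g x $ i)"
    by (intro continuous_on_vec_lambda continuous_on_mult assms continuous_on_component)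
  then show ?thesis
    by (simp add: vector_scalar_mult_def)
qed

lemma cpoly_mult:
  assumes "cpoly f" and "cpoly g"
  shows "cpoly (\<lambda>v. f v * g v)"
proof -
  obtain G H where "\<forall>v. cgrad f v (G v)" "continuous_on UNIV G" "\<forall>v. cgrad g v (H v)" "continuous_on UNIV H"
    using assms unfolding cpoly_def by blast
  then show ?thesis
    unfolding cpoly_def using assms
    by (intro exI[of _ "\<lambda>v. f v *s H v + g v *s G v"])
      (auto intro!: cgrad_mult continuous_intros cpoly_continuous)
qed

lemma cpoly_add:
  assumes "cpoly f" and "cpoly g"
  shows "cpoly (\<lambda>v. f v + g v)"
proof -
  obtain G H where "\<forall>v. cgrad f v (G v)" "continuous_on UNIV G" "\<forall>v. cgrad g v (H v)" "continuous_on UNIV H"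
    using assms unfolding cpoly_def by blast
  then show ?thesis
    unfolding cpoly_def
    by (intro exI[of _ "\<lambda>v. G v + H v"]) (auto intro!: cgrad_add continuous_intros)
qed

lemma cpoly_const: "cpoly (\<lambda>v. c)"
  unfolding cpoly_def by (intro exI[of _ "\<lambda>v. 0"] conjI allI cgrad_const continuous_on_const)

lemma cpoly_nth: "cpoly (\<lambda>v. v $ i)"
  unfolding cpoly_def by (intro exI[of _ "\<lambda>v. axis i 1"] conjI allI cgrad_nth continuous_on_const)

lemma cpoly_power: "cpoly f \<Longrightarrow> cpoly (\<lambda>v. f v ^ n)"
  by (induction n) (auto intro: cpoly_const cpoly_mult)

lemma cpoly_sum: "(\<And>i. i \<in> I \<Longrightarrow> cpoly (f i)) \<Longrightarrow> cpoly (\<lambda>v. \<Sum>i\<in>I. f i v)"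
  by (induction I rule: infinite_finite_induct) (auto intro: cpoly_const cpoly_add)

lemma cpoly_prod: "(\<And>i. i \<in> I \<Longrightarrow> cpoly (f i)) \<Longrightarrow> cpoly (\<lambda>v. \<Prod>i\<in>I. f i v)"
  by (induction I rule: infinite_finite_induct) (auto intro: cpoly_const cpoly_mult)

lemma hom_poly_cpoly: "hom_poly F d P \<Longrightarrow> cpoly P"
  unfolding hom_poly_def
  by (auto intro!: cpoly_sum cpoly_mult cpoly_const cpoly_prod cpoly_power cpoly_nth)

lemma hom_poly_scale:
  assumes "hom_poly F d P"
  shows "P (c *s v) = c ^ d * P v"
proof -
  obtain a :: "('a \<Rightarrow> nat) \<Rightarrow> real" where
    P: "P = (\<lambda>v. \<Sum>m \<in> {m. (\<Sum>i\<in>UNIV. m i) = d}. of_real (a m) * (\<Prod>i\<in>UNIV. (v $ i) ^ m i))"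
    using assms unfolding hom_poly_def by blast
  have "(\<Prod>i\<in>UNIV. ((c *s v) $ i) ^ m i) = c ^ (\<Sum>i\<in>UNIV. m i) * (\<Prod>i\<in>UNIV. (v $ i) ^ m i)" for m
    by (simp add: power_mult_distrib prod.distrib power_sum)
  then show ?thesis
    by (auto simp: P sum_distrib_left intro!: sum.cong)
qed

lemma hom_poly_F_inf: "hom_poly F d P \<Longrightarrow> P (F_inf v) = cnj (P v)"
  unfolding hom_poly_def by auto

text \<open>Differentiate the identity \<open>f x = cnj (f (F_inf x))\<close>, valid for functions
  with real coefficients.\<close>

lemma frechet_F_inf:
  assumes "cgrad f v g" and "\<And>x. f (F_inf x) = cnj (f x)"
  shows "frechet_derivative f (at (F_inf v)) (F_inf w) = cnj (frechet_derivative f (at v) w)"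
proof -
  have d: "(f has_derivative (\<lambda>w. \<Sum>i\<in>UNIV. g $ i * w $ i)) (at (F_inf (F_inf v)))"
    using assms(1) by (simp add: cgrad_def)
  have "((\<lambda>x. cnj (f (F_inf x))) has_derivative (\<lambda>w. cnj (\<Sum>i\<in>UNIV. g $ i * F_inf w $ i))) (at (F_inf v))"
    by (intro bounded_linear.has_derivative[OF bounded_linear_cnj] has_derivative_compose[where g = f and f = F_inf, OF _ d]
        bounded_linear_imp_has_derivative bounded_linear_F_inf)
  then have "(f has_derivative (\<lambda>w. cnj (\<Sum>i\<in>UNIV. g $ i * F_inf w $ i))) (at (F_inf v))"
    using assms(2) by simp
  from frechet_derivative_at[OF this] cgrad_frechet[OF assms(1)] show ?thesis
    by (metis (no_types, lifting) F_inf_F_inf sum.cong)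
qed

lemma frechet_cscale:
  "cgrad f v g \<Longrightarrow> frechet_derivative f (at v) (c *s w) = c * frechet_derivative f (at v) w"
  by (simp add: cgrad_frechet sum_distrib_left algebra_simps)

lemma frechet_add:
  "cgrad f v g \<Longrightarrow> frechet_derivative f (at v) (w + w') =
    frechet_derivative f (at v) w + frechet_derivative f (at v) w'"
  by (simp add: cgrad_frechet algebra_simps sum.distrib)

section \<open>Charts and smooth functions\<close>

lemma chart_has_derivative:
  assumes "chart E U u" and "z \<in> U"
  shows "(u has_derivative (\<lambda>h. h *s cderiv u z)) (at z)"
proof (rule has_derivative_vecI)
  fix i
  have "((\<lambda>x. u x $ i) has_field_derivative cderiv u z $ i) (at z)"
    using assms by (auto simp: chart_def cderiv_def intro: holomorphic_derivI)
  then show "((\<lambda>x. u x $ i) has_derivative (\<lambda>h. (h *s cderiv u z) $ i)) (at z)"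
    by (simp add: has_field_derivative_def mult_commute_abs)
qed

lemma chart_compose_deriv:
  assumes "chart E U u" and "z \<in> U" and "cgrad f (u z) g"
  shows "((\<lambda>z. f (u z)) has_field_derivative frechet_derivative f (at (u z)) (cderiv u z)) (at z)"
proof -
  have "((\<lambda>z. f (u z)) has_derivative (\<lambda>h. frechet_derivative f (at (u z)) (h *s cderiv u z))) (at z)"
    by (rule has_derivative_compose[where g = f, OF chart_has_derivative[OF assms(1,2)] cgrad_has_derivative[OF assms(3)]])
  then show ?thesis
    by (simp add: has_field_derivative_def frechet_cscale[OF assms(3)] mult_commute_abs)
qed

lemma chart_continuous: "chart E U u \<Longrightarrow> continuous_on U u"
  by (meson chart_has_derivative continuous_at_imp_continuous_on has_derivative_continuous)

lemma chart_subset: "chart E U u \<Longrightarrow> open V \<Longrightarrow> V \<subseteq> U \<Longrightarrow> chart E V u"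
  unfolding chart_def by (meson holomorphic_on_subset subset_iff)

definition has_partials :: "(complex \<Rightarrow> complex) \<Rightarrow> complex \<Rightarrow> complex \<Rightarrow> complex \<Rightarrow> bool" where
  "has_partials f z f1 f2 \<longleftrightarrow>
     (f has_derivative (\<lambda>h. of_real (Re h) * f1 + of_real (Im h) * f2)) (at z)"

text \<open>Exposes the family of mixed partial derivatives that \<open>smooth_fun\<close> hides
  behind a quantifier; \<open>p i j\<close> is the derivative of order \<open>i\<close> in the real
  and \<open>j\<close> in the imaginary direction.\<close>

definition jet :: "complex set \<Rightarrow> (nat \<Rightarrow> nat \<Rightarrow> complex \<Rightarrow> complex) \<Rightarrow> (complex \<Rightarrow> complex) \<Rightarrow> bool" where
  "jet U p f \<longleftrightarrow> p 0 0 = f \<and> (\<forall>i j. \<forall>z\<in>U. has_partials (p i j) z (p (Suc i) j z) (p i (Suc j) z))"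

lemma smooth_fun_iff_jet: "smooth_fun U f \<longleftrightarrow> (\<exists>p. jet U p f)"
  unfolding smooth_fun_def jet_def has_partials_def ..

lemma jet_partials: "jet U p f \<Longrightarrow> z \<in> U \<Longrightarrow> has_partials (p i j) z (p (Suc i) j z) (p i (Suc j) z)"
  by (simp add: jet_def)

lemma smooth_fun_partials: "smooth_fun U f \<Longrightarrow> z \<in> U \<Longrightarrow> \<exists>f1 f2. has_partials f z f1 f2"
  unfolding smooth_fun_iff_jet jet_def by metis

lemma has_partials_comb:
  assumes "has_partials f z f1 f2" and "has_partials g z g1 g2"
  shows "has_partials (\<lambda>z. a * f z + b * g z) z (a * f1 + b * g1) (a * f2 + b * g2)"
  using has_derivative_add[OF has_derivative_mult_right[OF assms(1)[unfolded has_partials_def], of a]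
      has_derivative_mult_right[OF assms(2)[unfolded has_partials_def], of b]]
  unfolding has_partials_def by (rule has_derivative_eq_rhs) (simp add: fun_eq_iff algebra_simps)

lemma smooth_fun_continuous:
  assumes "smooth_fun U f"
  shows "continuous_on U f"
  using smooth_fun_partials[OF assms] unfolding has_partials_def
  by (meson continuous_at_imp_continuous_on has_derivative_continuous)

lemma jet_comb: "jet U p f \<Longrightarrow> jet U q g \<Longrightarrow> jet U (\<lambda>i j z. a * p i j z + b * q i j z) (\<lambda>z. a * f z + b * g z)"
  by (auto simp: jet_def intro: has_partials_comb)

lemma smooth_fun_comb:
  assumes "smooth_fun U f" and "smooth_fun U g"
  shows "smooth_fun U (\<lambda>z. a * f z + b * g z)"
proof -
  obtain p q where "jet U p f" "jet U q g"
    using assms by (auto simp: smooth_fun_iff_jet)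
  from jet_comb[OF this, of a b] show ?thesis
    by (auto simp: smooth_fun_iff_jet)
qed

text \<open>By the Cauchy-Riemann equations the derivative in the imaginary direction is \<i> times
  the complex derivative, so the mixed partials are powers of \<i> times higher complex
  derivatives.\<close>

lemma smooth_fun_holomorphic:
  assumes "open U" and "f holomorphic_on U"
  shows "smooth_fun U f"
  unfolding smooth_fun_def
proof (intro exI[of _ "\<lambda>i j z. \<i> ^ j * (deriv ^^ (i + j)) f z"] conjI allI ballI)
  fix i j z assume z: "z \<in> U"
  have "((deriv ^^ (i + j)) f has_field_derivative (deriv ^^ Suc (i + j)) f z) (at z)"
    using holomorphic_derivI[OF holomorphic_higher_deriv[OF assms(2,1)] assms(1) z] by simp
  then have "((\<lambda>z. \<i> ^ j * (deriv ^^ (i + j)) f z) has_derivative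
      (\<lambda>h. \<i> ^ j * ((deriv ^^ Suc (i + j)) f z * h))) (at z)"
    unfolding has_field_derivative_def by (rule has_derivative_mult_right)
  moreover have "\<i> ^ j * ((deriv ^^ Suc (i + j)) f z * h) =
      of_real (Re h) * (\<i> ^ j * (deriv ^^ (Suc i + j)) f z) +
      of_real (Im h) * (\<i> ^ Suc j * (deriv ^^ (i + Suc j)) f z)" for h
    by (subst (1) complex_eq[of h]) (simp add: algebra_simps)
  ultimately show "((\<lambda>z. \<i> ^ j * (deriv ^^ (i + j)) f z) has_derivative
      (\<lambda>h. of_real (Re h) * (\<i> ^ j * (deriv ^^ (Suc i + j)) f z) +
      of_real (Im h) * (\<i> ^ Suc j * (deriv ^^ (i + Suc j)) f z))) (at z)"
    by simp
qed simp

lemma has_derivative_cnj_cnj: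
  assumes "(f has_derivative f') (at (cnj z))"
  shows "((\<lambda>z. cnj (f (cnj z))) has_derivative (\<lambda>h. cnj (f' (cnj h)))) (at z)"
  by (intro bounded_linear.has_derivative[OF bounded_linear_cnj] has_derivative_compose[where g = f and f = cnj, OF _ assms]
      bounded_linear_imp_has_derivative bounded_linear_cnj)

text \<open>Conjugating the argument reverses the imaginary direction, so every derivative in that
  direction contributes a sign.\<close>

lemma smooth_fun_cnj_cnj:
  assumes "smooth_fun (cnj ` U) f"
  shows "smooth_fun U (\<lambda>z. cnj (f (cnj z)))"
proof -
  obtain p where p: "jet (cnj ` U) p f"
    using assms by (auto simp: smooth_fun_iff_jet)
  have "jet U (\<lambda>i j z. (-1) ^ j * cnj (p i j (cnj z))) (\<lambda>z. cnj (f (cnj z)))"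
    unfolding jet_def has_partials_def
  proof (intro conjI allI ballI)
    fix i j z assume z: "z \<in> U"
    have "has_partials (p i j) (cnj z) (p (Suc i) j (cnj z)) (p i (Suc j) (cnj z))"
      using jet_partials[OF p, of "cnj z"] z by auto
    then have "((\<lambda>z. (-1) ^ j * cnj (p i j (cnj z))) has_derivative
       (\<lambda>h. (-1) ^ j * cnj (of_real (Re (cnj h)) * p (Suc i) j (cnj z) + of_real (Im (cnj h)) * p i (Suc j) (cnj z)))) (at z)"
      unfolding has_partials_def by (intro has_derivative_mult_right has_derivative_cnj_cnj)
    then show "((\<lambda>z. (-1) ^ j * cnj (p i j (cnj z))) has_derivative
       (\<lambda>h. of_real (Re h) * ((-1) ^ j * cnj (p (Suc i) j (cnj z))) +
            of_real (Im h) * ((-1) ^ Suc j * cnj (p i (Suc j) (cnj z))))) (at z)"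
      by (rule has_derivative_eq_rhs) (simp add: fun_eq_iff algebra_simps)
  qed (use p in \<open>simp add: jet_def\<close>)
  then show ?thesis
    by (auto simp: smooth_fun_iff_jet)
qed

text \<open>Holomorphic lifts pass to the conjugate curve by \<open>u \<mapsto> F_inf \<circ> u \<circ> cnj\<close>.\<close>

definition conj_chart :: "(complex \<Rightarrow> complex^'n) \<Rightarrow> complex \<Rightarrow> complex^'n" where
  "conj_chart u z = F_inf (u (cnj z))"

lemma conj_chart_deriv:
  assumes "chart E U u" and "cnj z \<in> U"
  shows "((\<lambda>z. conj_chart u z $ i) has_field_derivative F_inf (cderiv u (cnj z)) $ i) (at z)"
proof -
  have "((\<lambda>x. u x $ i) has_field_derivative cderiv u (cnj z) $ i) (at (cnj z))"
    using assms by (auto simp: chart_def cderiv_def intro: holomorphic_derivI)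
  then have "((\<lambda>z. cnj (u (cnj z) $ i)) has_derivative (\<lambda>h. cnj (cderiv u (cnj z) $ i * cnj h))) (at z)"
    unfolding has_field_derivative_def by (rule has_derivative_cnj_cnj)
  then show ?thesis
    by (simp add: has_field_derivative_def conj_chart_def)
qed

lemma cderiv_conj_chart:
  assumes "chart E U u" and "cnj z \<in> U"
  shows "cderiv (conj_chart u) z = F_inf (cderiv u (cnj z))"
  using DERIV_imp_deriv[OF conj_chart_deriv[OF assms]] by (simp add: cderiv_def vec_eq_iff)

section \<open>The cone of the curve, its divisor and its tangent spaces\<close>

locale curve =
  fixes F :: "real set" and E :: "(complex^'n \<Rightarrow> complex) set" and D :: "(complex^'n) set"
  assumes smooth_curve: "smooth_projective_curve F E" and divisor: "reduced_divisor F E D"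
begin

lemma hom: "P \<in> E \<Longrightarrow> \<exists>d. hom_poly F d P"
  using smooth_curve by (auto simp: smooth_projective_curve_def)

lemma E_cgrad: "P \<in> E \<Longrightarrow> \<exists>g. cgrad P v g"
  using hom hom_poly_cpoly cpoly_cgrad by blast

lemma cone_scale: "c \<noteq> 0 \<Longrightarrow> c *s v \<in> cone E \<longleftrightarrow> v \<in> cone E"
  unfolding cone_def using hom hom_poly_scale by fastforce

lemma cone_F_inf: "F_inf v \<in> cone E \<longleftrightarrow> v \<in> cone E"
  unfolding cone_def using hom hom_poly_F_inf by fastforce

lemma D_cone: "D \<subseteq> cone E"
  using divisor by (auto simp: reduced_divisor_def cone_def)

lemma D_scale: "c \<noteq> 0 \<Longrightarrow> c *s v \<in> D \<longleftrightarrow> v \<in> D"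
proof -
  assume c: "c \<noteq> 0"
  obtain G where G: "\<forall>P\<in>G. \<exists>d. hom_poly F d P" "D = cone (E \<union> G)"
    using divisor by (auto simp: reduced_divisor_def)
  have "P (c *s v) = 0 \<longleftrightarrow> P v = 0" if "P \<in> E \<union> G" for P
    using that G hom hom_poly_scale c by fastforce
  then show ?thesis
    unfolding G(2) cone_def using c by auto
qed

lemma D_F_inf: "F_inf v \<in> D \<longleftrightarrow> v \<in> D"
proof -
  obtain G where G: "\<forall>P\<in>G. \<exists>d. hom_poly F d P" "D = cone (E \<union> G)"
    using divisor by (auto simp: reduced_divisor_def)
  have "P (F_inf v) = 0 \<longleftrightarrow> P v = 0" if "P \<in> E \<union> G" for P
    using that G hom hom_poly_F_inf by fastforce
  then show ?thesis
    unfolding G(2) cone_def by auto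
qed

abbreviation Y where "Y \<equiv> open_part E D"

lemma Y_scale: "c \<noteq> 0 \<Longrightarrow> c *s v \<in> Y \<longleftrightarrow> v \<in> Y"
  by (simp add: open_part_def cone_scale D_scale)

lemma Y_F_inf: "F_inf v \<in> Y \<longleftrightarrow> v \<in> Y"
  by (simp add: open_part_def cone_F_inf D_F_inf)

lemma Y_cone: "v \<in> Y \<Longrightarrow> v \<in> cone E"
  by (simp add: open_part_def)

lemma cone_nz: "v \<in> cone E \<Longrightarrow> v \<noteq> 0"
  by (simp add: cone_def)

lemma tangent_add: "w \<in> tangent E v \<Longrightarrow> w' \<in> tangent E v \<Longrightarrow> w + w' \<in> tangent E v"
  unfolding tangent_def by (auto, metis E_cgrad frechet_add add_0)

lemma tangent_cscale: "w \<in> tangent E v \<Longrightarrow> c *s w \<in> tangent E v"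
  unfolding tangent_def by (auto, metis E_cgrad frechet_cscale mult_zero_right)

lemma tangent_F_inf: "F_inf w \<in> tangent E (F_inf v) \<longleftrightarrow> w \<in> tangent E v"
proof -
  have "frechet_derivative P (at (F_inf v)) (F_inf w) = cnj (frechet_derivative P (at v) w)" if "P \<in> E" for P
    using that E_cgrad frechet_F_inf hom hom_poly_F_inf by metis
  then show ?thesis
    by (auto simp: tangent_def)
qed

text \<open>Differentiate the homogeneity relation \<open>P (c *s x) = c ^ d * P x\<close> in
  \<open>x\<close>.\<close>

lemma tangent_scale_point:
  assumes "c \<noteq> 0"
  shows "tangent E (c *s v) = tangent E v"
proof -
  have "frechet_derivative P (at (c *s v)) w = 0 \<longleftrightarrow> frechet_derivative P (at v) w = 0" if P: "P \<in> E" for P w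
  proof -
    obtain d where d: "hom_poly F d P" using hom P by blast
    obtain g where g: "cgrad P (c *s v) g" using E_cgrad P by blast
    obtain g' where g': "cgrad P v g'" using E_cgrad P by blast
    have "bounded_linear ((*s) c :: complex^'n \<Rightarrow> complex^'n)"
      unfolding linear_conv_bounded_linear[symmetric]
      by (intro linearI) (simp_all add: vec_eq_iff algebra_simps)
    then have "((\<lambda>x. P (c *s x)) has_derivative (\<lambda>w. frechet_derivative P (at (c *s v)) (c *s w))) (at v)"
      by (intro has_derivative_compose[where g = P and f = "(*s) c", OF _ cgrad_has_derivative[OF g]] bounded_linear_imp_has_derivative)
    moreover have "((\<lambda>x. P (c *s x)) has_derivative (\<lambda>w. c ^ d * frechet_derivative P (at v) w)) (at v)"
      unfolding hom_poly_scale[OF d] by (rule has_derivative_mult_right[OF cgrad_has_derivative[OF g']])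
    ultimately have "c * frechet_derivative P (at (c *s v)) w = c ^ d * frechet_derivative P (at v) w"
      using has_derivative_unique[of "\<lambda>x. P (c *s x)"] frechet_cscale[OF g] by metis
    then show ?thesis
      using assms by (metis mult_eq_0_iff power_not_zero)
  qed
  then show ?thesis
    by (auto simp: tangent_def)
qed

text \<open>Euler's relation on the cone: an equation vanishes identically along the line through
  \<open>v\<close>.\<close>

lemma tangent_self:
  assumes "v \<in> cone E"
  shows "v \<in> tangent E v"
proof -
  have "frechet_derivative P (at v) v = 0" if P: "P \<in> E" for P
  proof -
    obtain d where d: "hom_poly F d P" using hom P by blast
    obtain g where g: "cgrad P v g" using E_cgrad P by blast
    have g1: "cgrad P (1 *s v) g" using g by simp
    have "P v = 0" using assms P by (auto simp: cone_def)
    then have z: "(\<lambda>c::complex. P (c *s v)) = (\<lambda>c. 0)"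
      unfolding hom_poly_scale[OF d] by simp
    have "bounded_linear (\<lambda>c::complex. c *s v)"
      unfolding linear_conv_bounded_linear[symmetric]
      by (intro linearI) (simp_all add: vec_eq_iff algebra_simps)
    then have "((\<lambda>c. P (c *s v)) has_derivative (\<lambda>c. frechet_derivative P (at (1 *s v)) (c *s v))) (at 1)"
      by (intro has_derivative_compose[where g = P and f = "\<lambda>c. c *s v", OF _ cgrad_has_derivative[OF g1]] bounded_linear_imp_has_derivative)
    moreover have "((\<lambda>c::complex. P (c *s v)) has_derivative (\<lambda>c. 0)) (at 1)"
      unfolding z by simp
    ultimately show ?thesis
      using has_derivative_unique by (metis vector_smult_lid)
  qed
  then show ?thesis by (auto simp: tangent_def)
qed

lemma cderiv_tangent:
  assumes "chart E U u" and "z \<in> U"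
  shows "cderiv u z \<in> tangent E (u z)"
proof -
  have "frechet_derivative P (at (u z)) (cderiv u z) = 0" if P: "P \<in> E" for P
  proof -
    obtain g where g: "cgrad P (u z) g" using E_cgrad P by blast
    have "P (u x) = 0" if "x \<in> U" for x
      using assms that P by (auto simp: chart_def cone_def)
    moreover have "open U" using assms by (simp add: chart_def)
    ultimately have "((\<lambda>z. P (u z)) has_field_derivative 0) (at z)"
      using has_field_derivative_transform_within_open[of "\<lambda>_. 0" 0 z U "\<lambda>z. P (u z)"] assms(2) by simp
    then show ?thesis
      using chart_compose_deriv[OF assms g] DERIV_unique by blast
  qed
  then show ?thesis by (auto simp: tangent_def)
qed

lemma conj_chart:
  assumes "chart E U u"
  shows "chart E (cnj ` U) (conj_chart u)"
  unfolding chart_def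
proof (intro conjI allI ballI)
  have "open U" using assms by (simp add: chart_def)
  moreover have "cnj ` U = cnj -` U"
    by (auto simp: image_iff) (metis complex_cnj_cnj)
  ultimately show "open (cnj ` U)"
    by (simp add: continuous_on_cnj open_vimage continuous_on_id)
  show "(\<lambda>z. conj_chart u z $ i) holomorphic_on cnj ` U" for i
    unfolding holomorphic_on_def field_differentiable_def
    using conj_chart_deriv[OF assms] has_field_derivative_at_within by (metis complex_cnj_cnj imageE)
  fix z assume z: "z \<in> cnj ` U"
  then have z': "cnj z \<in> U" by auto
  show "conj_chart u z \<in> cone E"
    using assms z' by (simp add: chart_def conj_chart_def cone_F_inf)
  show "cderiv (conj_chart u) z \<noteq> c *s conj_chart u z" for c
  proof
    assume "cderiv (conj_chart u) z = c *s conj_chart u z"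
    then have "F_inf (cderiv u (cnj z)) = F_inf (cnj c *s u (cnj z))"
      unfolding cderiv_conj_chart[OF assms z'] conj_chart_def F_inf_scale by simp
    then have "cderiv u (cnj z) = cnj c *s u (cnj z)"
      by (metis F_inf_F_inf)
    then show False using assms z' by (simp add: chart_def)
  qed
qed

section \<open>Forms\<close>

lemma one_formsD:
  assumes "\<omega> \<in> one_forms E D" and "v \<in> Y"
  shows "w \<in> tangent E v \<Longrightarrow> w' \<in> tangent E v \<Longrightarrow>
      \<omega> v (a *\<^sub>R w + b *\<^sub>R w') = of_real a * \<omega> v w + of_real b * \<omega> v w'"
    and "w \<in> tangent E v \<Longrightarrow> c \<noteq> 0 \<Longrightarrow> \<omega> (c *s v) (c *s w) = \<omega> v w"
    and "\<omega> v (c *s v) = 0"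
  using assms unfolding one_forms_def by blast+

lemma one_forms_outside: "\<omega> \<in> one_forms E D \<Longrightarrow> v \<notin> Y \<or> w \<notin> tangent E v \<Longrightarrow> \<omega> v w = 0"
  unfolding one_forms_def by blast

lemma one_forms_add:
  assumes "\<omega> \<in> one_forms E D" and "v \<in> Y" and "w \<in> tangent E v" "w' \<in> tangent E v"
  shows "\<omega> v (w + w') = \<omega> v w + \<omega> v w'"
  using one_formsD(1)[OF assms, of 1 1] by simp

lemma one_forms_comb:
  assumes "\<omega> \<in> one_forms E D" and "\<omega>' \<in> one_forms E D"
  shows "(\<lambda>v w. a * \<omega> v w + b * \<omega>' v w) \<in> one_forms E D"
  unfolding one_forms_def
  by (auto simp: one_formsD[OF assms(1)] one_formsD[OF assms(2)] one_forms_outside[OF assms(1)]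
      one_forms_outside[OF assms(2)] algebra_simps)

lemma pull_comb: "pull u (\<lambda>v w. a * \<omega> v w + b * \<omega>' v w) z h = a * pull u \<omega> z h + b * pull u \<omega>' z h"
  by (simp add: pull_def)

text \<open>The antilinear involution under which \<open>is_Omega\<close> requires the values of
  \<open>\<Omega>\<close> at rational words to be invariant, written as one operator on
  forms.\<close>

definition conj_inf :: "'n form \<Rightarrow> 'n form" where
  "conj_inf \<omega> = (\<lambda>v w. cnj (\<omega> (F_inf v) (F_inf w)))"

lemma one_forms_conj_inf:
  assumes "\<omega> \<in> one_forms E D"
  shows "conj_inf \<omega> \<in> one_forms E D"
proof -
  have s: "F_inf (a *\<^sub>R w + b *\<^sub>R w') = a *\<^sub>R F_inf w + b *\<^sub>R F_inf w'" for a b w w'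
    by (simp add: vec_eq_iff)
  show ?thesis
    unfolding one_forms_def conj_inf_def
    by (auto simp: s F_inf_scale one_formsD[OF assms] one_forms_outside[OF assms] Y_F_inf tangent_F_inf)
qed

lemma pull_conj_inf:
  assumes "chart E U u" and "z \<in> U"
  shows "pull u (conj_inf \<omega>) z h = cnj (pull (conj_chart u) \<omega> (cnj z) (cnj h))"
  using cderiv_conj_chart[OF assms(1), of "cnj z"] assms(2)
  by (simp add: pull_def conj_inf_def conj_chart_def F_inf_scale)

definition local_rep where
  "local_rep U u \<omega> f g \<longleftrightarrow> smooth_fun U f \<and> smooth_fun U g \<and>
     (\<forall>z\<in>U. \<forall>h. pull u \<omega> z h = f z * h + g z * cnj h)"

lemma smooth_forms_rep:
  "\<omega> \<in> smooth_forms E D \<Longrightarrow> chart E U u \<Longrightarrow> u ` U \<subseteq> Y \<Longrightarrow> \<exists>f g. local_rep U u \<omega> f g"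
  unfolding smooth_forms_def local_rep_def by blast

lemma smooth_formsI:
  assumes "\<omega> \<in> one_forms E D"
    and "\<And>U u. chart E U u \<Longrightarrow> u ` U \<subseteq> Y \<Longrightarrow> \<exists>f g. local_rep U u \<omega> f g"
  shows "\<omega> \<in> smooth_forms E D"
  using assms unfolding smooth_forms_def local_rep_def by blast

lemma smooth_forms_one: "\<omega> \<in> smooth_forms E D \<Longrightarrow> \<omega> \<in> one_forms E D"
  by (simp add: smooth_forms_def)

lemma smooth_forms_comb:
  assumes "\<omega> \<in> smooth_forms E D" and "\<omega>' \<in> smooth_forms E D"
  shows "(\<lambda>v w. a * \<omega> v w + b * \<omega>' v w) \<in> smooth_forms E D"
proof (rule smooth_formsI)
  fix U u assume u: "chart E U u" "u ` U \<subseteq> Y"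
  obtain f g f' g' where "local_rep U u \<omega> f g" "local_rep U u \<omega>' f' g'"
    using smooth_forms_rep[OF assms(1) u] smooth_forms_rep[OF assms(2) u] by blast
  then have "local_rep U u (\<lambda>v w. a * \<omega> v w + b * \<omega>' v w)
      (\<lambda>z. a * f z + b * f' z) (\<lambda>z. a * g z + b * g' z)"
    unfolding local_rep_def by (auto simp: pull_comb algebra_simps intro!: smooth_fun_comb)
  then show "\<exists>f g. local_rep U u (\<lambda>v w. a * \<omega> v w + b * \<omega>' v w) f g"
    by blast
qed (intro one_forms_comb smooth_forms_one assms)

lemma smooth_forms_conj_inf:
  assumes "\<omega> \<in> smooth_forms E D"
  shows "conj_inf \<omega> \<in> smooth_forms E D"
proof (rule smooth_formsI)
  fix U u assume u: "chart E U u" "u ` U \<subseteq> Y"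
  then have "conj_chart u ` (cnj ` U) \<subseteq> Y"
    by (auto simp: conj_chart_def Y_F_inf)
  then obtain f g where "local_rep (cnj ` U) (conj_chart u) \<omega> f g"
    using smooth_forms_rep[OF assms conj_chart] u by blast
  then have "local_rep U u (conj_inf \<omega>) (\<lambda>z. cnj (f (cnj z))) (\<lambda>z. cnj (g (cnj z)))"
    using u unfolding local_rep_def by (auto simp: pull_conj_inf intro!: smooth_fun_cnj_cnj)
  then show "\<exists>f g. local_rep U u (conj_inf \<omega>) f g"
    by blast
qed (intro one_forms_conj_inf smooth_forms_one assms)

text \<open>For \<open>f dz + g dz'\<close> the component in the real direction is
  \<open>f + g\<close> and the one in the imaginary direction is \<i> times \<open>f - g\<close>;
  the right hand side is their curl.\<close>

lemma d_coeff_eq: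
  assumes "open U" "z \<in> U" and pull: "\<And>z h. z \<in> U \<Longrightarrow> pull u \<omega> z h = f z * h + g z * cnj h"
    and f: "has_partials f z f1 f2" and g: "has_partials g z g1 g2"
  shows "d_coeff u \<omega> z = \<i> * (f1 - g1) - (f2 + g2)"
proof -
  have ev: "eventually (\<lambda>t::real. z + c * of_real t \<in> U) (nhds 0)" for c
  proof -
    have "((\<lambda>t::real. z + c * of_real t) \<longlongrightarrow> z + c * of_real 0) (nhds 0)"
      by (rule iffD1[OF tendsto_at_iff_tendsto_nhds]) (intro tendsto_intros)
    then show ?thesis
      using assms(1,2) topological_tendstoD by fastforce
  qed
  have vd: "((\<lambda>t::real. pull u \<omega> (z + c * of_real t) h) has_vector_derivative
      (of_real (Re c) * f1 + of_real (Im c) * f2) * h + (of_real (Re c) * g1 + of_real (Im c) * g2) * cnj h) (at 0)" for c h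
  proof -
    have lin: "((\<lambda>t::real. z + c * of_real t) has_derivative (\<lambda>t. c * of_real t)) (at 0)"
      by (auto intro!: derivative_eq_intros)
    have "((\<lambda>t::real. f (z + c * of_real t) * h + g (z + c * of_real t) * cnj h) has_derivative
        (\<lambda>t. (of_real (Re (c * of_real t)) * f1 + of_real (Im (c * of_real t)) * f2) * h +
             (of_real (Re (c * of_real t)) * g1 + of_real (Im (c * of_real t)) * g2) * cnj h)) (at 0)"
      by (intro has_derivative_add has_derivative_mult_left has_derivative_compose[OF lin, of f]
          has_derivative_compose[OF lin, of g]) (use f g in \<open>auto simp: has_partials_def\<close>)
    then have "((\<lambda>t::real. f (z + c * of_real t) * h + g (z + c * of_real t) * cnj h) has_vector_derivative
      (of_real (Re c) * f1 + of_real (Im c) * f2) * h + (of_real (Re c) * g1 + of_real (Im c) * g2) * cnj h) (at 0)"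
      unfolding has_vector_derivative_def
      by (rule has_derivative_eq_rhs) (simp add: fun_eq_iff scaleR_conv_of_real algebra_simps)
    then show ?thesis
      by (rule iffD1[OF has_vector_derivative_cong_ev, rotated 2])
        (use ev[of c] pull assms(2) in \<open>auto elim!: eventually_mono\<close>)
  qed
  show ?thesis
    unfolding d_coeff_def using vector_derivative_at[OF vd[of 1 \<i>]] vector_derivative_at[OF vd[of \<i> 1]]
    by (simp add: algebra_simps)
qed

lemma d_coeff_comb:
  assumes "\<omega> \<in> smooth_forms E D" and "\<omega>' \<in> smooth_forms E D" and u: "chart E U u" "u ` U \<subseteq> Y" "z \<in> U"
  shows "d_coeff u (\<lambda>v w. a * \<omega> v w + b * \<omega>' v w) z = a * d_coeff u \<omega> z + b * d_coeff u \<omega>' z"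
proof -
  have op: "open U" using u by (simp add: chart_def)
  obtain f g f' g' where *: "local_rep U u \<omega> f g" "local_rep U u \<omega>' f' g'"
    using smooth_forms_rep[OF assms(1) u(1,2)] smooth_forms_rep[OF assms(2) u(1,2)] by blast
  note D = smooth_fun_partials[OF _ u(3)]
  have sm: "smooth_fun U f" "smooth_fun U g" "smooth_fun U f'" "smooth_fun U g'"
    using * by (simp_all add: local_rep_def)
  obtain f1 f2 g1 g2 where d: "has_partials f z f1 f2" "has_partials g z g1 g2"
    using D[OF sm(1)] D[OF sm(2)] by blast
  obtain f1' f2' g1' g2' where d': "has_partials f' z f1' f2'" "has_partials g' z g1' g2'"
    using D[OF sm(3)] D[OF sm(4)] by blast
  have "d_coeff u (\<lambda>v w. a * \<omega> v w + b * \<omega>' v w) z =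
      \<i> * ((a * f1 + b * f1') - (a * g1 + b * g1')) - ((a * f2 + b * f2') + (a * g2 + b * g2'))"
    by (rule d_coeff_eq[OF op u(3) _ has_partials_comb[OF d(1) d'(1)] has_partials_comb[OF d(2) d'(2)]])
      (use * in \<open>simp add: pull_comb local_rep_def algebra_simps\<close>)
  moreover have e: "d_coeff u \<omega> z = \<i> * (f1 - g1) - (f2 + g2)"
    by (rule d_coeff_eq[OF op u(3) _ d]) (use * in \<open>simp add: local_rep_def\<close>)
  moreover have e': "d_coeff u \<omega>' z = \<i> * (f1' - g1') - (f2' + g2')"
    by (rule d_coeff_eq[OF op u(3) _ d']) (use * in \<open>simp add: local_rep_def\<close>)
  ultimately show ?thesis
    unfolding e e' by (simp add: algebra_simps)
qed

lemma closed_form_comb: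
  assumes "\<omega> \<in> smooth_forms E D" "closed_form E D \<omega>" and "\<omega>' \<in> smooth_forms E D" "closed_form E D \<omega>'"
  shows "closed_form E D (\<lambda>v w. a * \<omega> v w + b * \<omega>' v w)"
  using assms unfolding closed_form_def by (auto simp: d_coeff_comb[OF assms(1,3)])

section \<open>Exact forms and their potentials\<close>

definition potential :: "(complex^'n \<Rightarrow> complex) \<Rightarrow> 'n form \<Rightarrow> bool" where
  "potential \<Phi> \<omega> \<longleftrightarrow> (\<forall>v\<in>Y. \<forall>c. c \<noteq> 0 \<longrightarrow> \<Phi> (c *s v) = \<Phi> v) \<and>
     (\<forall>U u. chart E U u \<and> u ` U \<subseteq> Y \<longrightarrow>
        smooth_fun U (\<lambda>z. \<Phi> (u z)) \<and>
        (\<forall>z\<in>U. ((\<lambda>x. \<Phi> (u x)) has_derivative pull u \<omega> z) (at z)))"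

lemma exact_iff: "\<omega> \<in> exact_forms E D \<longleftrightarrow> \<omega> \<in> smooth_forms E D \<and> (\<exists>\<Phi>. potential \<Phi> \<omega>)"
  unfolding exact_forms_def potential_def by blast

lemma potential_comb:
  assumes "potential \<Phi> \<omega>" and "potential \<Psi> \<omega>'"
  shows "potential (\<lambda>v. a * \<Phi> v + b * \<Psi> v) (\<lambda>v w. a * \<omega> v w + b * \<omega>' v w)"
proof -
  have "((\<lambda>x. a * \<Phi> (u x) + b * \<Psi> (u x)) has_derivative
      pull u (\<lambda>v w. a * \<omega> v w + b * \<omega>' v w) z) (at z)"
    if "((\<lambda>x. \<Phi> (u x)) has_derivative pull u \<omega> z) (at z)"
      "((\<lambda>x. \<Psi> (u x)) has_derivative pull u \<omega>' z) (at z)" for u z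
    using has_derivative_add[OF has_derivative_mult_right[OF that(1), of a] has_derivative_mult_right[OF that(2), of b]]
    by (rule has_derivative_eq_rhs) (simp add: fun_eq_iff pull_comb)
  with assms show ?thesis
    unfolding potential_def by (auto intro!: smooth_fun_comb)
qed

lemma exact_comb:
  assumes "\<omega> \<in> exact_forms E D" and "\<omega>' \<in> exact_forms E D"
  shows "(\<lambda>v w. a * \<omega> v w + b * \<omega>' v w) \<in> exact_forms E D"
  using assms potential_comb smooth_forms_comb unfolding exact_iff by blast

lemma potential_conj_inf:
  assumes "potential \<Phi> \<omega>"
  shows "potential (\<lambda>v. cnj (\<Phi> (F_inf v))) (conj_inf \<omega>)"
  unfolding potential_def
proof (intro conjI allI impI ballI)
  show "cnj (\<Phi> (F_inf (c *s v))) = cnj (\<Phi> (F_inf v))" if "v \<in> Y" "c \<noteq> 0" for v c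
    using assms that by (simp add: potential_def F_inf_scale Y_F_inf)
  fix U u assume u: "chart E U u \<and> u ` U \<subseteq> Y"
  then have u': "chart E (cnj ` U) (conj_chart u) \<and> conj_chart u ` (cnj ` U) \<subseteq> Y"
    by (auto simp: conj_chart conj_chart_def Y_F_inf)
  have eq: "(\<lambda>z. cnj (\<Phi> (F_inf (u z)))) = (\<lambda>z. cnj (\<Phi> (conj_chart u (cnj z))))"
    by (simp add: conj_chart_def)
  show "smooth_fun U (\<lambda>z. cnj (\<Phi> (F_inf (u z))))"
    unfolding eq by (rule smooth_fun_cnj_cnj) (use assms u' in \<open>simp add: potential_def\<close>)
  show "((\<lambda>z. cnj (\<Phi> (F_inf (u z)))) has_derivative pull u (conj_inf \<omega>) z) (at z)" if z: "z \<in> U" for z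
  proof -
    have "((\<lambda>x. \<Phi> (conj_chart u x)) has_derivative pull (conj_chart u) \<omega> (cnj z)) (at (cnj z))"
      using assms u' z unfolding potential_def by blast
    from has_derivative_cnj_cnj[OF this] show ?thesis
      unfolding eq by (rule has_derivative_eq_rhs) (simp add: fun_eq_iff pull_conj_inf[OF conjunct1[OF u] z])
  qed
qed

lemma exact_conj_inf: "\<omega> \<in> exact_forms E D \<Longrightarrow> conj_inf \<omega> \<in> exact_forms E D"
  using potential_conj_inf smooth_forms_conj_inf unfolding exact_iff by blast

end

section \<open>De Rham classes\<close>

context curve
begin

section \<open>Algebraic forms in charts and their reality\<close>

lemma chart_poly_holomorphic:
  assumes "chart E U u" and "cpoly P"
  shows "(\<lambda>z. P (u z)) holomorphic_on U"
proof -
  have "(\<lambda>z. P (u z)) field_differentiable at z" if "z \<in> U" for z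
  proof -
    obtain g where "cgrad P (u z) g" using cpoly_cgrad[OF assms(2)] by blast
    from chart_compose_deriv[OF assms(1) that this] show ?thesis
      unfolding field_differentiable_def by blast
  qed
  then show ?thesis
    unfolding holomorphic_on_def using field_differentiable_at_within by blast
qed

text \<open>Forms without poles on \<open>X\<close>, including at the points of \<open>D\<close>.\<close>

definition regular_rep where
  "regular_rep U u z0 \<omega> \<phi> W \<longleftrightarrow> open W \<and> z0 \<in> W \<and> W \<subseteq> U \<and> \<phi> holomorphic_on W \<and>
     (\<forall>z\<in>W. u z \<in> Y \<longrightarrow> (\<forall>h. pull u \<omega> z h = \<phi> z * h))"

definition regular_form :: "'n form \<Rightarrow> bool" where
  "regular_form \<omega> \<longleftrightarrow>
     (\<forall>U u z0. chart E U u \<longrightarrow> z0 \<in> U \<longrightarrow> (\<exists>\<phi> W. regular_rep U u z0 \<omega> \<phi> W))"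

text \<open>Pulling back \<open>g dh\<close> gives \<open>g\<close> composed with the chart times
  the differential of \<open>h\<close> composed with the chart, which is holomorphic where the
  common denominator does not vanish. That denominator is chosen at \<open>u z0\<close>, which may
  be a point of \<open>D\<close> when \<open>V\<close> is the full cone.\<close>

lemma algebraic_pull:
  assumes "\<omega> \<in> algebraic_forms F E D V" and u: "chart E U u" and z0: "z0 \<in> U" "u z0 \<in> V"
  shows "\<exists>\<phi> W. regular_rep U u z0 \<omega> \<phi> W"
proof -
  obtain d N and k :: nat and P R where N: "hom_poly F d N" "N (u z0) \<noteq> 0"
    and PR: "\<forall>i<k. hom_poly F d (P i) \<and> hom_poly F d (R i)"
    and eq: "\<forall>x\<in>Y. N x \<noteq> 0 \<longrightarrow> (\<forall>w\<in>tangent E x.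
          \<omega> x w = (\<Sum>i<k. P i x / N x * frechet_derivative (\<lambda>y. R i y / N y) (at x) w))"
    using assms(1) z0(2) unfolding algebraic_forms_def by blast
  define W where "W = U \<inter> (\<lambda>z. N (u z)) -` (- {0})"
  have opU: "open U" using u by (simp add: chart_def)
  have hN: "(\<lambda>z. N (u z)) holomorphic_on U"
    by (intro chart_poly_holomorphic[OF u] hom_poly_cpoly[OF N(1)])
  have opW: "open W"
    unfolding W_def by (intro continuous_open_preimage holomorphic_on_imp_continuous_on hN opU) auto
  have WU: "W \<subseteq> U" and z0W: "z0 \<in> W"
    using z0 N by (auto simp: W_def)
  have hNW: "(\<lambda>z. N (u z)) holomorphic_on W"
    using hN WU holomorphic_on_subset by blast
  have hPR: "(\<lambda>z. P i (u z)) holomorphic_on W" "(\<lambda>z. R i (u z)) holomorphic_on W" if "i < k" for i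
    using PR that WU by (auto intro!: holomorphic_on_subset[OF chart_poly_holomorphic[OF u]] hom_poly_cpoly)
  have NW: "N (u z) \<noteq> 0" if "z \<in> W" for z
    using that by (simp add: W_def)
  define \<phi> where "\<phi> z = (\<Sum>i<k. P i (u z) / N (u z) * deriv (\<lambda>z. R i (u z) / N (u z)) z)" for z
  have "\<phi> holomorphic_on W"
    unfolding \<phi>_def
    by (intro holomorphic_on_sum holomorphic_on_mult holomorphic_on_divide holomorphic_deriv hNW opW hPR NW) auto
  moreover have "pull u \<omega> z h = \<phi> z * h" if z: "z \<in> W" and uz: "u z \<in> Y" for z h
  proof -
    have zU: "z \<in> U" using z WU by blast
    have "h *s cderiv u z \<in> tangent E (u z)"
      by (intro tangent_cscale cderiv_tangent[OF u zU])
    then have "pull u \<omega> z h = (\<Sum>i<k. P i (u z) / N (u z) *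
        frechet_derivative (\<lambda>y. R i y / N y) (at (u z)) (h *s cderiv u z))"
      unfolding pull_def using eq uz NW[OF z] by blast
    also have "\<dots> = (\<Sum>i<k. P i (u z) / N (u z) * deriv (\<lambda>z. R i (u z) / N (u z)) z * h)"
    proof (rule sum.cong[OF refl])
      fix i assume "i \<in> {..<k}"
      then obtain g g' where gg: "cgrad (R i) (u z) g" "cgrad N (u z) g'"
        using PR N hom_poly_cpoly cpoly_cgrad by (metis lessThan_iff)
      from cgrad_mult[OF gg(1) cgrad_inverse[OF gg(2) NW[OF z]]]
      obtain g'' where g'': "cgrad (\<lambda>y. R i y / N y) (u z) g''"
        unfolding divide_inverse by blast
      show "P i (u z) / N (u z) * frechet_derivative (\<lambda>y. R i y / N y) (at (u z)) (h *s cderiv u z) =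
          P i (u z) / N (u z) * deriv (\<lambda>z. R i (u z) / N (u z)) z * h"
        using DERIV_imp_deriv[OF chart_compose_deriv[OF u zU g'']] by (simp add: frechet_cscale[OF g''])
    qed
    finally show ?thesis
      by (simp add: \<phi>_def sum_distrib_right)
  qed
  ultimately have "regular_rep U u z0 \<omega> \<phi> W"
    using opW z0W WU by (simp add: regular_rep_def)
  then show ?thesis by blast
qed

lemma algebraic_mono: "V \<subseteq> V' \<Longrightarrow> algebraic_forms F E D V' \<subseteq> algebraic_forms F E D V"
  unfolding algebraic_forms_def by blast

lemma algebraic_one: "\<omega> \<in> algebraic_forms F E D V \<Longrightarrow> \<omega> \<in> one_forms E D"
  by (simp add: algebraic_forms_def)

text \<open>The local coefficients glue because each of them is the value of the form at
  \<open>h = 1\<close>.\<close>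

lemma algebraic_chart:
  assumes "\<omega> \<in> algebraic_forms F E D Y" and u: "chart E U u" "u ` U \<subseteq> Y"
  obtains \<phi> where "\<phi> holomorphic_on U" "\<And>z h. z \<in> U \<Longrightarrow> pull u \<omega> z h = \<phi> z * h"
proof
  have opU: "open U" using u by (simp add: chart_def)
  have loc: "\<exists>\<phi> W. regular_rep U u z0 \<omega> \<phi> W" if "z0 \<in> U" for z0
    using algebraic_pull[OF assms(1) u(1) that] u(2) that by blast
  have rep: "pull u \<omega> z h = \<phi> z * h" if "regular_rep U u z0 \<omega> \<phi> W" "z \<in> W" for z0 \<phi> W z h
    using that u(2) unfolding regular_rep_def by blast
  show "pull u \<omega> z h = pull u \<omega> z 1 * h" if z: "z \<in> U" for z h
  proof -
    obtain \<phi> W where W: "regular_rep U u z \<omega> \<phi> W" using loc[OF z] by blast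
    then have "z \<in> W" by (simp add: regular_rep_def)
    then show ?thesis using rep[OF W] by simp
  qed
  show "(\<lambda>z. pull u \<omega> z 1) holomorphic_on U"
    unfolding holomorphic_on_open[OF opU]
  proof
    fix z0 assume "z0 \<in> U"
    then obtain \<phi> W where R: "regular_rep U u z0 \<omega> \<phi> W"
      using loc by blast
    then have W: "open W" "z0 \<in> W" "\<phi> holomorphic_on W" "\<And>z. z \<in> W \<Longrightarrow> pull u \<omega> z 1 = \<phi> z"
      using rep[OF R] by (simp_all add: regular_rep_def)
    have "((\<lambda>z. pull u \<omega> z 1) has_field_derivative deriv \<phi> z0) (at z0)"
      by (rule has_field_derivative_transform_within_open[OF holomorphic_derivI[OF W(3,1,2)] W(1,2)])
        (simp add: W)
    then show "\<exists>f'. ((\<lambda>z. pull u \<omega> z 1) has_field_derivative f') (at z0)" ..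
  qed
qed

lemma algebraic_smooth:
  assumes "\<omega> \<in> algebraic_forms F E D Y"
  shows "\<omega> \<in> smooth_forms E D"
proof (rule smooth_formsI)
  fix U u assume u: "chart E U u" "u ` U \<subseteq> Y"
  then have opU: "open U" by (simp add: chart_def)
  obtain \<phi> where "\<phi> holomorphic_on U" "\<And>z h. z \<in> U \<Longrightarrow> pull u \<omega> z h = \<phi> z * h"
    using algebraic_chart[OF assms u] by blast
  then have "local_rep U u \<omega> \<phi> (\<lambda>z. 0)"
    unfolding local_rep_def by (auto intro: smooth_fun_holomorphic opU)
  then show "\<exists>f g. local_rep U u \<omega> f g" by blast
qed (rule algebraic_one[OF assms])

text \<open>For a holomorphic coefficient of \<open>dz\<close> closedness is the Cauchy-Riemann
  equation.\<close>

lemma algebraic_closed: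
  assumes "\<omega> \<in> algebraic_forms F E D Y"
  shows "closed_form E D \<omega>"
  unfolding closed_form_def
proof (intro allI impI ballI)
  fix U u z assume u: "chart E U u \<and> u ` U \<subseteq> Y" and z: "z \<in> U"
  then have opU: "open U" by (simp add: chart_def)
  obtain \<phi> where \<phi>: "\<phi> holomorphic_on U" "\<And>z h. z \<in> U \<Longrightarrow> pull u \<omega> z h = \<phi> z * h"
    using algebraic_chart[OF assms] u by blast
  have "(\<phi> has_derivative (\<lambda>h. deriv \<phi> z * h)) (at z)"
    using holomorphic_derivI[OF \<phi>(1) opU z] by (simp add: has_field_derivative_def)
  then have "has_partials \<phi> z (deriv \<phi> z) (\<i> * deriv \<phi> z)"
    unfolding has_partials_def
  proof (rule has_derivative_eq_rhs, intro ext)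
    show "deriv \<phi> z * h = of_real (Re h) * deriv \<phi> z + of_real (Im h) * (\<i> * deriv \<phi> z)" for h
      by (subst complex_eq[of h]) (simp add: algebra_simps)
  qed
  moreover have "has_partials (\<lambda>z. 0) z 0 0"
    by (simp add: has_partials_def)
  ultimately have "d_coeff u \<omega> z = \<i> * (deriv \<phi> z - 0) - (\<i> * deriv \<phi> z + 0)"
    by (intro d_coeff_eq[OF opU z]) (simp_all add: \<phi>)
  then show "d_coeff u \<omega> z = 0" by simp
qed

text \<open>Numerators and denominators have real coefficients, so they and their differentials are
  compatible with complex conjugation.\<close>

lemma algebraic_conj_inf:
  assumes "\<omega> \<in> algebraic_forms F E D Y"
  shows "conj_inf \<omega> = \<omega>"
proof (intro ext)
  fix x w
  show "conj_inf \<omega> x w = \<omega> x w"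
  proof (cases "x \<in> Y \<and> w \<in> tangent E x")
    case False
    then show ?thesis
      using one_forms_outside[OF algebraic_one[OF assms]]
      by (simp add: conj_inf_def Y_F_inf tangent_F_inf)
  next
    case True
    obtain d N and k :: nat and P R where N: "hom_poly F d N" "N x \<noteq> 0"
      and PR: "\<forall>i<k. hom_poly F d (P i) \<and> hom_poly F d (R i)"
      and eq: "\<forall>x\<in>Y. N x \<noteq> 0 \<longrightarrow> (\<forall>w\<in>tangent E x.
          \<omega> x w = (\<Sum>i<k. P i x / N x * frechet_derivative (\<lambda>y. R i y / N y) (at x) w))"
      using assms True unfolding algebraic_forms_def by blast
    have Nc: "N (F_inf y) = cnj (N y)" for y
      by (rule hom_poly_F_inf[OF N(1)])
    have "\<omega> (F_inf x) (F_inf w) =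
        (\<Sum>i<k. P i (F_inf x) / N (F_inf x) * frechet_derivative (\<lambda>y. R i y / N y) (at (F_inf x)) (F_inf w))"
      using eq True N(2) Nc by (simp add: Y_F_inf tangent_F_inf)
    also have "\<dots> = (\<Sum>i<k. cnj (P i x / N x * frechet_derivative (\<lambda>y. R i y / N y) (at x) w))"
    proof (rule sum.cong[OF refl])
      fix i assume i: "i \<in> {..<k}"
      then obtain g g' where gg: "cgrad (R i) x g" "cgrad N x g'"
        using PR N hom_poly_cpoly cpoly_cgrad by (metis lessThan_iff)
      from cgrad_mult[OF gg(1) cgrad_inverse[OF gg(2) N(2)]]
      obtain g'' where g'': "cgrad (\<lambda>y. R i y / N y) x g''"
        unfolding divide_inverse by blast
      have "P i (F_inf y) = cnj (P i y)" "R i (F_inf y) = cnj (R i y)" for y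
        using PR i hom_poly_F_inf by blast+
      then show "P i (F_inf x) / N (F_inf x) * frechet_derivative (\<lambda>y. R i y / N y) (at (F_inf x)) (F_inf w) =
          cnj (P i x / N x * frechet_derivative (\<lambda>y. R i y / N y) (at x) w)"
        using frechet_F_inf[OF g''] Nc by simp
    qed
    also have "\<dots> = cnj (\<omega> x w)"
      using eq True N(2) by simp
    finally show ?thesis
      by (simp add: conj_inf_def)
  qed
qed

lemma conj_inf_form_sum: "conj_inf (form_sum A k) = form_sum A (\<lambda>\<omega>. cnj (k \<omega>))"
  if "\<And>\<omega>. \<omega> \<in> A \<Longrightarrow> conj_inf \<omega> = \<omega>"
proof (intro ext)
  fix v w
  have "cnj (\<omega> (F_inf v) (F_inf w)) = \<omega> v w" if "\<omega> \<in> A" for \<omega>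
    using fun_cong[OF fun_cong[OF \<open>\<And>\<omega>. \<omega> \<in> A \<Longrightarrow> conj_inf \<omega> = \<omega>\<close>[OF that], of v], of w]
    by (simp add: conj_inf_def)
  then show "conj_inf (form_sum A k) v w = form_sum A (\<lambda>\<omega>. cnj (k \<omega>)) v w"
    by (simp add: conj_inf_def form_sum_def)
qed

lemma real_span_conj_inf:
  assumes "\<eta> \<in> lin_span \<real> (algebraic_forms F E D Y)"
  shows "conj_inf \<eta> = \<eta>"
proof -
  obtain A k where A: "\<eta> = form_sum A k" "A \<subseteq> algebraic_forms F E D Y" "\<forall>\<omega>\<in>A. k \<omega> \<in> \<real>"
    using assms unfolding lin_span_def by blast
  have "conj_inf \<eta> = form_sum A (\<lambda>\<omega>. cnj (k \<omega>))"
    unfolding A(1) by (rule conj_inf_form_sum) (use A algebraic_conj_inf in blast)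
  also have "\<dots> = \<eta>"
    unfolding A(1) form_sum_def using A(3) by (intro ext sum.cong) (auto simp: Reals_cnj_iff)
  finally show ?thesis .
qed

section \<open>The linear structure of de Rham classes\<close>

lemma one_forms_zero: "zero_form \<in> one_forms E D"
  by (simp add: one_forms_def zero_form_def)

lemma exact_zero: "zero_form \<in> exact_forms E D"
proof -
  have "smooth_fun U (\<lambda>z. 0)" for U
    unfolding smooth_fun_def by (intro exI[of _ "\<lambda>i j z. 0"]) simp
  then have "zero_form \<in> smooth_forms E D" "potential (\<lambda>v. 0) zero_form"
    unfolding smooth_forms_def potential_def using one_forms_zero
    by (auto simp: pull_def[abs_def] zero_form_def intro!: exI[of _ "\<lambda>z. 0"])
  then show ?thesis
    unfolding exact_iff by blast
qed

lemma smooth_zero: "zero_form \<in> smooth_forms E D"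
  using exact_zero exact_iff by blast

lemma closed_zero: "closed_form E D zero_form"
  by (simp add: closed_form_def d_coeff_def pull_def zero_form_def)

lemma cohomologous_refl: "cohomologous E D \<omega> \<omega>"
  using exact_zero by (simp add: cohomologous_def zero_form_def)

lemma lin_span_comb:
  assumes "\<eta> \<in> lin_span UNIV S" and "\<eta>' \<in> lin_span UNIV S"
  shows "(\<lambda>v w. a * \<eta> v w + b * \<eta>' v w) \<in> lin_span UNIV S"
proof -
  obtain A k A' k' where A: "\<eta> = form_sum A k" "finite A" "A \<subseteq> S" "\<eta>' = form_sum A' k'" "finite A'" "A' \<subseteq> S"
    using assms unfolding lin_span_def by blast
  define m where "m \<omega> = a * (if \<omega> \<in> A then k \<omega> else 0) + b * (if \<omega> \<in> A' then k' \<omega> else 0)" for \<omega>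
  have "(\<Sum>\<omega>\<in>A \<union> A'. (if \<omega> \<in> A then k \<omega> else 0) * \<omega> v w) = (\<Sum>\<omega>\<in>A. k \<omega> * \<omega> v w)" for v w
    using A by (intro sum.mono_neutral_cong_right) auto
  moreover have "(\<Sum>\<omega>\<in>A \<union> A'. (if \<omega> \<in> A' then k' \<omega> else 0) * \<omega> v w) = (\<Sum>\<omega>\<in>A'. k' \<omega> * \<omega> v w)" for v w
    using A by (intro sum.mono_neutral_cong_right) auto
  ultimately have "(\<lambda>v w. a * \<eta> v w + b * \<eta>' v w) = form_sum (A \<union> A') m"
    unfolding A(1,4) form_sum_def m_def
    by (simp add: distrib_right sum.distrib mult.assoc flip: sum_distrib_left)
  then show ?thesis
    unfolding lin_span_def using A by blast
qed

lemma dR_smooth: "\<omega> \<in> dR K F E D \<Longrightarrow> \<omega> \<in> smooth_forms E D"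
  and dR_closed: "\<omega> \<in> dR K F E D \<Longrightarrow> closed_form E D \<omega>"
  by (simp_all add: dR_def)

lemma dR_comb:
  assumes "\<omega> \<in> dR_C F E D" and "\<omega>' \<in> dR_C F E D"
  shows "(\<lambda>v w. a * \<omega> v w + b * \<omega>' v w) \<in> dR_C F E D"
proof -
  obtain \<eta> \<eta>' where \<eta>: "\<eta> \<in> lin_span UNIV (algebraic_forms F E D Y)" "cohomologous E D \<omega> \<eta>"
    "\<eta>' \<in> lin_span UNIV (algebraic_forms F E D Y)" "cohomologous E D \<omega>' \<eta>'"
    using assms unfolding dR_def by blast
  have "cohomologous E D (\<lambda>v w. a * \<omega> v w + b * \<omega>' v w) (\<lambda>v w. a * \<eta> v w + b * \<eta>' v w)"
    using exact_comb[OF \<eta>(2,4)[unfolded cohomologous_def], of a b]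
    by (simp add: cohomologous_def algebra_simps)
  then show ?thesis
    unfolding dR_def using lin_span_comb[OF \<eta>(1,3)]
    by (auto intro!: smooth_forms_comb closed_form_comb dR_smooth[OF assms(1)] dR_smooth[OF assms(2)]
        dR_closed[OF assms(1)] dR_closed[OF assms(2)])
qed

lemma dR_mono: "K \<subseteq> K' \<Longrightarrow> dR K F E D \<subseteq> dR K' F E D"
  unfolding dR_def lin_span_def by blast

lemma algebraic_dR:
  assumes "\<omega> \<in> algebraic_forms F E D Y" and "1 \<in> K"
  shows "\<omega> \<in> dR K F E D"
proof -
  have "\<omega> = form_sum {\<omega>} (\<lambda>_. 1)"
    by (simp add: form_sum_def)
  then have "\<omega> \<in> lin_span K (algebraic_forms F E D Y)"
    unfolding lin_span_def using assms by blast
  then show ?thesis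
    unfolding dR_def using assms algebraic_smooth algebraic_closed cohomologous_refl by blast
qed

lemma zero_dR: "zero_form \<in> dR_C F E D"
proof -
  have "zero_form = form_sum {} (\<lambda>_. 0)"
    by (simp add: form_sum_def zero_form_def)
  then have "zero_form \<in> lin_span UNIV (algebraic_forms F E D Y)"
    unfolding lin_span_def by blast
  then show ?thesis
    unfolding dR_def using smooth_zero closed_zero cohomologous_refl by blast
qed

lemma class_linear_form_sum:
  assumes "class_linear F E D g" and "finite A" and "A \<subseteq> dR_C F E D"
  shows "form_sum A k \<in> dR_C F E D \<and> g (form_sum A k) = (\<Sum>\<omega>\<in>A. k \<omega> * g \<omega>)"
  using assms(2,3)
proof (induction A)
  case empty
  have "g (\<lambda>v w. 0 * zero_form v w + 0 * zero_form v w) = 0"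
    using assms(1) zero_dR by (simp only: class_linear_def) simp
  moreover have "(\<lambda>v w. 0 * zero_form v w + 0 * zero_form v w) = form_sum {} k"
    by (simp add: form_sum_def)
  moreover have "form_sum {} k = zero_form"
    by (simp add: form_sum_def zero_form_def)
  ultimately show ?case
    using zero_dR by simp
next
  case (insert \<omega> A)
  have eq: "form_sum (insert \<omega> A) k = (\<lambda>v w. k \<omega> * \<omega> v w + 1 * form_sum A k v w)"
    using insert.hyps by (simp add: form_sum_def)
  have mem: "\<omega> \<in> dR_C F E D" "form_sum A k \<in> dR_C F E D"
    using insert by auto
  have "g (\<lambda>v w. k \<omega> * \<omega> v w + 1 * form_sum A k v w) = k \<omega> * g \<omega> + 1 * g (form_sum A k)"
    using assms(1) mem unfolding class_linear_def by blast
  then show ?case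
    unfolding eq using dR_comb[OF mem, of "k \<omega>" 1] insert by simp
qed

lemma class_linear_cohomologous:
  assumes "class_linear F E D g" and "\<omega> \<in> dR_C F E D" "\<omega>' \<in> dR_C F E D" and "cohomologous E D \<omega> \<omega>'"
  shows "g \<omega> = g \<omega>'"
proof -
  have "g (\<lambda>v w. 1 * \<omega> v w + (-1) * \<omega>' v w) = 1 * g \<omega> + (-1) * g \<omega>'"
    using assms(1-3) unfolding class_linear_def by blast
  moreover have "g (\<lambda>v w. 1 * \<omega> v w + (-1) * \<omega>' v w) = 0"
    using assms(1,4) unfolding class_linear_def cohomologous_def by simp
  ultimately show ?thesis by simp
qed

text \<open>A complex class is represented by a complex combination of algebraic forms, and each of
  those is a real class, hence a real combination of \<open>B\<close> up to exact forms.\<close>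

lemma real_basis_spans_classes:
  assumes "real_basis_mod (exact_forms E D) (dR_R F E D) B"
  shows "spans_classes F E D B"
  unfolding spans_classes_def
proof (intro allI impI)
  fix g \<omega> assume g: "class_linear F E D g" and B: "\<forall>\<beta>\<in>B. g \<beta> = 0"
  have RC: "dR_R F E D \<subseteq> dR_C F E D"
    by (rule dR_mono) simp
  have finB: "finite B" and BR: "B \<subseteq> dR_R F E D"
    using assms by (auto simp: real_basis_mod_def)
  have real: "g \<omega> = 0" if \<omega>: "\<omega> \<in> dR_R F E D" for \<omega>
  proof -
    obtain k where "(\<lambda>v w. \<omega> v w - form_sum B k v w) \<in> exact_forms E D"
      using assms \<omega> unfolding real_basis_mod_def by blast
    then have "g \<omega> = g (form_sum B k)"
      using class_linear_form_sum[OF g finB] BR RC \<omega>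
      by (intro class_linear_cohomologous[OF g]) (auto simp: cohomologous_def)
    also have "\<dots> = 0"
      using class_linear_form_sum[OF g finB, of k] BR RC B by auto
    finally show ?thesis .
  qed
  show "g \<omega> = 0"
  proof (cases "\<omega> \<in> dR_C F E D")
    case False
    then show ?thesis using g by (simp add: class_linear_def)
  next
    case True
    then obtain A k where A: "finite A" "A \<subseteq> algebraic_forms F E D Y" "cohomologous E D \<omega> (form_sum A k)"
      unfolding dR_def lin_span_def by blast
    have AR: "A \<subseteq> dR_R F E D"
      using A(2) algebraic_dR by auto
    note S = class_linear_form_sum[OF g A(1) order_trans[OF AR RC], of k]
    have "g \<omega> = g (form_sum A k)"
      using S by (intro class_linear_cohomologous[OF g True _ A(3)]) simp
    also have "\<dots> = (\<Sum>\<omega>\<in>A. k \<omega> * g \<omega>)"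
      using S by simp
    also have "\<dots> = 0"
      using AR real by (intro sum.neutral) auto
    finally show ?thesis .
  qed
qed

text \<open>A real class differs by an exact form from a representative that \<open>conj_inf\<close>
  fixes, and \<open>conj_inf\<close> preserves exactness.\<close>

lemma dR_R_conj_inf:
  assumes "\<omega> \<in> dR_R F E D"
  shows "(\<lambda>v w. conj_inf \<omega> v w - \<omega> v w) \<in> exact_forms E D"
proof -
  obtain \<eta> where \<eta>: "\<eta> \<in> lin_span \<real> (algebraic_forms F E D Y)" "(\<lambda>v w. \<omega> v w - \<eta> v w) \<in> exact_forms E D"
    using assms unfolding dR_def cohomologous_def by blast
  have "cnj (\<eta> (F_inf v) (F_inf w)) = \<eta> v w" for v w
    using fun_cong[OF fun_cong[OF real_span_conj_inf[OF \<eta>(1)], of v], of w] by (simp add: conj_inf_def)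
  then show ?thesis
    using exact_comb[OF exact_conj_inf[OF \<eta>(2)] \<eta>(2), of 1 "-1"] by (simp add: conj_inf_def)
qed

lemma exact_sum:
  assumes "finite B" and "\<And>\<beta>. \<beta> \<in> B \<Longrightarrow> f \<beta> \<in> exact_forms E D"
  shows "(\<lambda>v w. \<Sum>\<beta>\<in>B. c \<beta> * f \<beta> v w) \<in> exact_forms E D"
  using assms
proof (induction B)
  case empty
  then show ?case using exact_zero by (simp add: zero_form_def)
next
  case (insert \<beta> B)
  then have "(\<lambda>v w. c \<beta> * f \<beta> v w + 1 * (\<Sum>\<beta>\<in>B. c \<beta> * f \<beta> v w)) \<in> exact_forms E D"
    by (intro exact_comb) auto
  then show ?case using insert.hyps by simp
qed

text \<open>
  The antilinear involution \<open>conj_inf\<close> fixes real classes, so the real and imaginary parts of a complex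
  relation are relations.
\<close>

lemma real_basis_complex_independent:
  assumes B: "real_basis_mod (exact_forms E D) (dR_R F E D) B" and k: "form_sum B k \<in> exact_forms E D"
  shows "\<forall>\<beta>\<in>B. k \<beta> = 0"
proof -
  have fin: "finite B" and BR: "B \<subseteq> dR_R F E D"
    and ind: "\<And>k. (\<forall>\<beta>\<in>B. k \<beta> \<in> \<real>) \<Longrightarrow> form_sum B k \<in> exact_forms E D \<Longrightarrow> \<forall>\<beta>\<in>B. k \<beta> = 0"
    using B by (auto simp: real_basis_mod_def)
  \<comment> \<open>Replaces the conjugated basis forms by the basis forms themselves, so that
    conjugating a relation conjugates just its coefficients.\<close>
  have "(\<lambda>v w. \<Sum>\<beta>\<in>B. cnj (k \<beta>) * (conj_inf \<beta> v w - \<beta> v w)) \<in> exact_forms E D"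
    using BR dR_R_conj_inf by (intro exact_sum[OF fin, where f = "\<lambda>\<beta> v w. conj_inf \<beta> v w - \<beta> v w"]) auto
  from exact_comb[OF exact_conj_inf[OF k] this, of 1 "-1"]
  have c: "form_sum B (\<lambda>\<beta>. cnj (k \<beta>)) \<in> exact_forms E D"
    by (simp add: conj_inf_def form_sum_def algebra_simps sum_subtractf)
  have ab: "form_sum B (\<lambda>\<beta>. a * k \<beta> + b * cnj (k \<beta>)) \<in> exact_forms E D" for a b
    using exact_comb[OF k c, of a b]
    by (simp add: form_sum_def sum_distrib_left sum.distrib distrib_right mult.assoc)
  have eq: "(\<lambda>\<beta>. 1/2 * k \<beta> + 1/2 * cnj (k \<beta>)) = (\<lambda>\<beta>. of_real (Re (k \<beta>)))"
    by (simp add: fun_eq_iff complex_eq_iff)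
  have Re: "form_sum B (\<lambda>\<beta>. of_real (Re (k \<beta>))) \<in> exact_forms E D"
    using ab[of "1/2" "1/2"] unfolding eq .
  have re: "\<forall>\<beta>\<in>B. complex_of_real (Re (k \<beta>)) = 0"
    by (rule ind[OF _ Re]) simp
  have eq: "(\<lambda>\<beta>. (-\<i>/2) * k \<beta> + \<i>/2 * cnj (k \<beta>)) = (\<lambda>\<beta>. of_real (Im (k \<beta>)))"
    by (simp add: fun_eq_iff complex_eq_iff)
  have Im: "form_sum B (\<lambda>\<beta>. of_real (Im (k \<beta>))) \<in> exact_forms E D"
    using ab[of "-\<i>/2" "\<i>/2"] unfolding eq .
  have "\<forall>\<beta>\<in>B. complex_of_real (Im (k \<beta>)) = 0"
    by (rule ind[OF _ Im]) simp
  then show ?thesis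
    using re by (simp add: complex_eq_iff)
qed

section \<open>Regular forms and the basis of holomorphic forms\<close>

lemma regular_comb:
  assumes "regular_form \<omega>" and "regular_form \<omega>'"
  shows "regular_form (\<lambda>v w. a * \<omega> v w + b * \<omega>' v w)"
  unfolding regular_form_def
proof (intro allI impI)
  fix U u z0 assume u: "chart E U u" "z0 \<in> U"
  obtain \<phi> W \<phi>' W' where "regular_rep U u z0 \<omega> \<phi> W" "regular_rep U u z0 \<omega>' \<phi>' W'"
    using assms u unfolding regular_form_def by meson
  then have "regular_rep U u z0 (\<lambda>v w. a * \<omega> v w + b * \<omega>' v w) (\<lambda>z. a * \<phi> z + b * \<phi>' z) (W \<inter> W')"
    unfolding regular_rep_def
    by (auto simp: pull_comb algebra_simps intro!: holomorphic_intros elim: holomorphic_on_subset)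
  then show "\<exists>\<phi> W. regular_rep U u z0 (\<lambda>v w. a * \<omega> v w + b * \<omega>' v w) \<phi> W"
    by blast
qed

lemma regular_zero: "regular_form zero_form"
proof -
  have "regular_rep U u z0 zero_form (\<lambda>z. 0) U" if "chart E U u" "z0 \<in> U" for U u z0
    using that by (auto simp: regular_rep_def pull_def zero_form_def chart_def)
  then show ?thesis
    unfolding regular_form_def by blast
qed

lemma regular_span:
  assumes "\<omega> \<in> lin_span K (algebraic_forms F E D (cone E))"
  shows "regular_form \<omega>"
proof -
  obtain A k where A: "\<omega> = form_sum A k" "finite A" "A \<subseteq> algebraic_forms F E D (cone E)"
    using assms unfolding lin_span_def by blast
  have reg: "regular_form \<alpha>" if "\<alpha> \<in> A" for \<alpha>
    unfolding regular_form_def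
    using A(3) that algebraic_pull[of \<alpha> "cone E"] by (auto simp: chart_def)
  have "regular_form (form_sum A k)"
    using A(2) reg
  proof (induction A)
    case empty
    then show ?case
      using regular_zero by (simp add: form_sum_def zero_form_def)
  next
    case (insert \<alpha> A)
    have "form_sum (insert \<alpha> A) k = (\<lambda>v w. k \<alpha> * \<alpha> v w + 1 * form_sum A k v w)"
      using insert.hyps by (simp add: form_sum_def)
    moreover have "regular_form (\<lambda>v w. k \<alpha> * \<alpha> v w + 1 * form_sum A k v w)"
      by (intro regular_comb) (use insert in auto)
    ultimately show ?case by simp
  qed
  then show ?thesis by (simp add: A)
qed

text \<open>Elements of \<open>Bh\<close> lie in the real span as forms and not only as classes. So
  \<open>conj_inf\<close> fixes them exactly, which is what iterated integrals require: these are
  not determined by classes.\<close>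

lemma real_basis_holomorphic:
  assumes "real_basis_mod {zero_form} (lin_span \<real> (algebraic_forms F E D (cone E))) Bh" and "\<omega> \<in> Bh"
  shows "regular_form \<omega>" and "conj_inf \<omega> = \<omega>"
proof -
  have *: "\<omega> \<in> lin_span \<real> (algebraic_forms F E D (cone E))"
    using assms by (auto simp: real_basis_mod_def)
  then show "regular_form \<omega>" by (rule regular_span)
  have "algebraic_forms F E D (cone E) \<subseteq> algebraic_forms F E D Y"
    by (rule algebraic_mono) (auto simp: open_part_def)
  then have "\<omega> \<in> lin_span \<real> (algebraic_forms F E D Y)"
    using * unfolding lin_span_def by blast
  then show "conj_inf \<omega> = \<omega>" by (rule real_span_conj_inf)
qed

end

section \<open>Local coordinates\<close>

text \<open>The bilinear pairing, without conjugation. It lets vectors serve as complex linear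
  functionals, in particular gradients of equations.\<close>

definition dotc :: "complex^'n \<Rightarrow> complex^'n \<Rightarrow> complex" where
  "dotc a x = (\<Sum>i\<in>UNIV. a $ i * x $ i)"

lemma dotc_commute: "dotc a x = dotc x a"
  by (simp add: dotc_def mult.commute)

lemma dotc_add: "dotc a (x + y) = dotc a x + dotc a y"
  by (simp add: dotc_def algebra_simps sum.distrib)

lemma dotc_diff: "dotc a (x - y) = dotc a x - dotc a y"
  by (simp add: dotc_def algebra_simps sum_subtractf)

lemma dotc_scale: "dotc a (c *s x) = c * dotc a x"
  by (simp add: dotc_def algebra_simps sum_distrib_left)

lemma dotc_zero [simp]: "dotc a 0 = 0"
  by (simp add: dotc_def)

lemma dotc_sum: "dotc a (\<Sum>i\<in>I. f i) = (\<Sum>i\<in>I. dotc a (f i))"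
  by (induction I rule: infinite_finite_induct) (auto simp: dotc_add)

lemma dotc_cgrad: "cgrad (dotc a) v a"
  unfolding cgrad_def dotc_def[abs_def]
  by (intro bounded_linear_imp_has_derivative bounded_linear_sum
      bounded_linear_compose[OF bounded_linear_mult_right bounded_linear_vec_nth])

lemma cgrad_eq_dotc: "cgrad f v g \<longleftrightarrow> (f has_derivative dotc g) (at v)"
  by (simp add: cgrad_def dotc_def[abs_def])

lemma cgrad_frechet_dotc: "cgrad f v g \<Longrightarrow> frechet_derivative f (at v) w = dotc g w"
  by (simp add: cgrad_frechet dotc_def)

text \<open>By independence there is a linear map that sends \<open>c\<close> to the all-ones vector
  and the rest of \<open>B\<close> to zero; each row of its matrix is then a functional dual to
  \<open>c\<close>.\<close>

lemma dual_vectors: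
  fixes B :: "(complex^'n) set"
  assumes "vec.independent B"
  shows "\<exists>e. \<forall>b\<in>B. \<forall>c\<in>B. dotc b (e c) = (if b = c then 1 else 0)"
proof -
  have "\<exists>e. \<forall>b\<in>B. dotc b e = (if b = c then 1 else 0)" for c
  proof -
    obtain g :: "complex^'n \<Rightarrow> complex^'n" where g: "Vector_Spaces.linear (*s) (*s) g"
      "\<forall>b\<in>B. g b = (if b = c then vec 1 else 0)"
      using vec.linear_independent_extend[OF assms, of "\<lambda>b. if b = c then vec 1 else 0"] by blast
    \<comment> \<open>Any row will do; this merely names an index.\<close>
    obtain i :: 'n where True by simp
    have "dotc b (matrix g $ i) = g b $ i" for b
      using matrix_works[OF g(1), of b] by (simp add: dotc_def matrix_vector_mult_def mult.commute flip: matrix_works[OF g(1)])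
    then show ?thesis
      using g(2) by (intro exI[of _ "matrix g $ i"]) auto
  qed
  then have "\<exists>e. \<forall>c. \<forall>b\<in>B. dotc b (e c) = (if b = c then 1 else 0)"
    by (intro choice allI)
  then show ?thesis by blast
qed

lemma continuous_on_dotc [continuous_intros]:
  "continuous_on S f \<Longrightarrow> continuous_on S (\<lambda>x. dotc a (f x))"
  unfolding dotc_def by (intro continuous_intros continuous_on_component)

lemma pt_scale: "c \<noteq> 0 \<Longrightarrow> pt (c *s v) = pt v"
  unfolding pt_def
  by (auto simp: vector_smult_assoc) (metis divide_eq_0_iff nonzero_eq_divide_eq vector_smult_assoc)

lemma pt_self: "v \<in> pt v"
  unfolding pt_def by (auto intro!: exI[of _ 1])

lemma in_ptE: "x \<in> pt v \<Longrightarrow> \<exists>c. c \<noteq> 0 \<and> x = c *s v"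
  by (auto simp: pt_def)

text \<open>
  A local coordinate at \<open>v\<close>, given by linear functionals: \<open>u\<close> parametrises \<open>X\<close> near \<open>v\<close>, lifted to the affine
  chart \<open>l = 1\<close>, and its inverse is \<open>m / l\<close>.
\<close>

definition local_coordinate where
  "local_coordinate E v w r u l m \<longleftrightarrow> 0 < r \<and> chart E (ball 0 r) u \<and> u 0 = v \<and> cderiv u 0 = w \<and>
     (\<forall>z\<in>ball 0 r. dotc l (u z) = 1 \<and> dotc m (u z) = z) \<and>
     (\<forall>s. 0 < s \<and> s \<le> r \<longrightarrow> (\<exists>W. open W \<and> v \<in> W \<and>
        (\<forall>x\<in>W \<inter> cone E. dotc l x \<noteq> 0 \<and> dotc m x / dotc l x \<in> ball 0 s \<and>
           x = dotc l x *s u (dotc m x / dotc l x))))"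

context curve
begin

text \<open>Otherwise the point of \<open>v\<close> would be open and closed in the connected curve,
  which would then be a single point. It supplies the accumulation of points to which the identity
  theorem is applied when the local parametrisation is built.\<close>

lemma cone_not_isolated:
  assumes v: "v \<in> cone E" and W: "open W" "v \<in> W"
  shows "\<exists>x\<in>W \<inter> cone E. x \<notin> pt v"
proof (rule ccontr)
  assume neg: "\<not> ?thesis"
  \<comment> \<open>\<open>O1\<close> is the saturation of \<open>W\<close> under scalars and
    \<open>L\<close> is the line through \<open>v\<close>, given by the vanishing of all 2 by 2
    minors. On the cone both cut out exactly \<open>pt v\<close>, one being open and the other
    closed.\<close>
  define O1 where "O1 = (\<Union>c\<in>- {0}. (\<lambda>x. (1 / c) *s x) -` W)"
  define L where "L = {x. \<forall>i j. x $ i * v $ j = x $ j * v $ i}"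
  have cont: "continuous_on UNIV (\<lambda>x :: complex^'n. c *s x)" for c :: complex
    by (intro continuous_intros)
  have "open O1"
    unfolding O1_def using W(1) cont by (intro open_UN ballI open_vimage)
  moreover have "closed L"
    unfolding L_def by (intro closed_Collect_all closed_Collect_eq continuous_intros)
  moreover have pt_L: "x \<in> pt v \<longleftrightarrow> x \<in> L" if "x \<noteq> 0" for x
  proof
    assume "x \<in> L"
    obtain j where j: "v $ j \<noteq> 0"
      using cone_nz[OF v] by (auto simp: vec_eq_iff)
    have "x = (x $ j / v $ j) *s v"
      using \<open>x \<in> L\<close> j by (simp add: vec_eq_iff L_def field_simps)
    moreover from this that have "x $ j / v $ j \<noteq> 0"
      by (metis vector_smult_lzero)
    ultimately show "x \<in> pt v"
      unfolding pt_def by blast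
  qed (auto simp: pt_def L_def)
  have O1_pt: "x \<in> pt v" if "x \<in> O1" "x \<in> cone E" for x
  proof -
    from that(1) obtain c where "c \<in> - {0}" "x \<in> (\<lambda>x. (1 / c) *s x) -` W"
      unfolding O1_def by (rule UN_E)
    then have c: "c \<noteq> 0" "(1 / c) *s x \<in> W"
      by simp_all
    moreover have "(1 / c) *s x \<in> cone E"
      using that c cone_scale by simp
    ultimately have "(1 / c) *s x \<in> pt v"
      using neg by blast
    then have "pt x = pt v"
      using c pt_scale in_ptE by (metis divide_eq_0_iff one_neq_zero)
    then show ?thesis using pt_self by blast
  qed
  have pt_O1: "x \<in> O1" if x: "x \<in> pt v" for x
  proof -
    obtain c where "c \<noteq> 0" "x = c *s v" using in_ptE[OF x] by blast
    then show ?thesis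
      using W(2) by (auto simp: O1_def vector_smult_assoc intro!: bexI[of _ c])
  qed
  have "connected (cone E)"
    using smooth_curve by (simp add: smooth_projective_curve_def)
  moreover have "O1 \<inter> - L \<inter> cone E = {}"
    using O1_pt pt_L cone_nz by blast
  moreover have "cone E \<subseteq> O1 \<union> - L"
    using pt_O1 pt_L cone_nz by blast
  ultimately have "O1 \<inter> cone E = {} \<or> - L \<inter> cone E = {}"
    using \<open>open O1\<close> \<open>closed L\<close> by (intro connectedD) auto
  then have "- L \<inter> cone E = {}"
    using v pt_O1[OF pt_self] by blast
  then have "x \<in> L" if "x \<in> cone E" for x
    using that by blast
  then have "pt x = pt v" if "x \<in> cone E" for x
    using that pt_L[OF cone_nz[OF that]] in_ptE[of x v] pt_scale by blast
  then have "pt ` cone E \<subseteq> {pt v}"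
    by blast
  then have "finite (pt ` cone E)"
    by (rule finite_subset) simp
  then show False
    using smooth_curve by (simp add: smooth_projective_curve_def)
qed

text \<open>The Jacobian criterion makes the tangent space of the cone a plane, so \<open>v\<close>
  and \<open>w\<close> are a basis of it.\<close>

lemma tangent_span:
  assumes "v \<in> cone E" and w: "w \<in> tangent E v" "\<forall>c. w \<noteq> c *s v" and x: "x \<in> tangent E v"
  shows "\<exists>a b. x = a *s v + b *s w"
proof -
  have "v \<noteq> 0" "v \<noteq> w"
    using assms cone_nz w(2)[rule_format, of 1] by auto
  have ind: "vec.independent {w, v}"
    using \<open>v \<noteq> 0\<close> w(2) by (auto simp: vec.independent_insert vec.span_singleton)
  have "{w, v} \<subseteq> tangent E v"
    using w tangent_self assms by simp
  moreover have "card {w, v} = vec.dim (tangent E v)"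
    using \<open>v \<noteq> w\<close> smooth_curve assms by (simp add: smooth_projective_curve_def)
  ultimately have "tangent E v \<subseteq> vec.span {w, v}"
    using vec.card_eq_dim ind by blast
  then obtain b where "x - b *s w \<in> vec.span {v}"
    using x vec.span_breakdown_eq by blast
  then obtain a where "x - b *s w = a *s v"
    by (auto simp: vec.span_singleton)
  then have "x = a *s v + b *s w"
    by (metis diff_add_cancel)
  then show ?thesis by blast
qed

lemma tangent_direction:
  assumes "v \<in> cone E"
  shows "\<exists>w\<in>tangent E v. \<forall>c. w \<noteq> c *s v"
proof (rule ccontr)
  assume "\<not> ?thesis"
  then have "tangent E v \<subseteq> vec.span {v}"
    by (auto simp: vec.span_singleton)
  then have "vec.dim (tangent E v) \<le> card {v}"
    by (intro vec.dim_le_card) auto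
  then show False
    using smooth_curve assms by (simp add: smooth_projective_curve_def)
qed

text \<open>Picks equations whose gradients at \<open>v\<close> form a basis of the span of all
  gradients, so that their common kernel is the tangent plane. The functionals \<open>l\<close> and
  \<open>m\<close> are coordinates on that plane, and the \<open>e b\<close> are dual to the
  gradients and invisible to \<open>l\<close> and \<open>m\<close>.\<close>

lemma local_equations:
  assumes "v \<in> cone E" and w: "w \<in> tangent E v" "\<forall>c. w \<noteq> c *s v"
  obtains B P e l m where "finite B" "\<And>b. b \<in> B \<Longrightarrow> P b \<in> E" "\<And>b. b \<in> B \<Longrightarrow> cgrad (P b) v b"
    "\<And>b c. b \<in> B \<Longrightarrow> c \<in> B \<Longrightarrow> dotc b (e c) = (if b = c then 1 else 0)"
    "\<And>x. (\<forall>b\<in>B. dotc b x = 0) \<longleftrightarrow> x \<in> tangent E v"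
    "\<And>b. dotc l (e b) = 0" "\<And>b. dotc m (e b) = 0"
    "dotc l v = 1" "dotc l w = 0" "dotc m v = 0" "dotc m w = 1"
proof -
  define G where "G = {g. \<exists>P\<in>E. cgrad P v g}"
  obtain B where B: "B \<subseteq> G" "vec.independent B" "G \<subseteq> vec.span B"
    using vec.maximal_independent_subset by blast
  have "\<forall>b\<in>B. \<exists>P. P \<in> E \<and> cgrad P v b"
    using B(1) by (auto simp: G_def)
  then obtain P where P: "\<And>b. b \<in> B \<Longrightarrow> P b \<in> E \<and> cgrad (P b) v b"
    by metis
  have ker: "(\<forall>b\<in>B. dotc b x = 0) \<longleftrightarrow> x \<in> tangent E v" for x
  proof
    assume "\<forall>b\<in>B. dotc b x = 0"
    have sub: "vec.subspace {g. dotc g x = 0}"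
      by (auto simp: vec.subspace_def dotc_commute[of _ x] dotc_add dotc_scale)
    have "vec.span B \<subseteq> {g. dotc g x = 0}"
      using \<open>\<forall>b\<in>B. dotc b x = 0\<close> by (intro vec.span_minimal sub) auto
    then have G0: "dotc g x = 0" if "g \<in> G" for g
      using that B(3) by blast
    have "frechet_derivative Q (at v) x = 0" if Q: "Q \<in> E" for Q
    proof -
      obtain g where g: "cgrad Q v g" using E_cgrad[OF Q] by blast
      then show ?thesis using G0[of g] Q cgrad_frechet_dotc[OF g] by (auto simp: G_def)
    qed
    then show "x \<in> tangent E v" by (simp add: tangent_def)
  next
    assume "x \<in> tangent E v"
    then show "\<forall>b\<in>B. dotc b x = 0"
      using P cgrad_frechet_dotc by (fastforce simp: tangent_def)
  qed
  obtain e0 where e0: "\<forall>b\<in>B. \<forall>c\<in>B. dotc b (e0 c) = (if b = c then 1 else 0)"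
    using dual_vectors[OF B(2)] by blast
  have "v \<noteq> w" using w(2)[rule_format, of 1] by auto
  have "vec.independent {w, v}"
    using cone_nz[OF assms(1)] w(2) by (auto simp: vec.independent_insert vec.span_singleton)
  from dual_vectors[OF this] obtain d where
    d: "\<forall>b\<in>{w, v}. \<forall>c\<in>{w, v}. dotc b (d c) = (if b = c then 1 else 0)" by blast
  define l m where "l = d v" and "m = d w"
  have lm: "dotc l v = 1" "dotc l w = 0" "dotc m v = 0" "dotc m w = 1"
    using d \<open>v \<noteq> w\<close> by (auto simp: l_def m_def dotc_commute[of "d _"])
  \<comment> \<open>Corrected by tangent vectors, on which the gradients vanish: the duality with
    \<open>B\<close> survives while \<open>l\<close> and \<open>m\<close> become zero.\<close>
  define e where "e b = e0 b - dotc l (e0 b) *s v - dotc m (e0 b) *s w" for b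
  have "dotc b v = 0" "dotc b w = 0" if "b \<in> B" for b
    using ker[of v] ker[of w] w tangent_self assms that by auto
  then have "dotc b (e c) = (if b = c then 1 else 0)" if "b \<in> B" "c \<in> B" for b c
    using that e0 by (simp add: e_def dotc_diff dotc_scale)
  moreover have "dotc l (e b) = 0" "dotc m (e b) = 0" for b
    by (simp_all add: e_def dotc_diff dotc_scale lm)
  moreover have "finite B"
    using B(2) vec.finiteI_independent by blast
  ultimately show thesis
    using that[of B P e l m] P ker lm by blast
qed

end

text \<open>The inverse function theorem is applied over the reals; complex homogeneity of the
  derivative passes to its inverse and so makes the local inverse holomorphic.\<close>

lemma linear_inv_scale:
  fixes f :: "complex^'n \<Rightarrow> complex^'n"
  assumes "bij f" and "\<And>c x. f (c *s x) = c *s f x"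
  shows "inv f (c *s x) = c *s inv f x"
  using assms by (metis bij_inv_eq_iff)

context curve
begin

text \<open>
  \<open>\<Psi> x = x + \<Sum> (P\<^sub>b x - dP\<^sub>b(v) x) e\<^sub>b\<close> has derivative \<open>id\<close> at \<open>v\<close> and straightens the zero set of the \<open>P\<^sub>b\<close>
  to the tangent space, without changing the values of \<open>l\<close> and \<open>m\<close>.
\<close>

lemma straightening:
  fixes B :: "(complex^'n) set" and e :: "complex^'n \<Rightarrow> complex^'n"
  assumes fin: "finite B" and P: "\<And>b. b \<in> B \<Longrightarrow> P b \<in> E" "\<And>b. b \<in> B \<Longrightarrow> cgrad (P b) v b"
    and \<Psi>_def: "\<Psi> = (\<lambda>x. x + (\<Sum>b\<in>B. (P b x - dotc b x) *s e b))"
  obtains U' V g where "open U'" "v \<in> U'" "open V" "homeomorphism U' V \<Psi> g"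
    "\<And>y. y \<in> V \<Longrightarrow> \<exists>g'. (g has_derivative g') (at y) \<and> (\<forall>c x. g' (c *s x) = c *s g' x)"
    "(g has_derivative (\<lambda>h. h)) (at (\<Psi> v))"
proof -
  have "\<forall>b\<in>B. \<exists>G. (\<forall>x. cgrad (P b) x (G x)) \<and> continuous_on UNIV G"
    using P(1) hom hom_poly_cpoly unfolding cpoly_def by blast
  then obtain G where G: "\<And>b x. b \<in> B \<Longrightarrow> cgrad (P b) x (G b x)" "\<And>b. b \<in> B \<Longrightarrow> continuous_on UNIV (G b)"
    by metis
  define f' where "f' x h = h + (\<Sum>b\<in>B. (dotc (G b x) h - dotc b h) *s e b)" for x h
  have scale_bl: "bounded_linear (\<lambda>c::complex. c *s a)" for a :: "complex^'n"
    unfolding linear_conv_bounded_linear[symmetric]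
    by (intro linearI) (simp_all add: vec_eq_iff algebra_simps)
  have der: "(\<Psi> has_derivative f' x) (at x)" for x
    unfolding \<Psi>_def f'_def[abs_def]
    using G(1) dotc_cgrad unfolding cgrad_eq_dotc
    by (intro has_derivative_add has_derivative_ident has_derivative_sum
        bounded_linear.has_derivative[OF scale_bl] has_derivative_diff) auto
  have bl: "bounded_linear (f' x)" for x
    using der has_derivative_bounded_linear by blast
  have ap: "blinfun_apply (Blinfun (f' x)) = f' x" for x
    by (rule bounded_linear_Blinfun_apply[OF bl])
  \<comment> \<open>Uniqueness of gradients: at \<open>v\<close> the correction terms of
    \<open>\<Psi>\<close> have derivative zero, so its derivative there is the identity.\<close>
  have Gv: "G b v = b" if "b \<in> B" for b
  proof -
    have "dotc (G b v) = dotc b"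
      using G(1)[OF that] P(2)[OF that] unfolding cgrad_eq_dotc by (rule has_derivative_unique)
    then have "dotc (G b v) (axis i 1) = dotc b (axis i 1)" for i by simp
    then show ?thesis
      by (simp add: dotc_def axis_def vec_eq_iff if_distrib[of "\<lambda>x. _ * x"] cong: if_cong)
  qed
  have f'v: "f' v = (\<lambda>h. h)"
    by (simp add: f'_def fun_eq_iff Gv)
  have apv: "blinfun_apply (Blinfun (f' v)) = (\<lambda>h. h)"
    unfolding ap by (rule f'v)
  have contG: "continuous_on UNIV (\<lambda>x. dotc (G b x) h)" if "b \<in> B" for b h
    unfolding dotc_commute[of _ h] using G(2)[OF that] by (intro continuous_intros)
  have cont: "continuous_on UNIV (\<lambda>x. Blinfun (f' x))"
    unfolding f'_def[abs_def]
    by (rule continuous_on_blinfun_componentwise)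
      (unfold ap[unfolded f'_def[abs_def]], intro continuous_intros contG)
  obtain U' V g g' where g: "open U'" "v \<in> U'" "open V" "\<Psi> v \<in> V" "homeomorphism U' V \<Psi> g"
    "\<And>y. y \<in> V \<Longrightarrow> (g has_derivative (g' y)) (at y)"
    "\<And>y. y \<in> V \<Longrightarrow> g' y = inv (blinfun_apply (Blinfun (f' (g y))))"
    "\<And>y. y \<in> V \<Longrightarrow> bij (blinfun_apply (Blinfun (f' (g y))))"
  proof (rule inverse_function_theorem[of UNIV \<Psi> "\<lambda>x. Blinfun (f' x)" v id_blinfun])
    show "(\<Psi> has_derivative blinfun_apply (Blinfun (f' x))) (at x)" for x
      by (simp add: ap der)
    show "id_blinfun o\<^sub>L Blinfun (f' v) = id_blinfun"
      by (rule blinfun_eqI) (simp only: blinfun_apply_blinfun_compose apv blinfun_apply_id_blinfun)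
  qed (use cont in auto)
  have f'_scale: "f' x (c *s h) = c *s f' x h" for x c h
    by (simp add: f'_def dotc_scale vec_eq_iff sum_distrib_left algebra_simps)
  show thesis
  proof (rule that[OF g(1-3,5)])
    show "\<exists>g'. (g has_derivative g') (at y) \<and> (\<forall>c x. g' (c *s x) = c *s g' x)" if "y \<in> V" for y
      using g(6)[OF that] g(7)[OF that] g(8)[OF that] linear_inv_scale[of "f' (g y)"] f'_scale
      by (intro exI[of _ "g' y"]) (simp add: ap)
    have "g (\<Psi> v) = v"
      using g(2,5) homeomorphism_apply1 by metis
    then have "g' (\<Psi> v) = inv (\<lambda>h. h)"
      using g(7)[OF g(4)] by (simp only: apv)
    then have "g' (\<Psi> v) = (\<lambda>h. h)"
      using inv_id by (simp only: id_def)
    then show "(g has_derivative (\<lambda>h. h)) (at (\<Psi> v))"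
      using g(6)[OF g(4)] by simp
  qed
qed

text \<open>The inverse of the straightening map along the line \<open>v + z w\<close> gives
  \<open>u\<close>. Curve points near \<open>v\<close>, normalised to \<open>l = 1\<close>, satisfy
  the chosen equations and are therefore values of \<open>u\<close>. Conversely \<open>u\<close> is
  first known to satisfy the chosen equations only; every other equation of the curve vanishes at
  parameters of genuine curve points, these accumulate at \<open>0\<close>, and the identity theorem
  applies.\<close>

lemma local_coordinate_exists:
  assumes v: "v \<in> cone E" and w: "w \<in> tangent E v" "\<forall>c. w \<noteq> c *s v"
  shows "\<exists>r u l m. local_coordinate E v w r u l m"
proof -
  obtain B P e l m where fin: "finite B" and P: "\<And>b. b \<in> B \<Longrightarrow> P b \<in> E" "\<And>b. b \<in> B \<Longrightarrow> cgrad (P b) v b"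
    and e: "\<And>b c. b \<in> B \<Longrightarrow> c \<in> B \<Longrightarrow> dotc b (e c) = (if b = c then 1 else 0)"
    and ker: "\<And>x. (\<forall>b\<in>B. dotc b x = 0) \<longleftrightarrow> x \<in> tangent E v"
    and le: "\<And>b. dotc l (e b) = 0" and me: "\<And>b. dotc m (e b) = 0"
    and lm: "dotc l v = 1" "dotc l w = 0" "dotc m v = 0" "dotc m w = 1"
    by (rule local_equations[OF v w]) (rule that)
  define \<Psi> where "\<Psi> = (\<lambda>x. x + (\<Sum>b\<in>B. (P b x - dotc b x) *s e b))"
  obtain U' V g where U': "open U'" "v \<in> U'" and V: "open V" and hm: "homeomorphism U' V \<Psi> g"
    and dg: "\<And>y. y \<in> V \<Longrightarrow> \<exists>g'. (g has_derivative g') (at y) \<and> (\<forall>c x. g' (c *s x) = c *s g' x)"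
    and dgv: "(g has_derivative (\<lambda>h. h)) (at (\<Psi> v))"
  proof (rule straightening[where e = e and P = P, OF fin _ _ \<Psi>_def])
    show "P b \<in> E" "cgrad (P b) v b" if "b \<in> B" for b
      using that by (rule P)+
  qed (rule that)
  have l\<Psi>: "dotc l (\<Psi> x) = dotc l x" and m\<Psi>: "dotc m (\<Psi> x) = dotc m x" for x
    unfolding \<Psi>_def dotc_add dotc_sum dotc_scale by (simp_all add: le me)
  have P\<Psi>: "dotc b (\<Psi> x) = P b x" if b: "b \<in> B" for b x
  proof -
    have "(\<Sum>c\<in>B. (P c x - dotc c x) * dotc b (e c)) = (\<Sum>c\<in>B. if c = b then P b x - dotc b x else 0)"
      by (rule sum.cong) (use e b in auto)
    then show ?thesis
      using b fin unfolding \<Psi>_def dotc_add dotc_sum dotc_scale by simp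
  qed
  have "P b v - dotc b v = 0" if "b \<in> B" for b
    using v P(1) ker[of v] tangent_self[OF v] that by (simp add: cone_def)
  then have "(\<Sum>b\<in>B. (P b v - dotc b v) *s e b) = 0"
    by (intro sum.neutral) auto
  then have \<Psi>v: "\<Psi> v = v"
    by (simp only: \<Psi>_def add_0_right)
  have vV: "v \<in> V"
    using hm U'(2) \<Psi>v homeomorphism_image1 by (metis image_eqI)
  \<comment> \<open>The tangent line, on which \<open>l\<close> is constantly 1 and \<open>m\<close>
    is the parameter \<open>z\<close>.\<close>
  define lin where "lin z = v + z *s w" for z
  have lin_cont: "continuous_on UNIV lin"
    unfolding lin_def by (intro continuous_intros)
  have "open (lin -` V)"
    using lin_cont V by (rule open_vimage[rotated])
  moreover have "0 \<in> lin -` V"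
    using vV by (simp add: lin_def)
  ultimately obtain r where r: "0 < r" "ball 0 r \<subseteq> lin -` V"
    using open_contains_ball by metis
  have linV: "lin z \<in> V" if "z \<in> ball 0 r" for z
    using r(2) that by auto
  define u where "u z = g (lin z)" for z
  have \<Psi>u: "\<Psi> (u z) = lin z" if "z \<in> ball 0 r" for z
    using hm linV[OF that] by (simp add: u_def homeomorphism_def)
  have lu: "dotc l (u z) = 1" and mu: "dotc m (u z) = z" if "z \<in> ball 0 r" for z
    using l\<Psi>[of "u z"] m\<Psi>[of "u z"] \<Psi>u[OF that] by (simp_all add: lin_def dotc_add dotc_scale lm)
  have u0: "u 0 = v"
    using homeomorphism_apply1[OF hm U'(2)] \<Psi>v by (simp add: u_def lin_def)
  have lin_der: "(lin has_derivative (\<lambda>h. h *s w)) (at z)" for z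
  proof -
    have "bounded_linear (\<lambda>h::complex. h *s w)"
      unfolding linear_conv_bounded_linear[symmetric]
      by (intro linearI) (simp_all add: vec_eq_iff algebra_simps)
    from has_derivative_add[OF has_derivative_const bounded_linear_imp_has_derivative[OF this]]
    show ?thesis by (simp add: lin_def[abs_def])
  qed
  have udiff: "\<exists>a. (u has_derivative (\<lambda>h. h *s a)) (at z)" if z: "z \<in> ball 0 r" for z
  proof -
    obtain g' where g': "(g has_derivative g') (at (lin z))" "\<forall>c x. g' (c *s x) = c *s g' x"
      using dg[OF linV[OF z]] by blast
    have "((\<lambda>z. g (lin z)) has_derivative (\<lambda>h. g' (h *s w))) (at z)"
      by (rule has_derivative_compose[OF lin_der g'(1)])
    then show ?thesis
      using g'(2) by (auto simp: u_def[abs_def])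
  qed
  have comp: "((\<lambda>z. u z $ i) has_field_derivative a $ i) (at z)"
    if "(u has_derivative (\<lambda>h. h *s a)) (at z)" for z a i
    using bounded_linear.has_derivative[OF bounded_linear_vec_nth that, of i]
    by (simp add: has_field_derivative_def mult_commute_abs)
  have cder: "cderiv u z = a" if "(u has_derivative (\<lambda>h. h *s a)) (at z)" for z a
    using DERIV_imp_deriv[OF comp[OF that]] by (simp add: cderiv_def vec_eq_iff)
  have hol: "(\<lambda>z. u z $ i) holomorphic_on ball 0 r" for i
    unfolding holomorphic_on_open[OF open_ball] using udiff comp by blast
  have cd0: "cderiv u 0 = w"
  proof (rule cder)
    have "(g has_derivative (\<lambda>h. h)) (at (lin 0))"
      using dgv \<Psi>v by (simp add: lin_def)
    from has_derivative_compose[OF lin_der this] show "(u has_derivative (\<lambda>h. h *s w)) (at 0)"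
      by (simp add: u_def[abs_def])
  qed
  have cover: "\<exists>W. open W \<and> v \<in> W \<and>
        (\<forall>x\<in>W \<inter> cone E. dotc l x \<noteq> 0 \<and> dotc m x / dotc l x \<in> ball 0 s \<and>
           x = dotc l x *s u (dotc m x / dotc l x))" if s: "0 < s" "s \<le> r" for s
  proof -
    define N where "N = {x :: complex^'n. dotc l x \<noteq> 0}"
    have opN: "open N"
      unfolding N_def by (intro open_Collect_neq continuous_intros)
    \<comment> \<open>Two open conditions at \<open>v\<close>: the point normalised to
      \<open>l = 1\<close> lies where the straightening map is invertible, and its parameter
      \<open>m / l\<close> lies in the small ball.\<close>
    define W where "W = (N \<inter> (\<lambda>x. inverse (dotc l x) *s x) -` U') \<inter> (N \<inter> (\<lambda>x. dotc m x / dotc l x) -` ball 0 s)"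
    have "open W"
      unfolding W_def
      by (intro open_Int continuous_open_preimage opN U'(1) open_ball continuous_intros) (auto simp: N_def)
    moreover have "v \<in> W"
      using U'(2) s by (simp add: W_def N_def lm)
    moreover have "dotc l x \<noteq> 0 \<and> dotc m x / dotc l x \<in> ball 0 s \<and> x = dotc l x *s u (dotc m x / dotc l x)"
      if x: "x \<in> W" "x \<in> cone E" for x
    proof -
      let ?y = "inverse (dotc l x) *s x" and ?z = "dotc m x / dotc l x"
      have nz: "dotc l x \<noteq> 0" and yU: "?y \<in> U'" and zs: "?z \<in> ball 0 s"
        using x by (auto simp: W_def N_def)
      have yc: "?y \<in> cone E"
        using cone_scale x nz by simp
      have "dotc b (\<Psi> ?y) = 0" if "b \<in> B" for b
        using P\<Psi>[OF that] yc P(1)[OF that] by (simp add: cone_def)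
      then have "\<Psi> ?y \<in> tangent E v"
        using ker by blast
      then obtain a c where ac: "\<Psi> ?y = a *s v + c *s w"
        using tangent_span[OF v w] by blast
      have "a = 1"
        using l\<Psi>[of ?y] nz by (simp add: ac dotc_add dotc_scale lm)
      moreover have "c = ?z"
        using m\<Psi>[of ?y] unfolding ac by (simp add: dotc_add dotc_scale lm divide_inverse mult.commute)
      ultimately have "\<Psi> ?y = lin ?z"
        using ac by (simp add: lin_def)
      then have "?y = u ?z"
        using homeomorphism_apply1[OF hm yU] by (simp add: u_def)
      then have "dotc l x *s ?y = dotc l x *s u ?z"
        by simp
      then show ?thesis
        using nz zs by (simp add: vector_smult_assoc)
    qed
    ultimately show ?thesis by blast
  qed
  have Qu: "Q (u z) = 0" if Q: "Q \<in> E" and z: "z \<in> ball 0 r" for Q z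
  proof -
    obtain d where d: "hom_poly F d Q" using hom[OF Q] by blast
    have holQ: "(\<lambda>z. Q (u z)) holomorphic_on ball 0 r"
      unfolding holomorphic_on_open[OF open_ball]
    proof
      fix z assume "z \<in> ball (0::complex) r"
      then obtain a where a: "(u has_derivative (\<lambda>h. h *s a)) (at z)" using udiff by blast
      obtain q where q: "cgrad Q (u z) q" using E_cgrad[OF Q] by blast
      have "((\<lambda>z. Q (u z)) has_derivative (\<lambda>h. dotc q (h *s a))) (at z)"
        using has_derivative_compose[where g = Q, OF a] q by (simp add: cgrad_eq_dotc)
      then show "\<exists>f'. ((\<lambda>z. Q (u z)) has_field_derivative f') (at z)"
        by (auto simp: has_field_derivative_def dotc_scale mult_commute_abs)
    qed
    \<comment> \<open>Zeros near \<open>0\<close> come from curve points near \<open>v\<close> on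
      other lines; such a point has nonzero parameter, since parameter \<open>0\<close> gives the
      line of \<open>v\<close>.\<close>
    have lim: "0 islimpt {z \<in> ball 0 r. Q (u z) = 0}"
      unfolding islimpt_approachable
    proof (intro allI impI)
      fix \<epsilon> :: real assume "\<epsilon> > 0"
      define s where "s = min \<epsilon> r"
      have s: "0 < s" "s \<le> r" "s \<le> \<epsilon>" using \<open>\<epsilon> > 0\<close> r by (auto simp: s_def)
      obtain W where W: "open W" "v \<in> W"
        "\<And>x. x \<in> W \<inter> cone E \<Longrightarrow> dotc l x \<noteq> 0 \<and> dotc m x / dotc l x \<in> ball 0 s \<and>
           x = dotc l x *s u (dotc m x / dotc l x)"
        using cover[OF s(1,2)] by blast
      obtain x where x: "x \<in> W \<inter> cone E" "x \<notin> pt v"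
        using cone_not_isolated[OF v W(1,2)] by blast
      let ?z = "dotc m x / dotc l x"
      have "?z \<noteq> 0"
      proof
        assume "?z = 0"
        then have "x = dotc l x *s v" "dotc l x \<noteq> 0"
          using W(3)[OF x(1)] u0 by auto
        then show False using x(2) unfolding pt_def by blast
      qed
      moreover have "Q x = 0" using x Q by (simp add: cone_def)
      then have "dotc l x ^ d * Q (u ?z) = 0"
        using W(3)[OF x(1)] hom_poly_scale[OF d] by metis
      then have "Q (u ?z) = 0"
        using W(3)[OF x(1)] by simp
      ultimately show "\<exists>z\<in>{z \<in> ball 0 r. Q (u z) = 0}. z \<noteq> 0 \<and> dist z 0 < \<epsilon>"
        using W(3)[OF x(1)] s by (intro bexI[of _ ?z]) auto
    qed
    show ?thesis
      by (rule analytic_continuation[OF holQ open_ball _ _ _ lim _ z]) (use r in auto)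
  qed
  have "chart E (ball 0 r) u"
    unfolding chart_def
  proof (intro conjI allI ballI hol open_ball)
    fix z c assume z: "z \<in> ball (0::complex) r"
    have "u z \<noteq> 0"
      using lu[OF z] by auto
    then show "u z \<in> cone E"
      using Qu z by (simp add: cone_def)
    obtain a where a: "(u has_derivative (\<lambda>h. h *s a)) (at z)" using udiff[OF z] by blast
    have der: "((\<lambda>z. dotc q (u z)) has_field_derivative dotc q a) (at z)" for q
      using has_derivative_compose[OF a dotc_cgrad[unfolded cgrad_eq_dotc], of q]
      by (simp add: has_field_derivative_def dotc_scale mult_commute_abs)
    \<comment> \<open>Differentiating \<open>l (u z) = 1\<close> and \<open>m (u z) = z\<close>
      shows that the derivative is killed by \<open>l\<close> but not zero, hence is not a multiple
      of \<open>u z\<close>.\<close>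
    have "((\<lambda>z. dotc l (u z)) has_field_derivative 0) (at z)"
      by (rule has_field_derivative_transform_within_open[of "\<lambda>_. 1" _ _ "ball 0 r"]) (use z lu in auto)
    then have la: "dotc l a = 0"
      using der DERIV_unique by blast
    have "((\<lambda>z. dotc m (u z)) has_field_derivative 1) (at z)"
      by (rule has_field_derivative_transform_within_open[of "\<lambda>z. z" _ _ "ball 0 r"]) (use z mu in auto)
    then have ma: "dotc m a = 1"
      using der DERIV_unique by blast
    show "cderiv u z \<noteq> c *s u z"
    proof
      assume "cderiv u z = c *s u z"
      then have a': "a = c *s u z" using cder[OF a] by simp
      then have "c = 0" using la lu[OF z] by (simp add: dotc_scale)
      then show False using a' ma by simp
    qed
  qed
  then have "local_coordinate E v w r u l m"
    unfolding local_coordinate_def using r(1) u0 cd0 lu mu cover by blast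
  then show ?thesis by blast
qed

end

section \<open>Paths on the open curve\<close>

lemma valid_path_derivative:
  assumes "valid_path \<gamma>"
  obtains S where "finite S"
    "\<And>t. t \<in> {0..1} - S \<Longrightarrow> (\<gamma> has_vector_derivative vector_derivative \<gamma> (at t within {0..1})) (at t)"
proof -
  obtain S D where S: "finite S" "\<And>t. t \<in> {0..1} - S \<Longrightarrow> (\<gamma> has_vector_derivative D t) (at t)"
    using assms unfolding valid_path_def piecewise_C1_differentiable_on_def C1_differentiable_on_def by blast
  then have "vector_derivative \<gamma> (at t within {0..1}) = D t" if "t \<in> {0..1} - S" for t
    using that by (intro vector_derivative_at_within_ivl) auto
  with S that show thesis by (metis (no_types, lifting))
qed

lemma valid_path_linear_image:
  assumes "bounded_linear f" and "valid_path \<gamma>"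
  shows "valid_path (f \<circ> \<gamma>)"
proof -
  obtain S D where S: "continuous_on {0..1} \<gamma>" "finite S" "\<And>t. t \<in> {0..1} - S \<Longrightarrow> (\<gamma> has_vector_derivative D t) (at t)"
    "continuous_on ({0..1} - S) D"
    using assms(2) unfolding valid_path_def piecewise_C1_differentiable_on_def C1_differentiable_on_def by blast
  have "((f \<circ> \<gamma>) has_vector_derivative f (D t)) (at t)" if "t \<in> {0..1} - S" for t
    unfolding o_def by (rule bounded_linear.has_vector_derivative[OF assms(1) S(3)[OF that]])
  moreover have "continuous_on ({0..1} - S) (\<lambda>t. f (D t))" "continuous_on {0..1} (f \<circ> \<gamma>)"
    unfolding o_def by (intro bounded_linear.continuous_on[OF assms(1)] S)+
  ultimately have "(f \<circ> \<gamma>) C1_differentiable_on ({0..1} - S)"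
    unfolding C1_differentiable_on_def by (intro exI[of _ "\<lambda>t. f (D t)"]) auto
  with \<open>continuous_on {0..1} (f \<circ> \<gamma>)\<close> S(2) show ?thesis
    unfolding valid_path_def piecewise_C1_differentiable_on_def by blast
qed

lemma bounded_linear_scale: "bounded_linear ((*s) c :: complex^'n \<Rightarrow> complex^'n)"
  unfolding linear_conv_bounded_linear[symmetric]
  by (intro linearI) (simp_all add: vec_eq_iff algebra_simps)

context curve
begin

lemma path_tangent:
  assumes "open S" "t \<in> S" "\<gamma> ` S \<subseteq> cone E" and d: "(\<gamma> has_vector_derivative d) (at t)"
  shows "d \<in> tangent E (\<gamma> t)"
proof -
  have "frechet_derivative P (at (\<gamma> t)) d = 0" if P: "P \<in> E" for P
  proof -
    obtain g where g: "cgrad P (\<gamma> t) g" using E_cgrad[OF P] by blast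
    have 1: "((\<lambda>s. P (\<gamma> s)) has_derivative (\<lambda>h. dotc g (h *\<^sub>R d))) (at t)"
      using has_derivative_compose[where g = P and f = \<gamma>] d g
      by (simp add: has_vector_derivative_def cgrad_eq_dotc)
    have 2: "((\<lambda>s. P (\<gamma> s)) has_derivative (\<lambda>h. 0)) (at t)"
      by (rule has_derivative_transform_within_open[of "\<lambda>_. 0" _ _ _ S])
        (use assms P in \<open>auto simp: cone_def\<close>)
    show ?thesis
      using fun_cong[OF has_derivative_unique[OF 1 2], of 1] cgrad_frechet_dotc[OF g] by simp
  qed
  then show ?thesis by (simp add: tangent_def)
qed

lemma one_forms_cscale_real:
  assumes "\<omega> \<in> one_forms E D" "x \<in> Y" "d \<in> tangent E x" "c \<noteq> 0"
  shows "\<omega> (c *s x) (k *\<^sub>R (c *s d)) = of_real k * \<omega> x d"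
proof -
  have "c *s d \<in> tangent E (c *s x)"
    using assms by (simp add: tangent_scale_point tangent_cscale)
  moreover have "c *s x \<in> Y"
    using assms by (simp add: Y_scale)
  ultimately have "\<omega> (c *s x) (k *\<^sub>R (c *s d)) = of_real k * \<omega> (c *s x) (c *s d)"
    using one_formsD(1)[OF assms(1), of "c *s x" "c *s d" "c *s d" k 0] by simp
  then show ?thesis
    using one_formsD(2)[OF assms(1-3)] assms(4) by simp
qed

text \<open>Forms are invariant under scaling of the lift, so only the speed \<open>k\<close> of the
  reparametrisation is felt. Agreement is asked on the open interval alone, with the ends in the
  exceptional set; this covers rescaling, both halves of a join, and the first part of a ray
  path.\<close>

lemma along_affine:
  assumes \<gamma>1: "valid_path \<gamma>1" "\<gamma>1 ` {0<..<1} \<subseteq> Y" and ab: "0 \<le> a" "b \<le> 1" and k: "k > 0"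
    and d: "0 \<le> k * a + d" "k * b + d \<le> 1" and c: "c \<noteq> 0"
    and eq: "\<And>t. t \<in> {a<..<b} \<Longrightarrow> \<gamma> t = c *s \<gamma>1 (k * t + d)" and \<Omega>: "\<And>ws. \<Omega> ws \<in> one_forms E D"
  shows "\<exists>S. finite S \<and> (\<forall>t ws. t \<in> {a..b} - S \<longrightarrow>
    along \<Omega> \<gamma> t ws = of_real k * along \<Omega> \<gamma>1 (k * t + d) ws)"
proof -
  obtain S where S: "finite S"
    "\<And>t. t \<in> {0..1} - S \<Longrightarrow> (\<gamma>1 has_vector_derivative vector_derivative \<gamma>1 (at t within {0..1})) (at t)"
    using valid_path_derivative[OF \<gamma>1(1)] by blast
  define T where "T = {a, b} \<union> (\<lambda>t. (t - d) / k) ` S"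
  have "finite T"
    using S(1) by (simp add: T_def)
  moreover have "along \<Omega> \<gamma> t ws = of_real k * along \<Omega> \<gamma>1 (k * t + d) ws" if t: "t \<in> {a..b} - T" for t ws
  proof -
    let ?s = "k * t + d"
    have tab: "t \<in> {a<..<b}" using t by (auto simp: T_def)
    then have "k * a < k * t" "k * t < k * b"
      using k by auto
    then have s01: "?s \<in> {0<..<1}" using d by auto
    have "?s \<notin> S"
      using t k by (auto simp: T_def image_iff)
    then have d1: "(\<gamma>1 has_vector_derivative vector_derivative \<gamma>1 (at ?s within {0..1})) (at ?s)"
      using S(2)[of ?s] s01 by simp
    let ?d = "vector_derivative \<gamma>1 (at ?s within {0..1})"
    have tan: "?d \<in> tangent E (\<gamma>1 ?s)"
      by (rule path_tangent[OF _ s01 _ d1]) (use \<gamma>1(2) Y_cone in auto)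
    have "((\<lambda>t. k * t + d) has_vector_derivative k) (at t)"
      by (auto intro!: derivative_eq_intros)
    from vector_diff_chain_at[OF this d1]
    have "((\<lambda>t. \<gamma>1 (k * t + d)) has_vector_derivative k *\<^sub>R ?d) (at t)"
      by (simp add: o_def)
    from bounded_linear.has_vector_derivative[OF bounded_linear_scale this, of c]
    have "((\<lambda>t. c *s \<gamma>1 (k * t + d)) has_vector_derivative k *\<^sub>R (c *s ?d)) (at t)"
      by (simp add: scaleR_eq_scale vector_smult_assoc mult.commute)
    then have "(\<gamma> has_vector_derivative k *\<^sub>R (c *s ?d)) (at t)"
      by (rule has_vector_derivative_transform_within_open[OF _ open_greaterThanLessThan tab]) (simp add: eq)
    then have "vector_derivative \<gamma> (at t within {0..1}) = k *\<^sub>R (c *s ?d)"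
      using tab ab by (intro vector_derivative_at_within_ivl) auto
    moreover have "\<gamma>1 ?s \<in> Y"
      using \<gamma>1(2) s01 by blast
    ultimately show ?thesis
      using one_forms_cscale_real[OF \<Omega> _ tan c, of ws k] eq[OF tab]
      by (simp add: along_def)
  qed
  ultimately show ?thesis by blast
qed

text \<open>The last clause is demanded outright: smoothness of a form is only visible in charts,
  and a valid path need not stay in one. Every pullback of a smooth form along such a path is thus
  integrable.\<close>

definition nice :: "(real \<Rightarrow> complex^'n) \<Rightarrow> bool" where
  "nice \<gamma> \<longleftrightarrow> valid_path \<gamma> \<and> path_image \<gamma> \<subseteq> Y \<and>
     (\<forall>\<omega>\<in>smooth_forms E D. pcont 0 1 (\<lambda>t. \<omega> (\<gamma> t) (vector_derivative \<gamma> (at t within {0..1}))))"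

lemma nice_tpcont: "nice \<gamma> \<Longrightarrow> (\<And>ws. \<Omega> ws \<in> smooth_forms E D) \<Longrightarrow> tpcont 0 1 (along \<Omega> \<gamma>)"
  by (simp add: nice_def tpcont_def along_def)

lemma nice_interior: "nice \<gamma> \<Longrightarrow> \<gamma> ` {0<..<1} \<subseteq> Y"
  by (force simp: nice_def path_image_def)

lemma nice_affine_pcont:
  assumes \<gamma>1: "nice \<gamma>1" and ab: "0 \<le> a" "b \<le> 1" and k: "k > 0"
    and d: "0 \<le> k * a + d" "k * b + d \<le> 1" and c: "c \<noteq> 0"
    and eq: "\<And>t. t \<in> {a<..<b} \<Longrightarrow> \<gamma> t = c *s \<gamma>1 (k * t + d)" and \<omega>: "\<omega> \<in> smooth_forms E D"
  shows "pcont a b (\<lambda>t. \<omega> (\<gamma> t) (vector_derivative \<gamma> (at t within {0..1})))"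
proof -
  let ?f = "\<lambda>\<gamma> t. \<omega> (\<gamma> t) (vector_derivative \<gamma> (at t within {0..1}))"
  have "\<exists>S. finite S \<and> (\<forall>t ws. t \<in> {a..b} - S \<longrightarrow>
      along (\<lambda>_. \<omega>) \<gamma> t ws = of_real k * along (\<lambda>_. \<omega>) \<gamma>1 (k * t + d) ws)"
    by (rule along_affine[OF _ nice_interior[OF \<gamma>1] ab k d c eq smooth_forms_one[OF \<omega>]])
      (use \<gamma>1 in \<open>auto simp: nice_def\<close>)
  then obtain S where S: "finite S"
    "\<And>t ws. t \<in> {a..b} - S \<Longrightarrow> along (\<lambda>_. \<omega>) \<gamma> t ws = of_real k * along (\<lambda>_. \<omega>) \<gamma>1 (k * t + d) ws"
    by blast
  have "pcont 0 1 (?f \<gamma>1)"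
    using \<gamma>1 \<omega> by (simp add: nice_def)
  then have "pcont (k * a + d) (k * b + d) (?f \<gamma>1)"
    by (rule pcont_mono) (use d in auto)
  then have "pcont a b (\<lambda>t. of_real k * ?f \<gamma>1 (k * t + d))"
    using k by (intro pcont_mult pcont_const pcont_affine)
  then show ?thesis
    by (rule pcont_spike[OF _ S(1)]) (use S(2) in \<open>simp add: along_def\<close>)
qed

lemma nice_affine_transport:
  assumes \<gamma>1: "nice \<gamma>1" and ab: "0 \<le> a" "b \<le> 1" and k: "k > 0"
    and d: "0 \<le> k * a + d" "k * b + d \<le> 1" and c: "c \<noteq> 0"
    and eq: "\<And>t. t \<in> {a<..<b} \<Longrightarrow> \<gamma> t = c *s \<gamma>1 (k * t + d)" and \<Omega>: "\<And>ws. \<Omega> ws \<in> smooth_forms E D"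
  shows "transport (along \<Omega> \<gamma>) a b = transport (along \<Omega> \<gamma>1) (k * a + d) (k * b + d)"
proof
  fix ws
  have "\<exists>S. finite S \<and> (\<forall>t ws. t \<in> {a..b} - S \<longrightarrow>
      along \<Omega> \<gamma> t ws = of_real k * along \<Omega> \<gamma>1 (k * t + d) ws)"
    by (rule along_affine[OF _ nice_interior[OF \<gamma>1] ab k d c eq smooth_forms_one[OF \<Omega>]])
      (use \<gamma>1 in \<open>auto simp: nice_def\<close>)
  then obtain S where S: "finite S"
    "\<And>t ws. t \<in> {a..b} - S \<Longrightarrow> along \<Omega> \<gamma> t ws = of_real k * along \<Omega> \<gamma>1 (k * t + d) ws"
    by blast
  have "transport (along \<Omega> \<gamma>) a b ws = transport (\<lambda>t ws. of_real k * along \<Omega> \<gamma>1 (k * t + d) ws) a b ws"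
    by (rule transport_spike[OF S]) auto
  also have "\<dots> = transport (along \<Omega> \<gamma>1) (k * a + d) (k * b + d) ws"
    by (rule transport_affine[OF tpcont_mono[OF nice_tpcont[OF \<gamma>1 \<Omega>]] k]) (use d in auto)
  finally show "transport (along \<Omega> \<gamma>) a b ws = transport (along \<Omega> \<gamma>1) (k * a + d) (k * b + d) ws" .
qed

section \<open>Rescaling, joining and constructing nice paths\<close>

lemma nice_scale:
  assumes "nice \<gamma>" and "c \<noteq> 0"
  shows "nice (\<lambda>t. c *s \<gamma> t)"
  unfolding nice_def
proof (intro conjI ballI)
  show "valid_path (\<lambda>t. c *s \<gamma> t)"
    using valid_path_linear_image[OF bounded_linear_scale, of \<gamma> c] assms by (simp add: nice_def o_def)
  show "path_image (\<lambda>t. c *s \<gamma> t) \<subseteq> Y"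
    using assms by (auto simp: nice_def path_image_def Y_scale)
  show "pcont 0 1 (\<lambda>t. \<omega> (c *s \<gamma> t) (vector_derivative (\<lambda>t. c *s \<gamma> t) (at t within {0..1})))"
    if "\<omega> \<in> smooth_forms E D" for \<omega>
    by (rule nice_affine_pcont[OF assms(1), of 0 1 1 0 c]) (use assms that in auto)
qed

lemma nice_scale_transport:
  assumes "nice \<gamma>" and "c \<noteq> 0" and "\<And>ws. \<Omega> ws \<in> smooth_forms E D"
  shows "transport (along \<Omega> (\<lambda>t. c *s \<gamma> t)) 0 1 = transport (along \<Omega> \<gamma>) 0 1"
  using nice_affine_transport[OF assms(1), of 0 1 1 0 c "\<lambda>t. c *s \<gamma> t" \<Omega>] assms by simp

lemma nice_join:
  assumes "nice \<gamma>1" and "nice \<gamma>2" and "pathfinish \<gamma>1 = pathstart \<gamma>2"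
  shows "nice (\<gamma>1 +++ \<gamma>2)"
  unfolding nice_def
proof (intro conjI ballI)
  show "valid_path (\<gamma>1 +++ \<gamma>2)"
    using assms by (auto simp: nice_def intro: valid_path_join)
  show "path_image (\<gamma>1 +++ \<gamma>2) \<subseteq> Y"
    using assms path_image_join_subset[of \<gamma>1 \<gamma>2] unfolding nice_def by blast
  fix \<omega> assume \<omega>: "\<omega> \<in> smooth_forms E D"
  show "pcont 0 1 (\<lambda>t. \<omega> ((\<gamma>1 +++ \<gamma>2) t) (vector_derivative (\<gamma>1 +++ \<gamma>2) (at t within {0..1})))"
  proof (rule pcont_combine[of _ "1/2"])
    show "pcont 0 (1/2) (\<lambda>t. \<omega> ((\<gamma>1 +++ \<gamma>2) t) (vector_derivative (\<gamma>1 +++ \<gamma>2) (at t within {0..1})))"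
      by (rule nice_affine_pcont[OF assms(1), of _ _ 2 0 1]) (use \<omega> in \<open>auto simp: joinpaths_def\<close>)
    show "pcont (1/2) 1 (\<lambda>t. \<omega> ((\<gamma>1 +++ \<gamma>2) t) (vector_derivative (\<gamma>1 +++ \<gamma>2) (at t within {0..1})))"
      by (rule nice_affine_pcont[OF assms(2), of _ _ 2 "-1" 1]) (use \<omega> in \<open>auto simp: joinpaths_def\<close>)
  qed auto
qed

lemma nice_join_transport:
  assumes "nice \<gamma>1" and "nice \<gamma>2" and "pathfinish \<gamma>1 = pathstart \<gamma>2" and \<Omega>: "\<And>ws. \<Omega> ws \<in> smooth_forms E D"
  shows "transport (along \<Omega> (\<gamma>1 +++ \<gamma>2)) 0 1 =
    t_mult (transport (along \<Omega> \<gamma>2) 0 1) (transport (along \<Omega> \<gamma>1) 0 1)"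
proof -
  have "transport (along \<Omega> (\<gamma>1 +++ \<gamma>2)) 0 1 =
      t_mult (transport (along \<Omega> (\<gamma>1 +++ \<gamma>2)) (1/2) 1) (transport (along \<Omega> (\<gamma>1 +++ \<gamma>2)) 0 (1/2))"
    by (rule ext, rule transport_compose[OF nice_tpcont[OF nice_join[OF assms(1-3)] \<Omega>]]) auto
  moreover have "transport (along \<Omega> (\<gamma>1 +++ \<gamma>2)) 0 (1/2) = transport (along \<Omega> \<gamma>1) (2 * 0 + 0) (2 * (1/2) + 0)"
    by (rule nice_affine_transport[OF assms(1), of _ _ _ _ 1]) (use \<Omega> in \<open>auto simp: joinpaths_def\<close>)
  moreover have "transport (along \<Omega> (\<gamma>1 +++ \<gamma>2)) (1/2) 1 = transport (along \<Omega> \<gamma>2) (2 * (1/2) + - 1) (2 * 1 + - 1)"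
    by (rule nice_affine_transport[OF assms(2), of _ _ _ _ 1]) (use \<Omega> in \<open>auto simp: joinpaths_def\<close>)
  ultimately show ?thesis by simp
qed

lemma const_derivative: "t \<in> {0..1} \<Longrightarrow> vector_derivative (\<lambda>t. x) (at t within {0..1::real}) = 0"
  by (rule vector_derivative_at_within_ivl) auto

lemma nice_const: "x \<in> Y \<Longrightarrow> nice (\<lambda>t. x)"
  unfolding nice_def
proof (intro conjI ballI)
  show "pcont 0 1 (\<lambda>t. \<omega> x (vector_derivative (\<lambda>t. x) (at t within {0..1})))" for \<omega>
    by (rule pcont_spike[OF pcont_const[of 0 1 "\<omega> x 0"], of "{}"]) (simp_all add: const_derivative)
qed (auto simp: path_image_def intro!: valid_path_polynomial_function)

lemma const_transport:
  assumes "x \<in> Y" and "\<And>ws. \<Omega> ws \<in> smooth_forms E D" and "0 \<le> a" "s \<le> 1"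
  shows "transport (along \<Omega> (\<lambda>t. x)) a s = t_one"
proof
  fix ws
  have "\<Omega> zs x 0 = 0" for zs
    using one_formsD(3)[OF smooth_forms_one[OF assms(2)] assms(1), of _ 0] by simp
  then have "transport (along \<Omega> (\<lambda>t. x)) a s ws = transport (\<lambda>t zs. 0) a s ws"
    using assms(3,4) by (intro transport_spike[of "{}" a s]) (auto simp: along_def const_derivative)
  then show "transport (along \<Omega> (\<lambda>t. x)) a s ws = t_one ws"
    by (cases ws) (simp_all add: transport_Cons t_mult_zero_left)
qed

lemma cderiv_continuous:
  assumes "chart E U u"
  shows "continuous_on U (cderiv u)"
  unfolding cderiv_def[abs_def]
  using assms by (intro continuous_on_vec_lambda holomorphic_on_imp_continuous_on holomorphic_deriv)
    (auto simp: chart_def)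

lemma chart_path_derivative:
  assumes "chart E U u" and "g t \<in> U" and "(g has_vector_derivative g') (at t)"
  shows "((\<lambda>t. u (g t)) has_vector_derivative g' *s cderiv u (g t)) (at t)"
proof -
  have "((\<lambda>t. u (g t)) has_derivative (\<lambda>h. (h *\<^sub>R g') *s cderiv u (g t))) (at t)"
    using has_derivative_compose[where g = u and f = g, OF _ chart_has_derivative[OF assms(1,2)]] assms(3)
    by (simp add: has_vector_derivative_def)
  then show ?thesis
    unfolding has_vector_derivative_def
    by (rule has_derivative_eq_rhs) (simp add: fun_eq_iff scaleR_eq_scale vector_smult_assoc scaleR_conv_of_real)
qed

text \<open>The basic supply of nice paths: inside one chart the smooth coefficients of a form make
  its pullback continuous.\<close>

lemma nice_chart_path:
  assumes u: "chart E U u" "u ` U \<subseteq> Y" and g: "\<And>t. (g has_vector_derivative g' t) (at t)"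
    "continuous_on {0..1} g'" "g ` {0..1} \<subseteq> U"
  shows "nice (\<lambda>t. u (g t))"
    and "t \<in> {0..1} \<Longrightarrow> vector_derivative (\<lambda>t. u (g t)) (at t within {0..1}) = g' t *s cderiv u (g t)"
proof -
  have cg: "continuous_on {0..1} g"
    using g(1) by (meson continuous_at_imp_continuous_on has_vector_derivative_continuous)
  have d: "((\<lambda>t. u (g t)) has_vector_derivative g' t *s cderiv u (g t)) (at t)" if "t \<in> {0..1}" for t
    using chart_path_derivative[OF u(1) _ g(1)] g(3) that by blast
  have v: "vector_derivative (\<lambda>t. u (g t)) (at t within {0..1}) = g' t *s cderiv u (g t)" if "t \<in> {0..1}" for t
    using d[OF that] that by (intro vector_derivative_at_within_ivl) auto
  then show "t \<in> {0..1} \<Longrightarrow> vector_derivative (\<lambda>t. u (g t)) (at t within {0..1}) = g' t *s cderiv u (g t)" .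
  have "continuous_on {0..1} (\<lambda>t. g' t *s cderiv u (g t))"
    by (intro continuous_intros g continuous_on_compose2[OF cderiv_continuous[OF u(1)] cg])
  then have "(\<lambda>t. u (g t)) C1_differentiable_on {0..1}"
    unfolding C1_differentiable_on_def using d
    by (intro exI[of _ "\<lambda>t. g' t *s cderiv u (g t)"]) auto
  then have vp: "valid_path (\<lambda>t. u (g t))"
    unfolding valid_path_def by (rule C1_differentiable_imp_piecewise)
  have "pcont 0 1 (\<lambda>t. \<omega> (u (g t)) (vector_derivative (\<lambda>t. u (g t)) (at t within {0..1})))"
    if \<omega>: "\<omega> \<in> smooth_forms E D" for \<omega>
  proof -
    obtain f h where fh: "local_rep U u \<omega> f h"
      using smooth_forms_rep[OF \<omega> u] by blast
    have "continuous_on {0..1} (\<lambda>t. f (g t) * g' t + h (g t) * cnj (g' t))"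
      using fh g(2,3) unfolding local_rep_def
      by (intro continuous_intros continuous_on_cnj continuous_on_compose2[OF smooth_fun_continuous cg]) auto
    then have "pcont 0 1 (\<lambda>t. f (g t) * g' t + h (g t) * cnj (g' t))"
      by (rule pcont_continuous)
    then show ?thesis
    proof (rule pcont_spike[of _ _ _ "{}"])
      fix t :: real assume "t \<in> {0..1} - {}"
      then have t: "t \<in> {0..1}" by simp
      then have "g t \<in> U" using g(3) by blast
      then show "\<omega> (u (g t)) (vector_derivative (\<lambda>t. u (g t)) (at t within {0..1})) =
          f (g t) * g' t + h (g t) * cnj (g' t)"
        using fh v[OF t] by (simp add: local_rep_def pull_def)
    qed simp
  qed
  moreover have "path_image (\<lambda>t. u (g t)) \<subseteq> Y"
    using u(2) g(3) by (auto simp: path_image_def)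
  ultimately show "nice (\<lambda>t. u (g t))"
    using vp by (simp add: nice_def)
qed

section \<open>Connectedness of the open curve\<close>

lemma local_coordinate_cover:
  assumes "local_coordinate E v w r u l m" and "0 < s" "s \<le> r"
  shows "\<exists>W. open W \<and> v \<in> W \<and> (\<forall>x\<in>W \<inter> cone E. dotc l x \<noteq> 0 \<and> dotc m x / dotc l x \<in> ball 0 s \<and>
           x = dotc l x *s u (dotc m x / dotc l x))"
  using assms by (simp add: local_coordinate_def)

text \<open>The normalisation \<open>l = 1\<close> makes the parameter a function of the projective
  point, and \<open>D\<close> has finitely many points.\<close>

lemma coordinate_meets_D_finite:
  assumes "local_coordinate E v w r u l m"
  shows "finite {z \<in> ball 0 r. u z \<in> D}" (is "finite ?S")
proof -
  have lm: "\<And>z. z \<in> ball 0 r \<Longrightarrow> dotc l (u z) = 1 \<and> dotc m (u z) = z"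
    using assms by (auto simp: local_coordinate_def)
  have "finite (pt ` D)"
    using divisor by (simp add: reduced_divisor_def)
  moreover have "inj_on (\<lambda>z. pt (u z)) ?S"
  proof (rule inj_onI)
    fix z z' assume z: "z \<in> ?S" "z' \<in> ?S" "pt (u z) = pt (u z')"
    then obtain c where c: "u z = c *s u z'"
      using pt_self[of "u z"] in_ptE by metis
    then have "dotc l (u z) = c * dotc l (u z')" "dotc m (u z) = c * dotc m (u z')"
      by (simp_all add: dotc_scale)
    moreover have "dotc l (u z) = 1" "dotc m (u z) = z" "dotc l (u z') = 1" "dotc m (u z') = z'"
      using lm[of z] lm[of z'] z(1,2) by simp_all
    ultimately show "z = z'" by simp
  qed
  moreover have "(\<lambda>z. pt (u z)) ` ?S \<subseteq> pt ` D"
    by blast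
  ultimately show ?thesis
    by (rule_tac finite_imageD[OF finite_subset])
qed

text \<open>The start is fixed as a vector, the end only as a projective point; rescaling the second
  path then makes the relation transitive.\<close>

definition reach :: "complex^'n \<Rightarrow> complex^'n \<Rightarrow> bool" where
  "reach x y \<longleftrightarrow> (\<exists>\<gamma>. nice \<gamma> \<and> pathstart \<gamma> = x \<and> pathfinish \<gamma> \<in> pt y)"

lemma reach_trans:
  assumes "reach x y" and "reach y z"
  shows "reach x z"
proof -
  obtain \<gamma>1 \<gamma>2 where 1: "nice \<gamma>1" "pathstart \<gamma>1 = x" "pathfinish \<gamma>1 \<in> pt y"
    and 2: "nice \<gamma>2" "pathstart \<gamma>2 = y" "pathfinish \<gamma>2 \<in> pt z"
    using assms unfolding reach_def by blast
  obtain c where c: "c \<noteq> 0" "pathfinish \<gamma>1 = c *s y"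
    using in_ptE[OF 1(3)] by blast
  obtain d where d: "d \<noteq> 0" "pathfinish \<gamma>2 = d *s z"
    using in_ptE[OF 2(3)] by blast
  let ?\<gamma> = "\<lambda>t. c *s \<gamma>2 t"
  have "pathstart ?\<gamma> = pathfinish \<gamma>1" "pathfinish ?\<gamma> = c *s (d *s z)"
    using 2 c d by (simp_all add: pathstart_def pathfinish_def)
  moreover from this have "pathfinish ?\<gamma> \<in> pt z"
    using c d unfolding pt_def vector_smult_assoc by auto
  ultimately show ?thesis
    unfolding reach_def using 1 2 c
    by (intro exI[of _ "\<gamma>1 +++ ?\<gamma>"]) (auto intro!: nice_join nice_scale)
qed

text \<open>A disc minus finitely many points is open and connected, so polynomial paths in it join
  any two points, and their images in the curve are nice. Here \<open>v\<close> may lie in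
  \<open>D\<close>; the last clause is density of \<open>Y\<close> at \<open>v\<close>, as a
  nonempty open set of parameters is infinite.\<close>

lemma reach_local:
  assumes v: "v \<in> cone E"
  obtains W where "open W" "v \<in> W" "\<And>x y. x \<in> W \<inter> Y \<Longrightarrow> y \<in> W \<inter> Y \<Longrightarrow> reach x y"
    "\<And>W'. open W' \<Longrightarrow> v \<in> W' \<Longrightarrow> W' \<inter> Y \<noteq> {}"
proof -
  obtain w where w: "w \<in> tangent E v" "\<forall>c. w \<noteq> c *s v"
    using tangent_direction[OF v] by blast
  obtain r u l m where lc: "local_coordinate E v w r u l m"
    using local_coordinate_exists[OF v w] by blast
  then have r: "0 < r" and ch: "chart E (ball 0 r) u" and u0: "u 0 = v"
    and lm: "\<And>z. z \<in> ball 0 r \<Longrightarrow> dotc l (u z) = 1 \<and> dotc m (u z) = z"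
    by (auto simp: local_coordinate_def)
  obtain W where W: "open W" "v \<in> W"
     "\<And>x. x \<in> W \<inter> cone E \<Longrightarrow> dotc l x \<noteq> 0 \<and> dotc m x / dotc l x \<in> ball 0 r \<and>
           x = dotc l x *s u (dotc m x / dotc l x)"
    using local_coordinate_cover[OF lc r order_refl] by metis
  define S where "S = {z \<in> ball 0 r. u z \<in> D}"
  have finS: "finite S"
    unfolding S_def by (rule coordinate_meets_D_finite[OF lc])
  define B where "B = ball 0 r - S"
  have opB: "open B"
    unfolding B_def using finS by (intro open_Diff finite_imp_closed) auto
  have conB: "connected B"
    unfolding B_def using finS by (intro connected_open_diff_countable) (auto simp: countable_finite)
  have uB: "u ` B \<subseteq> Y"
    using ch by (auto simp: B_def S_def open_part_def chart_def)
  have chB: "chart E B u"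
    by (rule chart_subset[OF ch opB]) (auto simp: B_def)
  have inB: "dotc m x / dotc l x \<in> B" if x: "x \<in> W \<inter> Y" for x
  proof -
    have *: "dotc l x \<noteq> 0" "dotc m x / dotc l x \<in> ball 0 r" "x = dotc l x *s u (dotc m x / dotc l x)"
      using W(3)[of x] x Y_cone by auto
    have "x \<notin> D" using x by (simp add: open_part_def)
    then have "u (dotc m x / dotc l x) \<notin> D"
      using * D_scale by metis
    then show ?thesis using *(2) by (simp add: B_def S_def)
  qed
  have reach: "reach x y" if x: "x \<in> W \<inter> Y" and y: "y \<in> W \<inter> Y" for x y
  proof -
    let ?zx = "dotc m x / dotc l x" and ?zy = "dotc m y / dotc l y"
    have x': "dotc l x \<noteq> 0" "x = dotc l x *s u ?zx"
      using W(3)[of x] x Y_cone by auto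
    have y': "dotc l y \<noteq> 0" "y = dotc l y *s u ?zy"
      using W(3)[of y] y Y_cone by auto
    obtain g where g: "polynomial_function g" "path_image g \<subseteq> B" "pathstart g = ?zx" "pathfinish g = ?zy"
      using connected_open_polynomial_connected[OF opB conB inB[OF x] inB[OF y]] by blast
    obtain g' where g': "polynomial_function g'" "\<And>t. (g has_vector_derivative g' t) (at t)"
      using has_vector_derivative_polynomial_function[OF g(1)] by blast
    have "nice (\<lambda>t. u (g t))"
      by (rule nice_chart_path[OF chB uB g'(2)])
        (use g(2) g'(1) in \<open>auto simp: path_image_def intro: continuous_on_polymonial_function\<close>)
    then have n: "nice (\<lambda>t. dotc l x *s u (g t))"
      using x'(1) by (intro nice_scale)
    have "pathstart (\<lambda>t. dotc l x *s u (g t)) = x"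
      using g(3) x'(2) by (simp add: pathstart_def)
    moreover have "pathfinish (\<lambda>t. dotc l x *s u (g t)) \<in> pt y"
    proof -
      have "pt y = pt (u ?zy)"
        using y' pt_scale by metis
      moreover have "pt (u ?zy) = pt (dotc l x *s u ?zy)"
        using x'(1) pt_scale by metis
      ultimately show ?thesis
        using g(4) pt_self by (simp add: pathfinish_def)
    qed
    ultimately show ?thesis
      unfolding reach_def using n by blast
  qed
  have ne: "W' \<inter> Y \<noteq> {}" if W': "open W'" "v \<in> W'" for W'
  proof -
    have "open (ball 0 r \<inter> u -` W')"
      by (intro continuous_open_preimage chart_continuous[OF ch] W' open_ball)
    moreover have "0 \<in> ball 0 r \<inter> u -` W'"
      using r u0 W' by simp
    ultimately have "infinite (ball 0 r \<inter> u -` W')"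
      using finite_imp_not_open by blast
    then have "ball 0 r \<inter> u -` W' - S \<noteq> {}"
      using finS by (metis finite.emptyI finite_Diff2)
    then obtain z where "z \<in> B" "u z \<in> W'"
      unfolding B_def by blast
    then show ?thesis using uB by blast
  qed
  show thesis
    by (rule that[OF W(1,2) reach ne])
qed

text \<open>Points of the full cone, including those over \<open>D\<close>, are sorted by whether
  the nearby points of \<open>Y\<close> can be reached. Both kinds form open sets that cover the
  connected cone, and by density of \<open>Y\<close> no point is of both kinds.\<close>

lemma reach_all:
  assumes y: "y \<in> Y" and x: "x \<in> Y"
  shows "reach y x"
proof -
  define OA where "OA = \<Union>{W. open W \<and> (\<forall>z\<in>W \<inter> Y. reach y z)}"
  define OB where "OB = \<Union>{W. open W \<and> (\<forall>z\<in>W \<inter> Y. \<not> reach y z)}"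
  have self: "reach y y"
    unfolding reach_def using nice_const[OF y] pt_self
    by (intro exI[of _ "\<lambda>t. y"]) (simp add: pathstart_def pathfinish_def)
  have cover: "v \<in> OA \<or> v \<in> OB" if v: "v \<in> cone E" for v
  proof -
    obtain W where W: "open W" "v \<in> W" "\<And>x y. x \<in> W \<inter> Y \<Longrightarrow> y \<in> W \<inter> Y \<Longrightarrow> reach x y"
      using reach_local[OF v] by metis
    show ?thesis
    proof (cases "\<exists>z\<in>W \<inter> Y. reach y z")
      case True
      then have "\<forall>z\<in>W \<inter> Y. reach y z"
        using W(3) reach_trans by blast
      then show ?thesis using W(1,2) by (auto simp: OA_def)
    next
      case False
      then show ?thesis using W(1,2) by (auto simp: OB_def)
    qed
  qed
  have disj: "OA \<inter> OB \<inter> cone E = {}"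
  proof (rule ccontr)
    assume "\<not> ?thesis"
    then obtain v W1 W2 where v: "v \<in> cone E" "open W1" "v \<in> W1" "\<forall>z\<in>W1 \<inter> Y. reach y z"
      "open W2" "v \<in> W2" "\<forall>z\<in>W2 \<inter> Y. \<not> reach y z"
      unfolding OA_def OB_def by blast
    obtain W where ne: "\<And>W'. open W' \<Longrightarrow> v \<in> W' \<Longrightarrow> W' \<inter> Y \<noteq> {}"
      using reach_local[OF v(1)] by metis
    have "W1 \<inter> W2 \<inter> Y \<noteq> {}"
      using v by (intro ne open_Int) auto
    then show False using v by blast
  qed
  have "connected (cone E)"
    using smooth_curve by (simp add: smooth_projective_curve_def)
  moreover have "open OA" "open OB"
    unfolding OA_def OB_def by auto
  ultimately have "OA \<inter> cone E = {} \<or> OB \<inter> cone E = {}"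
    using disj cover by (intro connectedD) auto
  moreover have "y \<in> OA"
  proof (rule ccontr)
    assume "y \<notin> OA"
    then have "y \<in> OB" using cover y Y_cone by blast
    then show False using self y unfolding OB_def by blast
  qed
  ultimately have "x \<notin> OB"
    using y x Y_cone by blast
  then have "x \<in> OA"
    using cover x Y_cone by blast
  then show ?thesis
    using x unfolding OA_def by blast
qed

section \<open>Forms without periods are exact\<close>

definition path_int :: "'n form \<Rightarrow> (real \<Rightarrow> complex^'n) \<Rightarrow> complex" where
  "path_int \<omega> \<gamma> = integral {0..1} (\<lambda>t. \<omega> (\<gamma> t) (vector_derivative \<gamma> (at t within {0..1})))"

text \<open>An artificial \<open>\<Omega>\<close> concentrated in degree 1. Its transport at a
  one-letter word is the line integral of \<open>\<omega>\<close>, so statements on transports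
  specialise to line integrals; the letter is arbitrary, hence the choice
  \<open>[zero_form]\<close>.\<close>

definition only_letter :: "'n form \<Rightarrow> 'n form list \<Rightarrow> 'n form" where
  "only_letter \<omega> ws = (if length ws = 1 then \<omega> else zero_form)"

lemma only_letter_smooth: "\<omega> \<in> smooth_forms E D \<Longrightarrow> only_letter \<omega> ws \<in> smooth_forms E D"
  by (simp add: only_letter_def smooth_zero)

lemma transport_single: "transport (along \<Omega> \<gamma>) 0 1 [x] = path_int (\<Omega> [x]) \<gamma>"
  by (simp add: transport_Cons along_def path_int_def)

lemma path_int_join:
  assumes "\<omega> \<in> smooth_forms E D" and "nice \<gamma>1" and "nice \<gamma>2" and "pathfinish \<gamma>1 = pathstart \<gamma>2"
  shows "path_int \<omega> (\<gamma>1 +++ \<gamma>2) = path_int \<omega> \<gamma>1 + path_int \<omega> \<gamma>2"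
  using fun_cong[OF nice_join_transport[where \<Omega> = "only_letter \<omega>", OF assms(2-4) only_letter_smooth[OF assms(1)]], where x = "[zero_form]"]
  by (simp add: t_mult_single transport_single only_letter_def)

lemma path_int_scale:
  assumes "\<omega> \<in> smooth_forms E D" and "nice \<gamma>" and "c \<noteq> 0"
  shows "path_int \<omega> (\<lambda>t. c *s \<gamma> t) = path_int \<omega> \<gamma>"
  using fun_cong[OF nice_scale_transport[where \<Omega> = "only_letter \<omega>", OF assms(2,3) only_letter_smooth[OF assms(1)]], where x = "[zero_form]"]
  by (simp add: transport_single only_letter_def)

definition primitive :: "'n form \<Rightarrow> complex^'n \<Rightarrow> complex^'n \<Rightarrow> complex" where
  "primitive \<omega> y x = path_int \<omega> (SOME \<gamma>. nice \<gamma> \<and> pathstart \<gamma> = y \<and> pathfinish \<gamma> \<in> pt x)"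

definition no_periods :: "'n form \<Rightarrow> complex^'n \<Rightarrow> bool" where
  "no_periods \<omega> y \<longleftrightarrow> (\<forall>\<gamma>. nice \<gamma> \<and> pathstart \<gamma> = y \<and> pathfinish \<gamma> \<in> pt y \<longrightarrow> path_int \<omega> \<gamma> = 0)"

text \<open>The scalar \<open>c\<close> is the one by which the end of the first lift differs from
  the start of the second.\<close>

lemma extend_path:
  assumes "nice \<gamma>1" and "pathfinish \<gamma>1 \<in> pt x" and "nice \<gamma>2" and "pathstart \<gamma>2 = x"
    and "pathfinish \<gamma>2 \<in> pt z"
  obtains c where "c \<noteq> 0" "nice (\<gamma>1 +++ (\<lambda>t. c *s \<gamma>2 t))" "nice (\<lambda>t. c *s \<gamma>2 t)"
    "pathfinish \<gamma>1 = pathstart (\<lambda>t. c *s \<gamma>2 t)"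
    "pathstart (\<gamma>1 +++ (\<lambda>t. c *s \<gamma>2 t)) = pathstart \<gamma>1" "pathfinish (\<gamma>1 +++ (\<lambda>t. c *s \<gamma>2 t)) \<in> pt z"
proof -
  obtain c where c: "c \<noteq> 0" "pathfinish \<gamma>1 = c *s x"
    using in_ptE[OF assms(2)] by blast
  obtain d where d: "d \<noteq> 0" "pathfinish \<gamma>2 = d *s z"
    using in_ptE[OF assms(5)] by blast
  let ?\<gamma> = "\<lambda>t. c *s \<gamma>2 t"
  have n: "nice ?\<gamma>" by (rule nice_scale[OF assms(3) c(1)])
  have e: "pathfinish \<gamma>1 = pathstart ?\<gamma>" "pathfinish ?\<gamma> = c *s (d *s z)"
    using assms c d by (simp_all add: pathstart_def pathfinish_def)
  then have "pathfinish ?\<gamma> \<in> pt z"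
    using c d unfolding pt_def vector_smult_assoc by auto
  then show thesis
    using that[OF c(1) nice_join[OF assms(1) n e(1)] n e(1)] by simp
qed

text \<open>Both paths are closed up by the same return path \<open>\<delta>\<close>, so both
  integrals are the negative of that along \<open>\<delta>\<close>.\<close>

lemma path_int_unique:
  assumes \<omega>: "\<omega> \<in> smooth_forms E D" and np: "no_periods \<omega> y" and y: "y \<in> Y" and x: "x \<in> Y"
    and 1: "nice \<gamma>1" "pathstart \<gamma>1 = y" "pathfinish \<gamma>1 \<in> pt x"
    and 2: "nice \<gamma>2" "pathstart \<gamma>2 = y" "pathfinish \<gamma>2 \<in> pt x"
  shows "path_int \<omega> \<gamma>1 = path_int \<omega> \<gamma>2"
proof -
  obtain \<delta> where d: "nice \<delta>" "pathstart \<delta> = x" "pathfinish \<delta> \<in> pt y"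
    using reach_all[OF x y] unfolding reach_def by blast
  have "path_int \<omega> \<gamma> + path_int \<omega> \<delta> = 0" if g: "nice \<gamma>" "pathstart \<gamma> = y" "pathfinish \<gamma> \<in> pt x" for \<gamma>
  proof (rule extend_path[OF g(1,3) d])
    fix c assume c: "c \<noteq> 0" "nice (\<gamma> +++ (\<lambda>t. c *s \<delta> t))" "nice (\<lambda>t. c *s \<delta> t)"
      "pathfinish \<gamma> = pathstart (\<lambda>t. c *s \<delta> t)"
      "pathstart (\<gamma> +++ (\<lambda>t. c *s \<delta> t)) = pathstart \<gamma>" "pathfinish (\<gamma> +++ (\<lambda>t. c *s \<delta> t)) \<in> pt y"
    have "path_int \<omega> (\<gamma> +++ (\<lambda>t. c *s \<delta> t)) = 0"
      using np c g(2) unfolding no_periods_def by blast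
    then show ?thesis
      using path_int_join[OF \<omega> g(1) c(3,4)] path_int_scale[OF \<omega> d(1) c(1)] by simp
  qed
  from this[OF 1] this[OF 2] show ?thesis
    by (metis add_right_cancel)
qed

lemma primitive_eq:
  assumes \<omega>: "\<omega> \<in> smooth_forms E D" and np: "no_periods \<omega> y" and y: "y \<in> Y" and x: "x \<in> Y"
    and g: "nice \<gamma>" "pathstart \<gamma> = y" "pathfinish \<gamma> \<in> pt x"
  shows "primitive \<omega> y x = path_int \<omega> \<gamma>"
proof -
  let ?g = "SOME \<gamma>. nice \<gamma> \<and> pathstart \<gamma> = y \<and> pathfinish \<gamma> \<in> pt x"
  have "nice ?g \<and> pathstart ?g = y \<and> pathfinish ?g \<in> pt x"
    by (rule someI[of _ \<gamma>]) (use g in auto)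
  then show ?thesis
    unfolding primitive_def using path_int_unique[OF \<omega> np y x _ _ _ g] by blast
qed

lemma primitive_scale: "c \<noteq> 0 \<Longrightarrow> primitive \<omega> y (c *s x) = primitive \<omega> y x"
  by (simp add: primitive_def pt_scale)

text \<open>Extend a path to \<open>u z\<close> by the image of the segment; the absence of periods
  makes the choice of the path immaterial.\<close>

lemma primitive_segment:
  assumes \<omega>: "\<omega> \<in> smooth_forms E D" and np: "no_periods \<omega> y" and y: "y \<in> Y"
    and u: "chart E U u" "u ` U \<subseteq> Y" and rep: "local_rep U u \<omega> f g"
    and seg: "closed_segment z z' \<subseteq> U"
  shows "primitive \<omega> y (u z') - primitive \<omega> y (u z) =
    integral {0..1} (\<lambda>t. f (linepath z z' t) * (z' - z) + g (linepath z z' t) * cnj (z' - z))"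
    and "continuous_on {0..1} (\<lambda>t. f (linepath z z' t) * (z' - z) + g (linepath z z' t) * cnj (z' - z))"
proof -
  have zU: "z \<in> U" "z' \<in> U" using seg by auto
  then have uY: "u z \<in> Y" "u z' \<in> Y" using u by auto
  have lp: "linepath z z' ` {0..1} \<subseteq> U"
    using seg by (simp add: linepath_image_01)
  have dl: "(linepath z z' has_vector_derivative (z' - z)) (at t)" for t
    by (rule has_vector_derivative_linepath_within)
  note n = nice_chart_path[OF u dl continuous_on_const lp]
  have fh: "smooth_fun U f" "smooth_fun U g"
    "\<And>z h. z \<in> U \<Longrightarrow> \<omega> (u z) (h *s cderiv u z) = f z * h + g z * cnj h"
    using rep by (auto simp: local_rep_def pull_def)
  show "continuous_on {0..1} (\<lambda>t. f (linepath z z' t) * (z' - z) + g (linepath z z' t) * cnj (z' - z))"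
    by (intro continuous_intros continuous_on_compose2[OF smooth_fun_continuous[OF fh(1)] _ lp]
        continuous_on_compose2[OF smooth_fun_continuous[OF fh(2)] _ lp])
  have "path_int \<omega> (\<lambda>t. u (linepath z z' t)) =
      integral {0..1} (\<lambda>t. f (linepath z z' t) * (z' - z) + g (linepath z z' t) * cnj (z' - z))"
    unfolding path_int_def
  proof (rule Henstock_Kurzweil_Integration.integral_cong)
    fix t :: real assume t: "t \<in> {0..1}"
    then have "linepath z z' t \<in> U" using lp by blast
    then show "\<omega> (u (linepath z z' t)) (vector_derivative (\<lambda>t. u (linepath z z' t)) (at t within {0..1})) =
        f (linepath z z' t) * (z' - z) + g (linepath z z' t) * cnj (z' - z)"
      unfolding n(2)[OF t] by (rule fh(3))
  qed
  moreover obtain \<gamma> where g: "nice \<gamma>" "pathstart \<gamma> = y" "pathfinish \<gamma> \<in> pt (u z)"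
    using reach_all[OF y uY(1)] unfolding reach_def by blast
  have "primitive \<omega> y (u z') = path_int \<omega> \<gamma> + path_int \<omega> (\<lambda>t. u (linepath z z' t))"
  proof (rule extend_path[OF g(1,3) n(1)])
    let ?\<delta> = "\<lambda>t. u (linepath z z' t)"
    show "pathstart ?\<delta> = u z" "pathfinish ?\<delta> \<in> pt (u z')"
      by (simp_all add: pathstart_def pathfinish_def linepath_def pt_self)
    fix c assume c: "c \<noteq> 0" "nice (\<gamma> +++ (\<lambda>t. c *s ?\<delta> t))" "nice (\<lambda>t. c *s ?\<delta> t)"
      "pathfinish \<gamma> = pathstart (\<lambda>t. c *s ?\<delta> t)"
      "pathstart (\<gamma> +++ (\<lambda>t. c *s ?\<delta> t)) = pathstart \<gamma>" "pathfinish (\<gamma> +++ (\<lambda>t. c *s ?\<delta> t)) \<in> pt (u z')"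
    have "primitive \<omega> y (u z') = path_int \<omega> (\<gamma> +++ (\<lambda>t. c *s ?\<delta> t))"
      by (rule primitive_eq[OF \<omega> np y uY(2) c(2) _ c(6)]) (use c g in simp)
    then show ?thesis
      using path_int_join[OF \<omega> g(1) c(3,4)] path_int_scale[OF \<omega> n(1) c(1)] by simp
  qed
  ultimately show "primitive \<omega> y (u z') - primitive \<omega> y (u z) =
      integral {0..1} (\<lambda>t. f (linepath z z' t) * (z' - z) + g (linepath z z' t) * cnj (z' - z))"
    using primitive_eq[OF \<omega> np y uY(1) g] by simp
qed

text \<open>The increment is an integral over a segment, along which continuity keeps each of the
  two coefficients within \<open>e / 2\<close> of its value at \<open>z\<close>.\<close>

lemma primitive_has_derivative:
  assumes \<omega>: "\<omega> \<in> smooth_forms E D" and np: "no_periods \<omega> y" and y: "y \<in> Y"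
    and u: "chart E U u" "u ` U \<subseteq> Y" and rep: "local_rep U u \<omega> f g" and z: "z \<in> U"
  shows "((\<lambda>x. primitive \<omega> y (u x)) has_derivative (\<lambda>h. f z * h + g z * cnj h)) (at z)"
  unfolding has_derivative_at_alt
proof (intro conjI allI impI)
  show "bounded_linear (\<lambda>h. f z * h + g z * cnj h)"
    by (intro bounded_linear_add bounded_linear_mult_right
        bounded_linear_compose[OF bounded_linear_mult_right bounded_linear_cnj])
  fix e :: real assume e: "e > 0"
  have opU: "open U" using u by (simp add: chart_def)
  have "isCont f z" "isCont g z"
    using rep smooth_fun_continuous opU z continuous_on_eq_continuous_at unfolding local_rep_def by blast+
  then obtain d1 d2 where d: "d1 > 0" "\<And>x. dist x z < d1 \<Longrightarrow> dist (f x) (f z) < e / 2"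
    "d2 > 0" "\<And>x. dist x z < d2 \<Longrightarrow> dist (g x) (g z) < e / 2"
    using e unfolding continuous_at_eps_delta by (metis half_gt_zero)
  obtain r where r: "r > 0" "ball z r \<subseteq> U" using opU z open_contains_ball by blast
  define \<delta> where "\<delta> = min r (min d1 d2)"
  have "norm (primitive \<omega> y (u x) - primitive \<omega> y (u z) - (f z * (x - z) + g z * cnj (x - z))) \<le> e * norm (x - z)"
    if x: "norm (x - z) < \<delta>" for x
  proof -
    have seg: "closed_segment z x \<subseteq> ball z \<delta>"
      using x d r by (intro closed_segment_subset) (auto simp: dist_norm norm_minus_commute \<delta>_def)
    moreover have "ball z \<delta> \<subseteq> ball z r"
      by (rule subset_ball) (simp add: \<delta>_def)
    ultimately have segU: "closed_segment z x \<subseteq> U" using r(2) by blast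
    let ?F = "\<lambda>t. f (linepath z x t) * (x - z) + g (linepath z x t) * cnj (x - z)"
    let ?c = "f z * (x - z) + g z * cnj (x - z)"
    note P = primitive_segment[OF \<omega> np y u rep segU]
    have "?F integrable_on {0..1}"
      by (intro integrable_continuous_interval P(2))
    then have "primitive \<omega> y (u x) - primitive \<omega> y (u z) - ?c = integral {0..1} (\<lambda>t. ?F t - ?c)"
      unfolding P(1) by (subst Henstock_Kurzweil_Integration.integral_diff) auto
    also have "norm \<dots> \<le> (e * norm (x - z)) * (1 - 0)"
    proof (rule integral_bound)
      show "continuous_on {0..1} (\<lambda>t. ?F t - ?c)"
        by (intro continuous_on_diff P(2) continuous_on_const)
      fix t :: real assume "t \<in> {0..1}"
      then have "linepath z x t \<in> ball z \<delta>"
        using seg linepath_image_01[of z x] by blast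
      then have f: "norm (f (linepath z x t) - f z) \<le> e / 2" and g: "norm (g (linepath z x t) - g z) \<le> e / 2"
        using d(2)[of "linepath z x t"] d(4)[of "linepath z x t"]
        by (auto simp: \<delta>_def dist_commute simp flip: dist_norm intro: less_imp_le)
      have "?F t - ?c = (f (linepath z x t) - f z) * (x - z) + (g (linepath z x t) - g z) * cnj (x - z)"
        by (simp add: algebra_simps)
      also have "norm \<dots> \<le> e / 2 * norm (x - z) + e / 2 * norm (cnj (x - z))"
        by (intro norm_triangle_mono order_trans[OF norm_mult_ineq] mult_right_mono f g norm_ge_zero)
      also have "\<dots> = e * norm (x - z)"
        by (simp del: complex_cnj_diff)
      finally show "norm (?F t - ?c) \<le> e * norm (x - z)" .
    qed simp
    finally show ?thesis by simp
  qed
  moreover have "\<delta> > 0" using d r by (simp add: \<delta>_def)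
  ultimately show "\<exists>d>0. \<forall>x. norm (x - z) < d \<longrightarrow>
      norm (primitive \<omega> y (u x) - primitive \<omega> y (u z) - (f z * (x - z) + g z * cnj (x - z))) \<le> e * norm (x - z)"
    by blast
qed

end

section \<open>Smoothness of the primitive\<close>

lemma has_partials_unique:
  assumes "has_partials f z a b" and "has_partials f z a' b'"
  shows "a = a'" and "b = b'"
proof -
  have *: "(\<lambda>h. of_real (Re h) * a + of_real (Im h) * b) = (\<lambda>h. of_real (Re h) * a' + of_real (Im h) * b')"
    using assms unfolding has_partials_def by (rule has_derivative_unique)
  show "a = a'" using fun_cong[OF *, of 1] by simp
  show "b = b'" using fun_cong[OF *, of \<i>] by simp
qed

lemma has_partials_cong:
  assumes "has_partials f z a b" and "open U" "z \<in> U" "\<And>x. x \<in> U \<Longrightarrow> f x = g x"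
  shows "has_partials g z a b"
  using assms has_derivative_transform_within_open unfolding has_partials_def by blast

text \<open>The mixed partial derivatives of a primitive of \<open>a dx + b dy\<close> are those of \<open>a\<close> and \<open>b\<close>; the two choices agree by closedness.\<close>

lemma smooth_fun_primitive:
  assumes opU: "open U" and A: "jet U A a" and B: "jet U B b"
    and \<Phi>: "\<And>z. z \<in> U \<Longrightarrow> has_partials \<Phi> z (a z) (b z)"
    and closed: "\<And>z. z \<in> U \<Longrightarrow> B (Suc 0) 0 z = A 0 (Suc 0) z"
  shows "smooth_fun U \<Phi>"
proof -
  have AB: "B (Suc i) 0 z = A i (Suc 0) z" if "z \<in> U" for i z
    using that
  proof (induction i arbitrary: z)
    case (Suc i)
    have "has_partials (A i (Suc 0)) z (B (Suc (Suc i)) 0 z) (B (Suc i) (Suc 0) z)"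
      by (rule has_partials_cong[OF jet_partials[OF B Suc.prems] opU Suc.prems Suc.IH])
    then show ?case
      using has_partials_unique(1)[OF _ jet_partials[OF A Suc.prems]] by blast
  qed (rule closed)
  \<comment> \<open>Pure derivatives in the real direction are read off from \<open>A\<close>, all
    those with a derivative in the imaginary direction from \<open>B\<close>; \<open>AB\<close>
    matches the two where they meet.\<close>
  define p where "p i j = (case j of 0 \<Rightarrow> (case i of 0 \<Rightarrow> \<Phi> | Suc i' \<Rightarrow> A i' 0) | Suc j' \<Rightarrow> B i j')" for i j
  have "jet U p \<Phi>"
    unfolding jet_def
  proof (intro conjI allI ballI)
    show "p 0 0 = \<Phi>" by (simp add: p_def)
    fix i j z assume z: "z \<in> U"
    show "has_partials (p i j) z (p (Suc i) j z) (p i (Suc j) z)"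
    proof (cases j)
      case (Suc j')
      then show ?thesis using jet_partials[OF B z] by (simp add: p_def)
    next
      case 0
      show ?thesis
      proof (cases i)
        case 0
        then show ?thesis
          using \<open>j = 0\<close> \<Phi>[OF z] A B by (simp add: p_def jet_def)
      next
        case (Suc i')
        then show ?thesis
          using \<open>j = 0\<close> jet_partials[OF A z, of i' 0] AB[OF z, of i'] by (simp add: p_def)
      qed
    qed
  qed
  then show ?thesis
    by (auto simp: smooth_fun_iff_jet)
qed

context curve
begin

lemma no_periods_exact:
  assumes \<omega>: "\<omega> \<in> smooth_forms E D" and cl: "closed_form E D \<omega>" and y: "y \<in> Y" and np: "no_periods \<omega> y"
  shows "\<omega> \<in> exact_forms E D"
proof -
  have "potential (primitive \<omega> y) \<omega>"
    unfolding potential_def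
  proof (intro conjI allI impI ballI)
    fix U u assume u: "chart E U u \<and> u ` U \<subseteq> Y"
    then have opU: "open U" by (simp add: chart_def)
    obtain f g where rep: "local_rep U u \<omega> f g"
      using smooth_forms_rep[OF \<omega> conjunct1[OF u] conjunct2[OF u]] by blast
    have pull: "pull u \<omega> z = (\<lambda>h. f z * h + g z * cnj h)" if "z \<in> U" for z
      using rep that by (simp add: local_rep_def fun_eq_iff)
    have der: "((\<lambda>x. primitive \<omega> y (u x)) has_derivative pull u \<omega> z) (at z)" if "z \<in> U" for z
      unfolding pull[OF that] by (rule primitive_has_derivative[OF \<omega> np y conjunct1[OF u] conjunct2[OF u] rep that])
    then show "\<And>z. z \<in> U \<Longrightarrow> ((\<lambda>x. primitive \<omega> y (u x)) has_derivative pull u \<omega> z) (at z)" .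
    obtain p q where p: "jet U p f" and q: "jet U q g"
      using rep by (auto simp: local_rep_def smooth_fun_iff_jet)
    \<comment> \<open>Jets of the two partial derivatives of the primitive: the form evaluated at
      \<open>h = 1\<close> is \<open>f + g\<close>, and at \<open>h =\<close> \<i> it is \<i> times
      \<open>f - g\<close>.\<close>
    define A where "A i j z = 1 * p i j z + 1 * q i j z" for i j z
    define B where "B i j z = \<i> * p i j z + (- \<i>) * q i j z" for i j z
    have A: "jet U A (\<lambda>z. f z + g z)" and B: "jet U B (\<lambda>z. \<i> * (f z - g z))"
      using jet_comb[OF p q, of 1 1] jet_comb[OF p q, of \<i> "- \<i>"] unfolding A_def[abs_def] B_def[abs_def]
      by (simp_all add: right_diff_distrib)
    show "smooth_fun U (\<lambda>z. primitive \<omega> y (u z))"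
    proof (rule smooth_fun_primitive[OF opU A B])
      fix z assume z: "z \<in> U"
      show "has_partials (\<lambda>z. primitive \<omega> y (u z)) z (f z + g z) (\<i> * (f z - g z))"
        unfolding has_partials_def using der[OF z] unfolding pull[OF z]
      proof (rule has_derivative_eq_rhs, intro ext)
        show "f z * h + g z * cnj h = of_real (Re h) * (f z + g z) + of_real (Im h) * (\<i> * (f z - g z))" for h
          by (simp add: complex_eq_iff algebra_simps)
      qed
      have "d_coeff u \<omega> z = \<i> * (p (Suc 0) 0 z - q (Suc 0) 0 z) - (p 0 (Suc 0) z + q 0 (Suc 0) z)"
      proof (rule d_coeff_eq[OF opU z])
        show "has_partials f z (p (Suc 0) 0 z) (p 0 (Suc 0) z)" "has_partials g z (q (Suc 0) 0 z) (q 0 (Suc 0) z)"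
          using jet_partials[OF p z, of 0 0] jet_partials[OF q z, of 0 0] p q by (simp_all add: jet_def)
      qed (simp add: pull)
      moreover have "d_coeff u \<omega> z = 0"
        using cl u z unfolding closed_form_def by blast
      ultimately show "B (Suc 0) 0 z = A 0 (Suc 0) z"
        by (simp add: A_def B_def algebra_simps)
    qed
  qed (simp add: primitive_scale)
  then show ?thesis
    unfolding exact_iff using \<omega> by blast
qed

end

section \<open>Density of the transports of loops\<close>

context curve
begin

definition loops :: "complex^'n \<Rightarrow> (real \<Rightarrow> complex^'n) set" where
  "loops y = {\<gamma>. nice \<gamma> \<and> pathstart \<gamma> = y \<and> pathfinish \<gamma> \<in> pt y}"

lemma Omega_smooth: "is_Omega F E D \<Omega> \<Longrightarrow> \<Omega> ws \<in> smooth_forms E D"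
  by (simp add: is_Omega_def A1_log_def)

lemma Omega_Nil: "is_Omega F E D \<Omega> \<Longrightarrow> \<Omega> [] = zero_form"
  by (simp add: is_Omega_def)

lemma along_T_hat: "is_Omega F E D \<Omega> \<Longrightarrow> along \<Omega> \<gamma> t \<in> T_hat F E D"
  by (simp add: is_Omega_def along_def)

lemma along_Nil: "is_Omega F E D \<Omega> \<Longrightarrow> along \<Omega> \<gamma> t [] = 0"
  by (simp add: Omega_Nil along_def zero_form_def)

lemma nice_T_hat:
  assumes "is_Omega F E D \<Omega>" and "nice \<gamma>"
  shows "transport (along \<Omega> \<gamma>) 0 1 \<in> T_hat F E D"
  by (rule transport_T_hat[OF nice_tpcont[OF assms(2) Omega_smooth[OF assms(1)]]])
    (auto simp: along_T_hat along_Nil assms)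

lemma form_sum_smooth_closed:
  assumes "finite B" and "\<And>\<beta>. \<beta> \<in> B \<Longrightarrow> \<beta> \<in> smooth_forms E D \<and> closed_form E D \<beta>"
  shows "form_sum B k \<in> smooth_forms E D \<and> closed_form E D (form_sum B k)"
  using assms
proof (induction B)
  case empty
  have "form_sum {} k = zero_form"
    by (simp add: form_sum_def zero_form_def)
  then show ?case using smooth_zero closed_zero by simp
next
  case (insert \<beta> B)
  have "form_sum (insert \<beta> B) k = (\<lambda>v w. k \<beta> * \<beta> v w + 1 * form_sum B k v w)"
    using insert.hyps by (simp add: form_sum_def)
  then show ?case
    using insert smooth_forms_comb[of \<beta> "form_sum B k" "k \<beta>" 1] closed_form_comb[of \<beta> "form_sum B k" "k \<beta>" 1]
    by simp
qed

lemma path_int_form_sum: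
  assumes "finite B" and "\<And>\<beta>. \<beta> \<in> B \<Longrightarrow> \<beta> \<in> smooth_forms E D" and "nice \<gamma>"
  shows "path_int (form_sum B k) \<gamma> = (\<Sum>\<beta>\<in>B. k \<beta> * path_int \<beta> \<gamma>)"
proof -
  have "(\<lambda>t. k \<beta> * \<beta> (\<gamma> t) (vector_derivative \<gamma> (at t within {0..1}))) integrable_on {0..1}" if "\<beta> \<in> B" for \<beta>
    using assms that by (intro integrable_on_mult_right pcont_integrable) (auto simp: nice_def)
  then show ?thesis
    unfolding path_int_def form_sum_def
    by (subst Henstock_Kurzweil_Integration.integral_sum) (use assms(1) in auto)
qed

text \<open>A relation between the degree 1 coefficients says that the corresponding combination of
  basis forms has no periods; it is then exact, and the basis is independent modulo exact forms even
  over the complex numbers.\<close>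

lemma loops_relation_free:
  assumes B: "real_basis_mod (exact_forms E D) (dR_R F E D) B" and \<Omega>: "\<And>\<beta>. \<beta> \<in> B \<Longrightarrow> \<Omega> [\<beta>] = \<beta>"
    and y: "y \<in> Y" and k: "\<And>\<gamma>. \<gamma> \<in> loops y \<Longrightarrow> (\<Sum>\<beta>\<in>B. k \<beta> * transport (along \<Omega> \<gamma>) 0 1 [\<beta>]) = 0"
  shows "\<forall>\<beta>\<in>B. k \<beta> = 0"
proof -
  have fin: "finite B" and BR: "B \<subseteq> dR_R F E D"
    using B by (auto simp: real_basis_mod_def)
  have sm: "\<beta> \<in> smooth_forms E D \<and> closed_form E D \<beta>" if "\<beta> \<in> B" for \<beta>
    using that BR dR_smooth dR_closed by blast
  have "no_periods (form_sum B k) y"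
    unfolding no_periods_def
  proof (intro allI impI)
    fix \<gamma> assume g: "nice \<gamma> \<and> pathstart \<gamma> = y \<and> pathfinish \<gamma> \<in> pt y"
    then have "(\<Sum>\<beta>\<in>B. k \<beta> * path_int \<beta> \<gamma>) = 0"
      using k[of \<gamma>] \<Omega> by (simp add: loops_def transport_single)
    then show "path_int (form_sum B k) \<gamma> = 0"
      using path_int_form_sum[OF fin] sm g by simp
  qed
  then have "form_sum B k \<in> exact_forms E D"
    using form_sum_smooth_closed[OF fin sm] no_periods_exact y by blast
  then show ?thesis
    by (rule real_basis_complex_independent[OF B])
qed

text \<open>The right factor belongs to the part traversed first, so the loop is
  \<open>\<delta>\<close> followed by a rescaled \<open>\<gamma>\<close>.\<close>

lemma loops_mult:
  assumes "\<gamma> \<in> loops y" and "\<delta> \<in> loops y" and \<Omega>: "\<And>ws. \<Omega> ws \<in> smooth_forms E D"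
  shows "\<exists>\<epsilon>\<in>loops y. transport (along \<Omega> \<epsilon>) 0 1 =
    t_mult (transport (along \<Omega> \<gamma>) 0 1) (transport (along \<Omega> \<delta>) 0 1)"
proof -
  have g: "nice \<gamma>" "pathstart \<gamma> = y" "pathfinish \<gamma> \<in> pt y" and d: "nice \<delta>" "pathstart \<delta> = y" "pathfinish \<delta> \<in> pt y"
    using assms by (auto simp: loops_def)
  show ?thesis
  proof (rule extend_path[OF d(1,3) g])
    fix c assume c: "c \<noteq> 0" "nice (\<delta> +++ (\<lambda>t. c *s \<gamma> t))" "nice (\<lambda>t. c *s \<gamma> t)"
      "pathfinish \<delta> = pathstart (\<lambda>t. c *s \<gamma> t)"
      "pathstart (\<delta> +++ (\<lambda>t. c *s \<gamma> t)) = pathstart \<delta>" "pathfinish (\<delta> +++ (\<lambda>t. c *s \<gamma> t)) \<in> pt y"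
    have "transport (along \<Omega> (\<delta> +++ (\<lambda>t. c *s \<gamma> t))) 0 1 =
        t_mult (transport (along \<Omega> \<gamma>) 0 1) (transport (along \<Omega> \<delta>) 0 1)"
      using nice_join_transport[OF d(1) c(3,4), of \<Omega>] nice_scale_transport[OF g(1) c(1), of \<Omega>] \<Omega> by simp
    moreover have "\<delta> +++ (\<lambda>t. c *s \<gamma> t) \<in> loops y"
      using c d by (simp add: loops_def)
    ultimately show ?thesis by blast
  qed
qed

text \<open>
  The conjugation by \<open>R\<close> is trivial for a base point on \<open>Y\<close>; at a tangential base point it is the
  regularised transport from a nearby point.
\<close>

lemma loops_density:
  assumes \<Omega>: "is_Omega F E D \<Omega>" and B: "real_basis_mod (exact_forms E D) (dR_R F E D) B"
    and \<Omega>B: "\<And>\<beta>. \<beta> \<in> B \<Longrightarrow> \<Omega> [\<beta>] = \<beta>" and y: "y \<in> Y"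
    and R: "R \<in> T_hat F E D" "R [] = 1"
    and lin: "\<And>s t a b. s \<in> T_hat F E D \<Longrightarrow> t \<in> T_hat F E D \<Longrightarrow> L (t_comb a s b t) = a * L s + b * L t"
    and Lloop: "\<And>\<gamma>. \<gamma> \<in> loops y \<Longrightarrow> L (t_mult R (t_mult (transport (along \<Omega> \<gamma>) 0 1) (t_inverse R))) = (0::complex)"
    and Lm: "\<And>t. t \<in> T_hat_ge F E D m \<Longrightarrow> L t = 0"
    and \<eta>: "\<eta> \<in> B"
  shows "dual_basis_elem F E D B \<eta> \<in> T_deg F E D 1" and "L (dual_basis_elem F E D B \<eta>) = 0"
proof -
  define R' where "R' = t_inverse R"
  have RR: "t_mult R R' = t_one" "t_mult R' R = t_one"
    using t_neumann_inverse[where t = R, OF R(2)] t_inverse_eq_neumann[where t = R, OF R(2)] by (simp_all add: R'_def)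
  have R': "R' \<in> T_hat F E D" "R' [] = 1"
    using T_hat_neumann[OF R(1)] t_inverse_eq_neumann[where t = R, OF R(2)] t_inverse_low(1)[where t = R, OF R(2)]
    by (simp_all add: R'_def)
  let ?T = "\<lambda>\<gamma>. transport (along \<Omega> \<gamma>) 0 1"
  define S where "S = (\<lambda>\<gamma>. t_mult R (t_mult (?T \<gamma>) R')) ` loops y"
  have sm: "\<And>ws. \<Omega> ws \<in> smooth_forms E D"
    by (rule Omega_smooth[OF \<Omega>])
  have fin: "finite B"
    using B by (simp add: real_basis_mod_def)
  have span: "spans_classes F E D B"
    by (rule real_basis_spans_classes[OF B])
  have const: "(\<lambda>t. y) \<in> loops y"
    using nice_const[OF y] pt_self by (simp add: loops_def pathstart_def pathfinish_def)
  have ST: "S \<subseteq> T_hat F E D"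
    using nice_T_hat[OF \<Omega>] R R' by (auto simp: S_def loops_def intro!: T_hat_mult)
  have S1: "t_one \<in> S"
    unfolding S_def using const_transport[OF y sm, of 0 1] RR
    by (intro image_eqI[OF _ const]) simp
  have SNil: "s [] = 1" if "s \<in> S" for s
    using that R R' by (auto simp: S_def)
  have Smult: "t_mult s t \<in> S" if "s \<in> S" "t \<in> S" for s t
  proof -
    from that(1) obtain \<gamma> where g: "s = t_mult R (t_mult (?T \<gamma>) R')" "\<gamma> \<in> loops y"
      unfolding S_def by (rule imageE)
    from that(2) obtain \<delta> where d: "t = t_mult R (t_mult (?T \<delta>) R')" "\<delta> \<in> loops y"
      unfolding S_def by (rule imageE)
    have "\<exists>\<epsilon>\<in>loops y. ?T \<epsilon> = t_mult (?T \<gamma>) (?T \<delta>)"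
      by (rule loops_mult[OF g(2) d(2) sm])
    then obtain \<epsilon> where e: "\<epsilon> \<in> loops y" "?T \<epsilon> = t_mult (?T \<gamma>) (?T \<delta>)" ..
    have "t_mult s t = t_mult R (t_mult (?T \<gamma>) (t_mult (t_mult R' R) (t_mult (?T \<delta>) R')))"
      unfolding g(1) d(1) t_mult_assoc ..
    then have "t_mult s t = t_mult R (t_mult (?T \<epsilon>) R')"
      unfolding RR e(2) t_mult_assoc by simp
    then show ?thesis
      unfolding S_def using e(1) by blast
  qed
  have free: "relation_free S B"
    unfolding relation_free_def
  proof (intro allI impI)
    fix k assume k: "\<forall>s\<in>S. (\<Sum>\<beta>\<in>B. k \<beta> * s [\<beta>]) = 0"
    \<comment> \<open>Conjugation by \<open>R\<close> does not change degree 1 coefficients, because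
      those of \<open>R\<close> and of its inverse cancel.\<close>
    have RR1: "R [\<beta>] + R' [\<beta>] = 0" for \<beta>
      using fun_cong[OF RR(1), of "[\<beta>]"] R R' by (simp add: t_mult_single add.commute)
    have "t_mult R (t_mult (?T \<gamma>) R') [\<beta>] = R [\<beta>] + R' [\<beta>] + ?T \<gamma> [\<beta>]" for \<gamma> \<beta>
      using R R' by (simp add: t_mult_single)
    then have eq: "t_mult R (t_mult (?T \<gamma>) R') [\<beta>] = ?T \<gamma> [\<beta>]" for \<gamma> \<beta>
      by (simp add: RR1)
    show "\<forall>\<beta>\<in>B. k \<beta> = 0"
    proof (rule loops_relation_free[OF B \<Omega>B y])
      fix \<gamma> assume "\<gamma> \<in> loops y"
      then have "(\<Sum>\<beta>\<in>B. k \<beta> * t_mult R (t_mult (?T \<gamma>) R') [\<beta>]) = 0"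
        using k unfolding S_def by blast
      then show "(\<Sum>\<beta>\<in>B. k \<beta> * ?T \<gamma> [\<beta>]) = 0"
        unfolding eq .
    qed
  qed
  have LS: "L s = 0" if "s \<in> S" for s
    using that Lloop by (auto simp: S_def R'_def)
  obtain e where e: "e \<in> tensor_span S" "\<And>\<beta>. \<beta> \<in> B \<Longrightarrow> e [\<beta>] = (if \<beta> = \<eta> then 1 else 0)"
    using dual_elements[where S = S and B = B and f = "\<lambda>\<beta>. if \<beta> = \<eta> then 1 else 0", OF fin S1 _ free] SNil by blast
  have "e \<in> T_hat F E D"
    using e(1) by induction (use ST in \<open>auto intro: T_hat_comb\<close>)
  then show deg: "dual_basis_elem F E D B \<eta> \<in> T_deg F E D 1"
    by (rule dual_basis_elem_T_deg[OF span _ e(2)])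
  show "L (dual_basis_elem F E D B \<eta>) = 0"
    by (rule density[where L = L and S = S and m = m, OF fin span ST S1])
      (use SNil Smult free lin LS Lm deg in \<open>auto simp: T_deg_def\<close>)
qed

end

section \<open>Complex conjugation of paths\<close>

definition real_form :: "'n::finite form \<Rightarrow> bool" where
  "real_form \<omega> \<longleftrightarrow> (\<forall>v w. \<omega> (F_inf v) (F_inf w) = cnj (\<omega> v w))"

text \<open>Off a finite set the conjugate path has the conjugate velocity, on which a real letter
  takes its conjugate value. The result is also the complex conjugate of the integral along
  \<open>\<gamma>\<close>, but written with conjugate letters it is a coefficient of the same tensor
  and depends on it complex linearly.\<close>

lemma iter_int_F_inf:
  assumes "valid_path \<gamma>" and "\<forall>\<omega>\<in>set \<omega>s. real_form \<omega>" and "s \<le> 1"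
  shows "iter_int (F_inf \<circ> \<gamma>) \<omega>s s = iter_int \<gamma> (map conj_form \<omega>s) s"
  using assms(2,3)
proof (induction \<omega>s arbitrary: s)
  case (Cons \<omega> \<omega>s)
  obtain S where S: "finite S"
    "\<And>t. t \<in> {0..1} - S \<Longrightarrow> (\<gamma> has_vector_derivative vector_derivative \<gamma> (at t within {0..1})) (at t)"
    using valid_path_derivative[OF assms(1)] by blast
  have "integral {0..s} (\<lambda>t. \<omega> ((F_inf \<circ> \<gamma>) t) (vector_derivative (F_inf \<circ> \<gamma>) (at t within {0..1})) *
          iter_int (F_inf \<circ> \<gamma>) \<omega>s t) =
      integral {0..s} (\<lambda>t. conj_form \<omega> (\<gamma> t) (vector_derivative \<gamma> (at t within {0..1})) *
          iter_int \<gamma> (map conj_form \<omega>s) t)"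
  proof (rule integral_spike[OF negligible_finite[OF S(1)]])
    fix t assume t: "t \<in> {0..s} - S"
    then have t1: "t \<in> {0..1} - S" using Cons.prems by auto
    have "((F_inf \<circ> \<gamma>) has_vector_derivative F_inf (vector_derivative \<gamma> (at t within {0..1}))) (at t)"
      unfolding o_def by (rule bounded_linear.has_vector_derivative[OF bounded_linear_F_inf S(2)[OF t1]])
    then have "vector_derivative (F_inf \<circ> \<gamma>) (at t within {0..1}) = F_inf (vector_derivative \<gamma> (at t within {0..1}))"
      using t1 by (intro vector_derivative_at_within_ivl) auto
    moreover have "iter_int (F_inf \<circ> \<gamma>) \<omega>s t = iter_int \<gamma> (map conj_form \<omega>s) t"
      by (rule Cons.IH) (use Cons.prems t in auto)
    moreover have "\<omega> (F_inf v) (F_inf w) = conj_form \<omega> v w" for v w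
      using Cons.prems(1) by (simp add: real_form_def conj_form_def)
    ultimately show "conj_form \<omega> (\<gamma> t) (vector_derivative \<gamma> (at t within {0..1})) * iter_int \<gamma> (map conj_form \<omega>s) t =
        \<omega> ((F_inf \<circ> \<gamma>) t) (vector_derivative (F_inf \<circ> \<gamma>) (at t within {0..1})) * iter_int (F_inf \<circ> \<gamma>) \<omega>s t"
      by (simp only: comp_apply)
  qed
  then show ?case
    unfolding iter_int.simps list.map .
qed simp

lemma T_upto_Nil [simp]: "T_upto \<Omega> \<gamma> s [] = 1"
  by (simp add: T_upto_def flip: splittings_def)

lemma T_upto_single: "T_upto \<Omega> \<gamma> s [x] = iter_int \<gamma> [\<Omega> [x]] s"
  by (simp add: T_upto_def splittings_Cons flip: splittings_def)

lemma T_upto_pair: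
  "T_upto \<Omega> \<gamma> s [x, y] = iter_int \<gamma> [\<Omega> [x], \<Omega> [y]] s + iter_int \<gamma> [\<Omega> [x, y]] s"
proof -
  have "splittings [x, y] = {[[x], [y]], [[x, y]]}"
    by (auto simp: splittings_Cons atMost_Suc)
  then show ?thesis
    by (simp add: T_upto_def flip: splittings_def)
qed

lemma iter_int_zero_form: "iter_int \<gamma> [zero_form] s = 0"
  by (simp add: zero_form_def)

text \<open>What the two cases have in common. The condition is symmetric under conjugating both
  forms, so the holomorphic and the antiholomorphic case are treated at once.\<close>

definition same_type :: "('n::finite form list \<Rightarrow> 'n form) \<Rightarrow> 'n form \<Rightarrow> 'n form \<Rightarrow> bool" where
  "same_type \<Omega> \<omega> \<omega>' \<longleftrightarrow> real_form \<omega> \<and> real_form \<omega>' \<and> \<Omega> [\<omega>] = \<omega> \<and> \<Omega> [\<omega>'] = \<omega>' \<and>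
     \<Omega> [conj_form \<omega>] = conj_form \<omega> \<and> \<Omega> [conj_form \<omega>'] = conj_form \<omega>' \<and>
     \<Omega> [\<omega>, \<omega>'] = zero_form \<and> \<Omega> [conj_form \<omega>, conj_form \<omega>'] = zero_form"

lemma same_type_T_upto:
  assumes "same_type \<Omega> \<omega> \<omega>'" and "valid_path \<gamma>" and "s \<le> 1"
  shows "T_upto \<Omega> (F_inf \<circ> \<gamma>) s [\<omega>] = T_upto \<Omega> \<gamma> s [conj_form \<omega>]"
    and "T_upto \<Omega> (F_inf \<circ> \<gamma>) s [\<omega>'] = T_upto \<Omega> \<gamma> s [conj_form \<omega>']"
    and "T_upto \<Omega> (F_inf \<circ> \<gamma>) s [\<omega>, \<omega>'] = T_upto \<Omega> \<gamma> s [conj_form \<omega>, conj_form \<omega>']"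
proof -
  have st: "real_form \<omega>" "real_form \<omega>'" "\<Omega> [\<omega>] = \<omega>" "\<Omega> [\<omega>'] = \<omega>'"
     "\<Omega> [conj_form \<omega>] = conj_form \<omega>" "\<Omega> [conj_form \<omega>'] = conj_form \<omega>'"
     "\<Omega> [\<omega>, \<omega>'] = zero_form" "\<Omega> [conj_form \<omega>, conj_form \<omega>'] = zero_form"
    using assms(1) by (simp_all add: same_type_def)
  note I = iter_int_F_inf[OF assms(2) _ assms(3)]
  show "T_upto \<Omega> (F_inf \<circ> \<gamma>) s [\<omega>] = T_upto \<Omega> \<gamma> s [conj_form \<omega>]"
    using I[of "[\<omega>]"] st by (simp only: T_upto_single) simp
  show "T_upto \<Omega> (F_inf \<circ> \<gamma>) s [\<omega>'] = T_upto \<Omega> \<gamma> s [conj_form \<omega>']"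
    using I[of "[\<omega>']"] st by (simp only: T_upto_single) simp
  show "T_upto \<Omega> (F_inf \<circ> \<gamma>) s [\<omega>, \<omega>'] = T_upto \<Omega> \<gamma> s [conj_form \<omega>, conj_form \<omega>']"
    unfolding T_upto_pair st iter_int_zero_form using I[of "[\<omega>, \<omega>']"] st(1,2) by simp
qed

context curve
begin

text \<open>The part of the argument shared by both kinds of base point. They differ only in
  \<open>R\<close> and in how the identity \<open>loop\<close> between the coefficients at
  \<open>[\<omega>, \<omega>']\<close> and at \<open>[\<rho>, \<rho>']\<close> is obtained.\<close>

lemma phi_12_vanishes:
  assumes \<Omega>: "is_Omega F E D \<Omega>" and B: "real_basis_mod (exact_forms E D) (dR_R F E D) B"
    and \<Omega>B: "\<And>\<beta>. \<beta> \<in> B \<Longrightarrow> \<Omega> [\<beta>] = \<beta>" and y: "y \<in> Y"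
    and R: "R \<in> T_hat F E D" "R [] = 1" and \<phi>: "is_phi_inf F E D \<Omega> b \<phi>"
    and loop: "\<And>\<gamma>. \<gamma> \<in> loops y \<Longrightarrow>
      \<phi> (t_mult R (t_mult (transport (along \<Omega> \<gamma>) 0 1) (t_inverse R))) [\<omega>, \<omega>'] =
      t_mult R (t_mult (transport (along \<Omega> \<gamma>) 0 1) (t_inverse R)) [\<rho>, \<rho>']"
    and \<eta>: "\<eta> \<in> B"
  shows "pairing [\<omega>, \<omega>'] (phi_12 \<phi> (dual_basis_elem F E D B \<eta>)) = 0"
proof -
  define L where "L t = \<phi> t [\<omega>, \<omega>'] - t [\<rho>, \<rho>']" for t
  have \<phi>lin: "\<phi> (t_comb a s c t) = t_comb a (\<phi> s) c (\<phi> t)" if "s \<in> T_hat F E D" "t \<in> T_hat F E D" for s t a c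
    using \<phi> that by (simp add: is_phi_inf_def)
  have lin: "L (t_comb a s c t) = a * L s + c * L t" if "s \<in> T_hat F E D" "t \<in> T_hat F E D" for s t a c
    unfolding L_def \<phi>lin[OF that] by (simp add: t_comb_def algebra_simps)
  obtain m where m: "\<phi> ` T_hat_ge F E D m \<subseteq> T_hat_ge F E D 3"
    using \<phi> unfolding is_phi_inf_def by blast
  \<comment> \<open>Degree at least \<open>m\<close> puts the image under \<open>\<phi>\<close> into
    degree at least 3, where it vanishes on pairs; the bound 3 on \<open>t\<close> itself does the
    same for the second term of \<open>L\<close>.\<close>
  have Lm: "L t = 0" if t: "t \<in> T_hat_ge F E D (max m 3)" for t
  proof -
    have "t \<in> T_hat_ge F E D m" "t \<in> T_hat_ge F E D 3"
      using t by (auto simp: T_hat_ge_def)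
    then have "\<phi> t [\<omega>, \<omega>'] = 0" "t [\<rho>, \<rho>'] = 0"
      using m by (auto simp: T_hat_ge_def)
    then show ?thesis by (simp add: L_def)
  qed
  have Lloop: "L (t_mult R (t_mult (transport (along \<Omega> \<gamma>) 0 1) (t_inverse R))) = 0" if "\<gamma> \<in> loops y" for \<gamma>
    using loop[OF that] by (simp add: L_def)
  have L: "L (dual_basis_elem F E D B \<eta>) = 0"
    by (rule loops_density(2)[where L = L and R = R and m = "max m 3", OF \<Omega> B])
      (use \<Omega>B y R lin Lloop Lm \<eta> in auto)
  have deg: "dual_basis_elem F E D B \<eta> \<in> T_deg F E D 1"
    by (rule loops_density(1)[where L = L and R = R and m = "max m 3", OF \<Omega> B])
      (use \<Omega>B y R lin Lloop Lm \<eta> in auto)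
  have "dual_basis_elem F E D B \<eta> [\<rho>, \<rho>'] = 0"
    using deg by (simp add: T_deg_def)
  then show ?thesis
    using L by (simp add: L_def pairing_def phi_12_def deg_part_def)
qed

text \<open>At a point of \<open>Y\<close> nothing has to be regularised, so \<open>R\<close> is
  \<open>t_one\<close>.\<close>

lemma phi_12_vanishes_point:
  assumes \<Omega>: "is_Omega F E D \<Omega>" and B: "real_basis_mod (exact_forms E D) (dR_R F E D) B"
    and \<Omega>B: "\<And>\<beta>. \<beta> \<in> B \<Longrightarrow> \<Omega> [\<beta>] = \<beta>" and v: "v \<in> Y"
    and \<phi>: "is_phi_inf F E D \<Omega> (Point v) \<phi>" and st: "same_type \<Omega> \<omega> \<omega>'" and \<eta>: "\<eta> \<in> B"
  shows "pairing [\<omega>, \<omega>'] (phi_12 \<phi> (dual_basis_elem F E D B \<eta>)) = 0"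
proof (rule phi_12_vanishes[OF \<Omega> B \<Omega>B v T_hat_one _ \<phi> _ \<eta>])
  fix \<gamma> assume g: "\<gamma> \<in> loops v"
  then have n: "nice \<gamma>" by (simp add: loops_def)
  have "loop_at E D v \<gamma>"
    using g pt_self by (auto simp: loop_at_def loops_def nice_def)
  then have "\<phi> (T_upto \<Omega> \<gamma> 1) = T_upto \<Omega> (F_inf \<circ> \<gamma>) 1"
    using \<phi> by (simp add: is_phi_inf_def)
  moreover have "T_upto \<Omega> \<gamma> 1 = transport (along \<Omega> \<gamma>) 0 1"
    using T_upto_eq_transport[OF nice_tpcont[OF n Omega_smooth[OF \<Omega>]]] by (intro ext) simp
  ultimately have "\<phi> (transport (along \<Omega> \<gamma>) 0 1) [\<omega>, \<omega>'] = transport (along \<Omega> \<gamma>) 0 1 [conj_form \<omega>, conj_form \<omega>']"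
    using same_type_T_upto(3)[OF st, of \<gamma> 1] n by (simp add: nice_def)
  moreover have "t_inverse t_one = (t_one :: 'n tensor)"
    by (rule t_inverse_unique) simp_all
  ultimately show "\<phi> (t_mult t_one (t_mult (transport (along \<Omega> \<gamma>) 0 1) (t_inverse t_one))) [\<omega>, \<omega>'] =
      t_mult t_one (t_mult (transport (along \<Omega> \<gamma>) 0 1) (t_inverse t_one)) [conj_form \<omega>, conj_form \<omega>']"
    by simp
qed simp_all

lemma adapted_same_type:
  assumes B: "adapted_basis F E D Bh Bah Be" and \<Omega>: "Omega_compatible \<Omega> Bh Bah Be"
    and \<omega>: "\<omega> \<in> Bh \<and> \<omega>' \<in> Bh \<or> \<omega> \<in> Bah \<and> \<omega>' \<in> Bah"
  shows "same_type \<Omega> \<omega> \<omega>'"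
proof -
  have Bh: "real_basis_mod {zero_form} (lin_span \<real> (algebraic_forms F E D (cone E))) Bh"
    and Bah: "Bah = conj_form ` Bh"
    using B by (auto simp: adapted_basis_def)
  have real_h: "real_form \<alpha>" if "\<alpha> \<in> Bh" for \<alpha>
    unfolding real_form_def
  proof (intro allI)
    fix v w
    have "cnj (\<alpha> (F_inf v) (F_inf w)) = \<alpha> v w"
      using fun_cong[OF fun_cong[OF real_basis_holomorphic(2)[OF Bh that], of v], of w] by (simp add: conj_inf_def)
    then show "\<alpha> (F_inf v) (F_inf w) = cnj (\<alpha> v w)"
      by (metis complex_cnj_cnj)
  qed
  have real_ah: "real_form \<alpha>" if "\<alpha> \<in> Bah" for \<alpha>
    using that real_h by (auto simp: Bah real_form_def conj_form_def)
  have cc: "conj_form (conj_form \<alpha>) = \<alpha>" for \<alpha> :: "'n form"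
    by (simp add: conj_form_def)
  have conj: "\<alpha> \<in> Bh \<Longrightarrow> conj_form \<alpha> \<in> Bah" "\<alpha> \<in> Bah \<Longrightarrow> conj_form \<alpha> \<in> Bh" for \<alpha>
    using cc by (auto simp: Bah)
  show ?thesis
    using \<omega> \<Omega> real_h real_ah conj unfolding same_type_def Omega_compatible_def by blast
qed

end

section \<open>Residues\<close>

text \<open>The coefficients of \<open>dz\<close> and of its conjugate are separated by testing on 1
  and on \<i>.\<close>

lemma complex_linear_part:
  assumes "\<And>h. a * h + b * cnj h = a' * h + b' * cnj h"
  shows "a = a'"
proof -
  have "a + b = a' + b'" "a * \<i> + b * cnj \<i> = a' * \<i> + b' * cnj \<i>"
    using assms[of 1] assms[of \<i>] by simp_all
  then have "\<i> * (a - b) = \<i> * (a' - b')"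
    by (simp add: algebra_simps)
  then have "a - b = a' - b'"
    by simp
  with \<open>a + b = a' + b'\<close> show ?thesis
    by (simp add: complex_eq_iff)
qed

lemma chart_dotc_deriv:
  assumes "chart E U u" and "z \<in> U"
  shows "((\<lambda>z. dotc l (u z)) has_field_derivative dotc l (cderiv u z)) (at z)"
proof -
  have "((\<lambda>z. dotc l (u z)) has_derivative (\<lambda>h. dotc l (h *s cderiv u z))) (at z)"
    using has_derivative_compose[OF chart_has_derivative[OF assms] dotc_cgrad[unfolded cgrad_eq_dotc]] .
  then show ?thesis
    by (simp add: has_field_derivative_def dotc_scale mult_commute_abs)
qed

lemma ratio_tendsto:
  assumes "(\<tau> has_field_derivative d) (at 0)" and "\<tau> 0 = 0"
  shows "((\<lambda>z. \<tau> z / z) \<longlongrightarrow> d) (at (0::complex))"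
  using assms by (simp add: has_field_derivative_iff)

context curve
begin

lemma local_coordinate_shrink:
  "local_coordinate E v w r u l m \<Longrightarrow> 0 < s \<Longrightarrow> s \<le> r \<Longrightarrow> local_coordinate E v w s u l m"
  unfolding local_coordinate_def
  by (auto intro: chart_subset[of E "ball 0 r"] subset_ball)

lemma centred_coordinate_exists:
  assumes v: "v \<in> D" and w: "w \<in> tangent E v" "\<forall>c. w \<noteq> c *s v"
  shows "\<exists>r u l m. local_coordinate E v w r u l m \<and> centred_chart E D v (ball 0 r) u \<and> r < 1"
proof -
  obtain r u l m where lc: "local_coordinate E v w r u l m"
    using local_coordinate_exists w v D_cone by blast
  define S where "S = {z \<in> ball 0 r. u z \<in> D} - {0}"
  have "finite S"
    unfolding S_def using coordinate_meets_D_finite[OF lc] by simp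
  moreover have "0 \<notin> S" by (simp add: S_def)
  ultimately obtain d where d: "d > 0" "\<forall>z\<in>S. z \<noteq> 0 \<longrightarrow> d \<le> dist 0 z"
    using finite_set_avoid by blast
  \<comment> \<open>The radius avoids the other points of \<open>D\<close>. The bound 1/2 keeps it
    below 1, as required to run along the ray with \<open>q = 1 - t\<close> inside the unit
    interval.\<close>
  define s where "s = min (min d r) (1/2)"
  have r: "0 < r" using lc by (simp add: local_coordinate_def)
  then have s: "0 < s" "s \<le> r" "s < 1" using d by (auto simp: s_def)
  have lc': "local_coordinate E v w s u l m"
    by (rule local_coordinate_shrink[OF lc s(1,2)])
  have "u z \<notin> D" if z: "z \<in> ball 0 s - {0}" for z
  proof
    assume "u z \<in> D"
    then have "z \<in> S" using z s by (auto simp: S_def)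
    then have "d \<le> norm z" using d z by auto
    then show False using z by (simp add: s_def)
  qed
  then have "centred_chart E D v (ball 0 s) u"
    using lc' pt_self s(1) by (simp add: centred_chart_def local_coordinate_def)
  then show ?thesis using lc' s(3) by blast
qed

lemma centred_Y:
  assumes "centred_chart E D v U u" and "z \<in> U" "z \<noteq> 0"
  shows "u z \<in> Y"
  using assms by (auto simp: centred_chart_def chart_def open_part_def)

text \<open>Two centred charts differ by a change of coordinate \<open>\<tau>\<close> and a scaling of the lift.\<close>

lemma residue_chart_independent:
  assumes vD: "v \<in> D" and lc: "local_coordinate E v w r u0 l m" and c0: "centred_chart E D v (ball 0 r) u0"
    and rep0: "log_rep (ball 0 r) u0 \<omega> f0 g0" and \<omega>: "\<omega> \<in> one_forms E D"
    and c: "centred_chart E D v U u" and rep: "log_rep U u \<omega> f g"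
  shows "f 0 = f0 0"
proof -
  have r: "0 < r" and ch0: "chart E (ball 0 r) u0" and u00: "u0 0 = v"
    and lm0: "\<And>z. z \<in> ball 0 r \<Longrightarrow> dotc l (u0 z) = 1 \<and> dotc m (u0 z) = z"
    using lc by (auto simp: local_coordinate_def)
  have lv: "dotc l v = 1" and mv: "dotc m v = 0"
    using lm0[of 0] r u00 by auto
  have ch: "chart E U u" and U0: "0 \<in> U" and opU: "open U"
    using c by (auto simp: centred_chart_def chart_def)
  obtain \<kappa> where \<kappa>: "\<kappa> \<noteq> 0" "u 0 = \<kappa> *s v"
    using c in_ptE[of "u 0" v] by (auto simp: centred_chart_def)
  obtain W where W: "open W" "v \<in> W"
    "\<And>x. x \<in> W \<inter> cone E \<Longrightarrow> dotc l x \<noteq> 0 \<and> dotc m x / dotc l x \<in> ball 0 r \<and>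
       x = dotc l x *s u0 (dotc m x / dotc l x)"
    using local_coordinate_cover[OF lc r order_refl] by metis
  define a where "a z = dotc l (u z)" for z
  define \<tau> where "\<tau> z = dotc m (u z) / a z" for z
  define V where "V = U \<inter> (\<lambda>z. (1 / \<kappa>) *s u z) -` W"
  have opV: "open V"
    unfolding V_def by (intro continuous_open_preimage opU W(1) continuous_intros chart_continuous[OF ch])
  have V0: "0 \<in> V"
    using U0 W(2) \<kappa> by (simp add: V_def vector_smult_assoc)
  have VU: "V \<subseteq> U" by (auto simp: V_def)
  have fact: "a z \<noteq> 0 \<and> \<tau> z \<in> ball 0 r \<and> u z = a z *s u0 (\<tau> z)" if z: "z \<in> V" for z
  proof -
    let ?x = "(1 / \<kappa>) *s u z"
    have "u z \<in> cone E" using ch z VU by (auto simp: chart_def)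
    then have "?x \<in> W \<inter> cone E"
      using z \<kappa> cone_scale by (simp add: V_def)
    from W(3)[OF this] have x: "dotc l ?x \<noteq> 0" "dotc m ?x / dotc l ?x \<in> ball 0 r"
      "?x = dotc l ?x *s u0 (dotc m ?x / dotc l ?x)" by blast+
    have t: "dotc m ?x / dotc l ?x = \<tau> z" "dotc l ?x = a z / \<kappa>"
      using \<kappa>(1) by (simp_all add: dotc_scale \<tau>_def a_def)
    have "dotc l ?x *s u0 (dotc m ?x / dotc l ?x) = (a z / \<kappa>) *s u0 (\<tau> z)"
      by (simp only: t(1)) (simp only: t(2))
    then have "\<kappa> *s ?x = \<kappa> *s ((a z / \<kappa>) *s u0 (\<tau> z))"
      using x(3) by (simp only:)
    then have "u z = a z *s u0 (\<tau> z)"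
      using \<kappa>(1) by (simp add: vector_smult_assoc)
    then show ?thesis using x(1,2) t \<kappa>(1) by auto
  qed
  define a' where "a' z = dotc l (cderiv u z)" for z
  define t' where "t' z = (dotc m (cderiv u z) * a z - dotc m (u z) * a' z) / (a z * a z)" for z
  have da: "(a has_field_derivative a' z) (at z)" if "z \<in> V" for z
    unfolding a_def[abs_def] a'_def using chart_dotc_deriv[OF ch] that VU by blast
  have dt: "(\<tau> has_field_derivative t' z) (at z)" if z: "z \<in> V" for z
    unfolding \<tau>_def[abs_def] t'_def
    by (rule DERIV_divide[OF chart_dotc_deriv[OF ch] da[OF z]]) (use z VU fact in auto)
  have cont_t': "continuous_on V t'"
    unfolding t'_def a'_def a_def using fact
    by (intro continuous_intros continuous_on_subset[OF cderiv_continuous[OF ch] VU]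
        continuous_on_subset[OF chart_continuous[OF ch] VU]) (auto simp: a_def)
  have \<tau>0: "\<tau> 0 = 0"
    using \<kappa> by (simp add: \<tau>_def dotc_scale mv)
  \<comment> \<open>Product rule for the factorisation of \<open>u\<close>: the first summand points
    along the fibre and is killed by every form, the second is the change of coordinate.\<close>
  have cd: "cderiv u z = a' z *s u0 (\<tau> z) + (a z * t' z) *s cderiv u0 (\<tau> z)" if z: "z \<in> V" for z
  proof -
    have "((\<lambda>z. a z * u0 (\<tau> z) $ i) has_field_derivative
        a' z * u0 (\<tau> z) $ i + (cderiv u0 (\<tau> z) $ i * t' z) * a z) (at z)" for i
    proof (rule DERIV_mult[OF da[OF z]])
      have "((\<lambda>x. u0 x $ i) has_field_derivative cderiv u0 (\<tau> z) $ i) (at (\<tau> z))"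
        using ch0 fact[OF z] by (auto simp: chart_def cderiv_def intro: holomorphic_derivI)
      from DERIV_chain2[OF this dt[OF z]]
      show "((\<lambda>z. u0 (\<tau> z) $ i) has_field_derivative cderiv u0 (\<tau> z) $ i * t' z) (at z)" .
    qed
    then have "((\<lambda>z. u z $ i) has_field_derivative
        a' z * u0 (\<tau> z) $ i + (cderiv u0 (\<tau> z) $ i * t' z) * a z) (at z)" for i
      by (rule has_field_derivative_transform_within_open[OF _ opV z]) (use fact in simp)
    from DERIV_imp_deriv[OF this] show ?thesis
      by (simp add: cderiv_def[of u] vec_eq_iff mult.commute mult.left_commute)
  qed
  have t'0: "t' 0 \<noteq> 0"
  proof
    assume "t' 0 = 0"
    then have "cderiv u 0 = (a' 0 / \<kappa>) *s u 0"
      using cd[OF V0] \<kappa> by (simp add: \<tau>0 u00 vector_smult_assoc)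
    then show False using ch U0 by (simp add: chart_def)
  qed
  \<comment> \<open>Comparison of the \<open>dz\<close> parts off the centre. As \<open>z\<close>
    tends to \<open>0\<close> the quotient \<tau>(z)/z tends to \<open>t' 0\<close>, which cancels
    against the factor \<open>t' z\<close>.\<close>
  have fz: "f z = f0 (\<tau> z) * t' z / (\<tau> z / z)" if z: "z \<in> V" "z \<noteq> 0" for z
  proof -
    have zU: "z \<in> U" using z VU by blast
    have uY: "u z \<in> Y" by (rule centred_Y[OF c zU z(2)])
    have \<tau>b: "\<tau> z \<in> ball 0 r" using fact[OF z(1)] by simp
    have \<tau>n: "\<tau> z \<noteq> 0"
    proof
      assume "\<tau> z = 0"
      then have "u z = a z *s v" "a z \<noteq> 0" using fact[OF z(1)] u00 by auto
      then have "u z \<in> D" using vD D_scale by simp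
      then show False using uY by (simp add: open_part_def)
    qed
    have u0Y: "u0 (\<tau> z) \<in> Y" by (rule centred_Y[OF c0 \<tau>b \<tau>n])
    have t0: "cderiv u0 (\<tau> z) \<in> tangent E (u0 (\<tau> z))"
      by (rule cderiv_tangent[OF ch0 \<tau>b])
    have self: "u0 (\<tau> z) \<in> tangent E (u0 (\<tau> z))"
      by (rule tangent_self[OF Y_cone[OF u0Y]])
    have "pull u \<omega> z h = pull u0 \<omega> (\<tau> z) (h * t' z)" for h
    proof -
      let ?x = "u0 (\<tau> z)" and ?y = "(h * t' z) *s cderiv u0 (\<tau> z)" and ?b = "h * a' z / a z"
      have az: "a z \<noteq> 0" using fact[OF z(1)] by simp
      have "h *s cderiv u z = a z *s (?y + ?b *s ?x)"
        unfolding cd[OF z(1)] using az by (simp add: vec_eq_iff field_simps)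
      then have "pull u \<omega> z h = \<omega> (a z *s ?x) (a z *s (?y + ?b *s ?x))"
        using fact[OF z(1)] by (simp add: pull_def)
      also have "\<dots> = \<omega> ?x (?y + ?b *s ?x)"
        by (rule one_formsD(2)[OF \<omega> u0Y _ az]) (intro tangent_add tangent_cscale t0 self)
      also have "\<dots> = \<omega> ?x ?y + \<omega> ?x (?b *s ?x)"
        using one_forms_add[OF \<omega> u0Y] t0 self by (simp add: tangent_cscale)
      also have "\<omega> ?x (?b *s ?x) = 0"
        by (rule one_formsD(3)[OF \<omega> u0Y])
      finally show ?thesis by (simp add: pull_def)
    qed
    moreover have "pull u \<omega> z h = f z * (h / z) + g z * cnj h" for h
      using rep zU z(2) by (simp add: log_rep_def)
    moreover have "pull u0 \<omega> (\<tau> z) h = f0 (\<tau> z) * (h / \<tau> z) + g0 (\<tau> z) * cnj h" for h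
      using rep0 \<tau>b \<tau>n by (simp add: log_rep_def)
    ultimately have "f z / z * h + g z * cnj h = f0 (\<tau> z) * t' z / \<tau> z * h + g0 (\<tau> z) * cnj (t' z) * cnj h" for h
      by (simp add: algebra_simps)
    then have "f z / z = f0 (\<tau> z) * t' z / \<tau> z"
      by (rule complex_linear_part)
    then show ?thesis
      using z(2) by (simp add: field_simps)
  qed
  have "((\<lambda>z. f0 (\<tau> z) * t' z / (\<tau> z / z)) \<longlongrightarrow> f0 0 * t' 0 / t' 0) (at 0)"
  proof (intro tendsto_intros t'0 ratio_tendsto[OF dt[OF V0] \<tau>0])
    have "isCont \<tau> 0"
      using dt[OF V0] DERIV_isCont by blast
    moreover have "isCont f0 (\<tau> 0)"
      using rep0 smooth_fun_continuous r \<tau>0 unfolding log_rep_def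
      by (metis centre_in_ball continuous_on_eq_continuous_at open_ball)
    ultimately have "isCont (\<lambda>z. f0 (\<tau> z)) 0"
      by (rule isCont_o2)
    then show "((\<lambda>z. f0 (\<tau> z)) \<longlongrightarrow> f0 0) (at 0)"
      using \<tau>0 by (simp add: isCont_def)
    show "(t' \<longlongrightarrow> t' 0) (at 0)"
      using cont_t' opV V0 by (metis continuous_on_eq_continuous_at isCont_def)
  qed
  moreover have "eventually (\<lambda>z. f0 (\<tau> z) * t' z / (\<tau> z / z) = f z) (at 0)"
    using eventually_at_in_open[OF opV V0] by eventually_elim (use fz in auto)
  ultimately have "(f \<longlongrightarrow> f0 0) (at 0)"
    using t'0 by (simp add: tendsto_cong)
  moreover have "(f \<longlongrightarrow> f 0) (at 0)"
    using rep smooth_fun_continuous opU U0 unfolding log_rep_def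
    by (metis continuous_on_eq_continuous_at isCont_def)
  ultimately show ?thesis
    using tendsto_unique trivial_limit_at by blast
qed

lemma A1_log_one: "\<omega> \<in> A1_log E D \<Longrightarrow> \<omega> \<in> one_forms E D"
  by (simp add: A1_log_def smooth_forms_def)

text \<open>All charts are compared with one fixed local coordinate, so the description in
  \<open>residue_at\<close> has a unique solution, which any logarithmic representation
  computes.\<close>

lemma residue_eq:
  assumes v: "v \<in> D" and \<omega>: "\<omega> \<in> A1_log E D" and c: "centred_chart E D v U u" and rep: "log_rep U u \<omega> f g"
  shows "residue_at E D v \<omega> = f 0"
proof -
  obtain w where w: "w \<in> tangent E v" "\<forall>c. w \<noteq> c *s v"
    using tangent_direction v D_cone by blast
  obtain r u0 l m where lc: "local_coordinate E v w r u0 l m" and c0: "centred_chart E D v (ball 0 r) u0"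
    using centred_coordinate_exists[OF v w] by blast
  obtain f0 g0 where rep0: "log_rep (ball 0 r) u0 \<omega> f0 g0"
    using \<omega> v c0 unfolding A1_log_def by blast
  have *: "f 0 = f0 0" if "centred_chart E D v U u" "log_rep U u \<omega> f g" for U u f g
    by (rule residue_chart_independent[OF v lc c0 rep0 A1_log_one[OF \<omega>] that])
  have "residue_at E D v \<omega> = f0 0"
    unfolding residue_at_def
  proof (rule the_equality)
    fix r assume "\<forall>U u f g. centred_chart E D v U u \<and> log_rep U u \<omega> f g \<longrightarrow> f 0 = r"
    then show "r = f0 0" using c0 rep0 by blast
  qed (use * in blast)
  then show ?thesis using *[OF c rep] by simp
qed

lemma residue_comb:
  assumes v: "v \<in> D" and \<omega>: "\<omega> \<in> A1_log E D" "\<omega>' \<in> A1_log E D" "(\<lambda>x w. a * \<omega> x w + b * \<omega>' x w) \<in> A1_log E D"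
  shows "residue_at E D v (\<lambda>x w. a * \<omega> x w + b * \<omega>' x w) = a * residue_at E D v \<omega> + b * residue_at E D v \<omega>'"
proof -
  obtain w where w: "w \<in> tangent E v" "\<forall>c. w \<noteq> c *s v"
    using tangent_direction v D_cone by blast
  obtain r u l m where c: "centred_chart E D v (ball 0 r) u"
    using centred_coordinate_exists[OF v w] by blast
  obtain f g where rep: "log_rep (ball 0 r) u \<omega> f g"
    using \<omega>(1) v c unfolding A1_log_def by blast
  obtain f' g' where rep': "log_rep (ball 0 r) u \<omega>' f' g'"
    using \<omega>(2) v c unfolding A1_log_def by blast
  have "log_rep (ball 0 r) u (\<lambda>x w. a * \<omega> x w + b * \<omega>' x w) (\<lambda>z. a * f z + b * f' z) (\<lambda>z. a * g z + b * g' z)"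
    using rep rep' unfolding log_rep_def
    by (auto simp: pull_comb add_divide_distrib algebra_simps intro!: smooth_fun_comb)
  from residue_eq[OF v \<omega>(3) c this] show ?thesis
    using residue_eq[OF v \<omega>(1) c rep] residue_eq[OF v \<omega>(2) c rep'] by simp
qed

text \<open>The holomorphic part of a regular form or of its conjugate stays bounded at \<open>D\<close>.\<close>

lemma residue_zero:
  assumes v: "v \<in> D" and \<omega>: "\<omega> \<in> A1_log E D" and c: "centred_chart E D v U u"
    and W: "open W" "0 \<in> W" "W \<subseteq> U" and p: "isCont p 0"
    and pull: "\<And>z h. z \<in> W \<Longrightarrow> z \<noteq> 0 \<Longrightarrow> pull u \<omega> z h = p z * h + q z * cnj h"
  shows "residue_at E D v \<omega> = 0"
proof -
  obtain f g where rep: "log_rep U u \<omega> f g"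
    using \<omega> v c unfolding A1_log_def by blast
  have opU: "open U" "0 \<in> U" using c by (auto simp: centred_chart_def chart_def)
  have f: "z * p z = f z" if z: "z \<in> W - {0}" for z
  proof -
    have "p z * h + q z * cnj h = f z / z * h + g z * cnj h" for h
      using pull[of z h] rep z W(3) by (auto simp: log_rep_def)
    then have "p z = f z / z"
      by (rule complex_linear_part)
    then show ?thesis using z by simp
  qed
  have "((\<lambda>z. z * p z) \<longlongrightarrow> 0 * p 0) (at 0)"
    using p by (intro tendsto_intros) (simp add: isCont_def)
  moreover have "eventually (\<lambda>z. z * p z = f z) (at 0)"
    using eventually_at_in_open[OF W(1,2)] by eventually_elim (use f in auto)
  ultimately have "(f \<longlongrightarrow> 0) (at 0)"
    by (simp add: tendsto_cong)
  moreover have "(f \<longlongrightarrow> f 0) (at 0)"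
    using rep smooth_fun_continuous opU unfolding log_rep_def
    by (metis continuous_on_eq_continuous_at isCont_def)
  ultimately have "f 0 = 0"
    using tendsto_unique trivial_limit_at by blast
  then show ?thesis using residue_eq[OF v \<omega> c rep] by simp
qed

lemma residue_regular:
  assumes v: "v \<in> D" and reg: "regular_form \<omega>"
  shows "\<omega> \<in> A1_log E D \<Longrightarrow> residue_at E D v \<omega> = 0"
    and "conj_form \<omega> \<in> A1_log E D \<Longrightarrow> residue_at E D v (conj_form \<omega>) = 0"
proof -
  obtain w where w: "w \<in> tangent E v" "\<forall>c. w \<noteq> c *s v"
    using tangent_direction v D_cone by blast
  obtain r u l m where c: "centred_chart E D v (ball 0 r) u"
    using centred_coordinate_exists[OF v w] by blast
  then have "chart E (ball 0 r) u" "0 \<in> ball 0 r"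
    by (simp_all add: centred_chart_def)
  then obtain \<phi> W where R: "regular_rep (ball 0 r) u 0 \<omega> \<phi> W"
    using reg unfolding regular_form_def by blast
  then have W: "open W" "0 \<in> W" "W \<subseteq> ball 0 r" "\<phi> holomorphic_on W"
    by (simp_all add: regular_rep_def)
  have pull: "pull u \<omega> z h = \<phi> z * h" if z: "z \<in> W" "z \<noteq> 0" for z h
    using R centred_Y[OF c _ z(2)] z(1) W(3) unfolding regular_rep_def by blast
  have cont: "isCont \<phi> 0"
    using W holomorphic_on_imp_continuous_on continuous_on_eq_continuous_at by blast
  show "residue_at E D v \<omega> = 0" if "\<omega> \<in> A1_log E D"
    by (rule residue_zero[OF v that c W(1-3) cont, where q = "\<lambda>z. 0"]) (simp add: pull)
  \<comment> \<open>The conjugate of \<phi> dz is a multiple of the conjugate of \<open>dz\<close>,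
    so its \<open>dz\<close> part is zero.\<close>
  show "residue_at E D v (conj_form \<omega>) = 0" if "conj_form \<omega> \<in> A1_log E D"
  proof (rule residue_zero[OF v that c W(1-3), where p = "\<lambda>z. 0" and q = "\<lambda>z. cnj (\<phi> z)"])
    fix z h assume "z \<in> W" "z \<noteq> (0::complex)"
    from pull[OF this, of h] show "pull u (conj_form \<omega>) z h = 0 * h + cnj (\<phi> z) * cnj h"
      by (simp add: pull_def conj_form_def)
  qed simp
qed

lemma residue_zero_form:
  assumes "v \<in> D" and "zero_form \<in> A1_log E D"
  shows "residue_at E D v zero_form = 0"
  using residue_regular(1)[OF assms(1) regular_zero assms(2)] .

lemma Omega_log: "is_Omega F E D \<Omega> \<Longrightarrow> \<Omega> ws \<in> A1_log E D"
  by (simp add: is_Omega_def)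

lemma residue_T_hat:
  assumes \<Omega>: "is_Omega F E D \<Omega>" and v: "v \<in> D"
  shows "(\<lambda>ws. residue_at E D v (\<Omega> ws)) \<in> T_hat F E D"
  unfolding T_hat_iff
proof (intro allI)
  fix xs ys :: "'n form list"
  let ?R = "residue_at E D v"
  have T: "class_linear F E D (\<lambda>\<omega>. \<Omega> (xs @ \<omega> # ys) x w)" for x w
  proof -
    have "(\<lambda>ws. \<Omega> ws x w) \<in> T_hat F E D"
      using \<Omega> by (simp add: is_Omega_def)
    from T_hatD[OF this] show ?thesis .
  qed
  have z: "?R (\<Omega> zs) = 0" if "\<And>x w. \<Omega> zs x w = 0" for zs
  proof -
    have "\<Omega> zs = zero_form" using that by (simp add: zero_form_def fun_eq_iff)
    then show ?thesis using residue_zero_form[OF v] Omega_log[OF \<Omega>, of zs] by simp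
  qed
  show "class_linear F E D (\<lambda>\<omega>. ?R (\<Omega> (xs @ \<omega> # ys)))"
    unfolding class_linear_def
  proof (intro conjI allI ballI impI)
    show "?R (\<Omega> (xs @ \<omega> # ys)) = 0" if "\<omega> \<notin> dR_C F E D" for \<omega>
      by (rule z) (use T that in \<open>simp add: class_linear_def\<close>)
    show "?R (\<Omega> (xs @ \<omega> # ys)) = 0" if "\<omega> \<in> exact_forms E D" for \<omega>
      by (rule z) (use T that in \<open>simp add: class_linear_def\<close>)
    fix \<omega> \<omega>' a b assume "\<omega> \<in> dR_C F E D" "\<omega>' \<in> dR_C F E D"
    then have "\<Omega> (xs @ (\<lambda>v w. a * \<omega> v w + b * \<omega>' v w) # ys) x w =
        a * \<Omega> (xs @ \<omega> # ys) x w + b * \<Omega> (xs @ \<omega>' # ys) x w" for x w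
      using T[of x w] unfolding class_linear_def by blast
    then have eq: "\<Omega> (xs @ (\<lambda>v w. a * \<omega> v w + b * \<omega>' v w) # ys) =
        (\<lambda>x w. a * \<Omega> (xs @ \<omega> # ys) x w + b * \<Omega> (xs @ \<omega>' # ys) x w)"
      by (simp add: fun_eq_iff)
    have mem: "(\<lambda>x w. a * \<Omega> (xs @ \<omega> # ys) x w + b * \<Omega> (xs @ \<omega>' # ys) x w) \<in> A1_log E D"
      using Omega_log[OF \<Omega>, of "xs @ (\<lambda>v w. a * \<omega> v w + b * \<omega>' v w) # ys"] unfolding eq .
    show "?R (\<Omega> (xs @ (\<lambda>v w. a * \<omega> v w + b * \<omega>' v w) # ys)) =
        a * ?R (\<Omega> (xs @ \<omega> # ys)) + b * ?R (\<Omega> (xs @ \<omega>' # ys))"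
      unfolding eq by (rule residue_comb[OF v Omega_log[OF \<Omega>] Omega_log[OF \<Omega>] mem])
  qed
qed

end

section \<open>Slowly growing functions\<close>

text \<open>Growth below every negative power as \<open>q\<close> tends to \<open>0\<close>. The
  class contains the powers of the logarithm and is closed under products and under integration
  against \<open>dq/q\<close>, as solving an equation with a simple pole requires.\<close>

definition slow :: "real \<Rightarrow> (real \<Rightarrow> complex) \<Rightarrow> bool" where
  "slow \<delta> \<phi> \<longleftrightarrow> (\<forall>\<kappa>>0. \<exists>C. \<forall>q\<in>{0<..\<delta>}. cmod (\<phi> q) \<le> C * q powr (- \<kappa>))"

lemma slowE:
  assumes "slow \<delta> \<phi>" and "\<kappa> > 0"
  obtains C where "C \<ge> 0" "\<And>q. q \<in> {0<..\<delta>} \<Longrightarrow> cmod (\<phi> q) \<le> C * q powr (- \<kappa>)"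
proof -
  obtain C where C: "\<forall>q\<in>{0<..\<delta>}. cmod (\<phi> q) \<le> C * q powr (- \<kappa>)"
    using assms unfolding slow_def by blast
  have "cmod (\<phi> q) \<le> \<bar>C\<bar> * q powr (- \<kappa>)" if "q \<in> {0<..\<delta>}" for q
    using C that by (meson abs_ge_self mult_right_mono order_trans powr_ge_zero)
  then show thesis using that[of "\<bar>C\<bar>"] by simp
qed

lemma slow_mult:
  assumes "slow \<delta> \<phi>" and "slow \<delta> \<psi>"
  shows "slow \<delta> (\<lambda>q. \<phi> q * \<psi> q)"
  unfolding slow_def
proof (intro allI impI)
  fix \<kappa> :: real assume \<kappa>: "\<kappa> > 0"
  then have \<kappa>2: "\<kappa> / 2 > 0" by simp
  obtain C where C: "C \<ge> 0" "\<And>q. q \<in> {0<..\<delta>} \<Longrightarrow> cmod (\<phi> q) \<le> C * q powr (- (\<kappa> / 2))"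
    using slowE[OF assms(1) \<kappa>2] by blast
  obtain C' where C': "C' \<ge> 0" "\<And>q. q \<in> {0<..\<delta>} \<Longrightarrow> cmod (\<psi> q) \<le> C' * q powr (- (\<kappa> / 2))"
    using slowE[OF assms(2) \<kappa>2] by blast
  have "cmod (\<phi> q * \<psi> q) \<le> (C * C') * q powr (- \<kappa>)" if q: "q \<in> {0<..\<delta>}" for q
  proof -
    have "cmod (\<phi> q * \<psi> q) \<le> (C * q powr (- (\<kappa> / 2))) * (C' * q powr (- (\<kappa> / 2)))"
      unfolding norm_mult using C C' q by (intro mult_mono) auto
    also have "\<dots> = (C * C') * (q powr (- (\<kappa> / 2)) * q powr (- (\<kappa> / 2)))"
      by simp
    also have "q powr (- (\<kappa> / 2)) * q powr (- (\<kappa> / 2)) = q powr (- \<kappa>)"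
      by (simp flip: powr_add)
    finally show ?thesis .
  qed
  then show "\<exists>C. \<forall>q\<in>{0<..\<delta>}. cmod (\<phi> q * \<psi> q) \<le> C * q powr (- \<kappa>)" by blast
qed

lemma slow_add:
  assumes "slow \<delta> \<phi>" and "slow \<delta> \<psi>"
  shows "slow \<delta> (\<lambda>q. \<phi> q + \<psi> q)"
  unfolding slow_def
proof (intro allI impI)
  fix \<kappa> :: real assume \<kappa>: "\<kappa> > 0"
  obtain C where C: "\<And>q. q \<in> {0<..\<delta>} \<Longrightarrow> cmod (\<phi> q) \<le> C * q powr (- \<kappa>)"
    using slowE[OF assms(1) \<kappa>] by blast
  obtain C' where C': "\<And>q. q \<in> {0<..\<delta>} \<Longrightarrow> cmod (\<psi> q) \<le> C' * q powr (- \<kappa>)"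
    using slowE[OF assms(2) \<kappa>] by blast
  have "cmod (\<phi> q + \<psi> q) \<le> (C + C') * q powr (- \<kappa>)" if q: "q \<in> {0<..\<delta>}" for q
    unfolding distrib_right by (intro norm_triangle_mono C C' q)
  then show "\<exists>C. \<forall>q\<in>{0<..\<delta>}. cmod (\<phi> q + \<psi> q) \<le> C * q powr (- \<kappa>)" by blast
qed

lemma slow_bounded:
  assumes "\<delta> \<le> 1" and "\<And>q. q \<in> {0<..\<delta>} \<Longrightarrow> cmod (\<phi> q) \<le> C"
  shows "slow \<delta> \<phi>"
  unfolding slow_def
proof (intro allI impI exI ballI)
  fix \<kappa> q :: real assume \<kappa>: "\<kappa> > 0" and q: "q \<in> {0<..\<delta>}"
  have "1 \<le> q powr (- \<kappa>)"
    using powr_mono'[of "- \<kappa>" 0 q] q \<kappa> assms(1) by simp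
  moreover have "0 \<le> C" using assms(2)[OF q] norm_ge_zero order_trans by blast
  ultimately show "cmod (\<phi> q) \<le> C * q powr (- \<kappa>)"
    using assms(2)[OF q] mult_left_mono[of 1 "q powr (- \<kappa>)" C] by linarith
qed

lemma slow_const: "\<delta> \<le> 1 \<Longrightarrow> slow \<delta> (\<lambda>q. c)"
  by (rule slow_bounded) auto

lemma slow_sum: "\<delta> \<le> 1 \<Longrightarrow> (\<And>i. i \<in> I \<Longrightarrow> slow \<delta> (\<phi> i)) \<Longrightarrow> slow \<delta> (\<lambda>q. \<Sum>i\<in>I. \<phi> i q)"
  by (induction I rule: infinite_finite_induct) (auto intro: slow_const slow_add)

lemma slow_ln:
  assumes "\<delta> \<le> 1"
  shows "slow \<delta> (\<lambda>q. - of_real (ln q))"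
  unfolding slow_def
proof (intro allI impI exI ballI)
  fix \<kappa> q :: real assume \<kappa>: "\<kappa> > 0" and q: "q \<in> {0<..\<delta>}"
  have "\<kappa> * - ln q = ln (q powr (- \<kappa>))"
    using q by (simp add: ln_powr)
  also have "\<dots> \<le> q powr (- \<kappa>)"
    using ln_le_minus_one[of "q powr (- \<kappa>)"] q by simp
  finally have "- ln q \<le> 1 / \<kappa> * q powr (- \<kappa>)"
    using \<kappa> by (simp add: field_simps)
  moreover have "ln q \<le> 0" using q assms by simp
  ultimately show "cmod (- of_real (ln q)) \<le> 1 / \<kappa> * q powr (- \<kappa>)" by simp
qed

lemma slow_power: "\<delta> \<le> 1 \<Longrightarrow> slow \<delta> \<phi> \<Longrightarrow> slow \<delta> (\<lambda>q. \<phi> q ^ n)"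
  by (induction n) (auto intro: slow_const slow_mult)

lemma slow_cong: "slow \<delta> \<phi> \<Longrightarrow> (\<And>q. q \<in> {0<..\<delta>} \<Longrightarrow> \<psi> q = \<phi> q) \<Longrightarrow> slow \<delta> \<psi>"
  by (simp add: slow_def)

lemma slow_t_mult:
  "\<delta> \<le> 1 \<Longrightarrow> (\<And>us. slow \<delta> (\<lambda>q. A q us)) \<Longrightarrow> (\<And>us. slow \<delta> (\<lambda>q. B q us)) \<Longrightarrow> slow \<delta> (\<lambda>q. t_mult (A q) (B q) ws)"
  unfolding t_mult_def by (intro slow_sum slow_mult)

text \<open>Integrating a bound by the power \<open>- \<kappa> - 1\<close> from
  \<open>\<delta>\<close> down to \<open>q\<close> gives a bound by the power
  \<open>- \<kappa>\<close>, at the price of the constant \<open>1 / \<kappa>\<close>.\<close>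

lemma slow_primitive:
  assumes \<delta>: "0 < \<delta>" "\<delta> \<le> 1" and cont: "\<And>q. 0 < q \<Longrightarrow> q \<le> \<delta> \<Longrightarrow> continuous_on {q..\<delta>} Y"
    and der: "\<And>q. q \<in> {0<..<\<delta>} \<Longrightarrow> (Y has_vector_derivative \<phi> q / of_real q) (at q)" and slow: "slow \<delta> \<phi>"
  shows "slow \<delta> Y"
proof -
  have "slow \<delta> (\<lambda>q. Y q - Y \<delta>)"
    unfolding slow_def
  proof (intro allI impI)
    fix \<kappa> :: real assume \<kappa>: "\<kappa> > 0"
    obtain C where C: "C \<ge> 0" "\<And>q. q \<in> {0<..\<delta>} \<Longrightarrow> cmod (\<phi> q) \<le> C * q powr (- \<kappa>)"
      using slowE[OF slow \<kappa>] by blast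
    have "cmod (Y q - Y \<delta>) \<le> C / \<kappa> * q powr (- \<kappa>)" if q: "q \<in> {0<..\<delta>}" for q
    proof (cases "q = \<delta>")
      case True
      then show ?thesis using C \<kappa> by simp
    next
      case False
      then have q\<delta>: "q < \<delta>" using q by simp
      have q0: "0 < q" using q by simp
      have "norm (Y \<delta> - Y q) \<le> (- C / \<kappa> * \<delta> powr (- \<kappa>)) - (- C / \<kappa> * q powr (- \<kappa>))"
      proof (rule differentiable_bound_general[OF q\<delta>])
        show "continuous_on {q..\<delta>} Y"
          by (rule cont) (use q in auto)
        show "continuous_on {q..\<delta>} (\<lambda>x. - C / \<kappa> * x powr (- \<kappa>))"
          using q by (intro continuous_intros) auto
        fix x assume x: "q < x" "x < \<delta>"
        then have x0: "0 < x" using q by simp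
        show "(Y has_vector_derivative \<phi> x / of_real x) (at x)"
          by (rule der) (use x q in auto)
        have "((\<lambda>x. - C / \<kappa> * x powr (- \<kappa>)) has_real_derivative - C / \<kappa> * ((- \<kappa>) * x powr (- \<kappa> - 1))) (at x)"
          using x0 by (intro DERIV_cmult has_real_derivative_powr)
        then show "((\<lambda>x. - C / \<kappa> * x powr (- \<kappa>)) has_vector_derivative C * x powr (- \<kappa> - 1)) (at x)"
          using \<kappa> by (simp add: has_real_derivative_iff_has_vector_derivative)
        have "norm (\<phi> x / of_real x) \<le> C * x powr (- \<kappa>) / x"
          unfolding norm_divide using C(2)[of x] x x0 by (simp add: divide_right_mono)
        also have "\<dots> = C * x powr (- \<kappa> - 1)"
          using x0 by (simp add: powr_diff)
        finally show "norm (\<phi> x / of_real x) \<le> C * x powr (- \<kappa> - 1)" .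
      qed
      also have "\<dots> \<le> C / \<kappa> * q powr (- \<kappa>)"
        using C \<kappa> by simp
      finally show ?thesis by (simp add: norm_minus_commute)
    qed
    then show "\<exists>C. \<forall>q\<in>{0<..\<delta>}. cmod (Y q - Y \<delta>) \<le> C * q powr (- \<kappa>)" by blast
  qed
  from slow_add[OF this slow_const[OF \<delta>(2), of "Y \<delta>"]] show ?thesis by simp
qed

text \<open>Take the exponent 1/2: the derivative is dominated by an integrable inverse square root,
  so \<open>Y\<close> is Hoelder continuous of order 1/2, hence uniformly continuous, and extends to
  \<open>0\<close>.\<close>

lemma slow_derivative_limit:
  assumes \<delta>: "0 < \<delta>" and der: "\<And>q. q \<in> {0<..<\<delta>} \<Longrightarrow> (Y has_vector_derivative \<phi> q) (at q)"
    and slow: "slow \<delta> \<phi>"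
  shows "\<exists>l. (Y \<longlongrightarrow> l) (at_right 0)"
proof -
  obtain C where C: "C \<ge> 0" "\<And>q. q \<in> {0<..\<delta>} \<Longrightarrow> cmod (\<phi> q) \<le> C * q powr (- (1/2))"
    using slowE[OF slow, of "1/2"] by auto
  have bound: "norm (Y y - Y x) \<le> 2 * C * sqrt (y - x)" if xy: "0 < x" "x < y" "y < \<delta>" for x y
  proof -
    have "norm (Y y - Y x) \<le> 2 * C * sqrt y - 2 * C * sqrt x"
    proof (rule differentiable_bound_general[OF xy(2)])
      show "continuous_on {x..y} Y"
        by (intro continuous_at_imp_continuous_on ballI, rule has_vector_derivative_continuous[OF der])
          (use xy in auto)
      show "continuous_on {x..y} (\<lambda>t. 2 * C * sqrt t)"
        by (intro continuous_intros)
      fix t assume t: "x < t" "t < y"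
      then have t0: "0 < t" using xy by simp
      show "(Y has_vector_derivative \<phi> t) (at t)"
        by (rule der) (use t xy in auto)
      have "((\<lambda>t. 2 * C * sqrt t) has_real_derivative 2 * C * (inverse (sqrt t) / 2)) (at t)"
        using t0 by (intro DERIV_cmult DERIV_real_sqrt)
      moreover have "inverse (sqrt t) = t powr (- (1/2))"
        using t0 by (simp add: powr_minus powr_half_sqrt)
      ultimately show "((\<lambda>t. 2 * C * sqrt t) has_vector_derivative C * t powr (- (1/2))) (at t)"
        by (simp add: has_real_derivative_iff_has_vector_derivative)
      show "norm (\<phi> t) \<le> C * t powr (- (1/2))"
        by (rule C) (use t xy in auto)
    qed
    also have "\<dots> = 2 * C * (sqrt y - sqrt x)"
      by (simp add: algebra_simps)
    also have "\<dots> \<le> 2 * C * sqrt (y - x)"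
      using C(1) xy sqrt_add_le_add_sqrt[of "y - x" x] by (intro mult_left_mono) auto
    finally show ?thesis .
  qed
  have "uniformly_continuous_on {0<..<\<delta>} Y"
    unfolding uniformly_continuous_on_def
  proof (intro allI impI)
    fix e :: real assume e: "e > 0"
    \<comment> \<open>The inverse of the Hoelder bound; adding 1 avoids division by zero when
      \<open>C = 0\<close>.\<close>
    define d where "d = (e / (2 * C + 1))\<^sup>2"
    have d: "d > 0" using e C by (simp add: d_def)
    have close: "dist (Y y) (Y x) < e" if "0 < x" "x < y" "y < \<delta>" "y - x < d" for x y
    proof -
      have "sqrt (y - x) < e / (2 * C + 1)"
        using that e C by (intro real_less_lsqrt) (auto simp: d_def)
      then have "(2 * C + 1) * sqrt (y - x) < e"
        using C by (simp add: field_simps)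
      moreover have "(2 * C + 1) * sqrt (y - x) = 2 * C * sqrt (y - x) + sqrt (y - x)"
        by (rule distrib_right[of "2 * C" 1, simplified])
      moreover have "sqrt (y - x) \<ge> 0" using that by simp
      ultimately have "2 * C * sqrt (y - x) < e"
        by linarith
      then show ?thesis
        using bound[OF that(1-3)] by (simp add: dist_norm)
    qed
    have "dist (Y x') (Y x) < e" if "x \<in> {0<..<\<delta>}" "x' \<in> {0<..<\<delta>}" "dist x' x < d" for x x'
      using close[of x x'] close[of x' x] that e
      by (cases x x' rule: linorder_cases) (auto simp: dist_commute dist_real_def)
    then show "\<exists>d>0. \<forall>x\<in>{0<..<\<delta>}. \<forall>x'\<in>{0<..<\<delta>}. dist x' x < d \<longrightarrow> dist (Y x') (Y x) < e"
      using d by blast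
  qed
  moreover have "0 \<in> closure {0<..<\<delta>}"
    using \<delta> by simp
  ultimately obtain l where "(Y \<longlongrightarrow> l) (at 0 within {0<..<\<delta>})"
    using uniformly_continuous_on_extension_at_closure by blast
  moreover have "at 0 within {0<..<\<delta>} = at_right 0"
    by (rule at_within_nhd[of 0 "{..<\<delta>}"]) (use \<delta> in auto)
  ultimately show ?thesis by auto
qed

section \<open>Regularised transport to a tangential base point\<close>

lemma t_power_scale: "t_power (\<lambda>ws. c * t ws) k ws = c ^ k * t_power t k ws"
proof (induction k arbitrary: ws)
  case (Suc k)
  have "t_power (\<lambda>ws. c * t ws) k = (\<lambda>ws. c ^ k * t_power t k ws)"
    using Suc.IH by blast
  then show ?case
    by (simp add: t_mult_def sum_distrib_left algebra_simps)
qed simp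

lemma t_mult_cmult_left: "t_mult (\<lambda>ws. c * s ws) t ws = c * t_mult s t ws"
  by (simp add: t_mult_def sum_distrib_left algebra_simps)

lemma t_mult_has_vector_derivative:
  assumes "\<And>us. ((\<lambda>q. A q us) has_vector_derivative A' us) (at q)"
    and "\<And>us. ((\<lambda>q. B q us) has_vector_derivative B' us) (at q)"
  shows "((\<lambda>q. t_mult (A q) (B q) ws) has_vector_derivative t_mult A' (B q) ws + t_mult (A q) B' ws) (at q)"
proof -
  have "((\<lambda>q. \<Sum>i\<le>length ws. A q (take i ws) * B q (drop i ws)) has_vector_derivative
      (\<Sum>i\<le>length ws. A q (take i ws) * B' (drop i ws) + A' (take i ws) * B q (drop i ws))) (at q)"
    by (intro has_vector_derivative_sum has_vector_derivative_mult assms)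
  then show ?thesis
    by (simp add: t_mult_def sum.distrib add.commute)
qed

text \<open>The power of \<open>q\<close> with exponent \<open>- N\<close>, which is the
  regularising factor in \<open>T_to_tangential\<close> when \<open>N\<close> is the
  residue.\<close>

definition reg :: "'n::finite tensor \<Rightarrow> real \<Rightarrow> 'n tensor" where
  "reg N q = t_exp (\<lambda>ws. - of_real (ln q) * N ws)"

text \<open>Any cutoff beyond the length of the word may be used. Differentiation and products
  involve words of different lengths at once and ask for a common one.\<close>

lemma reg_eq:
  assumes N: "N [] = 0" and n: "length ws \<le> n"
  shows "reg N q ws = (\<Sum>k\<le>n. (- of_real (ln q)) ^ k / fact k * t_power N k ws)"
proof -
  have "(\<Sum>k\<le>n. (- of_real (ln q)) ^ k / fact k * t_power N k ws) =
      (\<Sum>k\<le>length ws. (- of_real (ln q)) ^ k / fact k * t_power N k ws)"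
    by (rule sum.mono_neutral_right) (use N n in \<open>auto simp: t_power_short\<close>)
  moreover have "reg N q ws = (\<Sum>k\<le>length ws. (- of_real (ln q)) ^ k * t_power N k ws / fact k)"
    unfolding reg_def t_exp_def by (rule sum.cong[OF refl]) (simp only: t_power_scale)
  ultimately show ?thesis by simp
qed

lemma reg_Nil: "reg N q [] = 1"
  by (simp add: reg_def t_exp_def)

text \<open>Termwise differentiation of the exponential series. The sum is first extended by one
  vanishing term, since differentiating lowers the power of the logarithm by one. The factor
  \<open>N\<close> is put on the right, next to the transport.\<close>

lemma reg_has_vector_derivative:
  assumes N: "N [] = 0" and q: "q > 0"
  shows "((\<lambda>q. reg N q ws) has_vector_derivative - 1 / of_real q * t_mult (reg N q) N ws) (at q)"
proof -
  let ?n = "length ws" and ?L = "\<lambda>q. - complex_of_real (ln q)"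
  have dl: "((\<lambda>q. ?L q) has_vector_derivative - 1 / of_real q) (at q)"
  proof -
    have "((\<lambda>q. - ln q) has_real_derivative - (1 / q)) (at q)"
      using q by (auto intro!: derivative_eq_intros)
    then have "((\<lambda>q. complex_of_real (- ln q)) has_vector_derivative of_real (- (1 / q))) (at q)"
      by (rule has_vector_derivative_of_real)
    then show ?thesis by simp
  qed
  have pow: "((\<lambda>q. ?L q ^ Suc k / fact (Suc k)) has_vector_derivative - 1 / of_real q * (?L q ^ k / fact k)) (at q)" for k
  proof -
    have "((\<lambda>x. x ^ Suc k / fact (Suc k)) has_field_derivative ?L q ^ k / fact k) (at (?L q))"
      by (rule DERIV_cong[OF DERIV_cdivide[OF DERIV_power[OF DERIV_ident]]])
        (simp add: fact_reduce field_simps del: of_nat_Suc)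
    from field_vector_diff_chain_at[OF dl this] show ?thesis
      by (simp add: o_def mult.commute)
  qed
  have "((\<lambda>q. (\<Sum>k\<le>Suc ?n. ?L q ^ k / fact k * t_power N k ws)) has_vector_derivative
      (\<Sum>k\<le>?n. - 1 / of_real q * (?L q ^ k / fact k) * t_power N (Suc k) ws)) (at q)"
  proof -
    have "((\<lambda>q. \<Sum>k\<le>?n. ?L q ^ Suc k / fact (Suc k) * t_power N (Suc k) ws) has_vector_derivative
        (\<Sum>k\<le>?n. - 1 / of_real q * (?L q ^ k / fact k) * t_power N (Suc k) ws)) (at q)"
      by (intro has_vector_derivative_sum has_vector_derivative_mult_left pow)
    from has_vector_derivative_add[OF has_vector_derivative_const[of "t_power N 0 ws"] this]
    show ?thesis
      unfolding sum.atMost_Suc_shift by simp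
  qed
  moreover have "(\<Sum>k\<le>Suc ?n. ?L q ^ k / fact k * t_power N k ws) = reg N q ws" for q
    by (rule reg_eq[where n = "Suc ?n" and N = N, symmetric]) (simp_all add: N)
  moreover have "t_mult (reg N q) N ws = (\<Sum>k\<le>?n. ?L q ^ k / fact k * t_power N (Suc k) ws)"
  proof -
    have "t_mult (reg N q) N ws = t_mult (\<lambda>us. \<Sum>k\<le>?n. ?L q ^ k / fact k * t_power N k us) N ws"
      by (rule t_mult_cong_length) (simp_all add: reg_eq[where N = N and n = ?n] N)
    also have "\<dots> = (\<Sum>k\<le>?n. t_mult (\<lambda>us. ?L q ^ k / fact k * t_power N k us) N ws)"
      by (rule t_mult_sum_left)
    also have "\<dots> = (\<Sum>k\<le>?n. ?L q ^ k / fact k * t_power N (Suc k) ws)"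
      by (simp only: t_mult_cmult_left t_power_commute t_power.simps)
    finally show ?thesis .
  qed
  ultimately show ?thesis
    by (simp add: sum_distrib_left mult.assoc)
qed

lemma reg_slow:
  assumes "N [] = 0" and "\<delta> \<le> 1"
  shows "slow \<delta> (\<lambda>q. reg N q ws)"
proof -
  have "slow \<delta> (\<lambda>q. \<Sum>k\<le>length ws. (- of_real (ln q)) ^ k * (t_power N k ws / fact k))"
    by (intro slow_sum slow_mult slow_power slow_ln slow_const assms)
  then show ?thesis
    by (rule slow_cong) (simp add: reg_eq[where N = N and n = "length ws"] assms)
qed

lemma reg_T_hat: "N \<in> T_hat F E D \<Longrightarrow> reg N q \<in> T_hat F E D"
  unfolding reg_def by (intro T_hat_exp T_hat_cmult)

text \<open>Near \<open>0\<close> the quotient is controlled by differentiability, with error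
  constant 1, and away from \<open>0\<close> by compactness.\<close>

lemma difference_quotient_bounded:
  assumes f: "smooth_fun (ball 0 r) f" and \<delta>: "0 < \<delta>" "\<delta> < r"
  shows "\<exists>C. \<forall>q\<in>{0<..\<delta>}. cmod ((f (of_real q) - f 0) / of_real q) \<le> C"
proof -
  obtain f1 f2 where "has_partials f 0 f1 f2"
    using smooth_fun_partials[OF f, of 0] \<delta> by auto
  then have "(f has_derivative (\<lambda>h. of_real (Re h) * f1 + of_real (Im h) * f2)) (at 0)"
    by (simp add: has_partials_def)
  then have "\<forall>e>0. \<exists>d>0. \<forall>y. cmod (y - 0) < d \<longrightarrow>
      cmod (f y - f 0 - (of_real (Re (y - 0)) * f1 + of_real (Im (y - 0)) * f2)) \<le> e * cmod (y - 0)"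
    unfolding has_derivative_at_alt by (rule conjunct2)
  then have "\<exists>d>0. \<forall>y. cmod y < d \<longrightarrow>
      cmod (f y - f 0 - (of_real (Re y) * f1 + of_real (Im y) * f2)) \<le> cmod y"
    by (drule_tac spec[of _ 1]) simp
  then obtain d where d: "d > 0" "\<And>z. cmod z < d \<Longrightarrow>
      cmod (f z - f 0 - (of_real (Re z) * f1 + of_real (Im z) * f2)) \<le> cmod z"
    by blast
  have "continuous_on {0..\<delta>} (\<lambda>q. f (of_real q) - f 0)"
    using \<delta> by (intro continuous_intros continuous_on_compose2[OF smooth_fun_continuous[OF f]]) auto
  then have "bounded ((\<lambda>q. f (of_real q) - f 0) ` {0..\<delta>})"
    by (intro compact_imp_bounded compact_continuous_image) auto
  then obtain M where "\<forall>y\<in>(\<lambda>q. f (of_real q) - f 0) ` {0..\<delta>}. cmod y \<le> M"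
    unfolding bounded_iff ..
  then have M: "cmod (f (of_real q) - f 0) \<le> M" if "q \<in> {0..\<delta>}" for q
    using that by blast
  have M0: "0 \<le> M" using M[of 0] \<delta> by simp
  have "cmod ((f (of_real q) - f 0) / of_real q) \<le> max (1 + cmod f1) (M / d)" if q: "q \<in> {0<..\<delta>}" for q
  proof (cases "q < d")
    case True
    have "cmod (f (of_real q) - f 0) \<le> cmod (f (of_real q) - f 0 - of_real q * f1) + cmod (of_real q * f1)"
      using norm_triangle_ineq[of "f (of_real q) - f 0 - of_real q * f1" "of_real q * f1"] by simp
    also have "\<dots> \<le> q + q * cmod f1"
      using d(2)[of "of_real q"] True q by (simp add: norm_mult)
    finally show ?thesis
      using q by (simp add: norm_divide field_simps le_max_iff_disj)
  next
    case False
    have "cmod ((f (of_real q) - f 0) / of_real q) \<le> M / d"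
      unfolding norm_divide using M[of q] q False d M0 by (intro frac_le) auto
    then show ?thesis by simp
  qed
  then show ?thesis by blast
qed

section \<open>Transport along the ray towards a tangential base point\<close>

locale tangential_ray = curve F E D
  for F :: "real set" and E :: "(complex^'n \<Rightarrow> complex) set" and D :: "(complex^'n) set" +
  fixes \<Omega> :: "'n form list \<Rightarrow> 'n form" and v w :: "complex^'n" and r :: real
    and u :: "complex \<Rightarrow> complex^'n" and l m :: "complex^'n" and \<delta> :: real
  assumes Omega: "is_Omega F E D \<Omega>" and vD: "v \<in> D"
    and coord: "local_coordinate E v w r u l m" and centred: "centred_chart E D v (ball 0 r) u"
    and \<delta>: "0 < \<delta>" "\<delta> < r" "r < 1"
begin

definition N :: "'n tensor" where "N ws = residue_at E D v (\<Omega> ws)"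

definition H :: "real \<Rightarrow> 'n tensor" where "H q ws = \<Omega> ws (u (of_real q)) (cderiv u (of_real q))"

text \<open>The coefficient \<open>H\<close> expressed in the time \<open>t = 1 - q\<close>; the ray
  is run towards \<open>q = 0\<close>, whence the sign.\<close>

definition K :: "real \<Rightarrow> 'n tensor" where "K t ws = - H (1 - t) ws"

text \<open>Transport along the ray from parameter \<open>\<delta>\<close> down to parameter
  \<open>q\<close>.\<close>

definition X :: "real \<Rightarrow> 'n tensor" where "X q = transport K (1 - \<delta>) (1 - q)"

text \<open>The regularised transport, whose limit for \<open>q\<close> tending to \<open>0\<close>
  is \<open>R\<close>.\<close>

definition G :: "real \<Rightarrow> 'n tensor" where "G q = t_mult (reg N q) (X q)"

lemma \<delta>1: "\<delta> \<le> 1" "\<delta> < 1" using \<delta> by auto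

lemma ray_chart: "chart E (ball 0 r) u"
  using coord by (simp add: local_coordinate_def)

lemma ray_Y: "0 < q \<Longrightarrow> q < r \<Longrightarrow> u (of_real q) \<in> Y"
  by (rule centred_Y[OF centred]) auto

lemma N_T_hat: "N \<in> T_hat F E D"
  using residue_T_hat[OF Omega vD] by (simp add: N_def[abs_def])

lemma N_Nil: "N [] = 0"
  using residue_zero_form[OF vD] Omega_log[OF Omega, of "[]"] by (simp add: N_def Omega_Nil[OF Omega])

lemma H_T_hat: "H q \<in> T_hat F E D"
  using Omega by (simp add: H_def[abs_def] is_Omega_def)

lemma H_Nil: "H q [] = 0"
  by (simp add: H_def Omega_Nil[OF Omega] zero_form_def)

text \<open>On the real ray \<open>dz/z\<close> becomes \<open>dq/q\<close>, so \<open>H\<close> has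
  a simple pole whose coefficient is the residue.\<close>

lemma H_rep: "\<exists>f g. smooth_fun (ball 0 r) f \<and> smooth_fun (ball 0 r) g \<and> f 0 = N ws \<and>
    (\<forall>q\<in>{0<..<r}. H q ws = f (of_real q) / of_real q + g (of_real q))"
proof -
  obtain f g where rep: "log_rep (ball 0 r) u (\<Omega> ws) f g"
    using Omega_log[OF Omega, of ws] vD centred unfolding A1_log_def by blast
  have "H q ws = f (of_real q) / of_real q + g (of_real q)" if q: "q \<in> {0<..<r}" for q
  proof -
    have "pull u (\<Omega> ws) (of_real q) 1 = f (of_real q) * (1 / of_real q) + g (of_real q) * cnj 1"
      using rep q by (auto simp: log_rep_def)
    then show ?thesis by (simp add: pull_def H_def)
  qed
  moreover have "f 0 = N ws"
    using residue_eq[OF vD Omega_log[OF Omega] centred rep] by (simp add: N_def)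
  ultimately show ?thesis
    using rep unfolding log_rep_def by blast
qed

lemma of_real_smooth_continuous: "smooth_fun (ball 0 r) f \<Longrightarrow> S \<subseteq> {-r<..<r} \<Longrightarrow> continuous_on S (\<lambda>q. f (of_real q))"
  by (rule continuous_on_compose2[OF smooth_fun_continuous]) (auto intro!: continuous_intros simp: abs_less_iff)

lemma H_continuous: "continuous_on {0<..<r} (\<lambda>q. H q ws)"
proof -
  obtain f g where fg: "smooth_fun (ball 0 r) f" "smooth_fun (ball 0 r) g"
    "\<And>q. q \<in> {0<..<r} \<Longrightarrow> H q ws = f (of_real q) / of_real q + g (of_real q)"
    using H_rep by blast
  have "continuous_on {0<..<r} (\<lambda>q. f (of_real q) / of_real q + g (of_real q))"
    by (intro continuous_intros of_real_smooth_continuous fg) auto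
  then show ?thesis
    by (rule continuous_on_eq) (simp add: fg)
qed

lemma K_T_hat: "K t \<in> T_hat F E D"
  using T_hat_cmult[OF H_T_hat, of "-1"] by (simp add: K_def[abs_def])

lemma K_continuous: "b < 1 \<Longrightarrow> continuous_on {1 - \<delta>..b} (\<lambda>t. K t ws)"
  unfolding K_def using \<delta>
  by (intro continuous_intros continuous_on_compose2[OF H_continuous]) auto

lemma K_tpcont: "b < 1 \<Longrightarrow> tpcont (1 - \<delta>) b K"
  unfolding tpcont_def by (intro allI pcont_continuous K_continuous)

lemma X_T_hat: "0 < q \<Longrightarrow> q \<le> \<delta> \<Longrightarrow> X q \<in> T_hat F E D"
  unfolding X_def by (rule transport_T_hat[OF K_tpcont[of "1 - q"]]) (auto simp: K_T_hat K_def H_Nil)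

lemma X_Nil [simp]: "X q [] = 1"
  by (simp add: X_def)

lemma X_continuous: "0 < q \<Longrightarrow> q \<le> \<delta> \<Longrightarrow> continuous_on {q..\<delta>} (\<lambda>s. X s ws)"
  unfolding X_def
  by (rule continuous_on_compose2[OF transport_continuous[OF K_tpcont[of "1 - q"]]])
    (auto intro!: continuous_intros)

lemma X_has_vector_derivative:
  assumes q: "0 < q" "q < \<delta>"
  shows "((\<lambda>q. X q ws) has_vector_derivative t_mult (H q) (X q) ws) (at q)"
proof (cases ws)
  case Nil
  then show ?thesis by (simp add: H_Nil)
next
  case (Cons x xs)
  let ?\<phi> = "\<lambda>t. t_mult (\<lambda>ys. K t (x # ys)) (transport K (1 - \<delta>) t) xs"
  \<comment> \<open>Leaves room beyond the time \<open>1 - q\<close>, so that the fundamental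
    theorem yields a two-sided derivative there.\<close>
  let ?b = "1 - q / 2"
  have b: "?b < 1" using q by simp
  have "continuous_on {1 - \<delta>..?b} ?\<phi>"
    unfolding t_mult_def
    by (intro continuous_intros K_continuous[OF b] transport_continuous[OF K_tpcont[OF b]])
  then have "((\<lambda>t. integral {1 - \<delta>..t} ?\<phi>) has_vector_derivative ?\<phi> (1 - q)) (at (1 - q) within {1 - \<delta>..?b})"
    by (rule integral_has_vector_derivative) (use q in auto)
  moreover have "1 - q \<in> interior {1 - \<delta>..?b}"
    using q by (simp add: interior_atLeastAtMost_real)
  then have at: "at (1 - q) within {1 - \<delta>..?b} = at (1 - q)"
    by (rule at_within_interior)
  ultimately have d: "((\<lambda>t. integral {1 - \<delta>..t} ?\<phi>) has_vector_derivative ?\<phi> (1 - q)) (at (1 - q))"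
    by (simp only:)
  have "((\<lambda>q::real. 1 - q) has_vector_derivative - 1) (at q)"
    by (auto intro!: derivative_eq_intros)
  from vector_diff_chain_at[OF this d]
  have "((\<lambda>q. integral {1 - \<delta>..1 - q} ?\<phi>) has_vector_derivative - ?\<phi> (1 - q)) (at q)"
    by (simp add: o_def)
  moreover have "- ?\<phi> (1 - q) = t_mult (H q) (X q) ws"
  proof -
    have "- ?\<phi> (1 - q) = t_mult (\<lambda>ys. H q (x # ys)) (X q) xs"
      by (simp add: X_def K_def[abs_def] t_mult_def sum_negf)
    then show ?thesis
      by (simp add: Cons t_mult_Cons H_Nil)
  qed
  ultimately show ?thesis
    by (simp add: X_def Cons transport_Cons)
qed

lemma H_times_bounded: "\<exists>C. \<forall>q\<in>{0<..\<delta>}. cmod (of_real q * H q ws) \<le> C"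
proof -
  obtain f g where fg: "smooth_fun (ball 0 r) f" "smooth_fun (ball 0 r) g"
    "\<And>q. q \<in> {0<..<r} \<Longrightarrow> H q ws = f (of_real q) / of_real q + g (of_real q)"
    using H_rep by blast
  let ?F = "\<lambda>q. f (of_real q) + of_real q * g (of_real q)"
  have "continuous_on {0..\<delta>} ?F"
    using \<delta> by (intro continuous_intros of_real_smooth_continuous fg) auto
  then have "bounded (?F ` {0..\<delta>})"
    by (intro compact_imp_bounded compact_continuous_image) auto
  then obtain C where "\<forall>y\<in>?F ` {0..\<delta>}. cmod y \<le> C"
    unfolding bounded_iff ..
  then have "cmod (?F q) \<le> C" if "q \<in> {0<..\<delta>}" for q
    using that by auto
  moreover have "of_real q * H q ws = ?F q" if "q \<in> {0<..\<delta>}" for q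
    using fg(3)[of q] that \<delta> by (simp add: field_simps)
  ultimately show ?thesis by force
qed

text \<open>In the equation \<open>q X' = (q H) X\<close> the factor \<open>q H\<close> is bounded,
  and since \<open>H\<close> has no constant term the right hand side involves \<open>X\<close> at
  shorter words only.\<close>

lemma X_slow: "slow \<delta> (\<lambda>q. X q ws)"
proof (induction ws rule: length_induct)
  case (1 ws)
  let ?\<phi> = "\<lambda>q. of_real q * t_mult (H q) (X q) ws"
  have "slow \<delta> (\<lambda>q. \<Sum>i\<le>length ws. (of_real q * H q (take i ws)) * X q (drop i ws))"
  proof (rule slow_sum[OF \<delta>1(1)])
    fix i assume i: "i \<in> {..length ws}"
    show "slow \<delta> (\<lambda>q. (of_real q * H q (take i ws)) * X q (drop i ws))"
    proof (cases "i = 0 \<or> ws = []")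
      case True
      then show ?thesis using slow_const[OF \<delta>1(1), of 0] by (auto simp: H_Nil)
    next
      case False
      then have sX: "slow \<delta> (\<lambda>q. X q (drop i ws))"
        using 1 by auto
      obtain C where C: "\<forall>q\<in>{0<..\<delta>}. cmod (of_real q * H q (take i ws)) \<le> C"
        using H_times_bounded by blast
      have "slow \<delta> (\<lambda>q. of_real q * H q (take i ws))"
        by (rule slow_bounded[OF \<delta>1(1), where C = C]) (use C in blast)
      then show ?thesis by (rule slow_mult) (rule sX)
    qed
  qed
  then have "slow \<delta> ?\<phi>"
    by (simp add: t_mult_def sum_distrib_left mult.assoc)
  then show ?case
  proof (rule slow_primitive[OF \<delta>(1) \<delta>1(1) X_continuous, rotated -1])
    fix q assume "q \<in> {0<..<\<delta>}"
    then show "((\<lambda>q. X q ws) has_vector_derivative ?\<phi> q / of_real q) (at q)"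
      using X_has_vector_derivative[of q ws] by simp
  qed
qed

text \<open>The coefficient along the ray with its polar part removed: a difference quotient of a
  smooth function plus a smooth function, hence bounded.\<close>

definition h :: "real \<Rightarrow> 'n tensor" where "h q ws = H q ws - N ws / of_real q"

lemma h_slow: "slow \<delta> (\<lambda>q. h q ws)"
proof -
  obtain f g where fg: "smooth_fun (ball 0 r) f" "smooth_fun (ball 0 r) g" "f 0 = N ws"
    "\<And>q. q \<in> {0<..<r} \<Longrightarrow> H q ws = f (of_real q) / of_real q + g (of_real q)"
    using H_rep by blast
  obtain C where C: "\<forall>q\<in>{0<..\<delta>}. cmod ((f (of_real q) - f 0) / of_real q) \<le> C"
    using difference_quotient_bounded[OF fg(1) \<delta>(1,2)] by blast
  have "continuous_on {0..\<delta>} (\<lambda>q. g (of_real q))"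
    using \<delta> by (intro of_real_smooth_continuous fg) auto
  then have "bounded ((\<lambda>q. g (of_real q)) ` {0..\<delta>})"
    by (intro compact_imp_bounded compact_continuous_image) auto
  then obtain C' where C': "\<forall>y\<in>(\<lambda>q. g (of_real q)) ` {0..\<delta>}. cmod y \<le> C'"
    unfolding bounded_iff ..
  have "slow \<delta> (\<lambda>q. (f (of_real q) - f 0) / of_real q)"
    by (rule slow_bounded[OF \<delta>1(1), where C = C]) (use C in blast)
  moreover have "slow \<delta> (\<lambda>q. g (of_real q))"
    by (rule slow_bounded[OF \<delta>1(1), where C = C']) (use C' in auto)
  ultimately have "slow \<delta> (\<lambda>q. (f (of_real q) - f 0) / of_real q + g (of_real q))"
    by (rule slow_add)
  then show ?thesis
    by (rule slow_cong) (use fg \<delta> in \<open>simp add: h_def diff_divide_distrib\<close>)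
qed

text \<open>The derivative of the regularising factor cancels the polar part of \<open>H\<close>,
  leaving the bounded coefficient \<open>h\<close> between the two slow factors.\<close>

lemma G_has_vector_derivative:
  assumes q: "0 < q" "q < \<delta>"
  shows "((\<lambda>q. G q ws) has_vector_derivative t_mult (reg N q) (t_mult (h q) (X q)) ws) (at q)"
proof -
  let ?R = "reg N q"
  have "((\<lambda>q. G q ws) has_vector_derivative
      t_mult (\<lambda>us. - 1 / of_real q * t_mult ?R N us) (X q) ws + t_mult ?R (t_mult (H q) (X q)) ws) (at q)"
    unfolding G_def
    by (rule t_mult_has_vector_derivative[where A = "reg N" and B = X,
        OF reg_has_vector_derivative[where N = N, OF N_Nil q(1)] X_has_vector_derivative[OF q]])
  moreover have "t_mult (\<lambda>us. - 1 / of_real q * t_mult ?R N us) (X q) ws =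
      - 1 / of_real q * t_mult ?R (t_mult N (X q)) ws"
    by (simp only: t_mult_cmult_left t_mult_assoc)
  moreover have "t_mult ?R (t_mult (h q) (X q)) ws =
      1 * t_mult ?R (t_mult (H q) (X q)) ws + (- 1 / of_real q) * t_mult ?R (t_mult N (X q)) ws"
  proof -
    have "h q = t_comb 1 (H q) (- 1 / of_real q) N"
      by (simp add: h_def t_comb_def fun_eq_iff)
    then have "t_mult (h q) (X q) = t_comb 1 (t_mult (H q) (X q)) (- 1 / of_real q) (t_mult N (X q))"
      unfolding t_comb_def by (rule ssubst) (rule ext, rule t_mult_comb_left)
    then have "t_mult ?R (t_mult (h q) (X q)) =
        t_comb 1 (t_mult ?R (t_mult (H q) (X q))) (- 1 / of_real q) (t_mult ?R (t_mult N (X q)))"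
      unfolding t_comb_def by (rule ssubst) (rule ext, rule t_mult_comb_right)
    then show ?thesis
      by (simp add: t_comb_def)
  qed
  ultimately show ?thesis by simp
qed

lemma G_limit: "\<exists>R. \<forall>ws. ((\<lambda>q. G q ws) \<longlongrightarrow> R ws) (at_right 0)"
proof -
  have "\<exists>l. ((\<lambda>q. G q ws) \<longlongrightarrow> l) (at_right 0)" for ws
  proof (rule slow_derivative_limit[OF \<delta>(1)])
    show "slow \<delta> (\<lambda>q. t_mult (reg N q) (t_mult (h q) (X q)) ws)"
      by (intro slow_t_mult \<delta>1 reg_slow N_Nil h_slow X_slow)
  qed (use G_has_vector_derivative in auto)
  then have "\<forall>ws. \<exists>l. ((\<lambda>q. G q ws) \<longlongrightarrow> l) (at_right 0)" ..
  then show ?thesis by (rule choice)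
qed

definition R :: "'n tensor" where "R = (SOME R. \<forall>ws. ((\<lambda>q. G q ws) \<longlongrightarrow> R ws) (at_right 0))"

lemma G_tendsto: "((\<lambda>q. G q ws) \<longlongrightarrow> R ws) (at_right 0)"
  using someI_ex[OF G_limit] unfolding R_def by blast

lemma R_Nil: "R [] = 1"
proof -
  have "((\<lambda>q. G q []) \<longlongrightarrow> 1) (at_right 0)"
    by (simp add: G_def reg_Nil)
  then show ?thesis
    using G_tendsto[of "[]"] tendsto_unique trivial_limit_at_right_real by blast
qed

lemma near_zero: "eventually (\<lambda>q. 0 < q \<and> q < \<delta>) (at_right 0)"
  using \<delta>(1) by (rule eventually_at_right_less[THEN eventually_conj[OF _ eventually_at_right_real], simplified])

lemma R_T_hat: "R \<in> T_hat F E D"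
proof (rule T_hat_limit[where G = "at_right 0" and t = "\<lambda>q. if 0 < q \<and> q < \<delta> then G q else t_one"])
  \<comment> \<open>The limit lemma asks for tensors at every \<open>q\<close>, so
    \<open>t_one\<close> is used as a default off the interval where \<open>G q\<close> is known to
    lie in \<open>T_hat\<close>.\<close>
  show "(if 0 < q \<and> q < \<delta> then G q else t_one) \<in> T_hat F E D" for q
    by (auto simp: G_def intro!: T_hat_mult reg_T_hat N_T_hat X_T_hat T_hat_one)
  show "((\<lambda>q. (if 0 < q \<and> q < \<delta> then G q else t_one) ws) \<longlongrightarrow> R ws) (at_right 0)" for ws
    by (rule Lim_transform_eventually[OF G_tendsto]) (use near_zero in eventually_elim, simp)
qed simp

end

context tangential_ray
begin

section \<open>Paths that end along the ray\<close>

abbreviation base :: "complex^'n" where "base \<equiv> u (of_real \<delta>)"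

lemma base_Y: "base \<in> Y"
  using ray_Y \<delta> by simp

text \<open>Compresses \<open>\<sigma>\<close> into time \<open>1 - \<delta>\<close> and then runs
  along the ray with \<open>q = 1 - t\<close>, the parametrisation that
  \<open>path_to_tangential\<close> prescribes. The scalar \<open>c\<close> makes the two lifts
  agree at the junction.\<close>

definition ray_path :: "(real \<Rightarrow> complex^'n) \<Rightarrow> complex \<Rightarrow> real \<Rightarrow> complex^'n" where
  "ray_path \<sigma> c t = (if t \<le> 1 - \<delta> then \<sigma> (1 / (1 - \<delta>) * t) else c *s u (of_real (1 - t)))"

lemma ray_derivative:
  assumes "t \<in> {1 - \<delta>..1}"
  shows "((\<lambda>t. c *s u (of_real (1 - t))) has_vector_derivative (- 1) *\<^sub>R (c *s cderiv u (of_real (1 - t)))) (at t)"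
proof -
  have "((\<lambda>t. of_real (1 - t)) has_vector_derivative complex_of_real (- 1)) (at t)"
    by (rule has_vector_derivative_of_real) (auto intro!: derivative_eq_intros)
  then have "((\<lambda>t. u (of_real (1 - t))) has_vector_derivative complex_of_real (- 1) *s cderiv u (of_real (1 - t))) (at t)"
    by (rule chart_path_derivative[OF ray_chart, rotated]) (use assms \<delta> in \<open>auto simp: dist_norm simp del: of_real_diff\<close>)
  from bounded_linear.has_vector_derivative[OF bounded_linear_scale this, of c]
  show ?thesis
    by (simp add: scaleR_eq_scale vector_smult_assoc)
qed

context
  fixes \<sigma> :: "real \<Rightarrow> complex^'n" and c :: complex
  assumes \<sigma>: "nice \<sigma>" and c: "c \<noteq> 0" and end\<sigma>: "pathfinish \<sigma> = c *s base"
begin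

lemma ray_path_valid: "valid_path (ray_path \<sigma> c)"
  unfolding valid_path_def ray_path_def
proof (rule piecewise_C1_differentiable_cases)
  have "\<sigma> piecewise_C1_differentiable_on (\<lambda>t. 1 / (1 - \<delta>) * t + 0) ` {0..1 - \<delta>}"
  proof (rule piecewise_C1_differentiable_on_subset)
    show "\<sigma> piecewise_C1_differentiable_on {0..1}"
      using \<sigma> by (simp add: nice_def valid_path_def)
  qed (use \<delta>1 in \<open>auto simp: field_simps\<close>)
  from piecewise_C1_differentiable_affine[OF this]
  show "(\<lambda>t. \<sigma> (1 / (1 - \<delta>) * t)) piecewise_C1_differentiable_on {0..1 - \<delta>}"
    by (simp add: o_def)
  have cont: "continuous_on {1 - \<delta>..1} (\<lambda>t. (- 1) *\<^sub>R (c *s cderiv u (of_real (1 - t))))"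
    using \<delta> by (intro continuous_intros continuous_on_compose2[OF cderiv_continuous[OF ray_chart]])
      (auto simp: dist_norm simp del: of_real_diff)
  have "(\<lambda>t. c *s u (of_real (1 - t))) C1_differentiable_on {1 - \<delta>..1}"
    unfolding C1_differentiable_on_def
    by (intro exI[of _ "\<lambda>t. (- 1) *\<^sub>R (c *s cderiv u (of_real (1 - t)))"] conjI ballI cont ray_derivative)
  then show "(\<lambda>t. c *s u (of_real (1 - t))) piecewise_C1_differentiable_on {1 - \<delta>..1}"
    by (rule C1_differentiable_imp_piecewise)
  show "\<sigma> (1 / (1 - \<delta>) * (1 - \<delta>)) = c *s u (of_real (1 - (1 - \<delta>)))"
    using end\<sigma> \<delta>1 by (simp add: pathfinish_def)
qed (use \<delta> in auto)

lemma ray_path_start: "pathstart (ray_path \<sigma> c) = pathstart \<sigma>"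
  using \<delta>1 by (simp add: ray_path_def pathstart_def)

lemma ray_path_to_tangential: "path_to_tangential E D v w (ray_path \<sigma> c)"
  unfolding path_to_tangential_def
proof (intro conjI exI ballI)
  show "valid_path (ray_path \<sigma> c)"
    by (rule ray_path_valid)
  show "ray_path \<sigma> c ` {0..<1} \<subseteq> Y"
  proof (rule image_subsetI)
    fix t :: real assume t: "t \<in> {0..<1}"
    show "ray_path \<sigma> c t \<in> Y"
    proof (cases "t \<le> 1 - \<delta>")
      case True
      then have "1 / (1 - \<delta>) * t \<in> {0..1}"
        using t \<delta>1 by (auto simp: field_simps)
      then show ?thesis
        using \<sigma> True by (auto simp: nice_def path_image_def ray_path_def)
    next
      case False
      then have "u (of_real (1 - t)) \<in> Y"
        using t \<delta> by (intro ray_Y) auto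
      then show ?thesis
        using False c by (simp add: ray_path_def Y_scale)
    qed
  qed
  have "u 0 = v" "cderiv u 0 = w"
    using coord by (simp_all add: local_coordinate_def)
  then show "tangential_chart E D v w (ball 0 r) u"
    unfolding tangential_chart_def using centred by (intro conjI exI[of _ 1] exI[of _ 0]) auto
  show "0 < \<delta>" "\<delta> < 1" using \<delta> by auto
  fix t assume t: "t \<in> {1 - \<delta>..1}"
  then show "of_real (1 - t) \<in> ball (0::complex) r"
    using \<delta> by (auto simp: dist_norm simp del: of_real_diff)
  show "ray_path \<sigma> c t \<in> pt (u (of_real (1 - t)))"
  proof (cases "t = 1 - \<delta>")
    case True
    then show ?thesis
      using end\<sigma> c \<delta>1 by (auto simp: ray_path_def pathfinish_def pt_def)
  next
    case False
    then show ?thesis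
      using t c by (auto simp: ray_path_def pt_def)
  qed
qed

lemma along_ray:
  assumes t: "1 - \<delta> < t" "t < 1"
  shows "along \<Omega> (ray_path \<sigma> c) t ws = K t ws"
proof -
  let ?x = "u (of_real (1 - t))" and ?d = "cderiv u (of_real (1 - t))"
  have b: "complex_of_real (1 - t) \<in> ball 0 r"
    using t \<delta> by (simp add: dist_norm del: of_real_diff)
  have "(ray_path \<sigma> c has_vector_derivative (- 1) *\<^sub>R (c *s ?d)) (at t)"
    by (rule has_vector_derivative_transform_within_open[OF ray_derivative, of _ "{1 - \<delta><..}"])
      (use t in \<open>auto simp: ray_path_def\<close>)
  then have "vector_derivative (ray_path \<sigma> c) (at t within {0..1}) = (- 1) *\<^sub>R (c *s ?d)"
    using t \<delta>1 by (intro vector_derivative_at_within_ivl) auto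
  then have "along \<Omega> (ray_path \<sigma> c) t ws = \<Omega> ws (c *s ?x) ((- 1) *\<^sub>R (c *s ?d))"
    using t by (simp add: along_def ray_path_def)
  also have "\<dots> = of_real (- 1) * \<Omega> ws ?x ?d"
    by (rule one_forms_cscale_real[OF smooth_forms_one[OF Omega_smooth[OF Omega]] _ cderiv_tangent[OF ray_chart b] c])
      (rule ray_Y, use t \<delta> in simp_all)
  finally show ?thesis
    by (simp add: K_def H_def)
qed

text \<open>Splitting at the junction separates the two contributions; the scalar \<open>c\<close>
  drops out because forms are invariant under scaling of the lift.\<close>

lemma ray_path_T_upto:
  assumes q: "0 < q" "q \<le> \<delta>"
  shows "T_upto \<Omega> (ray_path \<sigma> c) (1 - q) = t_mult (X q) (transport (along \<Omega> \<sigma>) 0 1)"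
proof
  fix ws
  let ?A = "along \<Omega> (ray_path \<sigma> c)"
  have sm: "\<And>ws. \<Omega> ws \<in> smooth_forms E D"
    by (rule Omega_smooth[OF Omega])
  have eq1: "ray_path \<sigma> c t = 1 *s \<sigma> (1 / (1 - \<delta>) * t + 0)" if "t \<in> {0<..<1 - \<delta>}" for t
    using that by (simp add: ray_path_def)
  have k: "0 < 1 / (1 - \<delta>)" "1 / (1 - \<delta>) * (1 - \<delta>) + 0 \<le> 1"
    using \<delta>1 by simp_all
  have A: "tpcont 0 (1 - q) ?A"
    unfolding tpcont_def
  proof (intro allI)
    fix ws
    show "pcont 0 (1 - q) (\<lambda>t. ?A t ws)"
    proof (rule pcont_combine[of _ "1 - \<delta>"])
      show "pcont 0 (1 - \<delta>) (\<lambda>t. ?A t ws)"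
        unfolding along_def
        by (rule nice_affine_pcont[OF \<sigma> _ _ k(1) _ k(2) _ eq1 sm]) (use \<delta> in auto)
      have "pcont (1 - \<delta>) (1 - q) (\<lambda>t. K t ws)"
        using K_tpcont[of "1 - q"] q by (simp add: tpcont_def)
      then show "pcont (1 - \<delta>) (1 - q) (\<lambda>t. ?A t ws)"
        by (rule pcont_spike[of _ _ _ "{1 - \<delta>}"]) (use q in \<open>auto intro!: along_ray\<close>)
    qed (use q \<delta>1 in auto)
  qed
  have "T_upto \<Omega> (ray_path \<sigma> c) (1 - q) ws = transport ?A 0 (1 - q) ws"
    by (rule T_upto_eq_transport[OF A]) simp
  also have "\<dots> = t_mult (transport ?A (1 - \<delta>) (1 - q)) (transport ?A 0 (1 - \<delta>)) ws"
    by (rule transport_compose[OF A]) (use q \<delta>1 in auto)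
  also have "transport ?A (1 - \<delta>) (1 - q) = X q"
    unfolding X_def
    by (rule ext, rule transport_spike[of "{1 - \<delta>}" _ "1 - q"]) (use q in \<open>auto intro!: along_ray\<close>)
  also have "transport ?A 0 (1 - \<delta>) = transport (along \<Omega> \<sigma>) (1 / (1 - \<delta>) * 0 + 0) (1 / (1 - \<delta>) * (1 - \<delta>) + 0)"
    by (rule nice_affine_transport[OF \<sigma> _ _ k(1) _ k(2) _ eq1 sm]) (use \<delta> in auto)
  also have "\<dots> = transport (along \<Omega> \<sigma>) 0 1"
    using \<delta>1 by simp
  finally show "T_upto \<Omega> (ray_path \<sigma> c) (1 - q) ws = t_mult (X q) (transport (along \<Omega> \<sigma>) 0 1) ws" .
qed

lemma ray_path_tendsto:
  "((\<lambda>q. t_mult (reg N q) (T_upto \<Omega> (ray_path \<sigma> c) (1 - q)) ws)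
     \<longlongrightarrow> t_mult R (transport (along \<Omega> \<sigma>) 0 1) ws) (at_right 0)"
proof (rule Lim_transform_eventually)
  show "((\<lambda>q. t_mult (G q) (transport (along \<Omega> \<sigma>) 0 1) ws) \<longlongrightarrow> t_mult R (transport (along \<Omega> \<sigma>) 0 1) ws) (at_right 0)"
    unfolding t_mult_def by (intro tendsto_intros G_tendsto)
  show "eventually (\<lambda>q. t_mult (G q) (transport (along \<Omega> \<sigma>) 0 1) ws =
      t_mult (reg N q) (T_upto \<Omega> (ray_path \<sigma> c) (1 - q)) ws) (at_right 0)"
    using near_zero
    by eventually_elim (simp add: ray_path_T_upto G_def t_mult_assoc)
qed

end

lemma T_to_tangential_reg:
  "T_to_tangential E D \<Omega> v \<gamma> ws = Lim (at_right 0) (\<lambda>q. t_mult (reg N q) (T_upto \<Omega> \<gamma> (1 - q)) ws)"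
  unfolding T_to_tangential_def reg_def N_def ..

lemma T_to_tangential_ray_path:
  assumes "nice \<sigma>" "c \<noteq> 0" "pathfinish \<sigma> = c *s base"
  shows "T_to_tangential E D \<Omega> v (ray_path \<sigma> c) = t_mult R (transport (along \<Omega> \<sigma>) 0 1)"
  unfolding T_to_tangential_reg
  by (rule ext, rule tendsto_Lim[OF trivial_limit_at_right_real ray_path_tendsto[OF assms]])

lemma T_to_tangential_Nil: "T_to_tangential E D \<Omega> v \<gamma> [] = 1"
  unfolding T_to_tangential_reg
  by (rule tendsto_Lim[OF trivial_limit_at_right_real]) (simp add: reg_Nil)

lemma reg_low:
  assumes "N [x] = 0" "N [y] = 0" "N [x, y] = 0"
  shows "reg N q [x] = 0" "reg N q [y] = 0" "reg N q [x, y] = 0"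
  using assms N_Nil by (simp_all add: reg_def t_exp_def t_mult_single t_mult_pair)

text \<open>Without residues the regularising factor is trivial on the words that matter, and complex conjugation acts as on an ordinary path.\<close>

lemma T_to_tangential_same_type:
  assumes st: "same_type \<Omega> \<omega> \<omega>'" and \<gamma>: "valid_path \<gamma>"
    and res: "N [\<omega>] = 0" "N [\<omega>'] = 0" "N [conj_form \<omega>] = 0" "N [conj_form \<omega>'] = 0"
  shows "T_to_tangential E D \<Omega> v (F_inf \<circ> \<gamma>) [\<omega>] = T_to_tangential E D \<Omega> v \<gamma> [conj_form \<omega>]"
    and "T_to_tangential E D \<Omega> v (F_inf \<circ> \<gamma>) [\<omega>'] = T_to_tangential E D \<Omega> v \<gamma> [conj_form \<omega>']"
    and "T_to_tangential E D \<Omega> v (F_inf \<circ> \<gamma>) [\<omega>, \<omega>'] = T_to_tangential E D \<Omega> v \<gamma> [conj_form \<omega>, conj_form \<omega>']"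
proof -
  have zero: "N ws = 0" if "\<Omega> ws = zero_form" for ws
    using residue_zero_form[OF vD] Omega_log[OF Omega, of ws] that by (simp add: N_def)
  have res2: "N [\<omega>, \<omega>'] = 0" "N [conj_form \<omega>, conj_form \<omega>'] = 0"
    using st by (auto simp: same_type_def intro!: zero)
  \<comment> \<open>Agreement for all \<open>q > 0\<close> gives equal values of \<open>Lim\<close>,
    whether or not the limits exist; for the conjugate path no convergence is asserted.\<close>
  have Lim: "Lim (at_right 0) f = Lim (at_right 0) g" if "\<And>q. q > 0 \<Longrightarrow> f q = g q" for f g :: "real \<Rightarrow> complex"
  proof -
    have "eventually (\<lambda>q. f q = g q) (at_right 0)"
      using that by (auto simp: eventually_at_right_field intro: exI[of _ 1])
    then have "(f \<longlongrightarrow> l) (at_right 0) \<longleftrightarrow> (g \<longlongrightarrow> l) (at_right 0)" for l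
      by (rule tendsto_cong)
    then show ?thesis
      unfolding t2_space_class.Lim_def by (simp only:)
  qed
  note low = reg_low[OF res(1,2) res2(1)] reg_low[OF res(3,4) res2(2)] reg_Nil
  show "T_to_tangential E D \<Omega> v (F_inf \<circ> \<gamma>) [\<omega>] = T_to_tangential E D \<Omega> v \<gamma> [conj_form \<omega>]"
    unfolding T_to_tangential_reg
    by (rule Lim) (simp add: t_mult_single low same_type_T_upto[OF st \<gamma>])
  show "T_to_tangential E D \<Omega> v (F_inf \<circ> \<gamma>) [\<omega>'] = T_to_tangential E D \<Omega> v \<gamma> [conj_form \<omega>']"
    unfolding T_to_tangential_reg
    by (rule Lim) (simp add: t_mult_single low same_type_T_upto[OF st \<gamma>])
  show "T_to_tangential E D \<Omega> v (F_inf \<circ> \<gamma>) [\<omega>, \<omega>'] = T_to_tangential E D \<Omega> v \<gamma> [conj_form \<omega>, conj_form \<omega>']"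
    unfolding T_to_tangential_reg
    by (rule Lim) (simp add: t_mult_pair low same_type_T_upto[OF st \<gamma>])
qed

text \<open>A loop \<open>\<sigma>\<close> at the nearby point \<open>base\<close> becomes a
  tangential loop: \<open>\<beta>\<close> is \<open>\<sigma>\<close> followed by the ray and
  \<open>\<alpha>\<close> is the ray alone, preceded by a constant path. Then T(\<beta>) times the
  inverse of T(\<alpha>) is the transport of \<open>\<sigma>\<close> conjugated by
  \<open>R\<close>.\<close>

lemma phi_12_vanishes_tangential:
  assumes B: "real_basis_mod (exact_forms E D) (dR_R F E D) B"
    and \<Omega>B: "\<And>\<beta>. \<beta> \<in> B \<Longrightarrow> \<Omega> [\<beta>] = \<beta>"
    and \<phi>: "is_phi_inf F E D \<Omega> (Tangential v w) \<phi>" and st: "same_type \<Omega> \<omega> \<omega>'"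
    and res: "N [\<omega>] = 0" "N [\<omega>'] = 0" "N [conj_form \<omega>] = 0" "N [conj_form \<omega>'] = 0"
    and \<eta>: "\<eta> \<in> B"
  shows "pairing [\<omega>, \<omega>'] (phi_12 \<phi> (dual_basis_elem F E D B \<eta>)) = 0"
proof (rule phi_12_vanishes[where R = R, OF Omega B \<Omega>B base_Y R_T_hat R_Nil \<phi> _ \<eta>])
  fix \<sigma> assume "\<sigma> \<in> loops base"
  then have \<sigma>: "nice \<sigma>" "pathstart \<sigma> = base" and "pathfinish \<sigma> \<in> pt base"
    by (auto simp: loops_def)
  then obtain c where c: "c \<noteq> 0" "pathfinish \<sigma> = c *s base"
    using in_ptE by blast
  let ?one = "\<lambda>t::real. base"
  have one: "nice ?one" "(1::complex) \<noteq> 0" "pathfinish ?one = 1 *s base"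
    using nice_const[OF base_Y] by (simp_all add: pathfinish_def)
  define \<beta> where "\<beta> = ray_path \<sigma> c"
  define \<alpha> where "\<alpha> = ray_path ?one 1"
  let ?T = "T_to_tangential E D \<Omega> v"
  have \<beta>: "path_to_tangential E D v w \<beta>" "valid_path \<beta>" "pathstart \<beta> = base"
      "?T \<beta> = t_mult R (transport (along \<Omega> \<sigma>) 0 1)"
    using ray_path_to_tangential[OF \<sigma>(1) c] ray_path_valid[OF \<sigma>(1) c] ray_path_start[OF \<sigma>(1) c]
      T_to_tangential_ray_path[OF \<sigma>(1) c] \<sigma>(2) by (simp_all add: \<beta>_def)
  have \<alpha>: "path_to_tangential E D v w \<alpha>" "valid_path \<alpha>" "pathstart \<alpha> = base" "?T \<alpha> = R"
    using ray_path_to_tangential[OF one] ray_path_valid[OF one] ray_path_start[OF one]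
      T_to_tangential_ray_path[OF one] const_transport[OF base_Y Omega_smooth[OF Omega], of 0 1]
    by (simp_all add: \<alpha>_def pathstart_def)
  have "\<phi> (t_mult (?T \<beta>) (t_inverse (?T \<alpha>))) = t_mult (?T (F_inf \<circ> \<beta>)) (t_inverse (?T (F_inf \<circ> \<alpha>)))"
    using \<phi> \<alpha>(1,3) \<beta>(1,3) by (simp add: is_phi_inf_def)
  \<comment> \<open>On words of length at most two product and inverse are explicit polynomials in
    the coefficients, and each of these coefficients passes to the conjugate word.\<close>
  moreover have "t_mult (?T (F_inf \<circ> \<beta>)) (t_inverse (?T (F_inf \<circ> \<alpha>))) [\<omega>, \<omega>'] =
      t_mult (?T \<beta>) (t_inverse (?T \<alpha>)) [conj_form \<omega>, conj_form \<omega>']"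
    unfolding t_mult_pair
    unfolding t_inverse_low[where t = "?T _", OF T_to_tangential_Nil]
      T_to_tangential_Nil T_to_tangential_same_type[OF st \<alpha>(2) res] T_to_tangential_same_type[OF st \<beta>(2) res]
    ..
  ultimately show "\<phi> (t_mult R (t_mult (transport (along \<Omega> \<sigma>) 0 1) (t_inverse R))) [\<omega>, \<omega>'] =
      t_mult R (t_mult (transport (along \<Omega> \<sigma>) 0 1) (t_inverse R)) [conj_form \<omega>, conj_form \<omega>']"
    unfolding \<alpha>(4) \<beta>(4) t_mult_assoc by simp
qed

end

section \<open>Residues of the basis forms and the two kinds of base point\<close>

lemma (in curve) adapted_residue:
  assumes B: "adapted_basis F E D Bh Bah Be" and v: "v \<in> D" and \<Omega>: "is_Omega F E D \<Omega>"
    and comp: "Omega_compatible \<Omega> Bh Bah Be" and \<omega>: "\<omega> \<in> Bh \<union> Bah"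
  shows "residue_at E D v (\<Omega> [\<omega>]) = 0" and "residue_at E D v (\<Omega> [conj_form \<omega>]) = 0"
proof -
  have Bh: "real_basis_mod {zero_form} (lin_span \<real> (algebraic_forms F E D (cone E))) Bh"
    and Bah: "Bah = conj_form ` Bh"
    using B by (auto simp: adapted_basis_def)
  have cc: "conj_form (conj_form \<alpha>) = \<alpha>" for \<alpha> :: "'n form"
    by (simp add: conj_form_def)
  have eq: "\<Omega> [\<alpha>] = \<alpha>" if "\<alpha> \<in> Bh \<union> Bah" for \<alpha>
    using comp that by (auto simp: Omega_compatible_def)
  have log: "\<alpha> \<in> A1_log E D" if "\<alpha> \<in> Bh \<union> Bah" for \<alpha>
    using Omega_log[OF \<Omega>, of "[\<alpha>]"] eq[OF that] by simp
  have zero: "residue_at E D v \<alpha> = 0" if \<alpha>: "\<alpha> \<in> Bh \<union> Bah" for \<alpha>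
  proof (cases "\<alpha> \<in> Bh")
    case True
    show ?thesis
      by (rule residue_regular(1)[OF v real_basis_holomorphic(1)[OF Bh True] log[OF \<alpha>]])
  next
    case False
    then obtain \<beta> where "\<beta> \<in> Bh" "\<alpha> = conj_form \<beta>"
      using \<alpha> Bah by blast
    then show ?thesis
      using residue_regular(2)[OF v real_basis_holomorphic(1)[OF Bh]] log[OF \<alpha>] by blast
  qed
  have "conj_form \<omega> \<in> Bh \<union> Bah"
    using \<omega> cc by (auto simp: Bah)
  then show "residue_at E D v (\<Omega> [\<omega>]) = 0" "residue_at E D v (\<Omega> [conj_form \<omega>]) = 0"
    using \<omega> eq zero by simp_all
qed

theorem theorem4p1:
  fixes F :: "real set"
    and E :: "(complex^'n \<Rightarrow> complex) set"
    and D :: "(complex^'n) set"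
    and b :: "'n::finite base_point"
    and \<Omega> :: "'n::finite form list \<Rightarrow> 'n::finite form"
    and \<phi> :: "'n::finite tensor \<Rightarrow> 'n::finite tensor"
    and Bh Bah Be :: "'n::finite form set"
    and \<omega> \<omega>' \<eta> :: "'n::finite form"
  assumes "real_subfield F"
    and "smooth_projective_curve F E"
    and "reduced_divisor F E D"
    and "rational_base_point F E D b"
    and "is_Omega F E D \<Omega>"
    and "adapted_basis F E D Bh Bah Be"
    and "Omega_compatible \<Omega> Bh Bah Be"
    and "is_phi_inf F E D \<Omega> b \<phi>"
    and "\<omega> \<in> Bh \<and> \<omega>' \<in> Bh \<or> \<omega> \<in> Bah \<and> \<omega>' \<in> Bah"
    and "\<eta> \<in> Bh \<union> Bah \<union> Be"
  shows "pairing [\<omega>, \<omega>'] (phi_12 \<phi> (dual_basis_elem F E D (Bh \<union> Bah \<union> Be) \<eta>)) = 0"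
proof -
  interpret curve F E D
    by unfold_locales (fact assms)+
  have B: "real_basis_mod (exact_forms E D) (dR_R F E D) (Bh \<union> Bah \<union> Be)"
    using assms(6) unfolding adapted_basis_def by blast
  have \<Omega>B: "\<And>\<beta>. \<beta> \<in> Bh \<union> Bah \<union> Be \<Longrightarrow> \<Omega> [\<beta>] = \<beta>"
    using assms(7) by (simp add: Omega_compatible_def)
  have st: "same_type \<Omega> \<omega> \<omega>'"
    by (rule adapted_same_type[OF assms(6,7,9)])
  show ?thesis
  proof (cases b)
    case (Point v)
    show ?thesis
      by (rule phi_12_vanishes_point[OF assms(5) B \<Omega>B _ _ st assms(10)])
        (use assms(4,8) in \<open>auto simp: Point\<close>)
  next
    case (Tangential v w)
    then have vw: "v \<in> D" "w \<in> tangent E v" "\<forall>c. w \<noteq> c *s v"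
      using assms(4) by simp_all
    obtain r u l m where c: "local_coordinate E v w r u l m" "centred_chart E D v (ball 0 r) u" "r < 1"
      using centred_coordinate_exists[OF vw] by blast
    then have r: "0 < r" by (simp add: local_coordinate_def)
    \<comment> \<open>The ray starts halfway to the boundary of the coordinate disc; any starting
      parameter strictly between \<open>0\<close> and \<open>r\<close> would serve.\<close>
    interpret tangential_ray F E D \<Omega> v w r u l m "r / 2"
      by unfold_locales (use assms(5) vw c r in auto)
    have "N [\<alpha>] = 0" "N [conj_form \<alpha>] = 0" if "\<alpha> \<in> Bh \<union> Bah" for \<alpha>
      using adapted_residue[OF assms(6) vw(1) assms(5,7) that] by (simp_all add: N_def)
    then show ?thesis
      using assms(9) assms(8)[unfolded Tangential]
      by (intro phi_12_vanishes_tangential[OF B \<Omega>B _ st _ _ _ _ assms(10)]) auto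
  qed
qed

end
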